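(* Let $d,\sigma,q\ge 1$ be integers, $V\ge 0$, $\nu,\mu\in\mathbb{R}$, and let $Q=(Q_1,\dots,Q_q):\mathbb{T}^d\to\mathbb{R}^q$ be smooth. Assume that $$\{\mathbf{1},\ \sin\langle x,k\rangle,\ \cos\langle x,k\rangle \mid k\in K\}\subset \operatorname{span}\{Q_j\mid j=1,\dots,q\},$$ where $K=\{(1,0,\dots,0),(0,1,\dots,0),\dots,(0,\dots,0,1,0),(1,\dots,1)\}\subset\mathbb{Z}^d\setminus\{0\}$. Let $s\ge s_d$ be an integer. Then for any $\varepsilon>0$, $\mathcal{T}>0$, $\psi_0\in H^s$ and $\theta\in C^\infty(\mathbb{T}^d;\mathbb{R})$, there are a time $T\in(0,\mathcal{T})$, a control $(u,R)\in C^\infty([0,T];\mathbb{R}^q)\times\mathbb{R}$, and a unique solution $\psi\in C([0,T];H^s)$ of $$\partial_t\psi=V\psi+(1+i\nu)\Delta\psi-(1+i\mu)|\psi|^{2\sigma}\psi+(1+iR)\langle u(t),Q(x)\rangle\psi,\qquad \psi(0,x)=\psi_0(x),\qquad x\in\mathbb{T}^d,$$ such that $$\left\|\psi(T)-e^{(1-i\nu)\theta}\psi_0\right\|_{H^s}<\varepsilon.$$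
   Context: $\mathbb{T}^d=\mathbb{R}^d/2\pi\mathbb{Z}^d$; $\langle\cdot,\cdot\rangle$ is the Euclidean scalar product; $\mathbf{1}$ is the function identically equal to $1$ on $\mathbb{T}^d$; $\operatorname{span}$ is the real linear span. $K$ consists of the $d$ vectors $e_1,\dots,e_{d-1}$ (the first $d-1$ standard basis vectors) and $(1,\dots,1)$; for $d=1$, $K=\{1\}$. $s_d$ is the smallest integer strictly greater than $d/2$. $H^s=H^s(\mathbb{T}^d;\mathbb{C})$ with norm $\|f\|_{H^s}^2=\sum_{k\in\mathbb{Z}^d}(1+|k|^2)^s|\widehat f(k)|^2$, where $\widehat f(k)=(2\pi)^{-d}\int_{[0,2\pi]^d}f(x)e^{-i\langle k,x\rangle}\,dx$. Solutions are understood in the mild (Duhamel) sense with respect to the semigroup generated by $V+(1+i\nu)\Delta$. *)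

theory Defs
  imports "HOL-Analysis.Analysis"
begin

section \<open>Functions on the torus\<close>

text \<open>
  The dimension is \<open>d = CARD('n)\<close>.  A function on \<open>\<real>\<^sup>d / 2\<pi>\<int>\<^sup>d\<close> is a function on
  \<open>real ^ 'n\<close> that is \<open>2\<pi>\<close>-periodic in each coordinate.
\<close>

definition torus_periodic :: "(real ^ 'n \<Rightarrow> 'b) \<Rightarrow> bool" where
  "torus_periodic f \<longleftrightarrow> (\<forall>x i. f (x + axis i (2 * pi)) = f x)"

primrec C_k :: "nat \<Rightarrow> ('a::real_normed_vector \<Rightarrow> 'b::real_normed_vector) \<Rightarrow> bool" where
  "C_k 0 f \<longleftrightarrow> continuous_on UNIV f"
| "C_k (Suc m) f \<longleftrightarrow>
     (\<forall>x. f differentiable (at x)) \<and> (\<forall>v. C_k m (\<lambda>x. frechet_derivative f (at x) v))"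

definition torus_smooth :: "(real ^ 'n \<Rightarrow> 'b::real_normed_vector) \<Rightarrow> bool" where
  "torus_smooth f \<longleftrightarrow> torus_periodic f \<and> (\<forall>m. C_k m f)"

text \<open>\<open>C\<^sup>\<infinity>([0,T])\<close>; at the end points the derivatives are one-sided. \<open>D m\<close> is the \<open>m\<close>-th derivative.\<close>

definition smooth_on_interval :: "real \<Rightarrow> (real \<Rightarrow> 'b::real_normed_vector) \<Rightarrow> bool" where
  "smooth_on_interval T u \<longleftrightarrow>
     (\<exists>D. (\<forall>t\<in>{0..T}. D 0 t = u t) \<and>
          (\<forall>m. \<forall>t\<in>{0..T}. (D m has_vector_derivative D (Suc m) t) (at t within {0..T})))"

definition freq :: "int ^ 'n \<Rightarrow> real ^ 'n" where
  "freq k = (\<chi> i. real_of_int (k $ i))"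

definition torus_cube :: "(real ^ 'n) set" where
  "torus_cube = cbox 0 (\<chi> i. 2 * pi)"

definition fourier_coeff :: "(real ^ 'n \<Rightarrow> complex) \<Rightarrow> int ^ 'n \<Rightarrow> complex" where
  "fourier_coeff f k =
     complex_of_real (1 / (2 * pi) ^ CARD('n)) *
     (LINT x:torus_cube|lebesgue. f x * exp (- \<i> * complex_of_real (freq k \<bullet> x)))"

section \<open>Sobolev spaces\<close>

text \<open>
  For \<open>s \<ge> 0\<close> the elements of \<open>H\<^sup>s\<close> are classes of square integrable functions modulo equality
  almost everywhere.  \<open>Hs s\<close> is the set of all representatives; two elements of it represent the
  same element of \<open>H\<^sup>s\<close> iff they agree almost everywhere.
\<close>

definition torus_L2 :: "(real ^ 'n \<Rightarrow> complex) set" where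
  "torus_L2 = {f. torus_periodic f \<and> f \<in> borel_measurable lebesgue \<and>
                  set_integrable lebesgue torus_cube (\<lambda>x. (cmod (f x))\<^sup>2)}"

definition Hs_term :: "nat \<Rightarrow> (real ^ 'n \<Rightarrow> complex) \<Rightarrow> int ^ 'n \<Rightarrow> real" where
  "Hs_term s f k = (1 + (norm (freq k))\<^sup>2) ^ s * (cmod (fourier_coeff f k))\<^sup>2"

definition Hs :: "nat \<Rightarrow> (real ^ 'n \<Rightarrow> complex) set" where
  "Hs s = {f \<in> torus_L2. Hs_term s f summable_on UNIV}"

text \<open>Meaningful only on \<open>Hs s\<close>: a divergent \<open>infsum\<close> has the value \<open>0\<close>.\<close>

definition Hs_norm :: "nat \<Rightarrow> (real ^ 'n \<Rightarrow> complex) \<Rightarrow> real" where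
  "Hs_norm s f = sqrt (infsum (Hs_term s f) UNIV)"

definition Hs_continuous :: "nat \<Rightarrow> real \<Rightarrow> (real \<Rightarrow> real ^ 'n \<Rightarrow> complex) \<Rightarrow> bool" where
  "Hs_continuous s T \<psi> \<longleftrightarrow>
     (\<forall>t\<in>{0..T}. \<psi> t \<in> Hs s) \<and>
     (\<forall>t\<in>{0..T}. ((\<lambda>r. Hs_norm s (\<lambda>x. \<psi> r x - \<psi> t x)) \<longlongrightarrow> 0) (at t within {0..T}))"

text \<open>
  The \<open>H\<^sup>s\<close>-valued integral: as \<open>has_integral\<close> on a compact interval, with the \<open>H\<^sup>s\<close> norm.
  For integrands continuous in \<open>H\<^sup>s\<close> this is the Riemann (or Bochner) integral.
\<close>

definition Hs_has_integral ::
    "nat \<Rightarrow> (real \<Rightarrow> real ^ 'n \<Rightarrow> complex) \<Rightarrow> (real ^ 'n \<Rightarrow> complex) \<Rightarrow> real \<Rightarrow> real \<Rightarrow> bool" where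
  "Hs_has_integral s F g a b \<longleftrightarrow>
     (\<forall>r\<in>{a..b}. F r \<in> Hs s) \<and> g \<in> Hs s \<and>
     (\<forall>e>0. \<exists>\<gamma>. gauge \<gamma> \<and>
        (\<forall>\<D>. \<D> tagged_division_of {a..b} \<and> \<gamma> fine \<D> \<longrightarrow>
           Hs_norm s (\<lambda>x. (\<Sum>(r, J)\<in>\<D>. measure lborel J *\<^sub>R F r x) - g x) < e))"

text \<open>The smallest integer strictly greater than \<open>d/2\<close>; it is positive, so the type \<open>nat\<close> is no restriction.\<close>

definition s_crit :: "nat \<Rightarrow> nat" where
  "s_crit d = (LEAST m::nat. real d / 2 < real m)"

section \<open>The equation\<close>

text \<open>
  The semigroup \<open>exp (t (V + (1 + i\<nu>)\<Delta>))\<close> as a Fourier multiplier.  For \<open>f\<close> in \<open>H\<^sup>s\<close> with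
  \<open>s > d/2\<close> and \<open>t \<ge> 0\<close> the series converges absolutely for every \<open>x\<close>.
\<close>

definition semigroup_gl :: "real \<Rightarrow> real \<Rightarrow> real \<Rightarrow> (real ^ 'n \<Rightarrow> complex) \<Rightarrow> real ^ 'n \<Rightarrow> complex" where
  "semigroup_gl V \<nu> t f x =
     (\<Sum>\<^sub>\<infinity>k. exp (complex_of_real t *
                (complex_of_real V - (1 + \<i> * complex_of_real \<nu>) * complex_of_real ((norm (freq k))\<^sup>2)))
            * fourier_coeff f k * exp (\<i> * complex_of_real (freq k \<bullet> x)))"

text \<open>All terms of the right-hand side that are not in the generator.\<close>

definition forcing_gl ::
    "nat \<Rightarrow> real \<Rightarrow> (real ^ 'n \<Rightarrow> real ^ 'q) \<Rightarrow> (real \<Rightarrow> real ^ 'q) \<Rightarrow> real \<Rightarrow>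
     (real \<Rightarrow> real ^ 'n \<Rightarrow> complex) \<Rightarrow> real \<Rightarrow> real ^ 'n \<Rightarrow> complex" where
  "forcing_gl \<sigma> \<mu> Q u R \<psi> t x =
     - (1 + \<i> * complex_of_real \<mu>) * complex_of_real (cmod (\<psi> t x) ^ (2 * \<sigma>)) * \<psi> t x
     + (1 + \<i> * complex_of_real R) * complex_of_real (u t \<bullet> Q x) * \<psi> t x"

text \<open>
  \<open>\<psi> \<in> C([0,T]; H\<^sup>s)\<close> with
  \<open>\<psi>(t) = S(t) \<psi>\<^sub>0 + \<integral>\<^sub>0\<^sup>t S(t-r) F(r) dr\<close> for all \<open>t \<in> [0,T]\<close>; at \<open>t = 0\<close> this is the
  initial condition.
\<close>

definition mild_solution ::
    "nat \<Rightarrow> real \<Rightarrow> real \<Rightarrow> nat \<Rightarrow> real \<Rightarrow> (real ^ 'n \<Rightarrow> real ^ 'q) \<Rightarrow> (real \<Rightarrow> real ^ 'q) \<Rightarrow> real \<Rightarrow>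
     (real ^ 'n \<Rightarrow> complex) \<Rightarrow> real \<Rightarrow> (real \<Rightarrow> real ^ 'n \<Rightarrow> complex) \<Rightarrow> bool" where
  "mild_solution s V \<nu> \<sigma> \<mu> Q u R \<psi>\<^sub>0 T \<psi> \<longleftrightarrow>
     Hs_continuous s T \<psi> \<and>
     (\<forall>t\<in>{0..T}.
        Hs_has_integral s (\<lambda>r. semigroup_gl V \<nu> (t - r) (forcing_gl \<sigma> \<mu> Q u R \<psi> r))
          (\<lambda>x. \<psi> t x - semigroup_gl V \<nu> t \<psi>\<^sub>0 x) 0 t)"

section \<open>The control directions\<close>

text \<open>The last coordinate is the greatest element of the index type; \<open>axis i 1\<close> is a standard basis vector.\<close>

definition control_freqs :: "(int ^ 'n::{finite,linorder}) set" where
  "control_freqs = {axis i 1 | i. i \<noteq> Max UNIV} \<union> {\<chi> i. 1}"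

definition component_span :: "(real ^ 'n \<Rightarrow> real ^ 'q) \<Rightarrow> (real ^ 'n \<Rightarrow> real) set" where
  "component_span Q = {f. \<exists>c :: 'q \<Rightarrow> real. \<forall>x. f x = (\<Sum>j\<in>UNIV. c j * Q x $ j)}"

end

theory Submission
  imports Defs "HOL-Probability.Probability" "HOL-Real_Asymp.Real_Asymp"
begin

text \<open>
  The Fourier coefficients weighted by \<open>(1 + |k|\<^sup>2)\<^bsup>s/2\<^esup>\<close> identify \<open>H\<^sup>s\<close> with \<open>\<ell>\<^sup>2\<close>.
  For \<open>s > d/2\<close> this is a Banach algebra, so the equation is semilinear with a locally Lipschitz nonlinearity,
  and its mild solutions are unique and stable under perturbations.

  Take \<open>R = -\<nu>\<close>, so that a control acts through \<open>1 - i \<nu>\<close>, as in the target \<open>e\<^bsup>(1 - i \<nu>) \<theta>\<^esup>\<close>.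
  A large control during a short time multiplies the state by \<open>e\<^bsup>(1 - i \<nu>) \<phi>\<^esup>\<close> for \<open>\<phi>\<close> in the span of the
  \<open>Q\<^sub>j\<close>. Multiplying by \<open>e\<^bsup>(1 - i \<nu>) (\<phi> - c) / r\<^esup>\<close>, evolving freely for the time \<open>r\<^sup>2\<close> and undoing the
  multiplication conjugates \<open>exp (r\<^sup>2 (1 + i \<nu>) \<Delta>)\<close>, which tends to multiplication by
  \<open>exp ((1 + i \<nu>) (1 - i \<nu>)\<^sup>2 |\<nabla>\<phi>|\<^sup>2) = exp ((1 - i \<nu>) (1 + \<nu>\<^sup>2) |\<nabla>\<phi>|\<^sup>2)\<close> as \<open>r \<rightarrow> 0\<close>. This is read off the
  representation of the semigroup by a complex Gaussian kernel. The constant \<open>c\<close> makes the state so small in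
  between that the nonlinearity is negligible.

  The phases that can be reached thus form a closed set of functions containing the span of the \<open>Q\<^sub>j\<close>, closed under sums and
  under adding \<open>|\<nabla>\<phi>|\<^sup>2\<close> for suitable trigonometric \<open>\<phi>\<close>. Products of sines and cosines of frequencies \<open>k\<close>, \<open>l\<close> with
  nonzero scalar product generate those of \<open>k \<plusminus> l\<close>; starting from \<open>K\<close> one gets all frequencies, hence all real
  functions in \<open>H\<^sup>s\<close>. Finally the continuous control is replaced by a polynomial one.
\<close>

section \<open>The Hilbert space of square summable families\<close>

text \<open>The flow is dissipative, so the limit yields only nonnegative multiples of |grad
  \<phi>|^2. Negative ones come from sin^2 + cos^2 = 1: the constant is available with both signs,
  and minus one square is the other square minus a constant. This is why K enters through pairs of
  sines and cosines together with 1; polarisation then gives the mixed products.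

  The conjugating factors have size exp(O(1/r)), so an error that is merely small with r would be
  destroyed by the last multiplication. The nonlinearity has degree 2\<sigma> + 1 \<ge> 3: shrinking
  the state by exp(-c/r) shrinks its contribution at least by exp(-3c/r), while undoing the
  shrinking costs only exp(c/r).

  The convergence is strong, not in operator norm: it holds for each state separately. Reachability
  is therefore stated for every initial state and every short time, and a concatenation fixes the
  later leg before the earlier one. Solutions are sought in the sequence space, where equality
  almost everywhere becomes equality; the return to functions needs that Fourier coefficients
  determine an integrable function almost everywhere.\<close>

typedef 'a ell2 = "{f :: 'a \<Rightarrow> complex. (\<lambda>k. (cmod (f k))\<^sup>2) summable_on UNIV}"
  morphisms coord Abs_ell2
  by (intro exI[of _ "\<lambda>_. 0"]) simp

setup_lifting type_definition_ell2

lemma coord_summable: "(\<lambda>k. (cmod (coord x k))\<^sup>2) summable_on UNIV"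
  using coord[of x] by simp

lemma coord_Abs_ell2: "(\<lambda>k. (cmod (f k))\<^sup>2) summable_on UNIV \<Longrightarrow> coord (Abs_ell2 f) = f"
  by (simp add: Abs_ell2_inverse)

lemma ell2_eqI: "(\<And>k. coord x k = coord y k) \<Longrightarrow> x = y"
  by (metis coord_inject ext)

lemma summable_sq_add:
  fixes f g :: "'a \<Rightarrow> complex"
  assumes "(\<lambda>k. (cmod (f k))\<^sup>2) summable_on UNIV" "(\<lambda>k. (cmod (g k))\<^sup>2) summable_on UNIV"
  shows "(\<lambda>k. (cmod (f k + g k))\<^sup>2) summable_on UNIV"
proof (rule summable_on_comparison_test)
  show "(\<lambda>k. 2 * (cmod (f k))\<^sup>2 + 2 * (cmod (g k))\<^sup>2) summable_on UNIV"
    by (intro summable_on_add summable_on_cmult_right assms)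
  fix k
  have "(cmod (f k + g k))\<^sup>2 \<le> (cmod (f k) + cmod (g k))\<^sup>2"
    by (intro power_mono norm_triangle_ineq) auto
  also have "\<dots> \<le> 2 * (cmod (f k))\<^sup>2 + 2 * (cmod (g k))\<^sup>2"
    using sum_squares_bound[of "cmod (f k)" "cmod (g k)"] by (simp add: power2_sum)
  finally show "(cmod (f k + g k))\<^sup>2 \<le> 2 * (cmod (f k))\<^sup>2 + 2 * (cmod (g k))\<^sup>2" .
qed auto

lemma summable_sq_mult:
  fixes f m :: "'a \<Rightarrow> complex"
  assumes "(\<lambda>k. (cmod (f k))\<^sup>2) summable_on UNIV" "\<And>k. cmod (m k) \<le> B"
  shows "(\<lambda>k. (cmod (m k * f k))\<^sup>2) summable_on UNIV"
proof (rule summable_on_comparison_test)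
  show "(\<lambda>k. B\<^sup>2 * (cmod (f k))\<^sup>2) summable_on UNIV"
    by (intro summable_on_cmult_right assms)
  show "(cmod (m k * f k))\<^sup>2 \<le> B\<^sup>2 * (cmod (f k))\<^sup>2" for k
    unfolding norm_mult power_mult_distrib by (intro mult_right_mono power_mono assms) auto
qed auto

instantiation ell2 :: (type) real_inner
begin

lift_definition zero_ell2 :: "'a ell2" is "\<lambda>_. 0" by simp
lift_definition plus_ell2 :: "'a ell2 \<Rightarrow> 'a ell2 \<Rightarrow> 'a ell2" is "\<lambda>f g k. f k + g k"
  by (rule summable_sq_add)
lift_definition uminus_ell2 :: "'a ell2 \<Rightarrow> 'a ell2" is "\<lambda>f k. - f k" by simp
lift_definition minus_ell2 :: "'a ell2 \<Rightarrow> 'a ell2 \<Rightarrow> 'a ell2" is "\<lambda>f g k. f k - g k"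
  using summable_sq_add[where g="\<lambda>k. - g k" for g] by fastforce
lift_definition scaleR_ell2 :: "real \<Rightarrow> 'a ell2 \<Rightarrow> 'a ell2" is "\<lambda>r f k. r *\<^sub>R f k"
  unfolding scaleR_conv_of_real by (rule summable_sq_mult) auto
definition inner_ell2 :: "'a ell2 \<Rightarrow> 'a ell2 \<Rightarrow> real" where
  "inner_ell2 x y = (\<Sum>\<^sub>\<infinity>k. coord x k \<bullet> coord y k)"
definition norm_ell2 :: "'a ell2 \<Rightarrow> real" where
  "norm_ell2 x = sqrt (x \<bullet> x)"
definition dist_ell2 :: "'a ell2 \<Rightarrow> 'a ell2 \<Rightarrow> real" where
  "dist_ell2 x y = norm (x - y)"
definition sgn_ell2 :: "'a ell2 \<Rightarrow> 'a ell2" where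
  "sgn_ell2 x = inverse (norm x) *\<^sub>R x"
definition uniformity_ell2 :: "('a ell2 \<times> 'a ell2) filter" where
  "uniformity_ell2 = (INF e\<in>{0 <..}. principal {(x, y). dist x y < e})"
definition open_ell2 :: "'a ell2 set \<Rightarrow> bool" where
  "open_ell2 S \<longleftrightarrow> (\<forall>x\<in>S. \<forall>\<^sub>F (x', y) in uniformity. x' = x \<longrightarrow> y \<in> S)"

lemma inner_summable_ell2: "(\<lambda>k. coord x k \<bullet> coord y k) summable_on UNIV"
proof -
  have "(\<lambda>k. norm (coord x k \<bullet> coord y k)) summable_on UNIV"
  proof (rule Infinite_Sum.abs_summable_on_comparison_test')
    show "(\<lambda>k. (cmod (coord x k))\<^sup>2 + (cmod (coord y k))\<^sup>2) summable_on UNIV"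
      by (intro summable_on_add coord_summable)
    fix k
    have "norm (coord x k \<bullet> coord y k) \<le> cmod (coord x k) * cmod (coord y k)"
      using Cauchy_Schwarz_ineq2 by auto
    also have "\<dots> \<le> 2 * cmod (coord x k) * cmod (coord y k)" by simp
    also have "\<dots> \<le> (cmod (coord x k))\<^sup>2 + (cmod (coord y k))\<^sup>2"
      by (rule sum_squares_bound)
    finally show "norm (coord x k \<bullet> coord y k) \<le> (cmod (coord x k))\<^sup>2 + (cmod (coord y k))\<^sup>2" .
  qed
  then show ?thesis by (rule abs_summable_summable)
qed

instance
proof
  fix x y z :: "'a ell2" and a b :: real
  show "x + y + z = x + (y + z)" "x + y = y + x" "0 + x = x" "- x + x = 0" "x - y = x + - y"
    "a *\<^sub>R (x + y) = a *\<^sub>R x + a *\<^sub>R y" "(a + b) *\<^sub>R x = a *\<^sub>R x + b *\<^sub>R x"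
    "a *\<^sub>R b *\<^sub>R x = (a * b) *\<^sub>R x" "1 *\<^sub>R x = x"
    by (transfer; simp add: algebra_simps)+
  show "x \<bullet> y = y \<bullet> x" by (simp add: inner_ell2_def inner_commute)
  show "(x + y) \<bullet> z = x \<bullet> z + y \<bullet> z"
    unfolding inner_ell2_def plus_ell2.rep_eq inner_add_left
    by (intro infsum_add inner_summable_ell2)
  show "a *\<^sub>R x \<bullet> y = a * (x \<bullet> y)"
    unfolding inner_ell2_def scaleR_ell2.rep_eq inner_scaleR_left
    by (rule infsum_cmult_right) (rule inner_summable_ell2)
  show "0 \<le> x \<bullet> x" unfolding inner_ell2_def by (intro infsum_nonneg) auto
  show "(x \<bullet> x = 0) = (x = 0)"
  proof
    assume "x \<bullet> x = 0"
    then have "coord x k \<bullet> coord x k = 0" for k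
      using nonneg_infsum_le_0D[of "\<lambda>k. coord x k \<bullet> coord x k" UNIV k] inner_summable_ell2[of x x]
      unfolding inner_ell2_def by auto
    then show "x = 0" by (intro ell2_eqI) (simp add: zero_ell2.rep_eq)
  qed (simp add: inner_ell2_def zero_ell2.rep_eq)
qed (simp_all add: norm_ell2_def dist_ell2_def sgn_ell2_def uniformity_ell2_def open_ell2_def)

end

lemmas coord_simps [simp] = zero_ell2.rep_eq plus_ell2.rep_eq minus_ell2.rep_eq uminus_ell2.rep_eq
  scaleR_ell2.rep_eq

lemma norm_ell2_sq: "(norm x)\<^sup>2 = (\<Sum>\<^sub>\<infinity>k. (cmod (coord x k))\<^sup>2)"
  unfolding power2_norm_eq_inner[of x] inner_ell2_def by (simp add: dot_square_norm)

lemma norm_ell2: "norm x = sqrt (\<Sum>\<^sub>\<infinity>k. (cmod (coord x k))\<^sup>2)"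
  by (simp flip: norm_ell2_sq)

lemma coord_le_norm: "cmod (coord x k) \<le> norm x"
proof -
  have "(cmod (coord x k))\<^sup>2 \<le> (norm x)\<^sup>2"
    using finite_sum_le_infsum[OF coord_summable[of x], of "{k}"] by (simp add: norm_ell2_sq)
  then show ?thesis by (rule power2_le_imp_le) simp
qed

lemma bounded_linear_coord: "bounded_linear (\<lambda>x. coord x k)"
  by (rule bounded_linear_intro[of _ 1]) (auto simp: coord_le_norm)

lemma norm_ell2_le_finite:
  assumes "0 \<le> B" "\<And>F. finite F \<Longrightarrow> (\<Sum>k\<in>F. (cmod (coord x k))\<^sup>2) \<le> B\<^sup>2"
  shows "norm x \<le> B"
proof -
  have "(norm x)\<^sup>2 \<le> B\<^sup>2" unfolding norm_ell2_sq
    by (rule infsum_le_finite_sums[OF coord_summable]) (use assms in auto)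
  then show ?thesis by (rule power2_le_imp_le) fact
qed

lemma summable_sq_finite_bound:
  fixes f :: "'a \<Rightarrow> complex"
  assumes "\<And>F. finite F \<Longrightarrow> (\<Sum>k\<in>F. (cmod (f k))\<^sup>2) \<le> B"
  shows "(\<lambda>k. (cmod (f k))\<^sup>2) summable_on UNIV"
  by (rule nonneg_bdd_above_summable_on) (use assms in \<open>auto intro!: bdd_aboveI[of _ B]\<close>)

lemma norm_ell2_mono:
  assumes "\<And>k. cmod (coord x k) \<le> cmod (coord y k)"
  shows "norm x \<le> norm y"
  unfolding norm_ell2
  by (intro real_sqrt_le_mono infsum_mono coord_summable power_mono assms) auto

instance ell2 :: (type) banach
proof
  fix X :: "nat \<Rightarrow> 'a ell2"
  assume C: "Cauchy X"
  have "Cauchy (\<lambda>n. coord (X n) k)" for k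
    by (rule bounded_linear.Cauchy[OF bounded_linear_coord C])
  then have "\<exists>l. (\<lambda>n. coord (X n) k) \<longlonglongrightarrow> l" for k
    by (simp add: Cauchy_convergent_iff convergent_def)
  then obtain l where l: "\<And>k. (\<lambda>n. coord (X n) k) \<longlonglongrightarrow> l k" by metis
  \<comment> \<open>The limit in m is taken inside finite sums, where it commutes with the sum; a
    bound valid for all finite \<open>F\<close> then survives for the infinite sum.\<close>
  have fin: "\<exists>N. \<forall>n\<ge>N. \<forall>F. finite F \<longrightarrow> (\<Sum>k\<in>F. (cmod (coord (X n) k - l k))\<^sup>2) \<le> e\<^sup>2" if "e > 0" for e
  proof -
    obtain N where N: "\<And>m n. m \<ge> N \<Longrightarrow> n \<ge> N \<Longrightarrow> norm (X m - X n) < e"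
      using CauchyD[OF C \<open>e > 0\<close>] by blast
    show ?thesis
    proof (intro exI allI impI)
      fix n and F :: "'a set" assume n: "n \<ge> N" and F: "finite F"
      have "(\<lambda>m. \<Sum>k\<in>F. (cmod (coord (X n) k - coord (X m) k))\<^sup>2) \<longlonglongrightarrow> (\<Sum>k\<in>F. (cmod (coord (X n) k - l k))\<^sup>2)"
        by (intro tendsto_intros l)
      moreover have "\<forall>\<^sub>F m in sequentially. (\<Sum>k\<in>F. (cmod (coord (X n) k - coord (X m) k))\<^sup>2) \<le> e\<^sup>2"
        unfolding eventually_sequentially
      proof (intro exI allI impI)
        fix m assume m: "N \<le> m"
        have "(\<Sum>k\<in>F. (cmod (coord (X n) k - coord (X m) k))\<^sup>2) \<le> (norm (X n - X m))\<^sup>2"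
          unfolding norm_ell2_sq using finite_sum_le_infsum[OF coord_summable[of "X n - X m"] F] by simp
        also have "\<dots> \<le> e\<^sup>2" using N[OF n m] by (intro power_mono) auto
        finally show "(\<Sum>k\<in>F. (cmod (coord (X n) k - coord (X m) k))\<^sup>2) \<le> e\<^sup>2" .
      qed
      ultimately show "(\<Sum>k\<in>F. (cmod (coord (X n) k - l k))\<^sup>2) \<le> e\<^sup>2"
        by (rule tendsto_upperbound) auto
    qed
  qed
  obtain N where "\<And>F. finite F \<Longrightarrow> (\<Sum>k\<in>F. (cmod (coord (X N) k - l k))\<^sup>2) \<le> 1\<^sup>2"
    using fin[of 1] by auto
  then have "(\<lambda>k. (cmod (coord (X N) k - l k))\<^sup>2) summable_on UNIV"
    by (rule summable_sq_finite_bound)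
  \<comment> \<open>\<open>l\<close> is \<open>X N\<close> minus the square summable difference,
    hence square summable itself.\<close>
  then have "(\<lambda>k. (cmod (coord (X N) k + - (coord (X N) k - l k)))\<^sup>2) summable_on UNIV"
    by (intro summable_sq_add coord_summable) (subst norm_minus_cancel)
  then have cl: "coord (Abs_ell2 l) = l" by (intro coord_Abs_ell2) simp
  have "X \<longlonglongrightarrow> Abs_ell2 l"
  proof (rule LIMSEQ_I)
    fix r :: real assume "r > 0"
    then obtain N where N: "\<forall>n\<ge>N. \<forall>F. finite F \<longrightarrow> (\<Sum>k\<in>F. (cmod (coord (X n) k - l k))\<^sup>2) \<le> (r/2)\<^sup>2"
      using fin[of "r/2"] by auto
    have "norm (X n - Abs_ell2 l) \<le> r/2" if "n \<ge> N" for n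
      by (rule norm_ell2_le_finite) (use N that \<open>r > 0\<close> cl in auto)
    then show "\<exists>N. \<forall>n\<ge>N. norm (X n - Abs_ell2 l) < r" using \<open>r > 0\<close> by force
  qed
  then show "convergent X" by (auto simp: convergent_def)
qed

lift_definition single :: "'a \<Rightarrow> complex \<Rightarrow> 'a ell2" is "\<lambda>k c j. if j = k then c else 0"
  by (rule finite_nonzero_values_imp_summable_on) (auto intro: finite_subset[of _ "{k}" for k])

lemma coord_single [simp]: "coord (single k c) j = (if j = k then c else 0)"
  by (simp add: single.rep_eq)

lemma norm_single [simp]: "norm (single k c) = cmod c"
proof -
  have "(norm (single k c))\<^sup>2 = (\<Sum>\<^sub>\<infinity>j\<in>{k}. (cmod c)\<^sup>2)"
    unfolding norm_ell2_sq by (rule infsum_cong_neutral) auto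
  then show ?thesis by simp
qed

lemma bounded_linear_single: "bounded_linear (single k)"
  by (rule bounded_linear_intro[of _ 1]) (auto intro!: ell2_eqI)

text \<open>By Pythagoras the squared distance from a partial sum to \<open>x\<close> is the tail of
  the convergent series of squares. Finitely supported vectors are thus dense, and the later
  identities between operators rest on this.\<close>

lemma has_sum_single: "((\<lambda>k. single k (coord x k)) has_sum x) UNIV"
  unfolding has_sum_def
proof (rule tendstoI)
  fix e :: real assume "e > 0"
  have "((\<lambda>k. (cmod (coord x k))\<^sup>2) has_sum (norm x)\<^sup>2) UNIV"
    unfolding norm_ell2_sq by (rule has_sum_infsum[OF coord_summable])
  then have "\<forall>\<^sub>F F in finite_subsets_at_top UNIV. dist (\<Sum>k\<in>F. (cmod (coord x k))\<^sup>2) ((norm x)\<^sup>2) < e\<^sup>2"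
    using \<open>e > 0\<close> by (auto simp: has_sum_def tendsto_iff)
  moreover have "\<forall>\<^sub>F F in finite_subsets_at_top (UNIV :: 'a set). finite F"
    by (rule eventually_finite_subsets_at_top_weakI)
  ultimately show "\<forall>\<^sub>F F in finite_subsets_at_top UNIV. dist (\<Sum>k\<in>F. single k (coord x k)) x < e"
  proof eventually_elim
    case (elim F)
    define y where "y = x - (\<Sum>k\<in>F. single k (coord x k))"
    have cs: "coord (\<Sum>k\<in>F. single k (coord x k)) j = (\<Sum>k\<in>F. coord (single k (coord x k)) j)" for j
      using bounded_linear.linear[OF bounded_linear_coord, THEN linear_sum] by metis
    have cy: "coord y j = (if j \<in> F then 0 else coord x j)" for j
      unfolding y_def minus_ell2.rep_eq cs by (simp add: elim(2))
    have "(norm y)\<^sup>2 = (norm x)\<^sup>2 - (\<Sum>k\<in>F. (cmod (coord x k))\<^sup>2)"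
    proof -
      have "(norm x)\<^sup>2 = (\<Sum>\<^sub>\<infinity>k. (cmod (coord y k))\<^sup>2 + (cmod (if k \<in> F then coord x k else 0))\<^sup>2)"
        unfolding norm_ell2_sq by (rule infsum_cong) (simp add: cy)
      also have "\<dots> = (norm y)\<^sup>2 + (\<Sum>\<^sub>\<infinity>k. (cmod (if k \<in> F then coord x k else 0))\<^sup>2)"
        unfolding norm_ell2_sq
        by (intro infsum_add coord_summable finite_nonzero_values_imp_summable_on)
          (auto intro: finite_subset[OF _ elim(2)])
      also have "(\<Sum>\<^sub>\<infinity>k. (cmod (if k \<in> F then coord x k else 0))\<^sup>2) = (\<Sum>\<^sub>\<infinity>k\<in>F. (cmod (coord x k))\<^sup>2)"
        by (rule infsum_cong_neutral) auto
      finally show ?thesis by (simp add: elim(2))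
    qed
    then have "(norm y)\<^sup>2 < e\<^sup>2" using elim(1) by (simp add: dist_real_def)
    then have "norm y < e" using \<open>e > 0\<close> by (simp add: power2_less_imp_less)
    then show ?case by (simp add: dist_norm y_def norm_minus_commute)
  qed
qed

text \<open>The expansion of \<open>x\<close> into unit vectors converges, and both maps may be
  applied termwise. The coefficient \<open>c\<close> ranges over the complex numbers because
  linearity is over the reals only.\<close>

lemma bounded_linear_eq_on_single:
  fixes f g :: "'a ell2 \<Rightarrow> 'b::real_normed_vector"
  assumes "bounded_linear f" "bounded_linear g" "\<And>k c. f (single k c) = g (single k c)"
  shows "f = g"
proof
  fix x
  have "((\<lambda>k. f (single k (coord x k))) has_sum f x) UNIV" "((\<lambda>k. g (single k (coord x k))) has_sum g x) UNIV"
    using has_sum_bounded_linear[OF assms(1) has_sum_single] has_sum_bounded_linear[OF assms(2) has_sum_single]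
    by auto
  then show "f x = g x" using has_sum_unique unfolding assms(3) by blast
qed

lemma ell2_finite_approx:
  assumes "e > 0"
  shows "\<exists>F. finite F \<and> norm (x - (\<Sum>k\<in>F. single k (coord x k))) < e"
proof -
  have "\<forall>\<^sub>F F in finite_subsets_at_top UNIV. dist (\<Sum>k\<in>F. single k (coord x k)) x < e"
    using has_sum_single[of x] assms by (auto simp: has_sum_def tendsto_iff)
  moreover have "\<forall>\<^sub>F F in finite_subsets_at_top (UNIV :: 'a set). finite F"
    by (rule eventually_finite_subsets_at_top_weakI)
  ultimately have "\<forall>\<^sub>F F in finite_subsets_at_top UNIV. finite F \<and> dist (\<Sum>k\<in>F. single k (coord x k)) x < e"
    by eventually_elim simp
  then show ?thesis
    by (auto simp: dist_norm norm_minus_commute dest: eventually_happens)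
qed

text \<open>Bochner integrals, which represent the heat semigroup below, are formed in second
  countable Banach spaces. Finite combinations of unit vectors with rational coefficients provide
  the countable dense set.\<close>

instance ell2 :: (countable) second_countable_topology
proof
  define g :: "('a \<times> rat \<times> rat) list \<Rightarrow> 'a ell2" where
    "g l = (\<Sum>(k, p, q)\<leftarrow>l. single k (Complex (of_rat p) (of_rat q)))" for l
  have dense: "\<exists>l. norm (x - g l) < e" if "e > 0" for x :: "'a ell2" and e
  proof -
    obtain F where F: "finite F" "norm (x - (\<Sum>k\<in>F. single k (coord x k))) < e/2"
      using ell2_finite_approx[of "e/2" x] \<open>e > 0\<close> by auto
    have "\<exists>l. norm ((\<Sum>k\<in>F. single k (coord x k)) - g l) < d" if "d > 0" for d
      using F(1) that
    proof (induction F arbitrary: d)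
      case empty
      then show ?case by (intro exI[of _ "[]"]) (simp add: g_def)
    next
      case (insert k F)
      obtain l where l: "norm ((\<Sum>k\<in>F. single k (coord x k)) - g l) < d/2"
        using insert.IH[of "d/2"] insert.prems by auto
      have "\<exists>p. \<bar>r - real_of_rat p\<bar> < d/4" for r
      proof -
        obtain p where "r - d/4 < real_of_rat p" "real_of_rat p < r + d/4"
          using of_rat_dense[of "r - d/4" "r + d/4"] insert.prems by auto
        then show ?thesis by (intro exI[of _ p]) linarith
      qed
      then obtain p q where pq: "\<bar>Re (coord x k) - real_of_rat p\<bar> < d/4" "\<bar>Im (coord x k) - real_of_rat q\<bar> < d/4"
        by metis
      have "single k (coord x k) - single k (Complex (of_rat p) (of_rat q))
          = single k (coord x k - Complex (of_rat p) (of_rat q))"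
        by (rule ell2_eqI) auto
      then have "norm (single k (coord x k) - single k (Complex (of_rat p) (of_rat q))) < d/2"
        using cmod_le[of "coord x k - Complex (of_rat p) (of_rat q)"] pq by simp
      then have "norm ((single k (coord x k) - single k (Complex (of_rat p) (of_rat q)))
          + ((\<Sum>k\<in>F. single k (coord x k)) - g l)) < d"
        using l by (intro norm_triangle_lt) linarith
      then show ?case using insert.hyps
        by (intro exI[of _ "(k, p, q) # l"]) (simp add: g_def algebra_simps)
    qed
    then obtain l where "norm ((\<Sum>k\<in>F. single k (coord x k)) - g l) < e/2"
      using \<open>e > 0\<close> half_gt_zero by blast
    then have "norm (x - g l) < e"
      using F(2) norm_triangle_ineq[of "x - (\<Sum>k\<in>F. single k (coord x k))" "(\<Sum>k\<in>F. single k (coord x k)) - g l"]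
      by simp
    then show ?thesis by blast
  qed
  define B where "B = (\<lambda>(l, n). ball (g l) (1 / Suc n)) ` UNIV"
  have "topological_basis B"
  proof (rule topological_basisI)
    show "open b" if "b \<in> B" for b using that by (auto simp: B_def)
    fix U :: "'a ell2 set" and x assume "open U" "x \<in> U"
    then obtain e where e: "e > 0" "ball x e \<subseteq> U" using openE by blast
    obtain n where n: "1 / Suc n < e/2" using nat_approx_posE[of "e/2"] e(1) by auto
    obtain l where l: "norm (x - g l) < 1 / Suc n" using dense[of "1 / Suc n" x] by auto
    have "ball (g l) (1 / Suc n) \<subseteq> ball x e"
    proof
      fix y assume y: "y \<in> ball (g l) (1 / Suc n)"
      have "dist x y \<le> dist x (g l) + dist (g l) y" by (rule dist_triangle)
      with l n y show "y \<in> ball x e" by (simp add: dist_norm)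
    qed
    then show "\<exists>B'\<in>B. x \<in> B' \<and> B' \<subseteq> U"
      using e(2) l by (intro bexI[of _ "ball (g l) (1 / Suc n)"]) (auto simp: B_def dist_norm norm_minus_commute)
  qed
  moreover have "countable B" unfolding B_def by auto
  ultimately show "\<exists>B::'a ell2 set set. countable B \<and> open = generate_topology B"
    using topological_basis_imp_subbasis by blast
qed

text \<open>Stands for nontriviality of the space: it is what gives the identity operator norm 1 in
  the algebra of operators.\<close>

instance ell2 :: (type) perfect_space
proof
  fix x :: "'a ell2"
  show "\<not> open {x}"
  proof
    assume "open {x}"
    then obtain e where e: "e > 0" "ball x e \<subseteq> {x}" by (meson openE singletonI)
    let ?y = "x + single undefined (of_real (e/2))"
    have "?y \<in> ball x e" using e(1) by (simp add: dist_norm)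
    then have "single undefined (of_real (e/2)) = (0::'a ell2)" using e(2) by auto
    then have "norm (single (undefined::'a) (of_real (e/2))) = 0" by simp
    then show False using e(1) by simp
  qed
qed

section \<open>The Banach algebra of bounded operators\<close>

text \<open>A class instance belongs to a type constructor, and \<open>blinfun\<close> also covers
  maps between different spaces. The copy for endomorphisms can be made a Banach algebra with unit,
  which gives the operator exponential and its power series.\<close>

typedef (overloaded) 'a blinop = "UNIV :: ('a::real_normed_vector \<Rightarrow>\<^sub>L 'a) set" ..

setup_lifting type_definition_blinop

instantiation blinop :: (real_normed_vector) real_normed_vector
begin

lift_definition zero_blinop :: "'a blinop" is 0 .
lift_definition plus_blinop :: "'a blinop \<Rightarrow> 'a blinop \<Rightarrow> 'a blinop" is "(+)" .
lift_definition uminus_blinop :: "'a blinop \<Rightarrow> 'a blinop" is uminus .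
lift_definition minus_blinop :: "'a blinop \<Rightarrow> 'a blinop \<Rightarrow> 'a blinop" is "(-)" .
lift_definition scaleR_blinop :: "real \<Rightarrow> 'a blinop \<Rightarrow> 'a blinop" is "(*\<^sub>R)" .
lift_definition norm_blinop :: "'a blinop \<Rightarrow> real" is norm .
definition dist_blinop :: "'a blinop \<Rightarrow> 'a blinop \<Rightarrow> real" where
  "dist_blinop x y = norm (x - y)"
definition sgn_blinop :: "'a blinop \<Rightarrow> 'a blinop" where
  "sgn_blinop x = inverse (norm x) *\<^sub>R x"
definition uniformity_blinop :: "('a blinop \<times> 'a blinop) filter" where
  "uniformity_blinop = (INF e\<in>{0 <..}. principal {(x, y). dist x y < e})"
definition open_blinop :: "'a blinop set \<Rightarrow> bool" where
  "open_blinop S \<longleftrightarrow> (\<forall>x\<in>S. \<forall>\<^sub>F (x', y) in uniformity. x' = x \<longrightarrow> y \<in> S)"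

instance
proof
  fix x y z :: "'a blinop" and a b :: real
  show "x + y + z = x + (y + z)" "x + y = y + x" "0 + x = x" "- x + x = 0" "x - y = x + - y"
    "a *\<^sub>R (x + y) = a *\<^sub>R x + a *\<^sub>R y" "(a + b) *\<^sub>R x = a *\<^sub>R x + b *\<^sub>R x"
    "a *\<^sub>R b *\<^sub>R x = (a * b) *\<^sub>R x" "1 *\<^sub>R x = x" "(norm x = 0) = (x = 0)"
    by (transfer; simp add: algebra_simps)+
  show "norm (x + y) \<le> norm x + norm y" by transfer (rule norm_triangle_ineq)
  show "norm (a *\<^sub>R x) = \<bar>a\<bar> * norm x" by transfer simp
qed (simp_all add: dist_blinop_def sgn_blinop_def uniformity_blinop_def open_blinop_def)

end

lift_definition app :: "'a::real_normed_vector blinop \<Rightarrow> 'a \<Rightarrow> 'a" (infixr "\<triangleright>" 75) is blinfun_apply .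

lemma blinop_eqI: "(\<And>x. T \<triangleright> x = U \<triangleright> x) \<Longrightarrow> T = U"
  by transfer (rule blinfun_eqI)

lemma norm_app: "norm (T \<triangleright> x) \<le> norm T * norm x"
  by transfer (rule norm_blinfun)

lemma norm_blinop_bound: "0 \<le> b \<Longrightarrow> (\<And>x. norm (T \<triangleright> x) \<le> b * norm x) \<Longrightarrow> norm T \<le> b"
  by transfer (rule norm_blinfun_bound)

lemma bounded_linear_app: "bounded_linear ((\<triangleright>) T)"
  by transfer (rule blinfun.bounded_linear_right)

lemma app_add_left [simp]: "(T + U) \<triangleright> x = T \<triangleright> x + U \<triangleright> x"
  by transfer (rule blinfun.add_left)

lemma app_scaleR_left [simp]: "(r *\<^sub>R T) \<triangleright> x = r *\<^sub>R (T \<triangleright> x)"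
  by transfer (rule blinfun.scaleR_left)

lemma bounded_bilinear_app: "bounded_bilinear (\<triangleright>)"
proof
  show "\<exists>K. \<forall>T x. norm (T \<triangleright> x :: 'a) \<le> norm T * norm x * K"
    by (intro exI[of _ 1]) (simp add: norm_app)
qed (simp_all add: bounded_linear.linear[OF bounded_linear_app] linear_add linear_scale)

interpretation app: bounded_bilinear "(\<triangleright>)"
  by (rule bounded_bilinear_app)

lemmas [simp] = app.add_right app.diff_left app.diff_right app.zero_left app.zero_right
  app.minus_left app.minus_right app.scaleR_right

lemmas continuous_on_app [continuous_intros] = app.continuous_on

instance blinop :: (banach) banach
proof
  fix X :: "nat \<Rightarrow> 'a blinop"
  assume "Cauchy X"
  then have "Cauchy (\<lambda>n. Rep_blinop (X n))"
    by (simp add: Cauchy_def dist_norm norm_blinop.rep_eq minus_blinop.rep_eq)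
  then obtain L where "(\<lambda>n. Rep_blinop (X n)) \<longlonglongrightarrow> L"
    by (auto simp: Cauchy_convergent_iff convergent_def)
  then have "X \<longlonglongrightarrow> Abs_blinop L"
    by (simp add: LIMSEQ_iff norm_blinop.rep_eq minus_blinop.rep_eq Abs_blinop_inverse)
  then show "convergent X" by (auto simp: convergent_def)
qed

instantiation blinop :: ("{real_normed_vector, perfect_space}") real_normed_algebra_1
begin

lift_definition one_blinop :: "'a blinop" is id_blinfun .
lift_definition times_blinop :: "'a blinop \<Rightarrow> 'a blinop \<Rightarrow> 'a blinop" is "(o\<^sub>L)" .

instance
proof
  fix x y z :: "'a blinop" and a :: real
  show "x * y * z = x * (y * z)" "1 * x = x" "x * 1 = x" "(x + y) * z = x * z + y * z"
    "x * (y + z) = x * y + x * z" "a *\<^sub>R x * y = a *\<^sub>R (x * y)" "x * a *\<^sub>R y = a *\<^sub>R (x * y)"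
    by (transfer; simp add: blinfun_eqI blinfun.bilinear_simps)+
  show "norm (x * y) \<le> norm x * norm y" by transfer (rule norm_blinfun_compose)
  show n1: "norm (1::'a blinop) = 1" by transfer simp
  show "(0::'a blinop) \<noteq> 1"
  proof
    assume "(0::'a blinop) = 1"
    then have "norm (1::'a blinop) = norm (0::'a blinop)" by simp
    then show False by (simp add: n1)
  qed
qed

end

lemma app_one [simp]: "1 \<triangleright> x = x"
  by transfer simp

lemma app_times [simp]: "(T * U) \<triangleright> x = T \<triangleright> (U \<triangleright> x)"
  by transfer simp

lift_definition Blinop :: "('a::real_normed_vector \<Rightarrow> 'a) \<Rightarrow> 'a blinop" is Blinfun .

lemma app_Blinop: "bounded_linear f \<Longrightarrow> Blinop f \<triangleright> x = f x"
  by transfer (simp add: bounded_linear_Blinfun_apply)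

text \<open>The relation passes to powers and, \<open>h\<close> being continuous, through the power
  series. With a point evaluation for \<open>h\<close> and a multiplication operator for
  \<open>T\<close>, the operator exponential becomes pointwise multiplication by an
  exponential.\<close>

lemma exp_app_eigen:
  fixes T :: "'a::{banach, perfect_space} blinop" and h :: "'a \<Rightarrow> complex"
  assumes h: "bounded_linear h" and T: "\<And>x. h (T \<triangleright> x) = c * h x"
  shows "h (exp T \<triangleright> x) = exp c * h x"
proof -
  have pow: "h (T ^ n \<triangleright> x) = c ^ n * h x" for n
    by (induction n) (simp_all add: T)
  have "bounded_linear (\<lambda>U. h (U \<triangleright> x))"
    by (rule bounded_linear_compose[OF h app.bounded_linear_left])
  from bounded_linear.sums[OF this exp_converges[of T]]
  have "(\<lambda>n. (c ^ n /\<^sub>R fact n) * h x) sums h (exp T \<triangleright> x)"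
    by (simp add: linear_scale[OF bounded_linear.linear[OF h]] pow)
  moreover have "(\<lambda>n. (c ^ n /\<^sub>R fact n) * h x) sums (exp c * h x)"
    by (intro sums_mult2 exp_converges)
  ultimately show ?thesis by (rule sums_unique2)
qed

section \<open>Multipliers\<close>

text \<open>Meaningful for bounded \<open>m\<close> only; the lemmas about it carry a bound
  \<open>B\<close>.\<close>

definition multiplier :: "('a \<Rightarrow> complex) \<Rightarrow> 'a ell2 blinop" where
  "multiplier m = Blinop (\<lambda>x. Abs_ell2 (\<lambda>k. m k * coord x k))"

lemma
  assumes m: "\<And>k. cmod (m k) \<le> B"
  shows coord_multiplier: "coord (multiplier m \<triangleright> x) k = m k * coord x k"
    and norm_multiplier_le: "norm (multiplier m) \<le> B"
proof -
  define f where "f x = Abs_ell2 (\<lambda>k. m k * coord x k)" for x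
  have c: "coord (f x) k = m k * coord x k" for x k
    unfolding f_def by (simp add: coord_Abs_ell2 summable_sq_mult[OF coord_summable m])
  have B: "0 \<le> B" using m norm_ge_zero order_trans by blast
  have n: "norm (f x) \<le> B * norm x" for x
  proof -
    have "norm (f x) \<le> norm (B *\<^sub>R x)"
      by (rule norm_ell2_mono) (use m B in \<open>simp add: c norm_mult mult_right_mono\<close>)
    then show ?thesis using B by simp
  qed
  have bl: "bounded_linear f"
    by (rule bounded_linear_intro[of _ B])
      (use n in \<open>auto intro!: ell2_eqI simp: c algebra_simps\<close>)
  have app: "multiplier m \<triangleright> x = f x" for x
    unfolding multiplier_def f_def[symmetric, abs_def] by (rule app_Blinop[OF bl])
  show "coord (multiplier m \<triangleright> x) k = m k * coord x k" by (simp add: app c)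
  show "norm (multiplier m) \<le> B" by (rule norm_blinop_bound[OF B]) (simp add: app n)
qed

text \<open>Strong convergence is all that can be expected: translations and the heat semigroup at
  time 0 are not continuous in operator norm. On a finitely supported vector the claim is a finite
  sum of limits, and the uniform bound controls the remainder.\<close>

lemma multiplier_tendsto:
  assumes m: "\<And>k. ((\<lambda>t. m t k) \<longlongrightarrow> m0 k) F"
    and B: "\<forall>\<^sub>F t in F. \<forall>k. cmod (m t k) \<le> B" "\<And>k. cmod (m0 k) \<le> B"
  shows "((\<lambda>t. multiplier (m t) \<triangleright> x) \<longlongrightarrow> multiplier m0 \<triangleright> x) F"
proof (rule tendstoI)
  fix e :: real assume e: "e > 0"
  have B0: "0 \<le> B" using B(2) norm_ge_zero order_trans by blast
  \<comment> \<open>The remainder \<open>x - y\<close> is hit by an operator of norm at most 2B, and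
    2B d \<le> e/2; the 1 in the denominator admits B = 0.\<close>
  define d where "d = e / (4 * (B + 1))"
  have d: "d > 0" using e B0 by (simp add: d_def)
  obtain A where A: "finite A" "norm (x - (\<Sum>k\<in>A. single k (coord x k))) < d"
    using ell2_finite_approx[OF d] by blast
  define y where "y = (\<Sum>k\<in>A. single k (coord x k))"
  have "((\<lambda>t. \<Sum>k\<in>A. cmod (m t k - m0 k) * cmod (coord x k)) \<longlongrightarrow> (\<Sum>k\<in>A. cmod (m0 k - m0 k) * cmod (coord x k))) F"
    by (intro tendsto_intros m)
  then have "\<forall>\<^sub>F t in F. (\<Sum>k\<in>A. cmod (m t k - m0 k) * cmod (coord x k)) < e/2"
    by (rule order_tendstoD) (use e in simp)
  with B(1) show "\<forall>\<^sub>F t in F. dist (multiplier (m t) \<triangleright> x) (multiplier m0 \<triangleright> x) < e"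
  proof eventually_elim
    case (elim t)
    have cm: "coord (multiplier (m t) \<triangleright> z) k = m t k * coord z k" for z k
      using elim(1) by (intro coord_multiplier) auto
    have nm: "norm (multiplier (m t)) \<le> B" using elim(1) by (intro norm_multiplier_le) auto
    have cm0: "coord (multiplier m0 \<triangleright> z) k = m0 k * coord z k" for z k
      by (rule coord_multiplier[OF B(2)])
    have nm0: "norm (multiplier m0) \<le> B" by (rule norm_multiplier_le[OF B(2)])
    let ?D = "multiplier (m t) - multiplier m0"
    have nD: "norm ?D \<le> 2 * B" using norm_triangle_ineq4[of "multiplier (m t)" "multiplier m0"] nm nm0 by linarith
    have "?D \<triangleright> single k c = single k ((m t k - m0 k) * c)" for k c
      by (rule ell2_eqI) (auto simp: cm cm0 algebra_simps)
    then have "?D \<triangleright> y = (\<Sum>k\<in>A. single k ((m t k - m0 k) * coord x k))"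
      unfolding y_def app.sum_right by (intro sum.cong) auto
    then have "norm (?D \<triangleright> y) \<le> (\<Sum>k\<in>A. cmod (m t k - m0 k) * cmod (coord x k))"
      by (simp add: norm_mult sum_norm_le)
    moreover have "norm (?D \<triangleright> (x - y)) \<le> 2 * B * d"
      using norm_app[of ?D "x - y"] mult_mono[OF nD less_imp_le[OF A(2)]] B0 by (simp add: y_def)
    moreover have "2 * B * d \<le> e / 2"
      using B0 e by (simp add: d_def field_simps)
    moreover have eq: "multiplier (m t) \<triangleright> x - multiplier m0 \<triangleright> x = ?D \<triangleright> y + ?D \<triangleright> (x - y)"
      by (simp only: app.diff_left app.diff_right) simp
    ultimately show ?case
      using elim(2) norm_triangle_ineq[of "?D \<triangleright> y" "?D \<triangleright> (x - y)"] unfolding dist_norm eq by linarith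
  qed
qed

text \<open>Complex conjugation of functions, read on Fourier coefficients: the reflection
  \<open>- k\<close> comes from conjugating the exponentials. The Sobolev weight is even, so the
  same formula serves for weighted coefficients.\<close>

definition conj_ell2 :: "'a::group_add ell2 \<Rightarrow> 'a ell2" where
  "conj_ell2 x = Abs_ell2 (\<lambda>k. cnj (coord x (- k)))"

lemma coord_conj_ell2 [simp]: "coord (conj_ell2 x) k = cnj (coord x (- k))"
proof -
  have "bij (uminus :: 'a \<Rightarrow> 'a)" by (rule involuntory_imp_bij) simp
  then have "(\<lambda>k. (cmod (coord x (- k)))\<^sup>2) summable_on UNIV"
    using summable_on_reindex_bij_betw[of uminus UNIV UNIV "\<lambda>k. (cmod (coord x k))\<^sup>2"] coord_summable[of x]
    by simp
  then show ?thesis by (simp add: conj_ell2_def coord_Abs_ell2)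
qed

lemma norm_conj_ell2 [simp]: "norm (conj_ell2 x) = norm x"
  unfolding norm_ell2 coord_conj_ell2 complex_mod_cnj
  by (subst infsum_reindex_bij_betw[of uminus UNIV UNIV "\<lambda>k. (cmod (coord x k))\<^sup>2"]) (auto intro: involuntory_imp_bij)

lemma bounded_linear_conj_ell2: "bounded_linear conj_ell2"
  by (rule bounded_linear_intro[of _ 1]) (auto intro!: ell2_eqI)

section \<open>Mild solutions in Banach spaces\<close>

definition trunc :: "real \<Rightarrow> 'a::real_normed_vector \<Rightarrow> 'a" where
  "trunc r x = (if norm x \<le> r then x else (r / norm x) *\<^sub>R x)"

lemma norm_trunc_le: "0 \<le> r \<Longrightarrow> norm (trunc r x) \<le> r"
  by (auto simp: trunc_def)

text \<open>The constant 2 holds in every normed space. A point outside the ball is moved by its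
  excess norm, which is at most the distance to any point of the ball; for two outer points the
  change of the radial factor costs at most the difference of the norms.\<close>

lemma trunc_lipschitz:
  assumes r: "0 < r"
  shows "norm (trunc r x - trunc r y) \<le> 2 * norm (x - y)"
proof -
  have one: "norm (trunc r x - trunc r y) \<le> 2 * norm (x - y)"
    if x: "norm x > r" and y: "norm y \<le> r" for x y :: 'a
  proof -
    have "trunc r x - x = - ((1 - r / norm x) *\<^sub>R x)" using x by (simp add: trunc_def algebra_simps)
    then have "norm (trunc r x - x) = \<bar>1 - r / norm x\<bar> * norm x" by simp
    also have "\<dots> = norm x - r"
    proof -
      have "0 < norm x" using x r by linarith
      then show ?thesis using x r by (simp add: abs_if divide_less_eq algebra_simps)
    qed
    also have "\<dots> \<le> norm (x - y) + (norm y - r)"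
      using norm_triangle_ineq2[of x y] by simp
    finally have "norm (trunc r x - x) \<le> norm (x - y)" using y by simp
    moreover have "trunc r x - trunc r y = (trunc r x - x) + (x - y)" using y by (simp add: trunc_def)
    ultimately show ?thesis using norm_triangle_ineq[of "trunc r x - x" "x - y"] by simp
  qed
  consider "norm x \<le> r" "norm y \<le> r" | "norm x > r" "norm y \<le> r" | "norm x \<le> r" "norm y > r"
    | "norm x > r" "norm y > r" by linarith
  then show ?thesis
  proof cases
    case 1 then show ?thesis by (simp add: trunc_def)
  next
    case 2 then show ?thesis by (rule one)
  next
    case 3 then show ?thesis using one[of y x] by (simp add: norm_minus_commute)
  next
    case 4
    have "trunc r x - trunc r y = (r / norm x) *\<^sub>R (x - y) + (r / norm x - r / norm y) *\<^sub>R y"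
      using 4 by (simp add: trunc_def algebra_simps)
    moreover have "norm ((r / norm x) *\<^sub>R (x - y)) \<le> norm (x - y)"
    proof -
      have "r / norm x * norm (x - y) \<le> 1 * norm (x - y)"
        using 4 r by (intro mult_right_mono) (auto simp: divide_le_eq)
      then show ?thesis using r by simp
    qed
    moreover have "norm ((r / norm x - r / norm y) *\<^sub>R y) \<le> norm (x - y)"
    proof -
      have "0 < norm x" "0 < norm y" using 4 r by auto
      then have "r / norm x - r / norm y = r / norm x * ((norm y - norm x) / norm y)"
        by (simp add: field_simps)
      then have "norm ((r / norm x - r / norm y) *\<^sub>R y) = r / norm x * \<bar>norm y - norm x\<bar>"
        using 4 r \<open>0 < norm y\<close> by (auto simp: abs_mult)
      also have "\<dots> \<le> 1 * \<bar>norm y - norm x\<bar>"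
        using 4 r by (intro mult_right_mono) (auto simp: divide_le_eq)
      also have "\<dots> \<le> norm (x - y)" using norm_triangle_ineq3[of y x] by (simp add: norm_minus_commute)
      finally show ?thesis .
    qed
    ultimately show ?thesis using norm_triangle_ineq by (smt (verit))
  qed
qed

text \<open>A bound on [0,1] is enough, since existence and stability are only used on intervals of
  length at most 1; the final time may be shortened at will.\<close>

locale strongly_continuous_semigroup =
  fixes S :: "real \<Rightarrow> 'a::{banach, perfect_space} blinop" and M :: real
  assumes S_zero [simp]: "S 0 = 1"
    and S_add: "0 \<le> s \<Longrightarrow> 0 \<le> t \<Longrightarrow> S (s + t) = S s * S t"
    and norm_S_le: "0 \<le> t \<Longrightarrow> t \<le> 1 \<Longrightarrow> norm (S t) \<le> M"
    and S_strong: "continuous_on {0..} (\<lambda>t. S t \<triangleright> x)"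
begin

lemma M_pos: "1 \<le> M"
  using norm_S_le[of 0] by simp

lemma norm_S_app_le: "0 \<le> t \<Longrightarrow> t \<le> 1 \<Longrightarrow> norm (S t \<triangleright> x) \<le> M * norm x"
  by (rule order_trans[OF norm_app]) (simp add: norm_S_le mult_right_mono)

text \<open>Strong continuity and a uniform bound give joint continuity: split off
  \<open>S (g q)\<close> applied to \<open>f q - f p\<close>, which is small uniformly in
  \<open>g q\<close>.\<close>

lemma continuous_on_S_app:
  fixes g :: "'b::metric_space \<Rightarrow> real" and f :: "'b \<Rightarrow> 'a"
  assumes f: "continuous_on A f" and g: "continuous_on A g" and g01: "g ` A \<subseteq> {0..1}"
  shows "continuous_on A (\<lambda>p. S (g p) \<triangleright> f p)"
  unfolding continuous_on_def
proof
  fix p assume p: "p \<in> A"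
  have "continuous_on A (\<lambda>q. S (g q) \<triangleright> f p)"
    by (rule continuous_on_compose2[OF S_strong g]) (use g01 in auto)
  then have 1: "((\<lambda>q. S (g q) \<triangleright> f p) \<longlongrightarrow> S (g p) \<triangleright> f p) (at p within A)"
    using p by (simp add: continuous_on_def)
  have "((\<lambda>q. M * norm (f q - f p)) \<longlongrightarrow> M * norm (f p - f p)) (at p within A)"
    using f p by (intro tendsto_intros) (simp add: continuous_on_def)
  then have z: "((\<lambda>q. M * norm (f q - f p)) \<longlongrightarrow> 0) (at p within A)" by simp
  have "((\<lambda>q. S (g q) \<triangleright> (f q - f p)) \<longlongrightarrow> 0) (at p within A)"
  proof (rule Lim_null_comparison[OF _ z])
    show "\<forall>\<^sub>F q in at p within A. norm (S (g q) \<triangleright> (f q - f p)) \<le> M * norm (f q - f p)"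
      unfolding eventually_at_filter using g01 by (intro always_eventually allI impI norm_S_app_le) auto
  qed
  from tendsto_add[OF this 1] show "((\<lambda>q. S (g q) \<triangleright> f q) \<longlongrightarrow> S (g p) \<triangleright> f p) (at p within A)"
    by simp
qed

lemma continuous_on_duhamel_integrand:
  assumes h: "continuous_on {0..T} h" and t: "t \<in> {0..T}" and T: "T \<le> 1"
  shows "continuous_on {0..t} (\<lambda>r. S (t - r) \<triangleright> h r)"
  by (rule continuous_on_S_app) (use t T in \<open>auto intro!: continuous_intros continuous_on_subset[OF h]\<close>)

lemma duhamel_integrable:
  assumes "continuous_on {0..T} h" "t \<in> {0..T}" "T \<le> 1"
  shows "(\<lambda>r. S (t - r) \<triangleright> h r) integrable_on {0..t}"
  by (rule integrable_continuous_real[OF continuous_on_duhamel_integrand[OF assms]])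

lemma continuous_on_duhamel:
  assumes h: "continuous_on {0..T} h" and T: "T \<le> 1"
  shows "continuous_on {0..T} (\<lambda>t. integral {0..t} (\<lambda>r. S (t - r) \<triangleright> h r))"
proof -
  \<comment> \<open>The moving upper limit is removed: for r > t the integrand becomes
    \<open>h r\<close> because \<open>S 0 = 1\<close>, and the surplus is the integral of
    \<open>h\<close> over [t,T].\<close>
  have 1: "continuous_on {0..T} (\<lambda>t. integral (cbox 0 T) (\<lambda>r. S (max 0 (t - r)) \<triangleright> h r))"
  proof (rule integral_continuous_on_param)
    have "continuous_on ({0..T} \<times> cbox 0 T) (\<lambda>p. S (max 0 (fst p - snd p)) \<triangleright> h (snd p))"
      by (rule continuous_on_S_app)
        (use T in \<open>auto intro!: continuous_intros continuous_on_compose2[OF h]\<close>)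
    then show "continuous_on ({0..T} \<times> cbox 0 T) (\<lambda>(t, r). S (max 0 (t - r)) \<triangleright> h r)"
      by (simp add: case_prod_unfold)
  qed
  have 2: "continuous_on {0..T} (\<lambda>t. integral {t..T} h)"
    by (rule indefinite_integral_continuous_1') (rule integrable_continuous_real[OF h])
  have "integral {0..t} (\<lambda>r. S (t - r) \<triangleright> h r)
      = integral (cbox 0 T) (\<lambda>r. S (max 0 (t - r)) \<triangleright> h r) - integral {t..T} h" if t: "t \<in> {0..T}" for t
  proof -
    have "continuous_on {0..T} (\<lambda>r. S (max 0 (t - r)) \<triangleright> h r)"
      by (rule continuous_on_S_app) (use t T in \<open>auto intro!: continuous_intros h\<close>)
    then have "integral {0..t} (\<lambda>r. S (max 0 (t - r)) \<triangleright> h r) + integral {t..T} (\<lambda>r. S (max 0 (t - r)) \<triangleright> h r)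
        = integral {0..T} (\<lambda>r. S (max 0 (t - r)) \<triangleright> h r)"
      using t by (intro Henstock_Kurzweil_Integration.integral_combine integrable_continuous_real) auto
    moreover have "integral {0..t} (\<lambda>r. S (max 0 (t - r)) \<triangleright> h r) = integral {0..t} (\<lambda>r. S (t - r) \<triangleright> h r)"
      by (rule integral_cong) (auto simp: max_def)
    moreover have "integral {t..T} (\<lambda>r. S (max 0 (t - r)) \<triangleright> h r) = integral {t..T} h"
      by (rule integral_cong) (auto simp: max_def)
    ultimately show ?thesis by (simp add: algebra_simps)
  qed
  then show ?thesis
    by (intro continuous_on_eq[OF continuous_on_diff[OF 1 2]]) metis
qed

lemma norm_duhamel_le:
  assumes h: "((\<lambda>r. S (t - r) \<triangleright> h r) has_integral I) {0..t}" and t: "0 \<le> t" "t \<le> 1"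
    and b: "(b has_integral J) {0..t}" and le: "\<And>r. r \<in> {0..t} \<Longrightarrow> norm (h r) \<le> b r"
  shows "norm I \<le> M * J"
proof -
  have "norm (integral {0..t} (\<lambda>r. S (t - r) \<triangleright> h r)) \<le> integral {0..t} (\<lambda>r. M * b r)"
  proof (rule integral_norm_bound_integral)
    show "(\<lambda>r. S (t - r) \<triangleright> h r) integrable_on {0..t}" using h by blast
    show "(\<lambda>r. M * b r) integrable_on {0..t}" using b by (auto intro!: integrable_on_mult_right)
    fix r assume r: "r \<in> {0..t}"
    have "norm (S (t - r) \<triangleright> h r) \<le> M * norm (h r)" by (rule norm_S_app_le) (use r t in auto)
    also have "\<dots> \<le> M * b r" using le[OF r] M_pos by (intro mult_left_mono) auto
    finally show "norm (S (t - r) \<triangleright> h r) \<le> M * b r" .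
  qed
  then show ?thesis
    using integral_unique[OF h] integral_unique[OF has_integral_mult_right[OF b, of M]] by (simp only:)
qed

text \<open>Gronwall's inequality, by means of the weight \<open>exp (- 2 M L t)\<close>.\<close>

lemma duhamel_stability:
  fixes x y A B h k :: "real \<Rightarrow> 'a"
  assumes T: "0 \<le> T" "T \<le> 1" and L: "0 < L"
    and x: "continuous_on {0..T} x" and y: "continuous_on {0..T} y"
    and hx: "\<And>t. t \<in> {0..T} \<Longrightarrow> ((\<lambda>r. S (t - r) \<triangleright> h r) has_integral (x t - A t)) {0..t}"
    and hy: "\<And>t. t \<in> {0..T} \<Longrightarrow> ((\<lambda>r. S (t - r) \<triangleright> k r) has_integral (y t - B t)) {0..t}"
    and lip: "\<And>t. t \<in> {0..T} \<Longrightarrow> norm (h t - k t) \<le> L * norm (x t - y t)"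
    and AB: "\<And>t. t \<in> {0..T} \<Longrightarrow> norm (A t - B t) \<le> \<eta>"
    and t: "t \<in> {0..T}"
  shows "norm (x t - y t) \<le> 2 * \<eta> * exp (2 * M * L * T)"
proof -
  define l where "l = 2 * M * L"
  have l: "l > 0" using M_pos L by (simp add: l_def)
  have "continuous_on {0..T} (\<lambda>t. exp (- l * t) * norm (x t - y t))"
    by (intro continuous_intros x y)
  \<comment> \<open>At a maximum t0 of the weighted distance the Duhamel term contributes at most
    half of that maximum, since M L / l = 1/2; it is absorbed, which leaves a bound by twice
    \<eta>.\<close>
  then obtain t0 where t0: "t0 \<in> {0..T}"
    and sup: "\<And>t. t \<in> {0..T} \<Longrightarrow> exp (- l * t) * norm (x t - y t) \<le> exp (- l * t0) * norm (x t0 - y t0)"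
    using continuous_attains_sup[of "{0..T}" "\<lambda>t. exp (- l * t) * norm (x t - y t)"] T by auto
  define D where "D = exp (- l * t0) * norm (x t0 - y t0)"
  have D0: "0 \<le> D" by (simp add: D_def)
  have D: "norm (x t - y t) \<le> D * exp (l * t)" if "t \<in> {0..T}" for t
    using sup[OF that] by (simp add: D_def exp_minus field_simps)
  have "((\<lambda>r. S (t0 - r) \<triangleright> (h r - k r)) has_integral ((x t0 - A t0) - (y t0 - B t0))) {0..t0}"
    using has_integral_diff[OF hx[OF t0] hy[OF t0]] by simp
  moreover have "((\<lambda>r. L * D * exp (l * r)) has_integral (L * D * ((exp (l * t0) - 1) / l))) {0..t0}"
  proof (rule has_integral_mult_right)
    have "((\<lambda>r. exp (l * r)) has_integral (exp (l * t0) / l - exp (l * 0) / l)) {0..t0}"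
      using t0 l by (intro fundamental_theorem_of_calculus)
        (auto intro!: derivative_eq_intros simp flip: has_real_derivative_iff_has_vector_derivative)
    then show "((\<lambda>r. exp (l * r)) has_integral ((exp (l * t0) - 1) / l)) {0..t0}"
      by (simp add: diff_divide_distrib)
  qed
  moreover have "norm (h r - k r) \<le> L * D * exp (l * r)" if "r \<in> {0..t0}" for r
  proof -
    have "norm (h r - k r) \<le> L * norm (x r - y r)" using that t0 by (intro lip) auto
    also have "\<dots> \<le> L * (D * exp (l * r))" using that t0 L by (intro mult_left_mono D) auto
    finally show ?thesis by simp
  qed
  ultimately have "norm ((x t0 - A t0) - (y t0 - B t0)) \<le> M * (L * D * ((exp (l * t0) - 1) / l))"
    using t0 T by (intro norm_duhamel_le) auto
  also have "\<dots> = D / 2 * (exp (l * t0) - 1)" using l L M_pos by (simp add: l_def field_simps)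
  also have "\<dots> \<le> D / 2 * exp (l * t0)" using D0 by (intro mult_left_mono) auto
  finally have "norm ((x t0 - A t0) - (y t0 - B t0)) \<le> D / 2 * exp (l * t0)" .
  moreover have "x t0 - y t0 = ((x t0 - A t0) - (y t0 - B t0)) + (A t0 - B t0)" by simp
  ultimately have "norm (x t0 - y t0) \<le> D / 2 * exp (l * t0) + \<eta>"
    using AB[OF t0] norm_triangle_ineq by (smt (verit))
  moreover have "norm (x t0 - y t0) = D * exp (l * t0)"
    by (simp add: D_def exp_minus)
  moreover have \<eta>: "0 \<le> \<eta>" using AB[OF t0] norm_ge_zero order_trans by blast
  ultimately have "D * exp (l * t0) \<le> 2 * \<eta>" by simp
  moreover have "D * 1 \<le> D * exp (l * t0)" using D0 l t0 by (intro mult_left_mono) auto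
  ultimately have "D \<le> 2 * \<eta>" by simp
  then have "norm (x t - y t) \<le> 2 * \<eta> * exp (l * T)"
    using t l \<eta> by (intro order_trans[OF D[OF t]] mult_mono) auto
  then show ?thesis by (simp add: l_def)
qed

definition mild :: "(real \<Rightarrow> 'a \<Rightarrow> 'a) \<Rightarrow> 'a \<Rightarrow> real \<Rightarrow> (real \<Rightarrow> 'a) \<Rightarrow> bool" where
  "mild F a T x \<longleftrightarrow> continuous_on {0..T} x \<and>
     (\<forall>t\<in>{0..T}. ((\<lambda>r. S (t - r) \<triangleright> F r (x r)) has_integral (x t - S t \<triangleright> a)) {0..t})"

text \<open>At time 0 the integral runs over a single point and vanishes.\<close>

lemma mild_init: "mild F a T x \<Longrightarrow> 0 \<le> T \<Longrightarrow> x 0 = a"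
proof -
  assume "mild F a T x" "0 \<le> T"
  then have "((\<lambda>r. S (0 - r) \<triangleright> F r (x r)) has_integral (x 0 - S 0 \<triangleright> a)) {0..0}"
    unfolding mild_def by (metis atLeastAtMost_iff order_refl)
  then have "x 0 - S 0 \<triangleright> a = 0" by (simp add: has_integral_refl has_integral_iff)
  then show ?thesis by simp
qed

text \<open>In the unknown \<open>exp (- l * t) *\<^sub>R x t\<close> with l = 2 M L the Duhamel map
  is a contraction with factor 1/2 on the whole interval, however large \<open>L\<close> is.\<close>

lemma mild_exists_lipschitz:
  assumes T: "0 \<le> T" "T \<le> 1" and L: "0 < L"
    and F: "\<And>x. continuous_on {0..T} x \<Longrightarrow> continuous_on {0..T} (\<lambda>t. F t (x t))"
    and lip: "\<And>t x y. t \<in> {0..T} \<Longrightarrow> norm (F t x - F t y) \<le> L * norm (x - y)"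
  shows "\<exists>x. mild F a T x"
proof -
  define l where "l = 2 * M * L"
  have l: "l > 0" using M_pos L by (simp add: l_def)
  \<comment> \<open>The fixed point is sought among bounded continuous functions on the whole line,
    a complete space; \<open>\<tau>\<close> clamps the time so that only values on [0,T]
    matter.\<close>
  define \<tau> where "\<tau> t = max 0 (min T t)" for t :: real
  have \<tau>: "\<tau> t \<in> {0..T}" "t \<in> {0..T} \<Longrightarrow> \<tau> t = t" for t using T by (auto simp: \<tau>_def)
  have c\<tau>: "continuous_on UNIV \<tau>" unfolding \<tau>_def[abs_def] by (intro continuous_intros)
  define h where "h g r = F r (exp (l * r) *\<^sub>R apply_bcontfun g r)" for g :: "real \<Rightarrow>\<^sub>C 'a" and r
  have ch: "continuous_on {0..T} (h g)" for g
    unfolding h_def[abs_def] by (intro F continuous_intros continuous_on_subset[OF continuous_on_apply_bcontfun]) auto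
  define G where "G g t = exp (- l * t) *\<^sub>R (S t \<triangleright> a + integral {0..t} (\<lambda>r. S (t - r) \<triangleright> h g r))" for g t
  have cG: "continuous_on {0..T} (G g)" for g
    unfolding G_def[abs_def]
    by (intro continuous_intros continuous_on_duhamel ch T continuous_on_subset[OF S_strong]) auto
  have bG: "(\<lambda>t. G g (\<tau> t)) \<in> bcontfun" for g
  proof -
    have "bounded (G g ` {0..T})"
      by (intro compact_imp_bounded compact_continuous_image cG) auto
    then obtain b where b: "\<And>t. t \<in> {0..T} \<Longrightarrow> norm (G g t) \<le> b"
      unfolding bounded_iff by blast
    show ?thesis
    proof (rule bcontfun_normI[where b = b])
      show "continuous_on UNIV (\<lambda>t. G g (\<tau> t))"
        by (rule continuous_on_compose2[OF cG c\<tau>]) (use \<tau> in auto)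
      show "norm (G g (\<tau> t)) \<le> b" for t by (rule b[OF \<tau>(1)])
    qed
  qed
  define P where "P g = Bcontfun (\<lambda>t. G g (\<tau> t))" for g
  have P: "apply_bcontfun (P g) t = G g (\<tau> t)" for g t
    unfolding P_def by (simp add: Bcontfun_inverse bG)
  have "dist (P f) (P g) \<le> 1/2 * dist f g" for f g
  proof (rule dist_bound)
    fix s
    define t where "t = \<tau> s"
    have t: "t \<in> {0..T}" unfolding t_def by (rule \<tau>(1))
    let ?I = "\<lambda>g. integral {0..t} (\<lambda>r. S (t - r) \<triangleright> h g r)"
    have "((\<lambda>r. S (t - r) \<triangleright> (h f r - h g r)) has_integral (?I f - ?I g)) {0..t}"
      using has_integral_diff[OF integrable_integral[OF duhamel_integrable[OF ch t T(2), of f]]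
        integrable_integral[OF duhamel_integrable[OF ch t T(2), of g]]] by simp
    moreover have "((\<lambda>r. L * dist f g * exp (l * r)) has_integral (L * dist f g * ((exp (l * t) - 1) / l))) {0..t}"
    proof (rule has_integral_mult_right)
      have "((\<lambda>r. exp (l * r)) has_integral (exp (l * t) / l - exp (l * 0) / l)) {0..t}"
        using t l by (intro fundamental_theorem_of_calculus)
          (auto intro!: derivative_eq_intros simp flip: has_real_derivative_iff_has_vector_derivative)
      then show "((\<lambda>r. exp (l * r)) has_integral ((exp (l * t) - 1) / l)) {0..t}"
        by (simp add: diff_divide_distrib)
    qed
    moreover have "norm (h f r - h g r) \<le> L * dist f g * exp (l * r)" if "r \<in> {0..t}" for r
    proof -
      have "norm (h f r - h g r) \<le> L * norm (exp (l * r) *\<^sub>R apply_bcontfun f r - exp (l * r) *\<^sub>R apply_bcontfun g r)"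
        unfolding h_def using that t by (intro lip) auto
      also have "\<dots> = L * (exp (l * r) * dist (apply_bcontfun f r) (apply_bcontfun g r))"
        by (simp add: dist_norm flip: scaleR_right_diff_distrib)
      also have "\<dots> \<le> L * (exp (l * r) * dist f g)"
        using L by (intro mult_left_mono dist_bounded) auto
      finally show ?thesis by (simp add: mult_ac)
    qed
    ultimately have "norm (?I f - ?I g) \<le> M * (L * dist f g * ((exp (l * t) - 1) / l))"
      using t T by (intro norm_duhamel_le) auto
    also have "\<dots> = dist f g / 2 * (exp (l * t) - 1)" using l L M_pos by (simp add: l_def field_simps)
    also have "\<dots> \<le> dist f g / 2 * exp (l * t)" by (intro mult_left_mono) auto
    finally have I: "norm (?I f - ?I g) \<le> dist f g / 2 * exp (l * t)" .
    have "dist (apply_bcontfun (P f) s) (apply_bcontfun (P g) s) = exp (- l * t) * norm (?I f - ?I g)"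
      by (simp add: P G_def dist_norm flip: t_def scaleR_right_diff_distrib)
    also have "\<dots> \<le> exp (- l * t) * (dist f g / 2 * exp (l * t))" by (intro mult_left_mono I) auto
    also have "\<dots> = 1/2 * dist f g" by (simp add: exp_minus)
    finally show "dist (apply_bcontfun (P f) s) (apply_bcontfun (P g) s) \<le> 1/2 * dist f g" .
  qed
  then obtain g where g: "P g = g"
    using banach_fix_type[of "1/2" P] by auto
  define x where "x t = exp (l * t) *\<^sub>R apply_bcontfun g t" for t
  have "mild F a T x"
    unfolding mild_def
  proof (intro conjI ballI)
    show "continuous_on {0..T} x"
      unfolding x_def[abs_def] by (intro continuous_intros continuous_on_subset[OF continuous_on_apply_bcontfun]) auto
    fix t assume t: "t \<in> {0..T}"
    have "x t = exp (l * t) *\<^sub>R G g (\<tau> t)" using P[of g t] by (simp add: x_def g)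
    also have "\<dots> = S t \<triangleright> a + integral {0..t} (\<lambda>r. S (t - r) \<triangleright> h g r)"
      by (simp add: \<tau>(2)[OF t] G_def flip: exp_add)
    finally have "x t - S t \<triangleright> a = integral {0..t} (\<lambda>r. S (t - r) \<triangleright> h g r)" by simp
    moreover have "((\<lambda>r. S (t - r) \<triangleright> h g r) has_integral integral {0..t} (\<lambda>r. S (t - r) \<triangleright> h g r)) {0..t}"
      by (rule integrable_integral[OF duhamel_integrable[OF ch t T(2)]])
    ultimately show "((\<lambda>r. S (t - r) \<triangleright> F r (x r)) has_integral (x t - S t \<triangleright> a)) {0..t}"
      by (simp add: h_def x_def)
  qed
  then show ?thesis by (rule exI[of "mild F a T" x])
qed

end

definition lipschitz_on_balls :: "('a::real_normed_vector \<Rightarrow> 'b::real_normed_vector) \<Rightarrow> bool" where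
  "lipschitz_on_balls N \<longleftrightarrow>
     (\<forall>r. \<exists>L>0. \<forall>x y. norm x \<le> r \<longrightarrow> norm y \<le> r \<longrightarrow> norm (N x - N y) \<le> L * norm (x - y))"

lemma lipschitz_on_ballsE:
  fixes N :: "'a::real_normed_vector \<Rightarrow> 'b::real_normed_vector"
  assumes "lipschitz_on_balls N"
  obtains L where "0 < L" "\<And>x y. norm x \<le> r \<Longrightarrow> norm y \<le> r \<Longrightarrow> norm (N x - N y) \<le> L * norm (x - y)"
  using assms unfolding lipschitz_on_balls_def by metis

lemma lipschitz_on_balls_continuous:
  fixes N :: "'a::real_normed_vector \<Rightarrow> 'b::real_normed_vector"
  assumes "lipschitz_on_balls N"
  shows "continuous_on A N"
proof (intro continuous_at_imp_continuous_on ballI)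
  fix x :: 'a
  obtain L where L: "0 < L" "\<And>y z. norm y \<le> norm x + 1 \<Longrightarrow> norm z \<le> norm x + 1 \<Longrightarrow> norm (N y - N z) \<le> L * norm (y - z)"
    using lipschitz_on_ballsE[OF assms] by metis
  have "((\<lambda>y. L * norm (y - x)) \<longlongrightarrow> L * norm (x - x)) (at x)" by (intro tendsto_intros)
  then have z: "((\<lambda>y. L * norm (y - x)) \<longlongrightarrow> 0) (at x)" by simp
  have "\<forall>\<^sub>F y in at x. norm (N y - N x) \<le> L * norm (y - x)"
    unfolding eventually_at
  proof (intro exI[of _ 1] conjI ballI impI)
    fix y assume "y \<noteq> x \<and> dist y x < 1"
    then have "norm y \<le> norm x + 1"
      using norm_triangle_ineq2[of y x] by (simp add: dist_norm)
    then show "norm (N y - N x) \<le> L * norm (y - x)" by (intro L) auto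
  qed simp
  then have "((\<lambda>y. N y - N x) \<longlongrightarrow> 0) (at x)" by (rule Lim_null_comparison[OF _ z])
  then show "isCont N x" unfolding isCont_def by (rule LIM_zero_cancel)
qed

locale semilinear = strongly_continuous_semigroup S M
  for S :: "real \<Rightarrow> 'a::{banach, perfect_space} blinop" and M :: real +
  fixes N :: "'a \<Rightarrow> 'a"
  assumes N: "lipschitz_on_balls N"
begin

abbreviation csol :: "(real \<Rightarrow> 'a blinop) \<Rightarrow> 'a \<Rightarrow> real \<Rightarrow> (real \<Rightarrow> 'a) \<Rightarrow> bool" where
  "csol C \<equiv> mild (\<lambda>t x. C t \<triangleright> x + N x)"

lemma continuous_on_N: "continuous_on A x \<Longrightarrow> continuous_on A (\<lambda>t. N (x t))"
  by (rule continuous_on_compose2[OF lipschitz_on_balls_continuous[OF N, of UNIV]]) auto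

lemma trunc_diff_le:
  assumes c: "norm C \<le> c" and r: "0 < r" and L: "0 < L"
    "\<And>x y. norm x \<le> r \<Longrightarrow> norm y \<le> r \<Longrightarrow> norm (N x - N y) \<le> L * norm (x - y)"
  shows "norm ((C \<triangleright> x + N (trunc r x)) - (C \<triangleright> y + N (trunc r y))) \<le> (c + 2 * L) * norm (x - y)"
proof -
  have "norm (N (trunc r x) - N (trunc r y)) \<le> L * norm (trunc r x - trunc r y)"
    using r by (intro L norm_trunc_le) auto
  also have "\<dots> \<le> L * (2 * norm (x - y))"
    using L trunc_lipschitz[OF r] by (intro mult_left_mono) auto
  finally have "norm (N (trunc r x) - N (trunc r y)) \<le> 2 * L * norm (x - y)" by simp
  moreover have "norm (C \<triangleright> (x - y)) \<le> c * norm (x - y)"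
    by (rule order_trans[OF norm_app]) (simp add: c mult_right_mono)
  moreover have "(C \<triangleright> x + N (trunc r x)) - (C \<triangleright> y + N (trunc r y))
      = C \<triangleright> (x - y) + (N (trunc r x) - N (trunc r y))" by simp
  ultimately show ?thesis
    using norm_triangle_ineq[of "C \<triangleright> (x - y)" "N (trunc r x) - N (trunc r y)"]
    by (simp only: distrib_right)
qed

text \<open>The Lipschitz constant only enters on the ball of radius \<open>r\<close>, because the equation is solved
  for the nonlinearity composed with the radial retraction onto that ball.\<close>

theorem csol_near_approximate_solution:
  assumes T: "0 \<le> T" "T \<le> 1"
    and C: "continuous_on {0..T} C" "\<And>t. t \<in> {0..T} \<Longrightarrow> norm (C t) \<le> c"
    and r: "0 < r" and L: "0 < L"
    "\<And>x y. norm x \<le> r \<Longrightarrow> norm y \<le> r \<Longrightarrow> norm (N x - N y) \<le> L * norm (x - y)"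
    and z: "continuous_on {0..T} z" "\<And>t. t \<in> {0..T} \<Longrightarrow> norm (z t) \<le> r0"
    and zA: "\<And>t. t \<in> {0..T} \<Longrightarrow> ((\<lambda>s. S (t - s) \<triangleright> (C s \<triangleright> z s + N (z s))) has_integral (z t - A t)) {0..t}"
    and A: "\<And>t. t \<in> {0..T} \<Longrightarrow> norm (S t \<triangleright> a - A t) \<le> \<eta>"
    and le: "r0 + 2 * \<eta> * exp (2 * M * (c + 2 * L) * T) \<le> r"
  shows "\<exists>x. csol C a T x \<and> (\<forall>t\<in>{0..T}. norm (x t - z t) \<le> 2 * \<eta> * exp (2 * M * (c + 2 * L) * T))"
proof -
  define F where "F t x = C t \<triangleright> x + N (trunc r x)" for t x
  have c0: "0 \<le> c" using order_trans[OF norm_ge_zero C(2)[of 0]] T by simp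
  have cL: "0 < c + 2 * L" using c0 L by simp
  have lip: "norm (F t x - F t y) \<le> (c + 2 * L) * norm (x - y)" if "t \<in> {0..T}" for t x y
    unfolding F_def by (rule trunc_diff_le[OF C(2)[OF that] r L])
  have ct: "continuous_on UNIV (trunc r :: 'a \<Rightarrow> 'a)"
    by (rule lipschitz_on_balls_continuous)
      (auto simp: lipschitz_on_balls_def intro!: exI[of _ 2] trunc_lipschitz r)
  have "\<exists>x. mild F a T x"
  proof (rule mild_exists_lipschitz[OF T cL _ lip])
    fix x :: "real \<Rightarrow> 'a" assume x: "continuous_on {0..T} x"
    show "continuous_on {0..T} (\<lambda>t. F t (x t))"
      unfolding F_def by (intro continuous_intros C x continuous_on_N continuous_on_compose2[OF ct x]) auto
  qed auto
  then obtain x where x: "continuous_on {0..T} x"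
    "\<And>t. t \<in> {0..T} \<Longrightarrow> ((\<lambda>s. S (t - s) \<triangleright> F s (x s)) has_integral (x t - S t \<triangleright> a)) {0..t}"
    by (auto simp: mild_def)
  have "0 \<le> \<eta>" using order_trans[OF norm_ge_zero A[of 0]] T by simp
  then have r0r: "r0 \<le> r" using le by (smt (verit) exp_ge_zero mult_nonneg_nonneg)
  \<comment> \<open>\<open>z\<close> stays in the ball where the retraction is the identity, so it
    also solves the truncated equation up to the same defect.\<close>
  have zF: "((\<lambda>s. S (t - s) \<triangleright> F s (z s)) has_integral (z t - A t)) {0..t}" if t: "t \<in> {0..T}" for t
  proof (rule has_integral_eq[OF _ zA[OF t]])
    fix s assume "s \<in> {0..t}"
    then have "norm (z s) \<le> r" using z(2)[of s] r0r t by auto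
    then show "S (t - s) \<triangleright> (C s \<triangleright> z s + N (z s)) = S (t - s) \<triangleright> F s (z s)" by (simp add: F_def trunc_def)
  qed
  have near: "norm (x t - z t) \<le> 2 * \<eta> * exp (2 * M * (c + 2 * L) * T)" if t: "t \<in> {0..T}" for t
    by (rule duhamel_stability[OF T cL x(1) z(1) x(2) zF lip A t])
  \<comment> \<open>The truncated solution never leaves the ball, hence it solves the original
    equation.\<close>
  have "norm (x t) \<le> r" if t: "t \<in> {0..T}" for t
    using near[OF t] z(2)[OF t] le norm_triangle_ineq2[of "x t" "z t"] by linarith
  then have "((\<lambda>s. S (t - s) \<triangleright> (C s \<triangleright> x s + N (x s))) has_integral (x t - S t \<triangleright> a)) {0..t}"
    if t: "t \<in> {0..T}" for t
    using t by (intro has_integral_eq[OF _ x(2)[OF t]]) (simp add: F_def trunc_def)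
  then have "csol C a T x" using x(1) by (simp add: mild_def)
  then show ?thesis using near by blast
qed

text \<open>Two continuous solutions on a compact interval are bounded, so a single Lipschitz
  constant serves both; the stability estimate with \<eta> = 0 then applies.\<close>

lemma csol_unique:
  assumes T: "0 \<le> T" "T \<le> 1" and C: "continuous_on {0..T} C"
    and x: "csol C a T x" and y: "csol C a T y" and t: "t \<in> {0..T}"
  shows "x t = y t"
proof -
  have cx: "continuous_on {0..T} x" and cy: "continuous_on {0..T} y" using x y by (auto simp: mild_def)
  have "bounded (x ` {0..T})" "bounded (y ` {0..T})" "bounded (C ` {0..T})"
    by (auto intro!: compact_imp_bounded compact_continuous_image cx cy C)
  then obtain r1 r2 c where b: "\<And>t. t \<in> {0..T} \<Longrightarrow> norm (x t) \<le> r1" "\<And>t. t \<in> {0..T} \<Longrightarrow> norm (y t) \<le> r2"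
    "\<And>t. t \<in> {0..T} \<Longrightarrow> norm (C t) \<le> c"
    by (fastforce simp: bounded_iff)
  obtain L where L: "0 < L" "\<And>x y. norm x \<le> max r1 r2 \<Longrightarrow> norm y \<le> max r1 r2 \<Longrightarrow> norm (N x - N y) \<le> L * norm (x - y)"
    using lipschitz_on_ballsE[OF N] by metis
  have c0: "0 \<le> c" using order_trans[OF norm_ge_zero b(3)[of 0]] T by simp
  have lip: "norm ((C s \<triangleright> x s + N (x s)) - (C s \<triangleright> y s + N (y s))) \<le> (c + L) * norm (x s - y s)"
    if s: "s \<in> {0..T}" for s
  proof -
    have "norm (N (x s) - N (y s)) \<le> L * norm (x s - y s)"
      using b(1,2)[OF s] by (intro L) auto
    moreover have "norm (C s \<triangleright> (x s - y s)) \<le> c * norm (x s - y s)"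
      by (rule order_trans[OF norm_app]) (simp add: b(3)[OF s] mult_right_mono)
    moreover have "(C s \<triangleright> x s + N (x s)) - (C s \<triangleright> y s + N (y s))
        = C s \<triangleright> (x s - y s) + (N (x s) - N (y s))" by simp
    ultimately show ?thesis
      using norm_triangle_ineq[of "C s \<triangleright> (x s - y s)" "N (x s) - N (y s)"] by (simp only: distrib_right)
  qed
  have "norm (x t - y t) \<le> 2 * 0 * exp (2 * M * (c + L) * T)"
    by (rule duhamel_stability[OF T _ cx cy _ _ lip _ t, where A = "\<lambda>t. S t \<triangleright> a" and B = "\<lambda>t. S t \<triangleright> a"])
      (use x y c0 L in \<open>auto simp: mild_def\<close>)
  then show ?thesis by simp
qed

text \<open>By the semigroup law the Duhamel integral over [0,t] splits at T1:
  \<open>S (t - T1)\<close> applied to the first mild identity, plus the second identity shifted by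
  T1. The condition \<open>F T1 = G 0\<close> makes the second description of \<open>H\<close> valid
  up to the junction.\<close>

lemma mild_concat:
  assumes T1: "0 \<le> T1" and T2: "0 \<le> T2"
    and x: "mild F a T1 x" and y: "mild G (x T1) T2 y" and FG: "F T1 = G 0"
  defines "H \<equiv> \<lambda>t. if t \<le> T1 then F t else G (t - T1)"
    and "w \<equiv> \<lambda>t. if t \<le> T1 then x t else y (t - T1)"
  shows "mild H a (T1 + T2) w"
proof -
  have y0: "y 0 = x T1" using mild_init[OF y T2] .
  have cx: "continuous_on {0..T1} x" and cy: "continuous_on {0..T2} y"
    using x y by (auto simp: mild_def)
  have w2: "w t = y (t - T1)" "H t = G (t - T1)" if "t \<ge> T1" for t
    using that y0 FG by (auto simp: w_def H_def)
  have "continuous_on ({0..T1} \<union> {T1..T1+T2}) w"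
  proof (rule continuous_on_closed_Un)
    show "continuous_on {0..T1} w"
      by (rule continuous_on_eq[OF cx]) (simp add: w_def)
    have "continuous_on {T1..T1+T2} (\<lambda>t. y (t - T1))"
      by (rule continuous_on_compose2[OF cy]) (auto intro!: continuous_intros)
    then show "continuous_on {T1..T1+T2} w"
      by (rule continuous_on_eq) (simp add: w2)
  qed auto
  then have cw: "continuous_on {0..T1+T2} w" using T1 T2 by (simp add: ivl_disj_un_two_touch(4))
  have "((\<lambda>r. S (t - r) \<triangleright> H r (w r)) has_integral (w t - S t \<triangleright> a)) {0..t}" if t: "t \<in> {0..T1+T2}" for t
  proof (cases "t \<le> T1")
    case True
    then have "((\<lambda>r. S (t - r) \<triangleright> F r (x r)) has_integral (x t - S t \<triangleright> a)) {0..t}"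
      using x t by (auto simp: mild_def)
    then have "((\<lambda>r. S (t - r) \<triangleright> H r (w r)) has_integral (x t - S t \<triangleright> a)) {0..t}"
      by (rule has_integral_eq[rotated]) (use True in \<open>auto simp: w_def H_def\<close>)
    then show ?thesis using True by (simp add: w_def)
  next
    case False
    have "((\<lambda>r. S (T1 - r) \<triangleright> F r (x r)) has_integral (x T1 - S T1 \<triangleright> a)) {0..T1}"
      using x T1 by (auto simp: mild_def)
    from has_integral_linear[OF this bounded_linear_app[of "S (t - T1)"]]
    have "((\<lambda>r. S (t - T1) \<triangleright> S (T1 - r) \<triangleright> F r (x r)) has_integral (S (t - T1) \<triangleright> x T1 - S t \<triangleright> a)) {0..T1}"
      using S_add[of "t - T1" T1] False T1 by (simp add: o_def)
    then have 1: "((\<lambda>r. S (t - r) \<triangleright> H r (w r)) has_integral (S (t - T1) \<triangleright> x T1 - S t \<triangleright> a)) {0..T1}"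
    proof (rule has_integral_eq[rotated])
      fix r assume r: "r \<in> {0..T1}"
      then have "S (t - r) = S (t - T1) * S (T1 - r)" using S_add[of "t - T1" "T1 - r"] False by simp
      then show "S (t - T1) \<triangleright> S (T1 - r) \<triangleright> F r (x r) = S (t - r) \<triangleright> H r (w r)"
        using r by (simp add: w_def H_def)
    qed
    have "((\<lambda>r. S ((t - T1) - r) \<triangleright> G r (y r)) has_integral (y (t - T1) - S (t - T1) \<triangleright> x T1)) {0..t - T1}"
      using y t False by (auto simp: mild_def)
    from has_integral_affinity[OF this[folded cbox_interval], of 1 "- T1"]
    have "((\<lambda>r. S (t - r) \<triangleright> G (r - T1) (y (r - T1))) has_integral (y (t - T1) - S (t - T1) \<triangleright> x T1)) {T1..t}"
      using False by (simp add: image_affinity_atLeastAtMost)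
    then have 2: "((\<lambda>r. S (t - r) \<triangleright> H r (w r)) has_integral (y (t - T1) - S (t - T1) \<triangleright> x T1)) {T1..t}"
      by (rule has_integral_eq[rotated]) (auto simp: w2)
    have "((\<lambda>r. S (t - r) \<triangleright> H r (w r)) has_integral
        ((S (t - T1) \<triangleright> x T1 - S t \<triangleright> a) + (y (t - T1) - S (t - T1) \<triangleright> x T1))) {0..t}"
      by (rule has_integral_combine[OF T1 _ 1 2]) (use False in auto)
    then show ?thesis using False by (simp add: w_def)
  qed
  then show ?thesis using cw by (simp add: mild_def)
qed

end

section \<open>Fourier coefficients on the torus\<close>

definition echar :: "int ^ 'n \<Rightarrow> real ^ 'n \<Rightarrow> complex" where
  "echar k x = exp (\<i> * complex_of_real (freq k \<bullet> x))"

lemma freq_add: "freq (k + l) = freq k + freq l"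
  and freq_minus: "freq (- k) = - freq k"
  and freq_zero [simp]: "freq 0 = 0"
  by (simp_all add: freq_def vec_eq_iff)

lemma freq_nth [simp]: "freq k $ i = real_of_int (k $ i)"
  by (simp add: freq_def)

lemma inner_freq_axis: "freq k \<bullet> axis i c = c * real_of_int (k $ i)"
  by (simp add: inner_axis mult.commute)

lemma norm_echar [simp]: "cmod (echar k x) = 1"
  by (simp add: echar_def)

lemma echar_add: "echar (k + l) x = echar k x * echar l x"
  by (simp add: echar_def freq_add inner_add_left algebra_simps flip: exp_add)

lemma echar_plus: "echar k (x + y) = echar k x * echar k y"
  by (simp add: echar_def inner_add_right algebra_simps flip: exp_add)

lemma echar_zero [simp]: "echar 0 x = 1" "echar k 0 = 1"
  by (simp_all add: echar_def)

lemma echar_uminus: "echar (- k) x = cnj (echar k x)"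
  by (simp add: echar_def freq_minus exp_cnj)

lemma continuous_on_echar [continuous_intros]: "continuous_on A (echar k)"
  unfolding echar_def[abs_def] by (intro continuous_intros)

lemma echar_axis: "echar k (axis i h) = cis (h * real_of_int (k $ i))"
  by (simp add: echar_def inner_freq_axis cis_conv_exp)

lemma torus_periodic_echar: "torus_periodic (echar k)"
  unfolding torus_periodic_def
  by (simp add: echar_plus echar_axis cis_multiple_2pi)

text \<open>Periodic integrals are shifted in one direction at a time, by cutting off a slab of the
  cube and moving it by a period.\<close>

definition slab :: "'n \<Rightarrow> real \<Rightarrow> real \<Rightarrow> (real ^ 'n) set" where
  "slab i u v = cbox (\<chi> j. if j = i then u else 0) (\<chi> j. if j = i then v else 2 * pi)"

lemma torus_cube_slab: "torus_cube = slab i 0 (2 * pi)"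
proof -
  have "0 = (\<chi> j. if j = i then 0 else (0::real))" "(\<chi> j. 2 * pi) = (\<chi> j. if j = i then 2 * pi else 2 * pi)"
    by (simp_all add: vec_eq_iff)
  then show ?thesis by (simp only: slab_def torus_cube_def)
qed

lemma mem_slab: "x \<in> slab i u v \<longleftrightarrow> u \<le> x $ i \<and> x $ i \<le> v \<and> (\<forall>j. j \<noteq> i \<longrightarrow> 0 \<le> x $ j \<and> x $ j \<le> 2 * pi)"
proof -
  have "x \<in> slab i u v \<longleftrightarrow> (\<forall>j. (if j = i then u \<le> x $ j \<and> x $ j \<le> v else 0 \<le> x $ j \<and> x $ j \<le> 2 * pi))"
    unfolding slab_def mem_box_cart by (intro iff_allI) auto
  also have "\<dots> \<longleftrightarrow> u \<le> x $ i \<and> x $ i \<le> v \<and> (\<forall>j. j \<noteq> i \<longrightarrow> 0 \<le> x $ j \<and> x $ j \<le> 2 * pi)"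
    by metis
  finally show ?thesis .
qed

lemma integral_slab_split:
  fixes f :: "real ^ 'n \<Rightarrow> complex"
  assumes f: "continuous_on UNIV f" and uv: "u \<le> v" "v \<le> w"
  shows "integral (slab i u w) f = integral (slab i u v) f + integral (slab i v w) f"
proof -
  have int: "f integrable_on slab i a b" for a b
    unfolding slab_def by (intro integrable_continuous continuous_on_subset[OF f]) auto
  have "slab i u w \<inter> {x. x \<bullet> axis i 1 \<le> v} = slab i u v" "slab i u w \<inter> {x. x \<bullet> axis i 1 \<ge> v} = slab i v w"
    using uv by (auto simp: mem_slab inner_axis)
  then have "(f has_integral (integral (slab i u v) f + integral (slab i v w) f)) (slab i u w)"
    using has_integral_split[of f "integral (slab i u v) f" "\<chi> j. if j = i then u else 0"
        "\<chi> j. if j = i then w else 2 * pi" "axis i 1" v "integral (slab i v w) f"]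
      integrable_integral[OF int, of u v] integrable_integral[OF int, of v w]
    by (simp add: axis_in_Basis_iff flip: slab_def)
  then show ?thesis by (rule integral_unique)
qed

lemma integral_slab_shift:
  fixes f :: "real ^ 'n \<Rightarrow> complex"
  shows "integral (slab i u v) (\<lambda>x. f (x + axis i h)) = integral (slab i (u + h) (v + h)) f"
proof -
  have "(\<chi> j. if j = i then u else 0) + axis i h = (\<chi> j. if j = i then u + h else 0)"
    "(\<chi> j. if j = i then v else 2 * pi) + axis i h = (\<chi> j. if j = i then v + h else 2 * pi)"
    by (auto simp: vec_eq_iff axis_def)
  then show ?thesis
    using integral_shift_cbox_plus[of "\<chi> j. if j = i then u else 0" "\<chi> j. if j = i then v else 2 * pi" f "axis i h"]
    by (simp only: slab_def o_def add.commute[of "axis i h"])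
qed

lemma torus_integral_shift:
  fixes f :: "real ^ 'n \<Rightarrow> complex"
  assumes f: "continuous_on UNIV f" and per: "torus_periodic f" and h: "0 \<le> h" "h \<le> 2 * pi"
  shows "integral torus_cube (\<lambda>x. f (x + axis i h)) = integral torus_cube f"
proof -
  have "integral torus_cube (\<lambda>x. f (x + axis i h)) = integral (slab i h (2 * pi + h)) f"
    by (simp add: torus_cube_slab[of i] integral_slab_shift)
  also have "\<dots> = integral (slab i h (2 * pi)) f + integral (slab i (2 * pi) (2 * pi + h)) f"
    by (rule integral_slab_split[OF f]) (use h in auto)
  also have "integral (slab i (2 * pi) (2 * pi + h)) f = integral (slab i 0 h) f"
    using integral_slab_shift[of i 0 h f "2 * pi"] per by (simp add: torus_periodic_def add.commute)
  also have "integral (slab i h (2 * pi)) f + integral (slab i 0 h) f = integral torus_cube f"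
    using integral_slab_split[OF f h, of i] by (simp add: torus_cube_slab[of i])
  finally show ?thesis .
qed

lemma measure_torus_cube: "measure lborel (torus_cube :: (real ^ 'n) set) = (2 * pi) ^ CARD('n)"
  unfolding torus_cube_def by (subst content_cbox_cart) (auto simp: interval_ne_empty_cart)

text \<open>If k has a nonzero entry k_i, shifting by half a period pi / |k_i| in direction i turns
  the exponential into its negative but leaves the integral unchanged.\<close>

lemma torus_integral_echar: "integral torus_cube (echar k) = (if k = 0 then (2 * pi) ^ CARD('n) else 0)"
  for k :: "int ^ 'n"
proof (cases "k = 0")
  case True
  have "integral torus_cube (\<lambda>x :: real ^ 'n. 1 :: complex) = measure lborel (torus_cube :: (real ^ 'n) set)"
    by (simp add: torus_cube_def scaleR_conv_of_real)
  also have "measure lborel (torus_cube :: (real ^ 'n) set) = (2 * pi) ^ CARD('n)"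
    by (rule measure_torus_cube)
  finally show ?thesis using True by (simp add: echar_zero(1)[abs_def])
next
  case False
  then obtain i where i: "k $ i \<noteq> 0" by (auto simp: vec_eq_iff)
  define m where "m = \<bar>k $ i\<bar>"
  define h where "h = pi / real_of_int m"
  have m: "m \<ge> 1" using i by (simp add: m_def)
  have h: "0 \<le> h" "h \<le> 2 * pi"
  proof -
    have "pi / real_of_int m \<le> pi / 1" using m by (intro divide_left_mono) auto
    then show "h \<le> 2 * pi" unfolding h_def using pi_gt_zero by linarith
    show "0 \<le> h" using m by (simp add: h_def)
  qed
  have "cis (h * real_of_int (k $ i)) = -1"
  proof (cases "k $ i > 0")
    case True
    then have "h * real_of_int (k $ i) = pi" using i by (simp add: h_def m_def)
    then show ?thesis by simp
  next
    case False
    then have "h * real_of_int (k $ i) = - pi" using i by (simp add: h_def m_def)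
    then show ?thesis by (simp add: cis.ctr complex_eq_iff)
  qed
  then have "integral torus_cube (\<lambda>x. echar k (x + axis i h)) = - integral torus_cube (echar k)"
    by (simp add: echar_plus echar_axis)
  moreover have "integral torus_cube (\<lambda>x. echar k (x + axis i h)) = integral torus_cube (echar k)"
    by (intro torus_integral_shift continuous_on_echar torus_periodic_echar h)
  ultimately show ?thesis using False by simp
qed

lemma set_integrable_torus_continuous:
  fixes f :: "real ^ 'n \<Rightarrow> complex"
  assumes "continuous_on UNIV f"
  shows "set_integrable lebesgue torus_cube f"
  unfolding torus_cube_def
  by (intro absolutely_integrable_continuous continuous_on_subset[OF assms]) auto

lemma fourier_coeff_alt:
  "fourier_coeff f k = of_real (1 / (2 * pi) ^ CARD('n)) * (LINT x:torus_cube|lebesgue. f x * echar (- k) x)"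
  for f :: "real ^ 'n \<Rightarrow> complex"
  unfolding fourier_coeff_def echar_def by (simp add: freq_minus)

lemma fourier_coeff_continuous:
  fixes f :: "real ^ 'n \<Rightarrow> complex"
  assumes "continuous_on UNIV f"
  shows "fourier_coeff f k = of_real (1 / (2 * pi) ^ CARD('n)) * integral torus_cube (\<lambda>x. f x * echar (- k) x)"
  unfolding fourier_coeff_alt
  by (subst set_lebesgue_integral_eq_integral(2)[OF set_integrable_torus_continuous])
    (auto intro!: continuous_intros assms)

lemma fourier_coeff_echar: "fourier_coeff (echar l) k = (if k = l then 1 else 0)"
proof -
  have "(\<lambda>x. echar l x * echar (- k) x) = echar (l - k)"
    using echar_add[of l "- k"] by auto
  then show ?thesis
    by (simp add: fourier_coeff_continuous continuous_on_echar torus_integral_echar)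
qed

lemma norm_fourier_coeff_le:
  fixes f :: "real ^ 'n \<Rightarrow> complex"
  assumes f: "continuous_on UNIV f" and b: "\<And>x. x \<in> torus_cube \<Longrightarrow> cmod (f x) \<le> b"
  shows "cmod (fourier_coeff f k) \<le> b"
proof -
  have "(0 :: real ^ 'n) \<in> torus_cube" by (simp add: torus_cube_def mem_box_cart)
  then have b0: "0 \<le> b" using b norm_ge_zero order_trans by blast
  have "((\<lambda>x. f x * echar (- k) x) has_integral integral torus_cube (\<lambda>x. f x * echar (- k) x)) torus_cube"
    unfolding torus_cube_def
    by (intro integrable_integral integrable_continuous continuous_intros continuous_on_subset[OF f]) auto
  then have "cmod (integral torus_cube (\<lambda>x. f x * echar (- k) x)) \<le> b * measure lborel (torus_cube :: (real ^ 'n) set)"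
    using b0 b unfolding torus_cube_def by (intro has_integral_bound) (auto simp: norm_mult)
  then show ?thesis
    unfolding fourier_coeff_continuous[OF f] norm_mult by (simp add: measure_torus_cube norm_divide norm_mult norm_power field_simps)
qed

lemma fourier_coeff_add:
  fixes f g :: "real ^ 'n \<Rightarrow> complex"
  assumes "continuous_on UNIV f" "continuous_on UNIV g"
  shows "fourier_coeff (\<lambda>x. f x + g x) k = fourier_coeff f k + fourier_coeff g k"
proof -
  have i: "(\<lambda>x. h x * echar (- k) x) integrable_on torus_cube" if "continuous_on UNIV h" for h :: "real ^ 'n \<Rightarrow> complex"
    unfolding torus_cube_def
    by (intro integrable_continuous continuous_intros continuous_on_subset[OF that]) auto
  show ?thesis
    using assms by (simp add: fourier_coeff_continuous continuous_intros distrib_right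
      Henstock_Kurzweil_Integration.integral_add i distrib_left)
qed

lemma fourier_coeff_cmult: "fourier_coeff (\<lambda>x. c * f x) k = c * fourier_coeff f k"
  unfolding fourier_coeff_def set_lebesgue_integral_def
  using integral_mult_right_zero[of lebesgue c]
  by (simp add: mult.assoc mult.left_commute[of _ c] flip: mult_scaleR_right)

section \<open>The Sobolev algebra\<close>

lemma summable_on_int_powr:
  assumes p: "p > 1/2"
  shows "(\<lambda>j::int. (1 + (real_of_int j)\<^sup>2) powr (- p)) summable_on UNIV"
proof -
  define g where "g j = (1 + (real_of_int j)\<^sup>2) powr (- p)" for j
  have "summable (\<lambda>n. real n powr (- 2 * p))"
    using p by (subst summable_real_powr_iff) simp
  then have "summable (\<lambda>n. g (int n))"
  proof (rule summable_comparison_test'[of _ 1])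
    fix n :: nat assume n: "1 \<le> n"
    have "g (int n) \<le> ((real n)\<^sup>2) powr (- p)"
      unfolding g_def using n p by (intro powr_mono2') auto
    also have "(real n)\<^sup>2 = real n powr 2" using n by (simp add: powr_numeral)
    also have "(real n powr 2) powr (- p) = real n powr (- 2 * p)" by (subst powr_powr) simp
    finally show "norm (g (int n)) \<le> real n powr (- 2 * p)" by (simp add: g_def)
  qed
  then have nat: "(\<lambda>n. g (int n)) summable_on UNIV"
    by (subst summable_on_UNIV_nonneg_real_iff) (auto simp: g_def)
  have "g summable_on range int"
    by (subst summable_on_reindex) (use nat in \<open>auto simp: o_def\<close>)
  moreover have "g summable_on range (\<lambda>n. - int n)"
    by (subst summable_on_reindex) (use nat in \<open>auto simp: o_def g_def inj_def\<close>)
  moreover have "UNIV = range int \<union> range (\<lambda>n. - int n)"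
  proof (intro equalityI subsetI UNIV_I)
    fix j :: int
    show "j \<in> range int \<union> range (\<lambda>n. - int n)"
      by (cases j rule: int_cases2) auto
  qed
  ultimately show ?thesis unfolding g_def[symmetric, abs_def] by (metis summable_on_union)
qed

text \<open>Every 1 + k_i^2 is at most 1 + |k|^2, so the term is bounded by the product over the d
  coordinates of (1 + k_i^2)^(-s/d). The product series factorises, and its one-dimensional factor
  converges because s/d > 1/2.\<close>

lemma summable_on_lattice:
  assumes s: "real CARD('n) / 2 < real s"
  shows "(\<lambda>k :: int ^ 'n. 1 / (1 + (norm (freq k))\<^sup>2) ^ s) summable_on UNIV"
proof -
  define d where "d = CARD('n)"
  define p where "p = real s / real d"
  have d: "d > 0" by (simp add: d_def)
  have p: "p > 1/2" using s d by (simp add: p_def d_def field_simps)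
  define g where "g j = (1 + (real_of_int j)\<^sup>2) powr (- p)" for j
  have g0: "0 \<le> g j" for j by (simp add: g_def)
  define B where "B = infsum g UNIV"
  have B: "sum g F \<le> B" if "finite F" for F
    unfolding B_def by (rule finite_sum_le_infsum) (use summable_on_int_powr[OF p] that in \<open>auto simp: g_def[abs_def]\<close>)
  have le: "1 / (1 + (norm (freq k))\<^sup>2) ^ s \<le> (\<Prod>i\<in>UNIV. g (k $ i))" for k :: "int ^ 'n"
  proof -
    let ?N = "1 + (norm (freq k))\<^sup>2"
    have N: "?N \<ge> 1" by simp
    have comp: "1 + (real_of_int (k $ i))\<^sup>2 \<le> ?N" for i
      using power_mono[OF component_le_norm_cart[of "freq k" i], of 2] by simp
    have "(\<Prod>i\<in>(UNIV :: 'n set). ?N powr (- p)) = (?N powr (- p)) ^ d" by (simp add: d_def)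
    also have "\<dots> = ?N powr (real d * - p)" by (rule powr_power) (use N in linarith)
    also have "real d * - p = - real s" using d by (simp add: p_def)
    also have "?N powr (- real s) = 1 / ?N powr real s" by (rule powr_minus_divide)
    also have "?N powr real s = ?N ^ s" using N by (intro powr_realpow) linarith
    finally have "1 / ?N ^ s = (\<Prod>i\<in>(UNIV :: 'n set). ?N powr (- p))" ..
    also have "\<dots> \<le> (\<Prod>i\<in>UNIV. g (k $ i))"
    proof (rule prod_mono)
      fix i :: 'n
      have "?N powr (- p) \<le> (1 + (real_of_int (k $ i))\<^sup>2) powr (- p)"
        using p comp by (intro powr_mono2') (auto simp: add_pos_nonneg)
      then show "0 \<le> ?N powr (- p) \<and> ?N powr (- p) \<le> g (k $ i)" by (simp add: g_def)
    qed
    finally show ?thesis .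
  qed
  have "(\<lambda>k :: int ^ 'n. \<Prod>i\<in>UNIV. g (k $ i)) summable_on UNIV"
  proof (rule nonneg_bdd_above_summable_on)
    show "bdd_above (sum (\<lambda>k :: int ^ 'n. \<Prod>i\<in>UNIV. g (k $ i)) ` {F. F \<subseteq> UNIV \<and> finite F})"
    proof (rule bdd_aboveI)
      fix y assume "y \<in> sum (\<lambda>k :: int ^ 'n. \<Prod>i\<in>UNIV. g (k $ i)) ` {F. F \<subseteq> UNIV \<and> finite F}"
      then obtain F :: "(int ^ 'n) set" where F: "finite F" "y = (\<Sum>k\<in>F. \<Prod>i\<in>UNIV. g (k $ i))" by auto
      \<comment> \<open>\<open>A\<close> collects every coordinate that occurs in \<open>F\<close>,
        so that \<open>F\<close> lies in the finite box of functions into \<open>A\<close>, whose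
        sum factorises.\<close>
      define A where "A = (\<Union>k\<in>F. range (\<lambda>i. k $ i))"
      have A: "finite A" using F by (auto simp: A_def)
      have inj: "inj_on (\<lambda>k :: int ^ 'n. \<lambda>i. k $ i) F" by (auto simp: inj_on_def vec_eq_iff fun_eq_iff)
      have "y = (\<Sum>h\<in>(\<lambda>k i. k $ i) ` F. \<Prod>i\<in>UNIV. g (h i))"
        by (subst sum.reindex[OF inj]) (simp add: F)
      also have "\<dots> \<le> (\<Sum>h\<in>(\<Pi>\<^sub>E i\<in>(UNIV :: 'n set). A). \<Prod>i\<in>UNIV. g (h i))"
        by (rule sum_mono2) (use A g0 in \<open>auto simp: A_def intro!: prod_nonneg finite_PiE\<close>)
      also have "\<dots> = (\<Prod>i\<in>(UNIV :: 'n set). sum g A)"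
        by (rule prod_sum_PiE[symmetric]) (use A in auto)
      also have "\<dots> \<le> B ^ d" using B[OF A] g0 by (simp add: d_def power_mono sum_nonneg)
      finally show "y \<le> B ^ d" .
    qed
  qed (use g0 in \<open>auto intro: prod_nonneg\<close>)
  then show ?thesis by (rule summable_on_comparison_test) (use le in \<open>auto\<close>)
qed

lemma norm_infsum_mult_le:
  fixes f g :: "'a \<Rightarrow> real"
  assumes f: "(\<lambda>k. (f k)\<^sup>2) summable_on UNIV" and g: "(\<lambda>k. (g k)\<^sup>2) summable_on UNIV"
  shows "(\<lambda>k. \<bar>f k * g k\<bar>) summable_on UNIV"
    and "(\<Sum>\<^sub>\<infinity>k. \<bar>f k * g k\<bar>) \<le> sqrt (\<Sum>\<^sub>\<infinity>k. (f k)\<^sup>2) * sqrt (\<Sum>\<^sub>\<infinity>k. (g k)\<^sup>2)"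
proof -
  have fin: "(\<Sum>k\<in>F. \<bar>f k * g k\<bar>) \<le> sqrt (\<Sum>\<^sub>\<infinity>k. (f k)\<^sup>2) * sqrt (\<Sum>\<^sub>\<infinity>k. (g k)\<^sup>2)" if "finite F" for F
  proof -
    have "(\<Sum>k\<in>F. \<bar>f k * g k\<bar>) \<le> L2_set f F * L2_set g F"
      using L2_set_mult_ineq[of f g F] by (simp add: abs_mult)
    also have "\<dots> \<le> sqrt (\<Sum>\<^sub>\<infinity>k. (f k)\<^sup>2) * sqrt (\<Sum>\<^sub>\<infinity>k. (g k)\<^sup>2)"
      unfolding L2_set_def using that
      by (intro mult_mono real_sqrt_le_mono finite_sum_le_infsum f g) (auto intro!: infsum_nonneg sum_nonneg)
    finally show ?thesis .
  qed
  show sm: "(\<lambda>k. \<bar>f k * g k\<bar>) summable_on UNIV"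
    by (rule nonneg_bdd_above_summable_on) (use fin in \<open>auto intro!: bdd_aboveI\<close>)
  show "(\<Sum>\<^sub>\<infinity>k. \<bar>f k * g k\<bar>) \<le> sqrt (\<Sum>\<^sub>\<infinity>k. (f k)\<^sup>2) * sqrt (\<Sum>\<^sub>\<infinity>k. (g k)\<^sup>2)"
    by (rule infsum_le_finite_sums[OF sm]) (use fin in auto)
qed

text \<open>Moduli are taken so that the translates add up to a majorant of a convolution.\<close>

definition shift_abs :: "'a::ab_group_add \<Rightarrow> 'a ell2 \<Rightarrow> 'a ell2" where
  "shift_abs l a = Abs_ell2 (\<lambda>k. of_real (cmod (coord a (k - l))))"

lemma coord_shift_abs [simp]: "coord (shift_abs l a) k = of_real (cmod (coord a (k - l)))"
  and norm_shift_abs [simp]: "norm (shift_abs l a) = norm a"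
proof -
  have bij: "bij (\<lambda>k. k - l)" for l :: 'a
    by (rule bij_betw_byWitness[where f' = "\<lambda>k. k + l"]) auto
  have "(\<lambda>k. (cmod (coord a (k - l)))\<^sup>2) summable_on UNIV"
    using summable_on_reindex_bij_betw[OF bij, of "\<lambda>k. (cmod (coord a k))\<^sup>2" l] coord_summable[of a] by simp
  then show c: "coord (shift_abs l a) k = of_real (cmod (coord a (k - l)))" for k
    by (simp add: shift_abs_def coord_Abs_ell2)
  show "norm (shift_abs l a) = norm a"
    unfolding norm_ell2 c
    using infsum_reindex_bij_betw[OF bij, of "\<lambda>k. (cmod (coord a k))\<^sup>2" l] by simp
qed

text \<open>Young's inequality \<open>\<ell>\<^sup>1 * \<ell>\<^sup>2 \<subseteq> \<ell>\<^sup>2\<close>, as an absolutely convergent series of translates.\<close>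

lemma young_ell2:
  fixes a :: "'a::ab_group_add ell2" and c :: "'a \<Rightarrow> real"
  assumes c: "c summable_on UNIV" "\<And>l. 0 \<le> c l"
  obtains y where "\<And>k. coord y k = of_real (\<Sum>\<^sub>\<infinity>l. c l * cmod (coord a (k - l)))"
    "\<And>k. (\<lambda>l. c l * cmod (coord a (k - l))) summable_on UNIV"
    "norm y \<le> (\<Sum>\<^sub>\<infinity>l. c l) * norm a"
proof -
  define f where "f l = c l *\<^sub>R shift_abs l a" for l
  have n: "norm (f l) = c l * norm a" for l using c by (simp add: f_def)
  have sn: "(\<lambda>l. norm (f l)) summable_on UNIV"
    unfolding n by (intro summable_on_cmult_left c)
  then have sf: "f summable_on UNIV" by (rule Infinite_Sum.abs_summable_summable)
  have sm: "(\<lambda>l. c l * cmod (coord a (k - l))) summable_on UNIV" for k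
  proof (rule summable_on_comparison_test)
    show "(\<lambda>l. c l * norm a) summable_on UNIV" by (intro summable_on_cmult_left c)
    show "c l * cmod (coord a (k - l)) \<le> c l * norm a" for l using c by (intro mult_left_mono coord_le_norm)
  qed (use c in auto)
  show thesis
  proof (rule that)
    show "coord (infsum f UNIV) k = of_real (\<Sum>\<^sub>\<infinity>l. c l * cmod (coord a (k - l)))" for k
    proof -
      have "coord (infsum f UNIV) k = (\<Sum>\<^sub>\<infinity>l. coord (f l) k)"
        using infsumI[OF has_sum_bounded_linear[OF bounded_linear_coord has_sum_infsum[OF sf]], of k] by simp
      also have "\<dots> = (\<Sum>\<^sub>\<infinity>l. complex_of_real (c l * cmod (coord a (k - l))))"
        by (simp add: f_def scaleR_conv_of_real)
      also have "\<dots> = of_real (\<Sum>\<^sub>\<infinity>l. c l * cmod (coord a (k - l)))"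
        using has_sum_of_real[OF has_sum_infsum[OF sm]] by (rule infsumI)
      finally show ?thesis .
    qed
    show "norm (infsum f UNIV) \<le> (\<Sum>\<^sub>\<infinity>l. c l) * norm a"
      using norm_infsum_bound[OF sn] by (simp add: n infsum_cmult_left c)
  qed (rule sm)
qed

text \<open>The parameter \<open>dim\<close> ties the index type \<open>'n\<close>, and with it the
  dimension, to the locale.\<close>

locale sobolev =
  fixes s :: nat and dim :: "'n::finite itself"
  assumes s_crit: "s_crit CARD('n) \<le> s"
begin

lemma half_dim_less: "real CARD('n) / 2 < real s"
proof -
  have "real CARD('n) / 2 < real (s_crit CARD('n))"
    unfolding s_crit_def by (rule LeastI_ex) (rule reals_Archimedean2)
  then show ?thesis using s_crit by linarith
qed

definition wt :: "int ^ 'n \<Rightarrow> real" where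
  "wt k = sqrt ((1 + (norm (freq k))\<^sup>2) ^ s)"

lemma wt_ge_1: "1 \<le> wt k" by (simp add: wt_def)
lemma wt_pos [simp]: "0 < wt k" using wt_ge_1[of k] by linarith
lemma wt_nonzero [simp]: "wt k \<noteq> 0" using wt_pos[of k] by linarith
lemma wt_nonneg [simp]: "0 \<le> wt k" using wt_pos[of k] by linarith
lemma wt_sq: "(wt k)\<^sup>2 = (1 + (norm (freq k))\<^sup>2) ^ s" by (simp add: wt_def)
lemma wt_zero [simp]: "wt 0 = 1" by (simp add: wt_def)

lemma wt_minus [simp]: "wt (- k) = wt k" by (simp add: wt_def freq_minus)

text \<open>If |l| \<le> |k| then 1 + |k + l|^2 \<le> 4 (1 + |k|^2). This passes the weight of a
  product on to one of its factors, which makes H^s an algebra.\<close>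

lemma wt_add_le: "wt (k + l) \<le> 2 ^ s * (wt k + wt l)"
proof -
  have one: "wt (k + l) \<le> 2 ^ s * wt k" if le: "norm (freq l) \<le> norm (freq k)" for k l
  proof -
    have "norm (freq k + freq l) \<le> 2 * norm (freq k)"
      using norm_triangle_ineq[of "freq k" "freq l"] le by simp
    then have "(norm (freq k + freq l))\<^sup>2 \<le> (2 * norm (freq k))\<^sup>2" by (intro power_mono) auto
    then have "1 + (norm (freq (k + l)))\<^sup>2 \<le> 4 * (1 + (norm (freq k))\<^sup>2)" by (simp add: freq_add power_mult_distrib)
    then have "(1 + (norm (freq (k + l)))\<^sup>2) ^ s \<le> (4 * (1 + (norm (freq k))\<^sup>2)) ^ s" by (intro power_mono) auto
    also have "\<dots> = (2 ^ s * wt k)\<^sup>2"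
    proof -
      have "(4::real) ^ s = (2 ^ s)\<^sup>2" by (simp add: power2_eq_square flip: power_mult_distrib)
      then show ?thesis by (simp only: power_mult_distrib wt_sq)
    qed
    finally show ?thesis unfolding wt_def[of "k + l"] by (rule real_le_lsqrt[rotated -1]) (auto simp: less_imp_le)
  qed
  show ?thesis
  proof (cases "norm (freq l) \<le> norm (freq k)")
    case True
    then show ?thesis using one[of l k] wt_pos[of l] by (simp add: distrib_left add_increasing2)
  next
    case False
    then show ?thesis using one[of k l] wt_pos[of k] by (simp add: distrib_left add.commute add_increasing)
  qed
qed

lemma summable_wt: "(\<lambda>k. (1 / wt k)\<^sup>2) summable_on UNIV"
  using summable_on_lattice[OF half_dim_less] by (simp add: power_divide wt_sq)

text \<open>Bounds the embedding of H^s into the absolutely convergent Fourier series, and hence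
  into the bounded continuous functions. The series is finite because s > d/2.\<close>

definition embK :: real where
  "embK = sqrt (\<Sum>\<^sub>\<infinity>k. (1 / wt k)\<^sup>2)"

lemma embK_nonneg: "0 \<le> embK" by (simp add: embK_def infsum_nonneg)

text \<open>Coordinates carry the Sobolev weight; dividing it out gives the Fourier
  coefficients.\<close>

definition fc :: "(int ^ 'n) ell2 \<Rightarrow> int ^ 'n \<Rightarrow> complex" where
  "fc a k = coord a k / of_real (wt k)"

lemma fc_add: "fc (a + b) k = fc a k + fc b k"
  and fc_scaleR: "fc (r *\<^sub>R a) k = r *\<^sub>R fc a k"
  and fc_single: "fc (single l c) k = (if k = l then c / of_real (wt l) else 0)"
  by (simp_all add: fc_def add_divide_distrib scaleR_conv_of_real)

lemma norm_fc: "cmod (fc a k) = cmod (coord a k) / wt k"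
  by (simp add: fc_def norm_divide)

lemma norm_fc_le: "cmod (fc a k) \<le> cmod (coord a k)"
  using wt_ge_1[of k] by (simp add: norm_fc divide_le_eq mult_le_cancel_left1)

lemma summable_fc: "(\<lambda>k. cmod (fc a k)) summable_on UNIV"
  and sum_fc_le: "(\<Sum>\<^sub>\<infinity>k. cmod (fc a k)) \<le> embK * norm a"
  using norm_infsum_mult_le[OF coord_summable[of a] summable_wt]
  by (simp_all add: norm_fc abs_mult embK_def norm_ell2 mult.commute)

text \<open>Elements of the sequence space stand for classes modulo equality almost everywhere;
  \<open>ev a\<close> is the continuous representative, so that values at points make sense.\<close>

definition ev :: "(int ^ 'n) ell2 \<Rightarrow> real ^ 'n \<Rightarrow> complex" where
  "ev a x = (\<Sum>\<^sub>\<infinity>k. fc a k * echar k x)"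

lemma summable_ev: "(\<lambda>k. fc a k * echar k x) summable_on UNIV"
  by (rule Infinite_Sum.abs_summable_summable) (simp add: norm_mult summable_fc)

lemma norm_ev_le: "cmod (ev a x) \<le> embK * norm a"
proof -
  have "cmod (ev a x) \<le> (\<Sum>\<^sub>\<infinity>k. cmod (fc a k))"
    unfolding ev_def using norm_infsum_bound[of "\<lambda>k. fc a k * echar k x" UNIV]
    by (simp add: norm_mult summable_fc)
  then show ?thesis using sum_fc_le by (rule order_trans)
qed

lemma bounded_linear_ev: "bounded_linear (\<lambda>a. ev a x)"
proof (rule bounded_linear_intro[of _ embK])
  show "ev (a + b) x = ev a x + ev b x" for a b
    using infsum_add[OF summable_ev[of a x] summable_ev[of b x]]
    by (simp add: ev_def fc_def add_divide_distrib distrib_right)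
  show "ev (r *\<^sub>R a) x = r *\<^sub>R ev a x" for r a
  proof -
    have "fc (r *\<^sub>R a) k * echar k x = r *\<^sub>R (fc a k * echar k x)" for k
      by (simp add: fc_def scaleR_conv_of_real)
    then show ?thesis using infsum_scaleR_right[of r "\<lambda>k. fc a k * echar k x" UNIV] by (simp add: ev_def)
  qed
  show "norm (ev a x) \<le> norm a * embK" for a using norm_ev_le[of a x] by (simp add: mult.commute)
qed

lemmas ev_linear = bounded_linear.linear[OF bounded_linear_ev]
lemmas ev_add [simp] = linear_add[OF ev_linear]
lemmas ev_diff [simp] = linear_diff[OF ev_linear]
lemmas ev_minus [simp] = linear_neg[OF ev_linear]
lemmas ev_scaleR [simp] = linear_scale[OF ev_linear]
lemmas ev_zero [simp] = linear_0[OF ev_linear]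
lemmas ev_sum = linear_sum[OF ev_linear]

lemma ev_single [simp]: "ev (single k c) x = c / of_real (wt k) * echar k x"
proof -
  have "ev (single k c) x = (\<Sum>\<^sub>\<infinity>l\<in>{k}. c / of_real (wt k) * echar k x)"
    unfolding ev_def by (rule infsum_cong_neutral) (auto simp: fc_def)
  then show ?thesis by simp
qed

lemma continuous_on_ev: "continuous_on A (ev a)"
proof -
  have "uniform_limit UNIV (\<lambda>F x. ev (\<Sum>k\<in>F. single k (coord a k)) x) (ev a) (finite_subsets_at_top UNIV)"
    unfolding uniform_limit_iff
  proof (intro allI impI)
    fix e :: real assume e: "e > 0"
    have "e / (embK + 1) > 0" using e embK_nonneg by simp
    then have "\<forall>\<^sub>F F in finite_subsets_at_top UNIV. dist (\<Sum>k\<in>F. single k (coord a k)) a < e / (embK + 1)"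
      using has_sum_single[of a] unfolding has_sum_def tendsto_iff by blast
    then show "\<forall>\<^sub>F F in finite_subsets_at_top UNIV. \<forall>x\<in>UNIV. dist (ev (\<Sum>k\<in>F. single k (coord a k)) x) (ev a x) < e"
    proof eventually_elim
      case (elim F)
      let ?b = "\<Sum>k\<in>F. single k (coord a k)"
      have "cmod (ev (?b - a) x) < e" for x
      proof -
        have "cmod (ev (?b - a) x) \<le> embK * norm (?b - a)" by (rule norm_ev_le)
        also have "\<dots> \<le> embK * (e / (embK + 1))"
          using elim embK_nonneg by (intro mult_left_mono) (auto simp: dist_norm)
        also have "\<dots> < e" using e embK_nonneg by (simp add: field_simps)
        finally show ?thesis .
      qed
      then show ?case by (simp add: dist_norm)
    qed
  qed
  then have "continuous_on UNIV (ev a)"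
  proof (rule uniform_limit_theorem[rotated])
    show "\<forall>\<^sub>F F in finite_subsets_at_top UNIV. continuous_on UNIV (\<lambda>x. ev (\<Sum>k\<in>F. single k (coord a k)) x)"
      by (intro always_eventually allI) (simp add: ev_sum continuous_intros)
  qed auto
  then show ?thesis by (rule continuous_on_subset) auto
qed

text \<open>Both sides are bounded and linear in \<open>a\<close>, and on unit vectors this is the
  orthogonality of the exponentials.\<close>

lemma fourier_coeff_ev: "fourier_coeff (ev a) k = fc a k"
proof -
  have "(\<lambda>a. fourier_coeff (ev a) k) = (\<lambda>a. fc a k)"
  proof (rule bounded_linear_eq_on_single)
    have "ev (a + b) = (\<lambda>x. ev a x + ev b x)" "ev (r *\<^sub>R a) = (\<lambda>x. complex_of_real r * ev a x)" for a b r
      by (auto simp: scaleR_conv_of_real)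
    then show "bounded_linear (\<lambda>a. fourier_coeff (ev a) k)"
      using norm_fourier_coeff_le[OF continuous_on_ev norm_ev_le, of _ k]
      by (intro bounded_linear_intro[of _ embK])
        (auto simp: fourier_coeff_add fourier_coeff_cmult continuous_on_ev scaleR_conv_of_real mult.commute)
    show "bounded_linear (\<lambda>a. fc a k)"
      by (rule bounded_linear_intro[of _ 1])
        (auto simp: fc_def add_divide_distrib scaleR_conv_of_real intro: order_trans[OF norm_fc_le[unfolded fc_def] coord_le_norm])
    have "ev (single l c) = (\<lambda>x. (c / of_real (wt l)) * echar l x)" for l c by auto
    then show "fourier_coeff (ev (single l c)) k = fc (single l c) k" for l c
      by (simp only: fourier_coeff_cmult fourier_coeff_echar fc_single) simp
  qed
  then show ?thesis by meson
qed

lemma ev_inject: "ev a = ev b \<longleftrightarrow> a = b"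
proof
  assume "ev a = ev b"
  then have "fc a k = fc b k" for k using fourier_coeff_ev by metis
  then show "a = b" by (intro ell2_eqI) (simp add: fc_def)
qed simp

text \<open>Allows identities between products, exponentials and translates to be checked pointwise
  from here on.\<close>

lemma ev_eqI: "(\<And>x. ev a x = ev b x) \<Longrightarrow> a = b"
  using ev_inject by blast

lemma torus_periodic_ev: "torus_periodic (ev a)"
  by (simp add: torus_periodic_def ev_def torus_periodic_echar[unfolded torus_periodic_def, rule_format])

lemma summable_prod: "(\<lambda>l. fc a l * fc b (k - l)) summable_on UNIV"
proof (rule Infinite_Sum.abs_summable_summable, rule summable_on_comparison_test)
  show "(\<lambda>l. cmod (fc a l) * norm b) summable_on UNIV" by (intro summable_on_cmult_left summable_fc)
  show "norm (fc a l * fc b (k - l)) \<le> cmod (fc a l) * norm b" for l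
    unfolding norm_mult by (intro mult_left_mono order_trans[OF norm_fc_le coord_le_norm]) auto
qed auto

definition prd :: "(int ^ 'n) ell2 \<Rightarrow> (int ^ 'n) ell2 \<Rightarrow> (int ^ 'n) ell2" where
  "prd a b = Abs_ell2 (\<lambda>k. of_real (wt k) * (\<Sum>\<^sub>\<infinity>l. fc a l * fc b (k - l)))"

text \<open>The weight at k is at most 2^s times the sum of the weights at l and k - l. Each summand
  leaves a convolution of an absolutely summable with a square summable sequence, to which Young's
  inequality applies.\<close>

lemma coord_prd: "coord (prd a b) k = of_real (wt k) * (\<Sum>\<^sub>\<infinity>l. fc a l * fc b (k - l))"
  and norm_prd_le: "norm (prd a b) \<le> norm a * norm b * (2 * 2 ^ s * embK)"
proof -
  obtain y where y: "\<And>k. coord y k = of_real (\<Sum>\<^sub>\<infinity>l. cmod (fc a l) * cmod (coord b (k - l)))"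
    "\<And>k. (\<lambda>l. cmod (fc a l) * cmod (coord b (k - l))) summable_on UNIV"
    "norm y \<le> (\<Sum>\<^sub>\<infinity>l. cmod (fc a l)) * norm b"
    by (rule young_ell2[OF summable_fc[of a], of b]) auto
  obtain z where z: "\<And>k. coord z k = of_real (\<Sum>\<^sub>\<infinity>l. cmod (fc b l) * cmod (coord a (k - l)))"
    "\<And>k. (\<lambda>l. cmod (fc b l) * cmod (coord a (k - l))) summable_on UNIV"
    "norm z \<le> (\<Sum>\<^sub>\<infinity>l. cmod (fc b l)) * norm a"
    by (rule young_ell2[OF summable_fc[of b], of a]) auto
  have bij: "bij (\<lambda>l. k - l)" for k :: "int ^ 'n"
    by (rule involuntory_imp_bij) simp
  have z': "coord z k = of_real (\<Sum>\<^sub>\<infinity>l. cmod (coord a l) * cmod (fc b (k - l)))"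
    "(\<lambda>l. cmod (coord a l) * cmod (fc b (k - l))) summable_on UNIV" for k
    using infsum_reindex_bij_betw[OF bij, of "\<lambda>l. cmod (fc b l) * cmod (coord a (k - l))" k]
      summable_on_reindex_bij_betw[OF bij, of "\<lambda>l. cmod (fc b l) * cmod (coord a (k - l))" k] z
    by (simp_all add: mult.commute)
  define w where "w = (2 ^ s :: real) *\<^sub>R (z + y)"
  have le: "cmod (of_real (wt k) * (\<Sum>\<^sub>\<infinity>l. fc a l * fc b (k - l))) \<le> cmod (coord w k)" for k
  proof -
    have "cmod (of_real (wt k) * (\<Sum>\<^sub>\<infinity>l. fc a l * fc b (k - l)))
        = cmod (\<Sum>\<^sub>\<infinity>l. of_real (wt k) * (fc a l * fc b (k - l)))"
      by (simp add: infsum_cmult_right summable_prod)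
    also have "\<dots> \<le> (\<Sum>\<^sub>\<infinity>l. 2 ^ s * (cmod (coord a l) * cmod (fc b (k - l)) + cmod (fc a l) * cmod (coord b (k - l))))"
    proof (rule norm_infsum_le)
      show "((\<lambda>l. of_real (wt k) * (fc a l * fc b (k - l))) has_sum (\<Sum>\<^sub>\<infinity>l. of_real (wt k) * (fc a l * fc b (k - l)))) UNIV"
        by (intro has_sum_infsum summable_on_cmult_right summable_prod)
      show "((\<lambda>l. 2 ^ s * (cmod (coord a l) * cmod (fc b (k - l)) + cmod (fc a l) * cmod (coord b (k - l)))) has_sum
          (\<Sum>\<^sub>\<infinity>l. 2 ^ s * (cmod (coord a l) * cmod (fc b (k - l)) + cmod (fc a l) * cmod (coord b (k - l))))) UNIV"
        by (intro has_sum_infsum summable_on_cmult_right summable_on_add y z')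
      fix l
      have "wt k * (cmod (fc a l) * cmod (fc b (k - l))) \<le> (2 ^ s * (wt l + wt (k - l))) * (cmod (fc a l) * cmod (fc b (k - l)))"
        using wt_add_le[of l "k - l"] by (intro mult_right_mono) auto
      also have "\<dots> = 2 ^ s * (cmod (coord a l) * cmod (fc b (k - l)) + cmod (fc a l) * cmod (coord b (k - l)))"
        by (simp add: norm_fc field_simps)
      finally show "cmod (of_real (wt k) * (fc a l * fc b (k - l)))
          \<le> 2 ^ s * (cmod (coord a l) * cmod (fc b (k - l)) + cmod (fc a l) * cmod (coord b (k - l)))"
        by (simp add: norm_mult)
    qed
    also have "\<dots> = 2 ^ s * ((\<Sum>\<^sub>\<infinity>l. cmod (coord a l) * cmod (fc b (k - l))) + (\<Sum>\<^sub>\<infinity>l. cmod (fc a l) * cmod (coord b (k - l))))"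
      by (simp add: infsum_cmult_right infsum_add summable_on_add y z')
    also have "\<dots> = Re (coord w k)" by (simp add: w_def y z')
    finally show ?thesis using complex_Re_le_cmod order_trans by blast
  qed
  have "(\<lambda>k. (cmod (of_real (wt k) * (\<Sum>\<^sub>\<infinity>l. fc a l * fc b (k - l))))\<^sup>2) summable_on UNIV"
    by (rule summable_on_comparison_test[OF coord_summable[of w]]) (auto intro!: power_mono le)
  then show c: "coord (prd a b) k = of_real (wt k) * (\<Sum>\<^sub>\<infinity>l. fc a l * fc b (k - l))" for k
    by (simp add: prd_def coord_Abs_ell2)
  have "norm (prd a b) \<le> norm w" by (rule norm_ell2_mono) (simp only: c le)
  also have "norm w = 2 ^ s * norm (z + y)" by (simp add: w_def)
  also have "\<dots> \<le> 2 ^ s * (norm z + norm y)" by (intro mult_left_mono norm_triangle_ineq) auto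
  also have "\<dots> \<le> 2 ^ s * (embK * norm b * norm a + embK * norm a * norm b)"
    by (intro mult_left_mono add_mono order_trans[OF z(3)] order_trans[OF y(3)] mult_right_mono sum_fc_le) auto
  finally show "norm (prd a b) \<le> norm a * norm b * (2 * 2 ^ s * embK)" by (simp add: algebra_simps)
qed

lemma bounded_bilinear_prd: "bounded_bilinear prd"
proof
  fix a a' b b' :: "(int ^ 'n) ell2" and r :: real
  show "prd (a + a') b = prd a b + prd a' b"
    by (rule ell2_eqI) (simp add: coord_prd fc_add distrib_right distrib_left infsum_add summable_prod)
  show "prd a (b + b') = prd a b + prd a b'"
    by (rule ell2_eqI) (simp add: coord_prd fc_add distrib_left infsum_add summable_prod)
  show "prd (r *\<^sub>R a) b = r *\<^sub>R prd a b"
    by (rule ell2_eqI) (simp add: coord_prd fc_scaleR infsum_scaleR_right)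
  show "prd a (r *\<^sub>R b) = r *\<^sub>R prd a b"
    by (rule ell2_eqI) (simp add: coord_prd fc_scaleR infsum_scaleR_right)
  show "\<exists>K. \<forall>a b. norm (prd a b) \<le> norm a * norm b * K"
    using norm_prd_le by blast
qed

interpretation prd: bounded_bilinear prd by (rule bounded_bilinear_prd)

lemma prd_single: "prd (single k c) (single l d) = single (k + l) (of_real (wt (k + l)) * (c / of_real (wt k)) * (d / of_real (wt l)))"
proof (rule ell2_eqI)
  fix m
  have "(\<Sum>\<^sub>\<infinity>j. fc (single k c) j * fc (single l d) (m - j)) = (\<Sum>\<^sub>\<infinity>j\<in>{k}. fc (single k c) j * fc (single l d) (m - j))"
    by (rule infsum_cong_neutral) (auto simp: fc_def)
  also have "\<dots> = (if m = k + l then (c / of_real (wt k)) * (d / of_real (wt l)) else 0)"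
    by (auto simp: fc_def algebra_simps)
  finally show "coord (prd (single k c) (single l d)) m
      = coord (single (k + l) (of_real (wt (k + l)) * (c / of_real (wt k)) * (d / of_real (wt l)))) m"
    by (simp add: coord_prd)
qed

text \<open>Reduced by density to exponentials in each factor in turn, where it is the addition law
  for exponents.\<close>

lemma ev_prd [simp]: "ev (prd a b) x = ev a x * ev b x"
proof -
  have 1: "ev (prd (single k c) b) x = ev (single k c) x * ev b x" for k c b
  proof -
    have "(\<lambda>b. ev (prd (single k c) b) x) = (\<lambda>b. ev (single k c) x * ev b x)"
    proof (rule bounded_linear_eq_on_single)
      show "bounded_linear (\<lambda>b. ev (prd (single k c) b) x)"
        by (rule bounded_linear_compose[OF bounded_linear_ev prd.bounded_linear_right])
      show "bounded_linear (\<lambda>b. ev (single k c) x * ev b x)"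
        by (rule bounded_linear_compose[OF bounded_linear_mult_right bounded_linear_ev])
    qed (simp add: prd_single echar_add)
    then show ?thesis by meson
  qed
  have "(\<lambda>a. ev (prd a b) x) = (\<lambda>a. ev a x * ev b x)"
  proof (rule bounded_linear_eq_on_single)
    show "bounded_linear (\<lambda>a. ev (prd a b) x)"
      by (rule bounded_linear_compose[OF bounded_linear_ev prd.bounded_linear_left])
    show "bounded_linear (\<lambda>a. ev a x * ev b x)"
      by (rule bounded_linear_compose[OF bounded_linear_mult_left bounded_linear_ev])
  qed (rule 1)
  then show ?thesis by meson
qed

lemma ev_conj_ell2 [simp]: "ev (conj_ell2 a) x = cnj (ev a x)"
proof -
  have "(\<lambda>a. ev (conj_ell2 a) x) = (\<lambda>a. cnj (ev a x))"
  proof (rule bounded_linear_eq_on_single)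
    show "bounded_linear (\<lambda>a. ev (conj_ell2 a) x)"
      by (rule bounded_linear_compose[OF bounded_linear_ev bounded_linear_conj_ell2])
    show "bounded_linear (\<lambda>a. cnj (ev a x))"
      by (rule bounded_linear_compose[OF bounded_linear_cnj bounded_linear_ev])
    have "conj_ell2 (single k c) = single (- k) (cnj c)" for k :: "int ^ 'n" and c
      by (rule ell2_eqI) auto
    then show "ev (conj_ell2 (single k c)) x = cnj (ev (single k c) x)" for k c
      by (simp add: echar_uminus)
  qed
  then show ?thesis by meson
qed

definition M :: "(int ^ 'n) ell2 \<Rightarrow> (int ^ 'n) ell2 blinop" where
  "M a = Blinop (prd a)"

lemma M_app: "M a \<triangleright> b = prd a b"
  unfolding M_def by (rule app_Blinop) (rule prd.bounded_linear_right)

lemma ev_M [simp]: "ev (M a \<triangleright> b) x = ev a x * ev b x"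
  by (simp add: M_app)

lemma bounded_linear_M: "bounded_linear M"
proof (rule bounded_linear_intro[of _ "2 * 2 ^ s * embK"])
  show "M (a + b) = M a + M b" for a b by (rule blinop_eqI) (simp add: M_app prd.add_left)
  show "M (r *\<^sub>R a) = r *\<^sub>R M a" for a r by (rule blinop_eqI) (simp add: M_app prd.scaleR_left)
  show "norm (M a) \<le> norm a * (2 * 2 ^ s * embK)" for a
  proof (rule norm_blinop_bound)
    show "norm (M a \<triangleright> b) \<le> norm a * (2 * 2 ^ s * embK) * norm b" for b
      using norm_prd_le[of a b] by (simp add: M_app mult_ac)
  qed (simp add: embK_nonneg)
qed

lemmas M_linear = bounded_linear.linear[OF bounded_linear_M]
lemmas M_add = linear_add[OF M_linear] and M_diff = linear_diff[OF M_linear]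
  and M_minus = linear_neg[OF M_linear] and M_scaleR = linear_scale[OF M_linear] and M_zero = linear_0[OF M_linear]

lemma M_commute: "M a * M b = M b * M a"
  by (rule blinop_eqI, rule ev_eqI) simp

text \<open>This is how e^a acts on H^s: as the exponential of a bounded operator, so that no
  estimate for compositions enters.\<close>

lemma ev_exp_M [simp]: "ev (exp (M a) \<triangleright> b) x = exp (ev a x) * ev b x"
  by (rule exp_app_eigen[OF bounded_linear_ev]) simp

lemma exp_M_add: "exp (M (a + b)) = exp (M a) * exp (M b)"
  unfolding M_add by (rule exp_add_commuting[OF M_commute])

end

section \<open>Uniqueness of Fourier coefficients\<close>

inductive trig :: "(real ^ 'n \<Rightarrow> complex) \<Rightarrow> bool" where
  trig_echar: "trig (\<lambda>x. c * echar k x)"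
| trig_add: "trig f \<Longrightarrow> trig g \<Longrightarrow> trig (\<lambda>x. f x + g x)"

lemma trig_const: "trig (\<lambda>x. c)"
  using trig_echar[of c 0] by simp

lemma trig_mult_echar: "trig f \<Longrightarrow> trig (\<lambda>x. f x * (c * echar k x))"
proof (induction rule: trig.induct)
  case (trig_echar d l)
  show ?case using trig.trig_echar[of "d * c" "l + k"] by (simp add: echar_add mult_ac)
next
  case (trig_add f g)
  then show ?case by (simp add: distrib_right trig.trig_add)
qed

lemma trig_mult:
  assumes "trig f" "trig g"
  shows "trig (\<lambda>x. f x * g x)"
  using assms(2)
proof (induction rule: trig.induct)
  case (trig_echar d l)
  then show ?case by (rule trig_mult_echar[OF assms(1)])
next
  case (trig_add f g)
  then show ?case by (simp add: distrib_left trig.trig_add)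
qed

lemma trig_sum: "finite A \<Longrightarrow> (\<And>i. i \<in> A \<Longrightarrow> trig (f i)) \<Longrightarrow> trig (\<lambda>x. \<Sum>i\<in>A. f i x)"
  by (induction rule: finite_induct) (auto intro: trig_const trig_add)

lemma continuous_on_trig: "trig f \<Longrightarrow> continuous_on A f"
  by (induction rule: trig.induct) (auto intro!: continuous_intros)

lemma bounded_trig: "trig f \<Longrightarrow> \<exists>b. \<forall>x. cmod (f x) \<le> b"
proof (induction rule: trig.induct)
  case (trig_echar c k)
  then show ?case by (auto simp: norm_mult)
next
  case (trig_add f g)
  then show ?case by (metis norm_triangle_mono)
qed

text \<open>Embeds the torus into a Euclidean space. Polynomials become trigonometric polynomials
  there, so polynomial approximation on a compact set yields approximation by exponentials.\<close>

definition circle_embed :: "real ^ 'n \<Rightarrow> (real ^ 'n) \<times> (real ^ 'n)" where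
  "circle_embed x = (\<chi> i. cos (x $ i), \<chi> i. sin (x $ i))"

lemma continuous_on_circle_embed [continuous_intros]: "continuous_on A circle_embed"
  unfolding circle_embed_def by (intro continuous_intros continuous_on_vec_lambda)

lemma cos_trig: "trig (\<lambda>x :: real ^ 'n. of_real (cos (x $ i)))"
  and sin_trig: "trig (\<lambda>x :: real ^ 'n. of_real (sin (x $ i)))"
proof -
  have e: "echar (axis i 1) x = cis (x $ i)" for x :: "real ^ 'n" and i
  proof -
    have "freq (axis i 1) = axis i 1" by (simp add: vec_eq_iff axis_def)
    then show ?thesis by (simp add: echar_def inner_commute[of _ x] inner_axis cis_conv_exp)
  qed
  have "of_real (cos (x $ i)) = (1/2) * echar (axis i 1) x + (1/2) * echar (- axis i 1) x" for x :: "real ^ 'n"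
    by (simp add: e echar_uminus complex_eq_iff)
  then show "trig (\<lambda>x :: real ^ 'n. of_real (cos (x $ i)))"
    by (simp only:) (intro trig.intros)
  have "of_real (sin (x $ i)) = (- \<i>/2) * echar (axis i 1) x + (\<i>/2) * echar (- axis i 1) x" for x :: "real ^ 'n"
    by (simp add: e echar_uminus complex_eq_iff)
  then show "trig (\<lambda>x :: real ^ 'n. of_real (sin (x $ i)))"
    by (simp only:) (intro trig.intros)
qed

lemma trig_polynomial_circle_embed:
  fixes p :: "(real ^ 'n) \<times> (real ^ 'n) \<Rightarrow> real"
  assumes "real_polynomial_function p"
  shows "trig (\<lambda>x. of_real (p (circle_embed x)))"
  using assms
proof (induction rule: real_polynomial_function.induct)
  case (linear h)
  interpret h: bounded_linear h by fact
  have "circle_embed x = (\<Sum>i\<in>UNIV. cos (x $ i) *\<^sub>R (axis i 1, 0)) + (\<Sum>i\<in>UNIV. sin (x $ i) *\<^sub>R (0, axis i 1))"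
    for x :: "real ^ 'n"
    by (simp add: circle_embed_def prod_eq_iff fst_sum snd_sum vec_eq_iff axis_def if_distrib cong: if_cong)
  then have "complex_of_real (h (circle_embed x)) = (\<Sum>i\<in>UNIV. of_real (cos (x $ i)) * of_real (h (axis i 1, 0)))
      + (\<Sum>i\<in>UNIV. of_real (sin (x $ i)) * of_real (h (0, axis i 1)))" for x
    by (simp only: h.add h.sum h.scaleR of_real_add of_real_sum real_scaleR_def of_real_mult)
  then show ?case
    by (simp only:) (intro trig_add trig_sum finite trig_mult trig_const cos_trig sin_trig)
next
  case (mult f g)
  then show ?case by (simp add: trig_mult)
qed (auto intro: trig_const trig_add)

lemma set_integrable_mult_bounded:
  fixes f g :: "real ^ 'n \<Rightarrow> complex"
  assumes f: "set_integrable lebesgue S f" and g: "g \<in> borel_measurable lebesgue" "\<And>x. cmod (g x) \<le> b"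
  shows "set_integrable lebesgue S (\<lambda>x. f x * g x)"
proof -
  have "integrable lebesgue (\<lambda>x. indicator S x *\<^sub>R f x * g x)"
  proof (rule Bochner_Integration.integrable_bound)
    show "integrable lebesgue (\<lambda>x. b * norm (indicator S x *\<^sub>R f x))"
      using f by (intro integrable_mult_right integrable_norm) (simp add: set_integrable_def)
    show "(\<lambda>x. indicator S x *\<^sub>R f x * g x) \<in> borel_measurable lebesgue"
      using f g by (intro borel_measurable_times) (auto simp: set_integrable_def)
    have "norm (indicator S x *\<^sub>R f x * g x) \<le> norm (b * norm (indicator S x *\<^sub>R f x))" for x
    proof -
      have "norm (indicator S x *\<^sub>R f x) * norm (g x) \<le> norm (indicator S x *\<^sub>R f x) * b"
        by (intro mult_left_mono g) auto
      then show ?thesis 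
        unfolding norm_mult real_norm_def by (metis abs_ge_self mult.commute order_trans abs_norm_cancel)
    qed
    then show "AE x in lebesgue. norm (indicator S x *\<^sub>R f x * g x) \<le> norm (b * norm (indicator S x *\<^sub>R f x))"
      by simp
  qed
  then show ?thesis by (simp add: set_integrable_def)
qed

lemma continuous_imp_measurable_lebesgue: "continuous_on UNIV f \<Longrightarrow> f \<in> borel_measurable lebesgue"
  for f :: "real ^ 'n \<Rightarrow> 'b::{second_countable_topology, t2_space}"
  using borel_measurable_continuous_onI[of f] by (simp add: measurable_completion)

context
  fixes f :: "real ^ 'n \<Rightarrow> complex"
  assumes f: "set_integrable lebesgue torus_cube f" and zero: "\<And>k. fourier_coeff f k = 0"
begin

lemma integral_trig_zero: "trig g \<Longrightarrow> (LINT x:torus_cube|lebesgue. f x * g x) = 0"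
proof (induction rule: trig.induct)
  case (trig_echar c k)
  have "(LINT x:torus_cube|lebesgue. f x * echar k x) = 0"
    using zero[of "- k"] by (simp add: fourier_coeff_alt)
  then show ?case
    using set_integral_mult_right[of lebesgue torus_cube c "\<lambda>x. f x * echar k x"]
    by (simp add: mult.left_commute)
next
  case (trig_add g h)
  have "set_integrable lebesgue torus_cube (\<lambda>x. f x * g x)" if "trig g" for g
    using bounded_trig[OF that] by (auto intro!: set_integrable_mult_bounded f continuous_imp_measurable_lebesgue continuous_on_trig that)
  then show ?case using trig_add by (simp add: distrib_left set_integral_add)
qed

text \<open>Approximate \<phi> uniformly on the image of the cube by polynomials, against which the
  integral vanishes; the error is at most e times the L^1 norm of \<open>f\<close>.\<close>

lemma integral_continuous_zero:
  fixes \<phi> :: "(real ^ 'n) \<times> (real ^ 'n) \<Rightarrow> real"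
  assumes \<phi>: "continuous_on UNIV \<phi>"
  shows "(LINT x:torus_cube|lebesgue. f x * of_real (\<phi> (circle_embed x))) = 0"
proof -
  let ?I = "\<lambda>g. LINT x:torus_cube|lebesgue. f x * of_real (g (circle_embed x))"
  define C where "C = (LINT x:torus_cube|lebesgue. cmod (f x))"
  define S where "S = circle_embed ` (torus_cube :: (real ^ 'n) set)"
  have S: "compact S" unfolding S_def torus_cube_def
    by (intro compact_continuous_image continuous_on_circle_embed compact_cbox)
  have meas: "(\<lambda>x :: real ^ 'n. complex_of_real (g (circle_embed x))) \<in> borel_measurable lebesgue"
    if "continuous_on UNIV g" for g
    by (intro continuous_imp_measurable_lebesgue continuous_intros continuous_on_compose2[OF that]) auto
  have bnd: "\<exists>b. \<forall>x. cmod (complex_of_real (g (circle_embed x))) \<le> b" if "continuous_on UNIV g"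
    for g :: "(real ^ 'n) \<times> (real ^ 'n) \<Rightarrow> real"
  proof -
    have "bounded (g ` (cbox (\<chi> i. -1, \<chi> i. -1) (\<chi> i. 1, \<chi> i. 1)))"
      by (intro compact_imp_bounded compact_continuous_image continuous_on_subset[OF that]) auto
    then obtain b where "\<forall>y\<in>cbox (\<chi> i. -1, \<chi> i. -1) (\<chi> i. 1, \<chi> i. 1). \<bar>g y\<bar> \<le> b"
      by (auto simp: bounded_iff)
    moreover have "circle_embed x \<in> cbox (\<chi> i. -1, \<chi> i. -1) (\<chi> i. 1, \<chi> i. 1)" for x :: "real ^ 'n"
      by (simp add: circle_embed_def cbox_Pair_eq mem_box_cart)
    ultimately have "\<forall>x. cmod (complex_of_real (g (circle_embed (x :: real ^ 'n)))) \<le> b" by simp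
    then show ?thesis by blast
  qed
  have si: "set_integrable lebesgue torus_cube (\<lambda>x. f x * of_real (g (circle_embed x)))" if cg: "continuous_on UNIV g" for g
  proof -
    obtain b where b: "\<And>x :: real ^ 'n. cmod (complex_of_real (g (circle_embed x))) \<le> b" using bnd[OF cg] by blast
    show ?thesis by (rule set_integrable_mult_bounded[OF f meas[OF cg] b])
  qed
  have le: "cmod (?I \<phi>) \<le> e * C" if e: "e > 0" for e
  proof -
    obtain p where p: "real_polynomial_function p" "\<And>y. y \<in> S \<Longrightarrow> \<bar>\<phi> y - p y\<bar> < e"
      using Stone_Weierstrass_real_polynomial_function[OF S continuous_on_subset[OF \<phi>] e] by auto
    have cp: "continuous_on UNIV p"
      using p(1) by (intro continuous_at_imp_continuous_on ballI continuous_real_polymonial_function)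
    have "?I \<phi> = ?I \<phi> - ?I p"
      using integral_trig_zero[OF trig_polynomial_circle_embed[OF p(1)]] by simp
    also have "\<dots> = (LINT x:torus_cube|lebesgue. f x * of_real (\<phi> (circle_embed x)) - f x * of_real (p (circle_embed x)))"
      by (rule set_integral_diff(2)[symmetric]) (intro si \<phi> cp)+
    also have "cmod \<dots> \<le> (LINT x:torus_cube|lebesgue. e * cmod (f x))"
      unfolding set_lebesgue_integral_def
    proof (rule Bochner_Integration.integral_norm_bound_integral)
      show "integrable lebesgue (\<lambda>x. indicator torus_cube x *\<^sub>R (f x * of_real (\<phi> (circle_embed x)) - f x * of_real (p (circle_embed x))))"
        using set_integral_diff(1)[OF si[OF \<phi>] si[OF cp]] by (simp add: set_integrable_def)
      show "integrable lebesgue (\<lambda>x. indicator torus_cube x *\<^sub>R (e * cmod (f x)))"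
        using set_integrable_mult_right[OF set_integrable_norm[OF f], of e] by (simp add: set_integrable_def)
      fix x :: "real ^ 'n"
      show "norm (indicator torus_cube x *\<^sub>R (f x * of_real (\<phi> (circle_embed x)) - f x * of_real (p (circle_embed x))))
          \<le> indicator torus_cube x *\<^sub>R (e * cmod (f x))"
      proof (cases "x \<in> torus_cube")
        case True
        then have "\<bar>\<phi> (circle_embed x) - p (circle_embed x)\<bar> \<le> e" using p(2)[of "circle_embed x"] by (auto simp: S_def)
        then have "cmod (f x) * \<bar>\<phi> (circle_embed x) - p (circle_embed x)\<bar> \<le> cmod (f x) * e"
          by (intro mult_left_mono) auto
        then show ?thesis using True
          by (simp add: norm_mult mult.commute flip: right_diff_distrib of_real_diff)
      qed simp
    qed
    also have "\<dots> = e * C" unfolding C_def by simp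
    finally show ?thesis .
  qed
  have C: "0 \<le> C" unfolding C_def set_lebesgue_integral_def by (intro Bochner_Integration.integral_nonneg) auto
  have "cmod (?I \<phi>) \<le> 0"
  proof (rule field_le_epsilon)
    fix e :: real assume e: "e > 0"
    have "cmod (?I \<phi>) \<le> e / (C + 1) * C" using e C by (intro le) auto
    also have "\<dots> \<le> e" using e C by (simp add: field_simps)
    finally show "cmod (?I \<phi>) \<le> 0 + e" by simp
  qed
  then show ?thesis by simp
qed

lemma integral_closed_zero:
  fixes C :: "((real ^ 'n) \<times> (real ^ 'n)) set"
  assumes C: "closed C" "C \<noteq> {}"
  shows "(LINT x:torus_cube|lebesgue. f x * indicator C (circle_embed x)) = 0"
proof -
  \<comment> \<open>Continuous functions decreasing to the indicator of \<open>C\<close>. The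
    distance to the empty set is 0 by convention, which would make every \<open>\<phi> n\<close>
    equal to 1; hence \<open>C\<close> is assumed nonempty.\<close>
  define \<phi> where "\<phi> n y = max 0 (1 - real n * infdist y C)" for n y
  have \<phi>: "continuous_on UNIV (\<phi> n)" for n unfolding \<phi>_def by (intro continuous_intros)
  have lim: "(\<lambda>n. \<phi> n y) \<longlonglongrightarrow> indicator C y" for y
  proof (cases "y \<in> C")
    case True
    then show ?thesis by (simp add: \<phi>_def)
  next
    case False
    then have pos: "infdist y C > 0" using C in_closed_iff_infdist_zero infdist_nonneg by (metis less_le)
    obtain N where N: "1 < real N * infdist y C" using reals_Archimedean3[OF pos] by auto
    have "\<phi> n y = 0" if "n \<ge> N" for n
    proof -
      have "real N * infdist y C \<le> real n * infdist y C" using that pos by (intro mult_right_mono) auto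
      then show ?thesis using N by (simp add: \<phi>_def)
    qed
    then show ?thesis using False
      by (intro tendsto_eventually) (auto simp: eventually_sequentially intro!: exI[of _ N])
  qed
  have "(\<lambda>n. LINT x:torus_cube|lebesgue. f x * of_real (\<phi> n (circle_embed x)))
      \<longlonglongrightarrow> (LINT x:torus_cube|lebesgue. f x * of_real (indicator C (circle_embed x)))"
    unfolding set_lebesgue_integral_def
  proof (rule integral_dominated_convergence)
    have mf: "(\<lambda>x. indicator torus_cube x *\<^sub>R f x) \<in> borel_measurable lebesgue"
      using f by (simp add: set_integrable_def)
    have m: "(\<lambda>x :: real ^ 'n. complex_of_real (\<phi> n (circle_embed x))) \<in> borel_measurable lebesgue" for n
      by (intro continuous_imp_measurable_lebesgue continuous_intros continuous_on_compose2[OF \<phi>]) auto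
    show "(\<lambda>x. indicator torus_cube x *\<^sub>R (f x * of_real (\<phi> n (circle_embed x)))) \<in> borel_measurable lebesgue" for n
      using borel_measurable_times[OF mf m[of n]] by simp
    have "(\<lambda>x :: real ^ 'n. complex_of_real (indicator C (circle_embed x))) \<in> borel_measurable lebesgue"
      by (rule borel_measurable_LIMSEQ_metric[where f = "\<lambda>n x. complex_of_real (\<phi> n (circle_embed x))"])
        (auto intro!: m tendsto_intros lim)
    from borel_measurable_times[OF mf this]
    show "(\<lambda>x. indicator torus_cube x *\<^sub>R (f x * of_real (indicator C (circle_embed x)))) \<in> borel_measurable lebesgue"
      by simp
    show "integrable lebesgue (\<lambda>x. norm (indicator torus_cube x *\<^sub>R f x))"
      using f by (intro integrable_norm) (simp add: set_integrable_def)
    show "AE x in lebesgue. (\<lambda>n. indicator torus_cube x *\<^sub>R (f x * of_real (\<phi> n (circle_embed x))))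
        \<longlonglongrightarrow> indicator torus_cube x *\<^sub>R (f x * of_real (indicator C (circle_embed x)))"
      by (intro always_eventually allI tendsto_intros lim)
    have "\<bar>\<phi> n y\<bar> \<le> 1" for n y using infdist_nonneg[of y C] by (auto simp: \<phi>_def max_def)
    then have "norm (indicator torus_cube x *\<^sub>R (f x * of_real (\<phi> n (circle_embed x)))) \<le> norm (indicator torus_cube x *\<^sub>R f x)" for n x
      by (auto simp: norm_mult mult_left_le indicator_def)
    then show "AE x in lebesgue. norm (indicator torus_cube x *\<^sub>R (f x * of_real (\<phi> n (circle_embed x)))) \<le> norm (indicator torus_cube x *\<^sub>R f x)" for n
      by simp
  qed
  then have "(\<lambda>n. 0) \<longlonglongrightarrow> (LINT x:torus_cube|lebesgue. f x * of_real (indicator C (circle_embed x)))"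
    by (simp add: integral_continuous_zero \<phi>)
  then have "(LINT x:torus_cube|lebesgue. f x * of_real (indicator C (circle_embed x))) = 0"
    using LIMSEQ_unique tendsto_const by blast
  moreover have "complex_of_real (indicator C y) = indicator C y" for y by (simp add: indicator_def)
  ultimately show ?thesis by simp
qed

text \<open>The embedding glues opposite faces of the cube. If one of the two points is interior,
  the coordinates differ by less than 2 pi, so the only possible multiple of 2 pi is 0.\<close>

lemma circle_embed_inj:
  fixes x y :: "real ^ 'n"
  assumes x: "x \<in> torus_cube" and y: "y \<in> box 0 (\<chi> i. 2 * pi)" and eq: "circle_embed x = circle_embed y"
  shows "x = y"
proof (rule vec_eq_iff[THEN iffD2], rule allI)
  fix i
  have "cos (x $ i) = cos (y $ i)" "sin (x $ i) = sin (y $ i)"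
    using eq by (simp_all add: circle_embed_def vec_eq_iff)
  then have "cos (x $ i - y $ i) = (cos (y $ i))\<^sup>2 + (sin (y $ i))\<^sup>2" by (simp add: cos_diff power2_eq_square)
  then have "cos (x $ i - y $ i) = 1" by simp
  then obtain n :: int where n: "x $ i - y $ i = n * 2 * pi" using cos_one_2pi_int by auto
  have b: "0 \<le> x $ i" "x $ i \<le> 2 * pi" "0 < y $ i" "y $ i < 2 * pi"
    using x y by (auto simp: torus_cube_def mem_box_cart)
  have "\<bar>real_of_int n\<bar> * (2 * pi) < 1 * (2 * pi)"
  proof -
    have "\<bar>real_of_int n\<bar> * (2 * pi) = \<bar>x $ i - y $ i\<bar>" using n by (simp add: abs_mult)
    then show ?thesis using b by linarith
  qed
  then have "\<bar>real_of_int n\<bar> < 1" using pi_gt_zero by (subst (asm) mult_less_cancel_right) auto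
  then have "n = 0" by linarith
  then show "x $ i = y $ i" using n by simp
qed

lemma integral_compact_zero:
  fixes Z :: "(real ^ 'n) set"
  assumes Z: "compact Z" "Z \<noteq> {}" "Z \<subseteq> box 0 (\<chi> i. 2 * pi)"
  shows "(LINT x:Z|lebesgue. f x) = 0"
proof -
  have "box 0 (\<chi> i. 2 * pi) \<subseteq> (torus_cube :: (real ^ 'n) set)" unfolding torus_cube_def by (rule box_subset_cbox)
  then have Zt: "Z \<subseteq> torus_cube" using Z by auto
  have "indicator torus_cube x *\<^sub>R (f x * indicator (circle_embed ` Z) (circle_embed x)) = indicator Z x *\<^sub>R f x" for x
  proof (cases "x \<in> torus_cube")
    case True
    then have "circle_embed x \<in> circle_embed ` Z \<longleftrightarrow> x \<in> Z"
      using circle_embed_inj[OF True] Z(3) by blast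
    then show ?thesis using True by (simp add: indicator_def)
  next
    case False
    then show ?thesis using Zt by (auto simp: indicator_def)
  qed
  then show ?thesis
    using integral_closed_zero[of "circle_embed ` Z"] Z compact_imp_closed[OF compact_continuous_image[OF continuous_on_circle_embed Z(1)]]
    unfolding set_lebesgue_integral_def by simp
qed

text \<open>Inner regularity: over a closed subset \<open>Z\<close> of the positivity set the
  integral of \<open>f\<close> vanishes by \<open>integral_compact_zero\<close>, so the positive
  function \<open>h (f x)\<close> integrates to 0 and \<open>Z\<close> is null. With
  \<open>h\<close> running through plus and minus the real and imaginary parts, \<open>f\<close>
  vanishes almost everywhere.\<close>

lemma positive_part_negligible:
  assumes h: "bounded_linear (h :: complex \<Rightarrow> real)"
  shows "negligible {x \<in> torus_cube. h (f x) > 0}"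
proof -
  define B :: "(real ^ 'n) set" where "B = box 0 (\<chi> i. 2 * pi)"
  have Bt: "B \<subseteq> torus_cube" unfolding B_def torus_cube_def by (rule box_subset_cbox)
  have B: "B \<in> sets lebesgue" unfolding B_def by simp
  have fB: "set_integrable lebesgue B f" by (rule set_integrable_subset[OF f B Bt])
  then have mB: "(\<lambda>x. indicator B x *\<^sub>R f x) \<in> borel_measurable lebesgue" by (simp add: set_integrable_def)
  have hm: "h \<in> borel_measurable borel"
    by (intro borel_measurable_continuous_onI linear_continuous_on h)
  define S where "S = {x \<in> B. h (f x) > 0}"
  have S_alt: "S = {x \<in> space lebesgue. h (indicator B x *\<^sub>R f x) > 0}"
    using linear_0[OF bounded_linear.linear[OF h]] by (auto simp: S_def indicator_def)
  have S: "S \<in> sets lebesgue" unfolding S_alt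
    using measurable_compose[OF mB hm] by measurable
  have Sl: "S \<in> lmeasurable"
    by (rule bounded_set_imp_lmeasurable[OF _ S]) (rule bounded_subset[OF bounded_box[of 0 "\<chi> i. 2 * pi"]], auto simp: S_def B_def)
  have "measure lebesgue S \<le> e" if e: "e > 0" for e
  proof -
    obtain Z where Z: "closed Z" "Z \<subseteq> S" "S - Z \<in> lmeasurable" and "emeasure lebesgue (S - Z) < ennreal e"
      by (rule sets_lebesgue_inner_closed[OF S e])
    then have Ze: "measure lebesgue (S - Z) < e"
      by (simp add: emeasure_eq_measure2 ennreal_less_iff)
    have "bounded Z"
      using Z(2) by (rule bounded_subset[rotated]) (rule bounded_subset[OF bounded_box[of 0 "\<chi> i. 2 * pi"]], auto simp: S_def B_def)
    then have cZ: "compact Z" using Z(1) by (simp add: compact_eq_bounded_closed)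
    have Zl: "Z \<in> lmeasurable" by (rule lmeasurable_compact[OF cZ])
    have "Z \<in> null_sets lebesgue"
    proof (cases "Z = {}")
      case False
      have fZ: "set_integrable lebesgue Z f"
        by (rule set_integrable_subset[OF fB]) (use Zl Z S_def in auto)
      have hz: "h 0 = 0" using linear_0[OF bounded_linear.linear[OF h]] .
      have "(LINT x|lebesgue. h (indicator Z x *\<^sub>R f x)) = h (LINT x|lebesgue. indicator Z x *\<^sub>R f x)"
        using fZ by (intro integral_bounded_linear h) (simp add: set_integrable_def)
      also have "\<dots> = 0"
      proof -
        have "Z \<subseteq> box 0 (\<chi> i. 2 * pi)" using Z(2) by (auto simp: S_def B_def)
        from integral_compact_zero[OF cZ False this] show ?thesis by (simp add: set_lebesgue_integral_def hz)
      qed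
      finally have "(LINT x|lebesgue. h (indicator Z x *\<^sub>R f x)) = 0" .
      moreover have "integrable lebesgue (\<lambda>x. h (indicator Z x *\<^sub>R f x))"
        using fZ by (intro integrable_bounded_linear[OF h]) (simp add: set_integrable_def)
      moreover have "h (indicator Z x *\<^sub>R f x) \<ge> 0" for x
        using Z(2) hz by (auto simp: indicator_def S_def)
      ultimately have "AE x in lebesgue. h (indicator Z x *\<^sub>R f x) = 0"
        by (subst (asm) integral_nonneg_eq_0_iff_AE) auto
      then have "AE x in lebesgue. x \<notin> Z"
        by eventually_elim (use Z(2) in \<open>auto simp: indicator_def S_def split: if_splits\<close>)
      then show ?thesis using Zl by (subst AE_iff_null_sets) auto
    qed auto
    then have "measure lebesgue S = measure lebesgue (S - Z)"
      using S by (simp add: measure_Diff_null_set)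
    then show ?thesis using Ze by simp
  qed
  then have "measure lebesgue S \<le> 0" by (rule field_le_epsilon[of _ 0, simplified])
  then have "negligible S" using Sl negligible_iff_measure measure_nonneg by (metis antisym)
  moreover have "negligible (torus_cube - B)" unfolding torus_cube_def B_def by (rule negligible_frontier_interval)
  ultimately have "negligible (S \<union> (torus_cube - B))" by (rule negligible_Un)
  then show ?thesis by (rule negligible_subset) (auto simp: S_def)
qed

lemma fourier_uniqueness: "negligible {x \<in> torus_cube. f x \<noteq> 0}"
proof (rule negligible_subset)
  show "negligible ({x \<in> torus_cube. Re (f x) > 0} \<union> {x \<in> torus_cube. - Re (f x) > 0}
      \<union> ({x \<in> torus_cube. Im (f x) > 0} \<union> {x \<in> torus_cube. - Im (f x) > 0}))"
    by (intro negligible_Un positive_part_negligible bounded_linear_Re bounded_linear_Im bounded_linear_minus)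
qed (auto simp: complex_eq_iff)

end

section \<open>Periodic functions almost everywhere, and the dictionary between representatives and
  sequences\<close>

lemma torus_periodic_lattice:
  assumes "torus_periodic f"
  shows "f (x + (2 * pi) *\<^sub>R freq k) = f x"
proof -
  have nat: "f (x + axis i (2 * pi * real n)) = f x" for x i n
  proof (induction n arbitrary: x)
    case 0
    then show ?case by (simp add: axis_eq_0_iff[THEN iffD2])
  next
    case (Suc n)
    have "x + axis i (2 * pi * real (Suc n)) = (x + axis i (2 * pi * real n)) + axis i (2 * pi)"
      by (simp add: vec_eq_iff axis_def algebra_simps)
    then show ?case using assms Suc unfolding torus_periodic_def by metis
  qed
  have int: "f (x + axis i (2 * pi * real_of_int n)) = f x" for x i n
  proof (cases n)
    case (nonneg m)
    then show ?thesis using nat by simp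
  next
    case (neg m)
    have "(x + axis i (2 * pi * real_of_int n)) + axis i (2 * pi * real (Suc m)) = x"
    proof -
      have "2 * pi * real_of_int n + 2 * pi * real (Suc m) = 0"
        unfolding neg by (simp add: algebra_simps)
      then show ?thesis by (auto simp: vec_eq_iff axis_def add.assoc)
    qed
    then show ?thesis using nat[of "x + axis i (2 * pi * real_of_int n)" i "Suc m"] by metis
  qed
  have "f (x + (\<Sum>i\<in>A. axis i (2 * pi * real_of_int (k $ i)))) = f x" if "finite A" for A x
    using that
  proof (induction A arbitrary: x rule: finite_induct)
    case (insert i A)
    then show ?case using insert.IH[of "x + axis i (2 * pi * real_of_int (k $ i))"] int by (simp add: add.assoc)
  qed simp
  moreover have "(\<Sum>i\<in>UNIV. axis i (2 * pi * real_of_int (k $ i))) = (2 * pi) *\<^sub>R freq k"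
    by (simp add: vec_eq_iff axis_def if_distrib cong: if_cong)
  ultimately show ?thesis using finite by metis
qed

text \<open>The exceptional set is covered by countably many lattice translates of its part in the
  cube; rounding each coordinate down finds the translate.\<close>

lemma AE_torus_periodic:
  fixes P :: "real ^ 'n \<Rightarrow> bool"
  assumes P: "torus_periodic P" and neg: "negligible {x \<in> torus_cube. \<not> P x}"
  shows "AE x in lebesgue. P x"
proof -
  define N where "N = (\<Union>k. (\<lambda>x. (2 * pi) *\<^sub>R freq k + x) ` {x \<in> torus_cube. \<not> P x})"
  have "negligible N" unfolding N_def
    by (intro negligible_countable_Union countable_image countableI_type) (use neg negligible_translation in auto)
  moreover have "{x. \<not> P x} \<subseteq> N"
  proof
    fix x assume x: "x \<in> {x. \<not> P x}"
    define k :: "int ^ 'n" where "k = (\<chi> i. \<lfloor>x $ i / (2 * pi)\<rfloor>)"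
    define y where "y = x + (2 * pi) *\<^sub>R freq (- k)"
    have "\<not> P y" using x torus_periodic_lattice[OF P] by (simp add: y_def)
    moreover have "0 \<le> y $ i \<and> y $ i \<le> 2 * pi" for i
    proof -
      have "of_int \<lfloor>x $ i / (2 * pi)\<rfloor> \<le> x $ i / (2 * pi)" "x $ i / (2 * pi) \<le> of_int \<lfloor>x $ i / (2 * pi)\<rfloor> + 1"
        by linarith+
      then have "of_int \<lfloor>x $ i / (2 * pi)\<rfloor> * (2 * pi) \<le> x $ i" "x $ i \<le> (of_int \<lfloor>x $ i / (2 * pi)\<rfloor> + 1) * (2 * pi)"
        using pi_gt_zero by (simp_all only: pos_le_divide_eq pos_divide_le_eq mult_2 add_pos_pos)
      then show ?thesis by (simp add: y_def k_def algebra_simps)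
    qed
    then have "y \<in> torus_cube" by (simp add: torus_cube_def mem_box_cart)
    moreover have "x = (2 * pi) *\<^sub>R freq k + y" by (simp add: y_def freq_minus)
    ultimately show "x \<in> N" by (auto simp: N_def)
  qed
  ultimately show ?thesis by (intro AE_I'[of N]) (auto simp: negligible_iff_null_sets)
qed

lemma fourier_coeff_cong_AE:
  fixes f g :: "real ^ 'n \<Rightarrow> complex"
  assumes "f \<in> borel_measurable lebesgue" "g \<in> borel_measurable lebesgue" "AE x in lebesgue. f x = g x"
  shows "fourier_coeff f k = fourier_coeff g k"
proof -
  have m: "echar (- k) \<in> borel_measurable lebesgue"
    by (intro continuous_imp_measurable_lebesgue continuous_on_echar)
  have "(LINT x:torus_cube|lebesgue. f x * echar (- k) x) = (LINT x:torus_cube|lebesgue. g x * echar (- k) x)"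
    unfolding set_lebesgue_integral_def
  proof (rule integral_cong_AE)
    have t: "torus_cube \<in> sets lebesgue" by (simp add: torus_cube_def)
    show "(\<lambda>x. indicator torus_cube x *\<^sub>R (f x * echar (- k) x)) \<in> borel_measurable lebesgue"
      "(\<lambda>x. indicator torus_cube x *\<^sub>R (g x * echar (- k) x)) \<in> borel_measurable lebesgue"
      using t by (intro borel_measurable_scaleR borel_measurable_times borel_measurable_indicator assms m; simp)+
    show "AE x in lebesgue. indicator torus_cube x *\<^sub>R (f x * echar (- k) x) = indicator torus_cube x *\<^sub>R (g x * echar (- k) x)"
      using assms(3) by eventually_elim simp
  qed
  then show ?thesis by (simp add: fourier_coeff_alt)
qed

lemma torus_L2_set_integrable:
  assumes "f \<in> torus_L2"
  shows "set_integrable lebesgue torus_cube f"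
proof -
  have t: "(torus_cube :: (real ^ 'n) set) \<in> lmeasurable" by (simp add: torus_cube_def)
  then have "integrable lebesgue (\<lambda>x. indicator torus_cube x *\<^sub>R (1::real))"
    by (simp add: integrable_indicator_iff fmeasurable_def)
  then have i: "integrable lebesgue (\<lambda>x. indicator torus_cube x *\<^sub>R (1::real) + indicator torus_cube x *\<^sub>R (cmod (f x))\<^sup>2)"
    using assms by (intro Bochner_Integration.integrable_add) (auto simp: torus_L2_def set_integrable_def)
  show ?thesis unfolding set_integrable_def
  proof (rule Bochner_Integration.integrable_bound[OF i])
    show "(\<lambda>x. indicator torus_cube x *\<^sub>R f x) \<in> borel_measurable lebesgue"
      using assms t by (auto simp: torus_L2_def fmeasurable_def intro!: borel_measurable_scaleR borel_measurable_indicator)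
    have "cmod (f x) \<le> 1 + (cmod (f x))\<^sup>2" for x
      using sum_squares_bound[of "cmod (f x)" 1] by (simp add: power2_eq_square) (smt (verit) norm_ge_zero)
    then show "AE x in lebesgue. norm (indicator torus_cube x *\<^sub>R f x)
        \<le> norm (indicator torus_cube x *\<^sub>R (1::real) + indicator torus_cube x *\<^sub>R (cmod (f x))\<^sup>2)"
      by (intro always_eventually allI) (auto simp: indicator_def)
  qed
qed

context sobolev
begin

text \<open>On \<open>Hs s\<close> this inverts \<open>ev\<close> up to equality almost everywhere;
  outside, the value is arbitrary.\<close>

definition emb :: "(real ^ 'n \<Rightarrow> complex) \<Rightarrow> (int ^ 'n) ell2" where
  "emb f = Abs_ell2 (\<lambda>k. of_real (wt k) * fourier_coeff f k)"

lemma Hs_term_wt: "Hs_term s f k = (cmod (of_real (wt k) * fourier_coeff f k))\<^sup>2"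
  by (simp add: Hs_term_def norm_mult power_mult_distrib wt_sq)

lemma coord_emb: "Hs_term s f summable_on UNIV \<Longrightarrow> coord (emb f) k = of_real (wt k) * fourier_coeff f k"
  unfolding emb_def by (subst coord_Abs_ell2) (simp_all add: Hs_term_wt[abs_def])

lemma Hs_norm_emb: "Hs_term s f summable_on UNIV \<Longrightarrow> Hs_norm s f = norm (emb f)"
  by (simp add: Hs_norm_def norm_ell2 coord_emb Hs_term_wt[abs_def])

text \<open>The difference of the two sides is integrable with vanishing Fourier
  coefficients.\<close>

lemma Hs_AE_ev:
  assumes "f \<in> Hs s"
  shows "AE x in lebesgue. f x = ev (emb f) x"
proof (rule AE_torus_periodic)
  have per: "torus_periodic f" and sm: "Hs_term s f summable_on UNIV" and L2: "f \<in> torus_L2"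
    using assms by (auto simp: Hs_def torus_L2_def)
  show "torus_periodic (\<lambda>x. f x = ev (emb f) x)"
    using per torus_periodic_ev[of "emb f"] by (auto simp: torus_periodic_def)
  have i: "set_integrable lebesgue torus_cube f" by (rule torus_L2_set_integrable[OF L2])
  have ie: "set_integrable lebesgue torus_cube (ev a)" for a
    by (intro set_integrable_torus_continuous continuous_on_ev)
  have m: "echar k \<in> borel_measurable lebesgue" for k :: "int ^ 'n"
    by (intro continuous_imp_measurable_lebesgue continuous_on_echar)
  have "negligible {x \<in> torus_cube. f x - ev (emb f) x \<noteq> 0}"
  proof (rule fourier_uniqueness)
    show "set_integrable lebesgue torus_cube (\<lambda>x. f x - ev (emb f) x)" by (intro set_integral_diff i ie)
    fix k
    have "fourier_coeff (\<lambda>x. f x - ev (emb f) x) k = fourier_coeff f k - fourier_coeff (ev (emb f)) k"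
      unfolding fourier_coeff_alt left_diff_distrib
      by (subst set_integral_diff(2)) (simp_all add: set_integrable_mult_bounded[OF _ m, of _ _ _ 1] i ie right_diff_distrib)
    then show "fourier_coeff (\<lambda>x. f x - ev (emb f) x) k = 0"
      by (simp add: fourier_coeff_ev fc_def coord_emb[OF sm])
  qed
  then show "negligible {x \<in> torus_cube. f x \<noteq> ev (emb f) x}" by simp
qed

text \<open>Converse of \<open>Hs_AE_ev\<close>: to place a function in H^s and to compute its
  coordinates it suffices to match it almost everywhere with some \<open>ev a\<close>. The forcing
  term and the final error are treated in this way.\<close>

lemma
  assumes per: "torus_periodic f" and m: "f \<in> borel_measurable lebesgue" and ae: "AE x in lebesgue. f x = ev a x"
  shows AE_ev_Hs: "f \<in> Hs s" and AE_ev_emb: "emb f = a"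
proof -
  have me: "ev a \<in> borel_measurable lebesgue" by (intro continuous_imp_measurable_lebesgue continuous_on_ev)
  have fc: "fourier_coeff f k = fc a k" for k
    using fourier_coeff_cong_AE[OF m me ae] fourier_coeff_ev by metis
  have t: "(torus_cube :: (real ^ 'n) set) \<in> sets lebesgue" by (simp add: torus_cube_def)
  have "set_integrable lebesgue torus_cube (\<lambda>x. (cmod (ev a x))\<^sup>2)"
    unfolding torus_cube_def by (intro absolutely_integrable_continuous continuous_intros continuous_on_ev)
  then have "set_integrable lebesgue torus_cube (\<lambda>x. (cmod (f x))\<^sup>2)"
    unfolding set_integrable_def
  proof (rule integrable_cong_AE_imp)
    show "(\<lambda>x. indicator torus_cube x *\<^sub>R (cmod (f x))\<^sup>2) \<in> borel_measurable lebesgue"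
      using m t by (intro borel_measurable_scaleR borel_measurable_indicator borel_measurable_power borel_measurable_norm) auto
    show "AE x in lebesgue. indicator torus_cube x *\<^sub>R (cmod (ev a x))\<^sup>2 = indicator torus_cube x *\<^sub>R (cmod (f x))\<^sup>2"
      using ae by eventually_elim simp
  qed
  then have "f \<in> torus_L2" using per m by (simp add: torus_L2_def)
  moreover have c: "of_real (wt k) * fourier_coeff f k = coord a k" for k by (simp add: fc fc_def)
  then have sm: "Hs_term s f summable_on UNIV" using coord_summable[of a] by (simp add: Hs_term_wt[abs_def])
  ultimately show "f \<in> Hs s" by (simp add: Hs_def)
  show "emb f = a" by (rule ell2_eqI) (simp add: coord_emb[OF sm] c)
qed

lemma ev_Hs: "ev a \<in> Hs s" and emb_ev [simp]: "emb (ev a) = a"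
proof -
  have m: "ev a \<in> borel_measurable lebesgue" by (intro continuous_imp_measurable_lebesgue continuous_on_ev)
  show "ev a \<in> Hs s" by (rule AE_ev_Hs[OF torus_periodic_ev m, of a]) simp
  show "emb (ev a) = a" by (rule AE_ev_emb[OF torus_periodic_ev m, of a]) simp
qed

lemma Hs_measurable: "f \<in> Hs s \<Longrightarrow> f \<in> borel_measurable lebesgue"
  and Hs_periodic: "f \<in> Hs s \<Longrightarrow> torus_periodic f"
  by (auto simp: Hs_def torus_L2_def)

end

section \<open>The complex Gaussian kernel\<close>

text \<open>A Gaussian with complex linear and quadratic coefficients. Its integrals are found from
  differential equations in these parameters, without contour shifts.\<close>

definition gexp :: "complex \<Rightarrow> complex \<Rightarrow> real \<Rightarrow> complex" where
  "gexp \<alpha> \<beta> y = exp (\<alpha> * of_real y - \<beta> * of_real (y\<^sup>2))"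

lemma norm_gexp_le: "m \<le> Re \<beta> \<Longrightarrow> cmod \<alpha> \<le> A \<Longrightarrow> cmod (gexp \<alpha> \<beta> y) \<le> exp (A * \<bar>y\<bar> - m * y\<^sup>2)"
proof -
  assume m: "m \<le> Re \<beta>" and A: "cmod \<alpha> \<le> A"
  have "Re \<alpha> * y \<le> \<bar>Re \<alpha>\<bar> * \<bar>y\<bar>" by (metis abs_ge_self abs_mult)
  also have "\<dots> \<le> A * \<bar>y\<bar>" using abs_Re_le_cmod[of \<alpha>] A by (intro mult_right_mono) auto
  finally have "Re \<alpha> * y - Re \<beta> * y\<^sup>2 \<le> A * \<bar>y\<bar> - m * y\<^sup>2"
    using m by (intro diff_mono mult_right_mono) auto
  then show ?thesis by (simp add: gexp_def)
qed

text \<open>The power costs a factor 2 e^|y|, and completing the square trades (C + 1) |y| for half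
  of the quadratic decay.\<close>

lemma gaussian_bound:
  fixes y C m :: real
  assumes m: "0 < m" and j: "j \<le> 2" and C: "0 \<le> C"
  shows "\<bar>y\<bar> ^ j * exp (C * \<bar>y\<bar> - m * y\<^sup>2) \<le> 2 * exp ((C + 1)\<^sup>2 / (2 * m)) * exp (- (m / 2) * y\<^sup>2)"
proof -
  have "\<bar>y\<bar> ^ j \<le> 2 * exp \<bar>y\<bar>"
  proof -
    have e: "1 + \<bar>y\<bar> + \<bar>y\<bar>\<^sup>2 / 2 \<le> exp \<bar>y\<bar>" by (rule exp_lower_Taylor_quadratic) simp
    consider "j = 0" | "j = 1" | "j = 2" using j by linarith
    then show ?thesis
    proof cases
      case 1
      have "1 \<le> exp \<bar>y\<bar>" by simp
      then have "1 \<le> 2 * exp \<bar>y\<bar>" by linarith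
      then show ?thesis unfolding 1 by (simp only: power_0)
    next
      case 2
      have "0 \<le> \<bar>y\<bar>\<^sup>2" by simp
      then show ?thesis using e 2 by (simp only: power_one_right)
    next
      case 3 then show ?thesis using e by simp
    qed
  qed
  then have "\<bar>y\<bar> ^ j * exp (C * \<bar>y\<bar> - m * y\<^sup>2) \<le> 2 * exp \<bar>y\<bar> * exp (C * \<bar>y\<bar> - m * y\<^sup>2)"
    by (intro mult_right_mono) auto
  also have "\<dots> = 2 * exp ((C + 1) * \<bar>y\<bar> - m * y\<^sup>2)"
    by (simp add: algebra_simps flip: exp_add)
  also have "\<dots> \<le> 2 * exp ((C + 1)\<^sup>2 / (2 * m) + - (m / 2) * y\<^sup>2)"
  proof -
    have "0 \<le> (m / 2) * (\<bar>y\<bar> - (C + 1) / m)\<^sup>2" using m by simp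
    also have "\<dots> = (m / 2) * y\<^sup>2 - (C + 1) * \<bar>y\<bar> + (C + 1)\<^sup>2 / (2 * m)"
      using m by (simp add: power2_eq_square field_simps)
    finally show ?thesis by (simp add: algebra_simps)
  qed
  also have "\<dots> = 2 * exp ((C + 1)\<^sup>2 / (2 * m)) * exp (- (m / 2) * y\<^sup>2)" by (simp only: exp_add mult.assoc)
  finally show ?thesis .
qed

lemma integrable_gaussian:
  assumes c: "c > 0"
  shows "integrable lborel (\<lambda>y::real. exp (- c * y\<^sup>2))"
proof -
  define \<sigma> where "\<sigma> = 1 / sqrt (2 * c)"
  have s: "\<sigma>\<^sup>2 = 1 / (2 * c)" using c by (simp add: \<sigma>_def power_divide)
  have "exp (- c * y\<^sup>2) = sqrt (2 * pi * \<sigma>\<^sup>2) * normal_density 0 \<sigma> y" for y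
    using c by (simp add: normal_density_def s)
  moreover have "\<sigma> > 0" using c by (simp add: \<sigma>_def)
  ultimately show ?thesis by (simp only:) (intro integrable_mult_right integrable_normal_density)
qed

lemma integrable_gaussian_moment:
  fixes C m :: real
  assumes "0 < m" "j \<le> 2" "0 \<le> C"
  shows "integrable lborel (\<lambda>y::real. \<bar>y\<bar> ^ j * exp (C * \<bar>y\<bar> - m * y\<^sup>2))"
proof (rule Bochner_Integration.integrable_bound)
  show "integrable lborel (\<lambda>y. 2 * exp ((C + 1)\<^sup>2 / (2 * m)) * exp (- (m / 2) * y\<^sup>2))"
    using assms by (intro integrable_mult_right integrable_gaussian) simp
  show "AE y in lborel. norm (\<bar>y\<bar> ^ j * exp (C * \<bar>y\<bar> - m * y\<^sup>2)) \<le> norm (2 * exp ((C + 1)\<^sup>2 / (2 * m)) * exp (- (m / 2) * y\<^sup>2))"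
    using gaussian_bound[OF assms] by (intro always_eventually allI) (simp add: abs_mult)
qed measurable

lemma continuous_on_gexp [continuous_intros]: "continuous_on A (gexp \<alpha> \<beta>)"
  unfolding gexp_def[abs_def] by (intro continuous_intros)

lemma measurable_gexp [measurable]: "gexp \<alpha> \<beta> \<in> borel_measurable borel"
  by (intro borel_measurable_continuous_onI continuous_on_gexp)

lemma integrable_gexp:
  assumes b: "0 < Re \<beta>" and j: "j \<le> 2"
  shows "integrable lborel (\<lambda>y. of_real y ^ j * gexp \<alpha> \<beta> y)"
proof (rule Bochner_Integration.integrable_bound)
  show "integrable lborel (\<lambda>y. \<bar>y\<bar> ^ j * exp (cmod \<alpha> * \<bar>y\<bar> - Re \<beta> * y\<^sup>2))"
    using assms by (intro integrable_gaussian_moment) auto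
  show "AE y in lborel. norm (of_real y ^ j * gexp \<alpha> \<beta> y) \<le> norm (\<bar>y\<bar> ^ j * exp (cmod \<alpha> * \<bar>y\<bar> - Re \<beta> * y\<^sup>2))"
    using norm_gexp_le[of "Re \<beta>" \<beta> \<alpha> "cmod \<alpha>"] by (intro always_eventually allI)
      (auto simp: norm_mult norm_power abs_mult power_abs intro!: mult_left_mono)
qed measurable

definition gint :: "nat \<Rightarrow> complex \<Rightarrow> complex \<Rightarrow> complex" where
  "gint j \<alpha> \<beta> = (LINT y|lborel. of_real y ^ j * gexp \<alpha> \<beta> y)"

lemma integral_derivative_zero:
  fixes F f :: "real \<Rightarrow> complex"
  assumes F: "\<And>y. (F has_vector_derivative f y) (at y)" and f: "continuous_on UNIV f" "integrable lborel f"
    and lim: "(F \<longlongrightarrow> 0) at_top" "(F \<longlongrightarrow> 0) at_bot"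
  shows "(LINT y|lborel. f y) = 0"
proof -
  have "(LBINT x=-\<infinity>..\<infinity>. f x) = 0 - 0"
  proof (rule interval_integral_FTC_integrable[where F = F])
    show "set_integrable lborel (einterval (-\<infinity>) \<infinity>) f"
      using f(2) by (simp add: set_integrable_def einterval_def)
    show "isCont f x" for x using f(1) by (simp add: continuous_on_eq_continuous_at)
    show "((F \<circ> real_of_ereal) \<longlongrightarrow> 0) (at_right (-\<infinity>))" "((F \<circ> real_of_ereal) \<longlongrightarrow> 0) (at_left \<infinity>)"
      using lim by (simp_all add: ereal_tendsto_simps)
  qed (use F in auto)
  then show ?thesis
    by (simp add: interval_lebesgue_integral_def set_lebesgue_integral_def einterval_def)
qed

lemma gexp_tendsto_zero:
  assumes b: "0 < Re \<beta>" and j: "j \<le> 2"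
  shows "((\<lambda>y. of_real y ^ j * gexp \<alpha> \<beta> y) \<longlongrightarrow> 0) at_top"
    and "((\<lambda>y. of_real y ^ j * gexp \<alpha> \<beta> y) \<longlongrightarrow> 0) at_bot"
proof -
  define c where "c = Re \<beta> / 2"
  define K where "K = 2 * exp ((cmod \<alpha> + 1)\<^sup>2 / (2 * Re \<beta>))"
  have c: "c > 0" using b by (simp add: c_def)
  have le: "norm (of_real y ^ j * gexp \<alpha> \<beta> y) \<le> K * exp (- c * y\<^sup>2)" for y
  proof -
    have "norm (of_real y ^ j * gexp \<alpha> \<beta> y) \<le> \<bar>y\<bar> ^ j * exp (cmod \<alpha> * \<bar>y\<bar> - Re \<beta> * y\<^sup>2)"
      unfolding norm_mult norm_power by (intro mult_mono norm_gexp_le) auto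
    also have "\<dots> \<le> K * exp (- c * y\<^sup>2)" unfolding K_def c_def by (rule gaussian_bound) (use assms in auto)
    finally show ?thesis .
  qed
  have "((\<lambda>y::real. K * exp (- c * y\<^sup>2)) \<longlongrightarrow> 0) at_top" "((\<lambda>y::real. K * exp (- c * y\<^sup>2)) \<longlongrightarrow> 0) at_bot"
    using c by real_asymp+
  note lims = this
  show "((\<lambda>y. of_real y ^ j * gexp \<alpha> \<beta> y) \<longlongrightarrow> 0) at_top"
    by (rule Lim_null_comparison[OF _ lims(1)]) (simp add: le[simplified])
  show "((\<lambda>y. of_real y ^ j * gexp \<alpha> \<beta> y) \<longlongrightarrow> 0) at_bot"
    by (rule Lim_null_comparison[OF _ lims(2)]) (simp add: le[simplified])
qed

lemma gexp_has_vector_derivative: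
  "(gexp \<alpha> \<beta> has_vector_derivative (\<alpha> - 2 * \<beta> * of_real y) * gexp \<alpha> \<beta> y) (at y)"
proof -
  have "((\<lambda>z. exp (\<alpha> * z - \<beta> * z\<^sup>2)) has_field_derivative (\<alpha> - 2 * \<beta> * of_real y) * exp (\<alpha> * of_real y - \<beta> * (of_real y)\<^sup>2)) (at (of_real y))"
    by (auto intro!: derivative_eq_intros)
  from has_vector_derivative_real_field[OF this] show ?thesis
    by (simp add: gexp_def[abs_def] mult.commute)
qed

text \<open>The derivatives of \<open>gexp\<close> and of y times \<open>gexp\<close> integrate to 0
  over the line.\<close>

lemma gint_ibp:
  assumes b: "0 < Re \<beta>"
  shows "\<alpha> * gint 0 \<alpha> \<beta> = 2 * \<beta> * gint 1 \<alpha> \<beta>"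
    and "gint 0 \<alpha> \<beta> + \<alpha> * gint 1 \<alpha> \<beta> = 2 * \<beta> * gint 2 \<alpha> \<beta>"
proof -
  note i = integrable_gexp[OF b]
  have i0: "integrable lborel (gexp \<alpha> \<beta>)" and i1: "integrable lborel (\<lambda>y. of_real y * gexp \<alpha> \<beta> y)"
    using i[of 0] i[of 1] by simp_all
  have "(LINT y|lborel. (\<alpha> - 2 * \<beta> * of_real y) * gexp \<alpha> \<beta> y) = 0"
  proof (rule integral_derivative_zero[OF gexp_has_vector_derivative])
    show "integrable lborel (\<lambda>y. (\<alpha> - 2 * \<beta> * of_real y) * gexp \<alpha> \<beta> y)"
      using Bochner_Integration.integrable_diff[OF integrable_mult_right[OF i0, of \<alpha>] integrable_mult_right[OF i1, of "2 * \<beta>"]]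
      by (simp add: algebra_simps)
  qed (use gexp_tendsto_zero[OF b, of 0] in \<open>auto intro!: continuous_intros\<close>)
  also have "(LINT y|lborel. (\<alpha> - 2 * \<beta> * of_real y) * gexp \<alpha> \<beta> y)
      = (LINT y|lborel. \<alpha> * gexp \<alpha> \<beta> y - 2 * \<beta> * (of_real y * gexp \<alpha> \<beta> y))" by (simp add: algebra_simps)
  also have "\<dots> = \<alpha> * gint 0 \<alpha> \<beta> - 2 * \<beta> * gint 1 \<alpha> \<beta>"
    using i0 i1 by (subst Bochner_Integration.integral_diff) (auto simp: gint_def)
  finally show "\<alpha> * gint 0 \<alpha> \<beta> = 2 * \<beta> * gint 1 \<alpha> \<beta>" by simp
  have "(LINT y|lborel. (\<alpha> - 2 * \<beta> * of_real y) * gexp \<alpha> \<beta> y * of_real y + gexp \<alpha> \<beta> y) = 0"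
  proof (rule integral_derivative_zero)
    have "((\<lambda>y. gexp \<alpha> \<beta> y * of_real y) has_vector_derivative
       gexp \<alpha> \<beta> y * of_real 1 + (\<alpha> - 2 * \<beta> * of_real y) * gexp \<alpha> \<beta> y * of_real y) (at y)" for y
      by (intro has_vector_derivative_mult gexp_has_vector_derivative has_vector_derivative_of_real) (auto intro: DERIV_ident)
    then show "((\<lambda>y. gexp \<alpha> \<beta> y * of_real y) has_vector_derivative
       (\<alpha> - 2 * \<beta> * of_real y) * gexp \<alpha> \<beta> y * of_real y + gexp \<alpha> \<beta> y) (at y)" for y
      by (simp add: add.commute)
    show "integrable lborel (\<lambda>y. (\<alpha> - 2 * \<beta> * of_real y) * gexp \<alpha> \<beta> y * of_real y + gexp \<alpha> \<beta> y)"
      using Bochner_Integration.integrable_add[OF i0 Bochner_Integration.integrable_diff[OF integrable_mult_right[OF i1, of \<alpha>]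
        integrable_mult_right[OF i[of 2], of "2 * \<beta>"]]]
      by (simp add: algebra_simps power2_eq_square)
  qed (use gexp_tendsto_zero[OF b, of 1] in \<open>auto intro!: continuous_intros simp: mult.commute\<close>)
  also have "(LINT y|lborel. (\<alpha> - 2 * \<beta> * of_real y) * gexp \<alpha> \<beta> y * of_real y + gexp \<alpha> \<beta> y)
      = (LINT y|lborel. gexp \<alpha> \<beta> y + (\<alpha> * (of_real y * gexp \<alpha> \<beta> y) - 2 * \<beta> * (of_real y ^ 2 * gexp \<alpha> \<beta> y)))"
    by (simp add: algebra_simps power2_eq_square)
  also have "\<dots> = gint 0 \<alpha> \<beta> + (\<alpha> * gint 1 \<alpha> \<beta> - 2 * \<beta> * gint 2 \<alpha> \<beta>)"
    using i0 i1 i[of 2] by (subst Bochner_Integration.integral_add Bochner_Integration.integral_diff; simp add: gint_def)+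
  finally show "gint 0 \<alpha> \<beta> + \<alpha> * gint 1 \<alpha> \<beta> = 2 * \<beta> * gint 2 \<alpha> \<beta>" by (simp add: algebra_simps)
qed

text \<open>Differentiation under the integral along a line in the parameters. The convexity of
  \<open>S\<close> lets the mean value inequality bound the difference quotients by the same
  \<open>h\<close> that bounds the derivative.\<close>

lemma gint_has_field_derivative:
  fixes S :: "complex set"
  assumes S: "convex S" "t \<in> S" and m: "0 < m"
    and b: "\<And>t. t \<in> S \<Longrightarrow> m \<le> Re (b0 + t * b1)" and A: "\<And>t. t \<in> S \<Longrightarrow> cmod (t * w) \<le> A"
  shows "((\<lambda>t. gint 0 (t * w) (b0 + t * b1)) has_field_derivative
      w * gint 1 (t * w) (b0 + t * b1) - b1 * gint 2 (t * w) (b0 + t * b1)) (at t within S)"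
proof -
  define E where "E t y = gexp (t * w) (b0 + t * b1) y" for t y
  define D where "D t y = w * (of_real y * E t y) - b1 * (of_real y ^ 2 * E t y)" for t y
  define h where "h y = cmod w * (\<bar>y\<bar> ^ 1 * exp (A * \<bar>y\<bar> - m * y\<^sup>2)) + cmod b1 * (\<bar>y\<bar> ^ 2 * exp (A * \<bar>y\<bar> - m * y\<^sup>2))" for y :: real
  have A0: "0 \<le> A" using A[OF S(2)] norm_ge_zero order_trans by blast
  have bp: "0 < Re (b0 + t * b1)" if "t \<in> S" for t using b[OF that] m by linarith
  have deriv: "((\<lambda>t. E t y) has_field_derivative D t y) (at t within S)" for t y
    unfolding E_def gexp_def D_def by (auto intro!: derivative_eq_intros simp: algebra_simps power2_eq_square)
  have Dh: "cmod (D t y) \<le> h y" if "t \<in> S" for t y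
  proof -
    have E: "cmod (E t y) \<le> exp (A * \<bar>y\<bar> - m * y\<^sup>2)" unfolding E_def by (rule norm_gexp_le[OF b[OF that] A[OF that]])
    have "cmod (D t y) \<le> cmod (w * (of_real y * E t y)) + cmod (b1 * (of_real y ^ 2 * E t y))"
      unfolding D_def by (rule norm_triangle_ineq4)
    also have "\<dots> = cmod w * (\<bar>y\<bar> ^ 1 * cmod (E t y)) + cmod b1 * (\<bar>y\<bar> ^ 2 * cmod (E t y))"
      by (simp add: norm_mult norm_power)
    also have "\<dots> \<le> h y" unfolding h_def by (intro add_mono mult_left_mono E) auto
    finally show ?thesis .
  qed
  have ih: "integrable lborel h" unfolding h_def
    by (intro Bochner_Integration.integrable_add integrable_mult_right integrable_gaussian_moment m A0) auto
  have iE: "integrable lborel (\<lambda>y. of_real y ^ j * E t y)" if "t \<in> S" "j \<le> 2" for t j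
    unfolding E_def by (rule integrable_gexp[OF bp[OF that(1)] that(2)])
  have iE0: "integrable lborel (E t)" if "t \<in> S" for t using iE[OF that, of 0] by simp
  have F: "gint 0 (t * w) (b0 + t * b1) = (LINT y|lborel. E t y)" for t by (simp add: gint_def E_def)
  have G: "(LINT y|lborel. D t y) = w * gint 1 (t * w) (b0 + t * b1) - b1 * gint 2 (t * w) (b0 + t * b1)"
    unfolding D_def gint_def E_def[symmetric]
    using iE[OF S(2), of 1] iE[OF S(2), of 2] by (subst Bochner_Integration.integral_diff) auto
  have mE: "E t \<in> borel_measurable borel" for t unfolding E_def by measurable
  have mD: "D t \<in> borel_measurable borel" for t unfolding D_def using mE by measurable
  have "((\<lambda>z. ((LINT y|lborel. E z y) - (LINT y|lborel. E t y)) / (z - t)) \<longlongrightarrow> (LINT y|lborel. D t y)) (at t within S)"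
    unfolding tendsto_at_iff_sequentially
  proof (intro allI impI)
    fix X assume X: "\<forall>i. X i \<in> S - {t}" "X \<longlonglongrightarrow> t"
    have "(\<lambda>i. LINT y|lborel. (E (X i) y - E t y) / (X i - t)) \<longlonglongrightarrow> (LINT y|lborel. D t y)"
    proof (rule integral_dominated_convergence[OF _ _ ih])
      show "AE y in lborel. (\<lambda>i. (E (X i) y - E t y) / (X i - t)) \<longlonglongrightarrow> D t y"
      proof (intro always_eventually allI)
        fix y
        have "((\<lambda>z. (E z y - E t y) / (z - t)) \<longlongrightarrow> D t y) (at t within S)"
          using deriv[where y = y and t = t] by (simp add: has_field_derivative_iff)
        then show "(\<lambda>i. (E (X i) y - E t y) / (X i - t)) \<longlonglongrightarrow> D t y"
          using X unfolding tendsto_at_iff_sequentially by (auto simp: o_def)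
      qed
      show "AE y in lborel. norm ((E (X i) y - E t y) / (X i - t)) \<le> h y" for i
      proof (intro always_eventually allI)
        fix y
        have "cmod (E (X i) y - E t y) \<le> h y * cmod (X i - t)"
          by (rule field_differentiable_bound[OF S(1) deriv Dh]) (use X S in auto)
        then show "norm ((E (X i) y - E t y) / (X i - t)) \<le> h y"
          using X by (auto simp: norm_divide divide_le_eq)
      qed
    qed (use mE mD in measurable)
    moreover have "(LINT y|lborel. (E (X i) y - E t y) / (X i - t)) = ((LINT y|lborel. E (X i) y) - (LINT y|lborel. E t y)) / (X i - t)" for i
      using Bochner_Integration.integral_diff[OF iE0[of "X i"] iE0[OF S(2)]] X by (simp only: integral_divide_zero) auto
    ultimately show "((\<lambda>z. ((LINT y|lborel. E z y) - (LINT y|lborel. E t y)) / (z - t)) \<circ> X) \<longlonglongrightarrow> (LINT y|lborel. D t y)"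
      by (simp only: o_def)
  qed
  then show ?thesis unfolding has_field_derivative_iff F G .
qed

lemma gint_0_1: "gint 0 0 1 \<noteq> 0"
proof -
  have "gint 0 0 1 = (LINT y|lborel. complex_of_real (exp (- (1::real) * y\<^sup>2)))"
    by (simp add: gint_def gexp_def exp_of_real[symmetric])
  also have "\<dots> = of_real (LINT y|lborel. exp (- (1::real) * y\<^sup>2))" by (rule integral_complex_of_real)
  finally have g: "gint 0 0 1 = of_real (LINT y|lborel. exp (- (1::real) * y\<^sup>2))" .
  have "(LINT y|lborel. exp (- (1::real) * y\<^sup>2)) \<noteq> 0"
  proof
    assume "(LINT y|lborel. exp (- (1::real) * y\<^sup>2)) = 0"
    then have "AE y in lborel. exp (- (1::real) * y\<^sup>2) = 0"
      using integral_nonneg_eq_0_iff_AE[OF integrable_gaussian[of 1]] by simp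
    then have "AE y in (lborel :: real measure). False" by simp
    then have "emeasure lborel (UNIV :: real set) = 0" by (simp add: AE_iff_measurable[OF _ refl])
    then show False by simp
  qed
  then show ?thesis by (simp only: g of_real_eq_0_iff not_False_eq_True)
qed

lemma closed_segment_01_cases: "t \<in> closed_segment 0 (1::complex) \<Longrightarrow> \<exists>r\<in>{0..1}. t = of_real r"
  by (auto simp: closed_segment_def scaleR_conv_of_real)

text \<open>Along the segment from 1 to b the product of \<beta> and the square of
  \<open>gint 0 0 \<beta>\<close> is constant, by the second integration by parts. Squaring avoids a
  choice of complex root; the value itself is never computed, as the kernel is normalised by
  division.\<close>

lemma gint_nonzero:
  assumes b: "0 < Re b"
  shows "gint 0 0 b \<noteq> 0"
proof -
  let ?S = "closed_segment 0 (1::complex)"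
  define \<beta> where "\<beta> t = 1 + t * (b - 1)" for t
  define m where "m = min 1 (Re b)"
  have m: "0 < m" using b by (simp add: m_def)
  have \<beta>: "m \<le> Re (\<beta> t)" if "t \<in> ?S" for t
  proof -
    from closed_segment_01_cases[OF that] obtain r where r: "r \<in> {0..1}" "t = of_real r" by blast
    have "(1 - r) * m \<le> (1 - r) * 1" "r * m \<le> r * Re b"
      by (rule mult_left_mono; use r in \<open>simp add: m_def\<close>)+
    then show ?thesis using r by (simp add: \<beta>_def algebra_simps)
  qed
  have zero: "((\<lambda>t. \<beta> t * (gint 0 0 (\<beta> t))\<^sup>2) has_field_derivative 0) (at t within ?S)" if t: "t \<in> ?S" for t
  proof -
    have d: "((\<lambda>t. gint 0 0 (\<beta> t)) has_field_derivative (1 - b) * gint 2 0 (\<beta> t)) (at t within ?S)"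
    proof -
      have "((\<lambda>t. gint 0 (t * 0) (1 + t * (b - 1))) has_field_derivative
          0 * gint 1 (t * 0) (1 + t * (b - 1)) - (b - 1) * gint 2 (t * 0) (1 + t * (b - 1))) (at t within ?S)"
        by (rule gint_has_field_derivative[OF convex_closed_segment t m, of 1 "b - 1" 0 0]) (use \<beta> in \<open>simp_all only: \<beta>_def, simp_all\<close>)
      from DERIV_cong[OF this, of "(1 - b) * gint 2 0 (\<beta> t)"] show ?thesis
        by (simp add: \<beta>_def algebra_simps)
    qed
    have d\<beta>: "(\<beta> has_field_derivative (b - 1)) (at t within ?S)"
      unfolding \<beta>_def[abs_def] by (auto intro!: derivative_eq_intros)
    from DERIV_mult[OF d\<beta> DERIV_power[OF d, of 2]]
    show ?thesis
    proof (rule DERIV_cong)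
      have "gint 0 0 (\<beta> t) = 2 * \<beta> t * gint 2 0 (\<beta> t)"
        using gint_ibp(2)[of "\<beta> t" 0] \<beta>[OF t] m by simp
      then have "(b - 1) * gint 0 0 (\<beta> t) * (gint 0 0 (\<beta> t) - 2 * \<beta> t * gint 2 0 (\<beta> t)) = 0" by simp
      then show "(b - 1) * (gint 0 0 (\<beta> t))\<^sup>2 + of_nat 2 * ((1 - b) * gint 2 0 (\<beta> t) * gint 0 0 (\<beta> t) ^ (2 - Suc 0)) * \<beta> t = 0"
        by (simp add: power2_eq_square algebra_simps)
    qed
  qed
  from has_field_derivative_zero_constant[OF convex_closed_segment zero]
  obtain c where c: "\<And>t. t \<in> ?S \<Longrightarrow> \<beta> t * (gint 0 0 (\<beta> t))\<^sup>2 = c" by blast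
  have "b * (gint 0 0 b)\<^sup>2 = 1 * (gint 0 0 1)\<^sup>2"
    using c[of 0] c[of 1] by (simp add: \<beta>_def)
  then show ?thesis using gint_0_1 by auto
qed

text \<open>Replaces completing the square with a complex shift: \<open>gint 0 (t * w) b\<close>
  times exp(-(t w)^2 / (4 b)) has zero derivative in t by the first integration by parts.\<close>

lemma gint_exp:
  assumes b: "0 < Re b"
  shows "gint 0 w b = gint 0 0 b * exp (w\<^sup>2 / (4 * b))"
proof -
  let ?S = "closed_segment 0 (1::complex)"
  have b0: "b \<noteq> 0" using b by auto
  have zero: "((\<lambda>t. gint 0 (t * w) b * exp (- ((t * w)\<^sup>2 / (4 * b)))) has_field_derivative 0) (at t within ?S)" if t: "t \<in> ?S" for t
  proof -
    have A: "cmod (t * w) \<le> cmod w" if "t \<in> ?S" for t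
      using closed_segment_01_cases[OF that] by (auto simp: norm_mult mult_left_le_one_le)
    have d: "((\<lambda>t. gint 0 (t * w) b) has_field_derivative w * gint 1 (t * w) b) (at t within ?S)"
      using gint_has_field_derivative[OF convex_closed_segment t b, of b 0 w "cmod w"] A by simp
    have g1: "w * gint 1 (t * w) b = (2 * t * w\<^sup>2 / (4 * b)) * gint 0 (t * w) b"
    proof -
      have "(2 * t * w\<^sup>2 / (4 * b)) * gint 0 (t * w) b = w * (t * w * gint 0 (t * w) b) / (2 * b)"
        using b0 by (simp add: power2_eq_square)
      also have "\<dots> = w * (2 * b * gint 1 (t * w) b) / (2 * b)" by (simp only: gint_ibp(1)[OF b])
      also have "\<dots> = w * gint 1 (t * w) b" using b0 by simp
      finally show ?thesis by simp
    qed
    have "((\<lambda>t. exp (- ((t * w)\<^sup>2 / (4 * b)))) has_field_derivative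
        exp (- ((t * w)\<^sup>2 / (4 * b))) * - (2 * t * w\<^sup>2 / (4 * b))) (at t within ?S)"
    proof (rule DERIV_chain2[OF DERIV_exp])
      have "((\<lambda>t. - (t\<^sup>2 * c)) has_field_derivative - (2 * t * c)) (at t within ?S)" for c
        by (auto intro!: derivative_eq_intros)
      from this[of "w\<^sup>2 / (4 * b)"] show "((\<lambda>t. - ((t * w)\<^sup>2 / (4 * b))) has_field_derivative - (2 * t * w\<^sup>2 / (4 * b))) (at t within ?S)"
        by (simp add: power_mult_distrib)
    qed
    from DERIV_mult[OF d this] show ?thesis
      by (rule DERIV_cong) (simp only: g1, simp add: b0)
  qed
  from has_field_derivative_zero_constant[OF convex_closed_segment zero]
  obtain c where c: "\<And>t. t \<in> ?S \<Longrightarrow> gint 0 (t * w) b * exp (- ((t * w)\<^sup>2 / (4 * b))) = c" by blast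
  have "gint 0 w b * exp (- (w\<^sup>2 / (4 * b))) = gint 0 0 b"
    using c[of 0] c[of 1] by simp
  then have "gint 0 w b * exp (- (w\<^sup>2 / (4 * b))) * exp (w\<^sup>2 / (4 * b)) = gint 0 0 b * exp (w\<^sup>2 / (4 * b))" by simp
  then show ?thesis by (simp add: exp_minus field_simps)
qed

text \<open>Lebesgue measure on a Euclidean space is the image of the product measure over the
  basis.\<close>

lemma lborel_integral_prod:
  fixes f :: "'a::euclidean_space \<Rightarrow> real \<Rightarrow> complex"
  assumes f: "\<And>b. b \<in> Basis \<Longrightarrow> integrable lborel (f b)"
  shows "integrable lborel (\<lambda>x. \<Prod>b\<in>Basis. f b (x \<bullet> b))"
    and "(LINT x|lborel. (\<Prod>b\<in>Basis. f b (x \<bullet> b))) = (\<Prod>b\<in>Basis. (LINT y|lborel. f b y))"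
proof -
  interpret product_sigma_finite "\<lambda>_::'a. lborel :: real measure" by standard
  let ?T = "\<lambda>g. \<Sum>b\<in>Basis. g b *\<^sub>R (b :: 'a)"
  have T: "?T \<in> measurable (\<Pi>\<^sub>M b\<in>Basis. lborel) borel" by measurable
  have m: "(\<lambda>x. \<Prod>b\<in>Basis. f b (x \<bullet> b)) \<in> borel_measurable borel"
  proof (rule borel_measurable_prod)
    fix b :: 'a assume "b \<in> Basis"
    then have "f b \<in> borel_measurable borel" using borel_measurable_integrable[OF f] by simp
    then show "(\<lambda>x. f b (x \<bullet> b)) \<in> borel_measurable borel" by measurable
  qed
  have e: "(\<Prod>b\<in>Basis. f b (?T g \<bullet> b)) = (\<Prod>b\<in>Basis. f b (g b))" for g
    by (rule prod.cong) (auto simp: inner_sum_left_Basis)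
  show "integrable lborel (\<lambda>x. \<Prod>b\<in>Basis. f b (x \<bullet> b))"
    unfolding lborel_eq[where 'a='a]
    by (subst integrable_distr_eq[OF T m]) (simp only: e, rule product_integrable_prod, use f in auto)
  have "(LINT x|lborel. (\<Prod>b\<in>Basis. f b (x \<bullet> b))) = (LINT g|(\<Pi>\<^sub>M b\<in>Basis. lborel). (\<Prod>b\<in>Basis. f b (?T g \<bullet> b)))"
    unfolding lborel_eq[where 'a='a] by (rule integral_distr[OF T m])
  also have "\<dots> = (\<Prod>b\<in>Basis. (LINT y|lborel. f b y))"
    unfolding e by (rule product_integral_prod) (use f in auto)
  finally show "(LINT x|lborel. (\<Prod>b\<in>Basis. f b (x \<bullet> b))) = (\<Prod>b\<in>Basis. (LINT y|lborel. f b y))" .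
qed

text \<open>The density of \<open>exp (a \<Delta>)\<close> at time one; here \<open>\<beta> = 1 / (4 a)\<close>.\<close>

definition gker :: "complex \<Rightarrow> 'a::euclidean_space \<Rightarrow> complex" where
  "gker a y = (\<Prod>b\<in>Basis. gexp 0 (1 / (4 * a)) (y \<bullet> b) / gint 0 0 (1 / (4 * a)))"

lemma gker_measurable [measurable]: "gker a \<in> borel_measurable borel"
  unfolding gker_def[abs_def] by measurable

lemma Re_inverse_pos: "0 < Re a \<Longrightarrow> 0 < Re (1 / (4 * a))"
proof -
  assume a: "0 < Re a"
  then have "a \<noteq> 0" by auto
  then have "0 < (Re a)\<^sup>2 + (Im a)\<^sup>2" by (simp add: complex_neq_0)
  moreover have "1 / (4 * a) = inverse a / 4" by (simp add: field_simps)
  moreover have "Re (inverse a / 4) = Re a / ((Re a)\<^sup>2 + (Im a)\<^sup>2) / 4" by simp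
  ultimately show ?thesis using a by (simp only: divide_pos_pos zero_less_numeral)
qed

text \<open>The integral factorises over the coordinates. It is used twice: z = i recovers the
  Fourier multiplier of the heat semigroup, and z = \<open>Z\<close> with the gradient for
  \<open>v\<close> produces the limiting exponent.\<close>

lemma gker_laplace:
  fixes v :: "'a::euclidean_space"
  assumes a: "0 < Re a"
  shows "integrable lborel (\<lambda>y::'a. gker a y * exp (z * of_real (y \<bullet> v)))"
    and "(LINT y|lborel. gker a y * exp (z * of_real (y \<bullet> v))) = exp (a * z\<^sup>2 * of_real ((norm v)\<^sup>2))"
proof -
  let ?\<beta> = "1 / (4 * a)"
  have \<beta>: "0 < Re ?\<beta>" by (rule Re_inverse_pos[OF a])
  have a0: "a \<noteq> 0" using a by auto
  define f where "f b t = gexp (z * of_real (v \<bullet> b)) ?\<beta> t / gint 0 0 ?\<beta>" for b t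
  have i: "integrable lborel (f b)" for b
    unfolding f_def using integrable_gexp[OF \<beta>, of 0] by (intro integrable_divide_zero) simp
  have e: "gker a y * exp (z * of_real (y \<bullet> v)) = (\<Prod>b\<in>Basis. f b (y \<bullet> b))" for y
  proof -
    have "exp (z * of_real (y \<bullet> v)) = (\<Prod>b\<in>Basis. exp (z * of_real ((y \<bullet> b) * (v \<bullet> b))))"
      by (subst euclidean_inner) (simp add: exp_sum sum_distrib_left)
    then show ?thesis
      unfolding gker_def f_def
      by (simp add: gexp_def mult_ac flip: prod.distrib exp_add)
  qed
  show "integrable lborel (\<lambda>y::'a. gker a y * exp (z * of_real (y \<bullet> v)))"
    unfolding e by (rule lborel_integral_prod) (rule i)
  have "(LINT y|lborel. gker a y * exp (z * of_real (y \<bullet> v))) = (\<Prod>b\<in>Basis. (LINT t|lborel. f b t))"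
    unfolding e by (rule lborel_integral_prod) (rule i)
  also have "\<dots> = (\<Prod>b\<in>(Basis::'a set). exp (a * z\<^sup>2 * of_real ((v \<bullet> b)\<^sup>2)))"
  proof (rule prod.cong[OF refl])
    fix b :: 'a
    have "(LINT t|lborel. f b t) = gint 0 (z * of_real (v \<bullet> b)) ?\<beta> / gint 0 0 ?\<beta>"
      by (simp add: f_def gint_def)
    also have "\<dots> = exp ((z * of_real (v \<bullet> b))\<^sup>2 / (4 * ?\<beta>))"
      using gint_nonzero[OF \<beta>] by (subst gint_exp[OF \<beta>]) simp
    finally show "(LINT t|lborel. f b t) = exp (a * z\<^sup>2 * of_real ((v \<bullet> b)\<^sup>2))"
      using a0 by (simp add: power_mult_distrib mult_ac)
  qed
  also have "\<dots> = exp (a * z\<^sup>2 * of_real ((norm v)\<^sup>2))"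
  proof -
    have "(norm v)\<^sup>2 = (\<Sum>b\<in>Basis. (v \<bullet> b)\<^sup>2)"
      unfolding power2_norm_eq_inner by (subst euclidean_inner) (simp add: power2_eq_square)
    then show ?thesis by (simp add: sum_distrib_left exp_sum)
  qed
  finally show "(LINT y|lborel. gker a y * exp (z * of_real (y \<bullet> v))) = exp (a * z\<^sup>2 * of_real ((norm v)\<^sup>2))" .
qed

text \<open>Supplies the dominating function, since the conjugating factor grows at most like exp(C
  |y|). Bounding |y| by the sum of the absolute coordinates splits the exponential into a
  product.\<close>

lemma gker_exp_integrable:
  assumes a: "0 < Re a" and C: "0 \<le> C"
  shows "integrable lborel (\<lambda>y::'a::euclidean_space. cmod (gker a y) * exp (C * norm y))"
proof -
  let ?\<beta> = "1 / (4 * a)"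
  have \<beta>: "0 < Re ?\<beta>" by (rule Re_inverse_pos[OF a])
  define f where "f t = complex_of_real (cmod (gexp 0 ?\<beta> t / gint 0 0 ?\<beta>) * exp (C * \<bar>t\<bar>))" for t
  have "integrable lborel f"
  proof (rule Bochner_Integration.integrable_bound)
    show "integrable lborel (\<lambda>y. 1 / cmod (gint 0 0 ?\<beta>) * (\<bar>y\<bar> ^ 0 * exp (C * \<bar>y\<bar> - Re ?\<beta> * y\<^sup>2)))"
      using \<beta> C by (intro integrable_mult_right integrable_gaussian_moment) auto
    show "AE y in lborel. norm (f y) \<le> norm (1 / cmod (gint 0 0 ?\<beta>) * (\<bar>y\<bar> ^ 0 * exp (C * \<bar>y\<bar> - Re ?\<beta> * y\<^sup>2)))"
    proof (intro always_eventually allI)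
      fix y
      have "cmod (gexp 0 ?\<beta> y) \<le> exp (0 * \<bar>y\<bar> - Re ?\<beta> * y\<^sup>2)" by (rule norm_gexp_le) auto
      then have "cmod (gexp 0 ?\<beta> y) * exp (C * \<bar>y\<bar>) \<le> exp (- (Re ?\<beta> * y\<^sup>2)) * exp (C * \<bar>y\<bar>)"
        by (intro mult_right_mono) auto
      also have "\<dots> = exp (C * \<bar>y\<bar> - Re ?\<beta> * y\<^sup>2)" by (simp flip: exp_add)
      finally show "norm (f y) \<le> norm (1 / cmod (gint 0 0 ?\<beta>) * (\<bar>y\<bar> ^ 0 * exp (C * \<bar>y\<bar> - Re ?\<beta> * y\<^sup>2)))"
        by (simp add: f_def norm_mult norm_divide divide_right_mono del: Re_divide_numeral)
    qed
  qed (unfold f_def, measurable)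
  then have "integrable lborel (\<lambda>x::'a. \<Prod>b\<in>Basis. f (x \<bullet> b))" by (intro lborel_integral_prod)
  then show ?thesis
  proof (rule Bochner_Integration.integrable_bound)
    show "AE y in lborel. norm (cmod (gker a y) * exp (C * norm y)) \<le> norm (\<Prod>b\<in>Basis. f ((y::'a) \<bullet> b))"
    proof (intro always_eventually allI)
      fix y :: 'a
      have "exp (C * norm y) \<le> exp (C * (\<Sum>b\<in>Basis. \<bar>y \<bullet> b\<bar>))"
        using norm_le_l1[of y] C by (simp add: mult_left_mono)
      also have "\<dots> = (\<Prod>b\<in>Basis. exp (C * \<bar>y \<bullet> b\<bar>))" by (simp add: sum_distrib_left exp_sum)
      finally have "cmod (gker a y) * exp (C * norm y) \<le> cmod (gker a y) * (\<Prod>b\<in>Basis. exp (C * \<bar>y \<bullet> b\<bar>))"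
        by (intro mult_left_mono) auto
      also have "\<dots> = norm (\<Prod>b\<in>Basis. f (y \<bullet> b))"
        by (simp add: gker_def f_def prod_norm[symmetric] norm_mult prod.distrib)
      finally show "norm (cmod (gker a y) * exp (C * norm y)) \<le> norm (\<Prod>b\<in>Basis. f (y \<bullet> b))" by simp
    qed
  qed measurable
qed

section \<open>The semigroup on the Sobolev space\<close>

text \<open>The sequence space is a vector space over the reals only; multiplication by a complex
  number is therefore an operator.\<close>

definition cs :: "complex \<Rightarrow> 'a ell2 blinop" where
  "cs c = multiplier (\<lambda>_. c)"

lemma coord_cs [simp]: "coord (cs c \<triangleright> a) k = c * coord a k"
  unfolding cs_def by (rule coord_multiplier[of _ "cmod c"]) simp

lemma norm_cs_le: "norm (cs c) \<le> cmod c"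
  unfolding cs_def by (rule norm_multiplier_le) simp

lemma bounded_linear_cs: "bounded_linear cs"
  by (rule bounded_linear_intro[of _ 1]) (auto intro!: blinop_eqI ell2_eqI simp: norm_cs_le distrib_right)

definition translate :: "real ^ 'n \<Rightarrow> (int ^ 'n) ell2 blinop" where
  "translate h = multiplier (\<lambda>k. echar k h)"

lemma coord_translate [simp]: "coord (translate h \<triangleright> a) k = echar k h * coord a k"
  unfolding translate_def by (rule coord_multiplier[of _ 1]) simp

lemma norm_translate_le: "norm (translate h) \<le> 1"
  unfolding translate_def by (rule norm_multiplier_le) simp

lemma norm_translate_app_le: "norm (translate h \<triangleright> a) \<le> norm a"
  by (rule order_trans[OF norm_app]) (simp add: norm_translate_le mult_left_le_one_le)

lemma continuous_on_translate: "continuous_on A (\<lambda>h :: real ^ 'n. translate h \<triangleright> a)"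
  unfolding continuous_on_def translate_def
proof
  fix h :: "real ^ 'n" assume "h \<in> A"
  show "((\<lambda>h. multiplier (\<lambda>k. echar k h) \<triangleright> a) \<longlongrightarrow> multiplier (\<lambda>k. echar k h) \<triangleright> a) (at h within A)"
  proof (rule multiplier_tendsto[of _ _ _ 1])
    show "((\<lambda>h. echar k h) \<longlongrightarrow> echar k h) (at h within A)" for k
      using continuous_on_echar[of A k] \<open>h \<in> A\<close> by (simp add: continuous_on_def)
  qed auto
qed

lemma norm_exp_minus_one_le:
  fixes x :: "'a::{real_normed_algebra_1, banach}"
  shows "norm (exp x - 1) \<le> exp (norm x) - 1"
proof -
  have s: "summable (\<lambda>n. x ^ Suc n /\<^sub>R fact (Suc n))"
    using summable_exp_generic[of x] by (subst summable_Suc_iff)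
  have sn: "summable (\<lambda>n. norm x ^ Suc n /\<^sub>R fact (Suc n))"
    using summable_exp_generic[of "norm x"] by (subst summable_Suc_iff)
  have "exp x - 1 = (\<Sum>n. x ^ Suc n /\<^sub>R fact (Suc n))"
    unfolding exp_def using suminf_split_head[OF summable_exp_generic[of x]] by simp
  also have "norm \<dots> \<le> (\<Sum>n. norm x ^ Suc n /\<^sub>R fact (Suc n))"
  proof (rule norm_suminf_le[OF _ sn])
    show "norm (x ^ Suc n /\<^sub>R fact (Suc n)) \<le> norm x ^ Suc n /\<^sub>R fact (Suc n)" for n
      using norm_power_ineq[of x "Suc n"] by (simp add: divide_right_mono divide_inverse mult_left_mono del: power_Suc)
  qed
  also have "\<dots> = exp (norm x) - 1"
    unfolding exp_def using suminf_split_head[OF summable_exp_generic[of "norm x"]] by simp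
  finally show ?thesis .
qed

lemma continuous_on_gker: "continuous_on A (gker a)"
  unfolding gker_def[abs_def]
  by (cases "gint 0 0 (1 / (4 * a)) = 0")
    (auto intro!: continuous_on_prod continuous_on_divide continuous_on_const continuous_on_compose2[OF continuous_on_gexp[of UNIV]] continuous_intros)

context sobolev
begin

lemma fc_cs: "fc (cs c \<triangleright> a) k = c * fc a k"
  and fc_translate: "fc (translate h \<triangleright> a) k = echar k h * fc a k"
  by (simp_all add: fc_def)

lemma ev_cs [simp]: "ev (cs c \<triangleright> a) x = c * ev a x"
  using infsum_cmult_right[OF summable_ev[of a x], of c]
  by (simp add: ev_def fc_cs mult.assoc)

lemma ev_translate [simp]: "ev (translate h \<triangleright> a) x = ev a (x + h)"
  by (simp add: ev_def fc_translate echar_plus mult_ac)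

text \<open>Multiplication operators commute, so exp(b) - exp(a) = exp(a) (exp(b - a) - 1), and the
  last factor is controlled by the norm of multiplication by b - a.\<close>

lemma exp_M_tendsto:
  assumes "(f \<longlongrightarrow> a) F"
  shows "((\<lambda>t. exp (M (f t))) \<longlongrightarrow> exp (M a)) F"
proof -
  have eq: "exp (M b) - exp (M a) = exp (M a) * (exp (M (b - a)) - 1)" for b
    using exp_M_add[of a "b - a"] by (simp add: right_diff_distrib)
  have "((\<lambda>t. M (f t - a)) \<longlongrightarrow> M (a - a)) F"
    by (intro bounded_linear.tendsto[OF bounded_linear_M] tendsto_intros assms)
  then have "((\<lambda>t. norm (exp (M a)) * (exp (norm (M (f t - a))) - 1)) \<longlongrightarrow> norm (exp (M a)) * (exp (norm (M (a - a))) - 1)) F"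
    by (intro tendsto_intros)
  then have "((\<lambda>t. norm (exp (M a)) * (exp (norm (M (f t - a))) - 1)) \<longlongrightarrow> 0) F" by (simp add: M_zero)
  moreover have "norm (exp (M (f t)) - exp (M a)) \<le> norm (exp (M a)) * (exp (norm (M (f t - a))) - 1)" for t
    unfolding eq by (intro order_trans[OF norm_mult_ineq] mult_left_mono norm_exp_minus_one_le) auto
  ultimately have "((\<lambda>t. exp (M (f t)) - exp (M a)) \<longlongrightarrow> 0) F"
    by (auto intro!: Lim_null_comparison[of _ "\<lambda>t. norm (exp (M a)) * (exp (norm (M (f t - a))) - 1)"] always_eventually)
  then show ?thesis by (rule LIM_zero_cancel)
qed

lemma continuous_on_exp_M: "continuous_on A f \<Longrightarrow> continuous_on A (\<lambda>t. exp (M (f t)))"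
  unfolding continuous_on_def by (auto intro: exp_M_tendsto)

text \<open>Difference quotients converge in the ambient Sobolev norm, so \<open>\<phi>\<close> is one degree smoother.\<close>

definition has_grad :: "(int ^ 'n) ell2 \<Rightarrow> ('n \<Rightarrow> (int ^ 'n) ell2) \<Rightarrow> bool" where
  "has_grad \<phi> G \<longleftrightarrow>
     (\<exists>C\<ge>0. \<forall>h. norm (translate h \<triangleright> \<phi> - \<phi>) \<le> C * norm h) \<and>
     (\<forall>y. ((\<lambda>r. (1 / r) *\<^sub>R (translate (r *\<^sub>R y) \<triangleright> \<phi> - \<phi>)) \<longlongrightarrow> (\<Sum>i\<in>UNIV. (y $ i) *\<^sub>R G i)) (at_right 0))"

lemma has_grad_add:
  assumes "has_grad \<phi> G" "has_grad \<psi> H"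
  shows "has_grad (\<phi> + \<psi>) (\<lambda>i. G i + H i)"
  unfolding has_grad_def
proof (intro conjI allI)
  obtain C D where C: "C \<ge> 0" "\<And>h. norm (translate h \<triangleright> \<phi> - \<phi>) \<le> C * norm h"
    and D: "D \<ge> 0" "\<And>h. norm (translate h \<triangleright> \<psi> - \<psi>) \<le> D * norm h"
    using assms unfolding has_grad_def by blast
  have "norm (translate h \<triangleright> (\<phi> + \<psi>) - (\<phi> + \<psi>)) \<le> (C + D) * norm h" for h
    using norm_triangle_ineq[of "translate h \<triangleright> \<phi> - \<phi>" "translate h \<triangleright> \<psi> - \<psi>"] C(2)[of h] D(2)[of h]
    by (simp add: algebra_simps)
  then show "\<exists>C\<ge>0. \<forall>h. norm (translate h \<triangleright> (\<phi> + \<psi>) - (\<phi> + \<psi>)) \<le> C * norm h"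
    using C(1) D(1) by (intro exI[of _ "C + D"]) auto
  fix y
  have "((\<lambda>r. (1 / r) *\<^sub>R (translate (r *\<^sub>R y) \<triangleright> \<phi> - \<phi>) + (1 / r) *\<^sub>R (translate (r *\<^sub>R y) \<triangleright> \<psi> - \<psi>))
      \<longlongrightarrow> (\<Sum>i\<in>UNIV. (y $ i) *\<^sub>R G i) + (\<Sum>i\<in>UNIV. (y $ i) *\<^sub>R H i)) (at_right 0)"
    using assms unfolding has_grad_def by (intro tendsto_add) auto
  then show "((\<lambda>r. (1 / r) *\<^sub>R (translate (r *\<^sub>R y) \<triangleright> (\<phi> + \<psi>) - (\<phi> + \<psi>))) \<longlongrightarrow> (\<Sum>i\<in>UNIV. (y $ i) *\<^sub>R (G i + H i))) (at_right 0)"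
    by (simp add: algebra_simps sum.distrib)
qed

lemma has_grad_scaleR:
  assumes "has_grad \<phi> G"
  shows "has_grad (c *\<^sub>R \<phi>) (\<lambda>i. c *\<^sub>R G i)"
  unfolding has_grad_def
proof (intro conjI allI)
  obtain C where C: "C \<ge> 0" "\<And>h. norm (translate h \<triangleright> \<phi> - \<phi>) \<le> C * norm h"
    using assms unfolding has_grad_def by blast
  have "norm (translate h \<triangleright> (c *\<^sub>R \<phi>) - c *\<^sub>R \<phi>) \<le> (\<bar>c\<bar> * C) * norm h" for h
  proof -
    have "norm (translate h \<triangleright> (c *\<^sub>R \<phi>) - c *\<^sub>R \<phi>) = \<bar>c\<bar> * norm (translate h \<triangleright> \<phi> - \<phi>)"
      by (simp flip: scaleR_right_diff_distrib)
    also have "\<dots> \<le> \<bar>c\<bar> * (C * norm h)" by (intro mult_left_mono C) auto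
    finally show ?thesis by (simp add: mult.assoc)
  qed
  then show "\<exists>C\<ge>0. \<forall>h. norm (translate h \<triangleright> (c *\<^sub>R \<phi>) - c *\<^sub>R \<phi>) \<le> C * norm h"
    using C(1) by (intro exI[of _ "\<bar>c\<bar> * C"]) auto
  fix y
  have "((\<lambda>r. c *\<^sub>R ((1 / r) *\<^sub>R (translate (r *\<^sub>R y) \<triangleright> \<phi> - \<phi>)))
      \<longlongrightarrow> c *\<^sub>R (\<Sum>i\<in>UNIV. (y $ i) *\<^sub>R G i)) (at_right 0)"
    using assms unfolding has_grad_def by (intro tendsto_scaleR tendsto_const) auto
  then show "((\<lambda>r. (1 / r) *\<^sub>R (translate (r *\<^sub>R y) \<triangleright> (c *\<^sub>R \<phi>) - c *\<^sub>R \<phi>)) \<longlongrightarrow> (\<Sum>i\<in>UNIV. (y $ i) *\<^sub>R (c *\<^sub>R G i))) (at_right 0)"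
    by (simp add: scaleR_diff_right scaleR_sum_right mult.commute)
qed

end

locale gl = sobolev s dim
  for s :: nat and dim :: "'n::finite itself" +
  fixes V \<nu> :: real
  assumes V: "0 \<le> V"
begin

definition A :: complex where "A = 1 + \<i> * complex_of_real \<nu>"
definition Z :: complex where "Z = 1 - \<i> * complex_of_real \<nu>"

lemma A_pos: "0 < Re A" by (simp add: A_def)

text \<open>(1 + i\<nu>)(1 - i\<nu>) is real. Hence the limiting exponent is again \<open>Z\<close>
  times a real function, and the procedure can be iterated.\<close>

lemma AZ: "A * Z\<^sup>2 = of_real (1 + \<nu>\<^sup>2) * Z"
  by (simp add: A_def Z_def complex_eq_iff power2_eq_square algebra_simps)

definition sg :: "real \<Rightarrow> int ^ 'n \<Rightarrow> complex" where
  "sg t k = exp (complex_of_real t * (complex_of_real V - A * complex_of_real ((norm (freq k))\<^sup>2)))"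

lemma norm_sg_le: "0 \<le> t \<Longrightarrow> cmod (sg t k) \<le> exp (t * V)"
  by (simp add: sg_def A_def mult_left_mono)

definition S :: "real \<Rightarrow> (int ^ 'n) ell2 blinop" where
  "S t = multiplier (sg t)"

lemma coord_S: "0 \<le> t \<Longrightarrow> coord (S t \<triangleright> a) k = sg t k * coord a k"
  unfolding S_def by (rule coord_multiplier[OF norm_sg_le])

lemma fc_S: "0 \<le> t \<Longrightarrow> fc (S t \<triangleright> a) k = sg t k * fc a k"
  by (simp add: fc_def coord_S)

lemma semigroup_gl_ev:
  assumes t: "0 \<le> t" and f: "f \<in> Hs s"
  shows "semigroup_gl V \<nu> t f = ev (S t \<triangleright> emb f)"
proof
  fix x
  have "fourier_coeff f k = fc (emb f) k" for k
    using f by (simp add: Hs_def fc_def coord_emb)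
  then show "semigroup_gl V \<nu> t f x = ev (S t \<triangleright> emb f) x"
    by (simp add: semigroup_gl_def ev_def fc_S[OF t] sg_def A_def echar_def)
qed

sublocale strongly_continuous_semigroup S "exp V"
proof
  show "S 0 = 1" by (rule blinop_eqI, rule ell2_eqI) (simp add: coord_S sg_def)
  show "S (r + t) = S r * S t" if "0 \<le> r" "0 \<le> t" for r t
    by (rule blinop_eqI, rule ell2_eqI) (use that in \<open>simp add: coord_S sg_def distrib_right flip: exp_add mult.assoc\<close>)
  show "norm (S t) \<le> exp V" if "0 \<le> t" "t \<le> 1" for t
    unfolding S_def
  proof (rule norm_multiplier_le)
    fix k
    have "t * V \<le> 1 * V" using that V by (intro mult_right_mono) auto
    then show "cmod (sg t k) \<le> exp V" using norm_sg_le[OF that(1), of k] by (smt (verit) exp_le_cancel_iff)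
  qed
  show "continuous_on {0..} (\<lambda>t. S t \<triangleright> a)" for a
    unfolding continuous_on_def S_def
  proof
    fix t :: real assume t: "t \<in> {0..}"
    show "((\<lambda>t. multiplier (sg t) \<triangleright> a) \<longlongrightarrow> multiplier (sg t) \<triangleright> a) (at t within {0..})"
    proof (rule multiplier_tendsto)
      show "((\<lambda>t. sg t k) \<longlongrightarrow> sg t k) (at t within {0..})" for k
        unfolding sg_def by (intro tendsto_intros)
      have le: "cmod (sg r k) \<le> exp ((t + 1) * V)" if "0 \<le> r" "r \<le> t + 1" for r k
        by (rule order_trans[OF norm_sg_le]) (use that V in \<open>auto intro: mult_right_mono\<close>)
      show "\<forall>\<^sub>F r in at t within {0..}. \<forall>k. cmod (sg r k) \<le> exp ((t + 1) * V)"
        unfolding eventually_at by (intro exI[of _ 1]) (auto simp: dist_real_def intro!: le)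
      show "cmod (sg t k) \<le> exp ((t + 1) * V)" for k using t by (intro le) auto
    qed
  qed
qed

lemma integrable_kernel:
  fixes f :: "real ^ 'n \<Rightarrow> (int ^ 'n) ell2"
  assumes f: "continuous_on UNIV f" and C: "0 \<le> C" and le: "\<And>y. norm (f y) \<le> B * exp (C * norm y)"
  shows "integrable lborel (\<lambda>y. cs (gker A y) \<triangleright> f y)"
proof (rule Bochner_Integration.integrable_bound)
  show "integrable lborel (\<lambda>y::real ^ 'n. B * (cmod (gker A y) * exp (C * norm y)))"
    by (intro integrable_mult_right gker_exp_integrable A_pos C)
  show "(\<lambda>y. cs (gker A y) \<triangleright> f y) \<in> borel_measurable lborel"
    by (auto intro!: borel_measurable_continuous_onI continuous_intros f bounded_linear.continuous_on[OF bounded_linear_cs] continuous_on_gker)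
  show "AE y in lborel. norm (cs (gker A y) \<triangleright> f y) \<le> norm (B * (cmod (gker A y) * exp (C * norm y)))"
  proof (intro always_eventually allI)
    fix y
    have "norm (cs (gker A y) \<triangleright> f y) \<le> norm (cs (gker A y) :: (int ^ 'n) ell2 blinop) * norm (f y)" by (rule norm_app)
    also have "\<dots> \<le> cmod (gker A y) * (B * exp (C * norm y))"
      by (intro mult_mono norm_cs_le le) auto
    finally show "norm (cs (gker A y) \<triangleright> f y) \<le> norm (B * (cmod (gker A y) * exp (C * norm y)))"
      by (simp add: mult_ac)
  qed
qed

lemma continuous_on_translate_scaled: "continuous_on X (\<lambda>y. translate (r *\<^sub>R y) \<triangleright> a)"
  by (rule continuous_on_compose2[OF continuous_on_translate[of UNIV]]) (auto intro!: continuous_intros)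

text \<open>Coordinatewise this is \<open>gker_laplace\<close> with z = i. The time is written r^2
  because the kernel for time r^2 is the unit-time kernel at spatial scale r, the scale at which a
  phase \<phi>/r changes by order one.\<close>

lemma S_kernel:
  assumes r: "0 \<le> r"
  shows "S (r\<^sup>2) \<triangleright> a = exp (r\<^sup>2 * V) *\<^sub>R (LINT y|lborel. cs (gker A y) \<triangleright> translate (r *\<^sub>R y) \<triangleright> a)"
proof (rule ell2_eqI)
  fix k
  have i: "integrable lborel (\<lambda>y. cs (gker A y) \<triangleright> translate (r *\<^sub>R y) \<triangleright> a)"
    by (rule integrable_kernel[where C = 0 and B = "norm a"]) (auto intro: continuous_on_translate_scaled norm_translate_app_le)
  have "coord (LINT y|lborel. cs (gker A y) \<triangleright> translate (r *\<^sub>R y) \<triangleright> a) k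
      = (LINT y|lborel. coord (cs (gker A y) \<triangleright> translate (r *\<^sub>R y) \<triangleright> a) k)"
    by (rule integral_bounded_linear[OF bounded_linear_coord i, symmetric])
  also have "\<dots> = (LINT y|lborel. coord a k * (gker A y * exp (\<i> * of_real (y \<bullet> (r *\<^sub>R freq k)))))"
    by (simp add: echar_def inner_commute mult_ac)
  also have "\<dots> = coord a k * exp (A * \<i>\<^sup>2 * of_real ((norm (r *\<^sub>R freq k))\<^sup>2))"
    by (simp only: integral_mult_right_zero gker_laplace(2)[OF A_pos])
  also have "A * \<i>\<^sup>2 * of_real ((norm (r *\<^sub>R freq k))\<^sup>2) = - (of_real (r\<^sup>2) * (A * of_real ((norm (freq k))\<^sup>2)))"
    by (simp add: power_mult_distrib)
  finally have eq: "coord (LINT y|lborel. cs (gker A y) \<triangleright> translate (r *\<^sub>R y) \<triangleright> a) k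
      = coord a k * exp (- (of_real (r\<^sup>2) * (A * of_real ((norm (freq k))\<^sup>2))))" .
  have "sg (r\<^sup>2) k = exp (complex_of_real (r\<^sup>2 * V) + - (of_real (r\<^sup>2) * (A * of_real ((norm (freq k))\<^sup>2))))"
    unfolding sg_def by (simp add: right_diff_distrib)
  also have "\<dots> = exp (r\<^sup>2 * V) * exp (- (of_real (r\<^sup>2) * (A * of_real ((norm (freq k))\<^sup>2))))"
    by (simp only: exp_add exp_of_real)
  finally show "coord (S (r\<^sup>2) \<triangleright> a) k = coord (exp (r\<^sup>2 * V) *\<^sub>R (LINT y|lborel. cs (gker A y) \<triangleright> translate (r *\<^sub>R y) \<triangleright> a)) k"
    unfolding scaleR_ell2.rep_eq eq by (simp add: coord_S scaleR_conv_of_real[where 'a=complex] mult_ac)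
qed

text \<open>Conjugating the heat kernel representation by \<open>exp (\<phi> / r)\<close> turns the large exponents into
  the difference quotient \<open>(\<phi>(x + r y) - \<phi>(x)) / r\<close>, which is bounded by \<open>C |y|\<close>; so dominated
  convergence replaces any parabolic estimate for the conjugated equation.\<close>

theorem conjugated_semigroup_tendsto:
  assumes G: "has_grad \<phi> G" and real: "\<And>i x. ev (G i) x \<in> \<real>"
    and r: "\<And>n. 0 < r n" "r \<longlonglongrightarrow> 0"
  shows "(\<lambda>n. exp (M (cs Z \<triangleright> (- (1 / r n)) *\<^sub>R \<phi>)) \<triangleright> S ((r n)\<^sup>2) \<triangleright> exp (M (cs Z \<triangleright> (1 / r n) *\<^sub>R \<phi>)) \<triangleright> a)
    \<longlonglongrightarrow> exp (M (cs Z \<triangleright> (1 + \<nu>\<^sup>2) *\<^sub>R (\<Sum>i\<in>UNIV. prd (G i) (G i)))) \<triangleright> a"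
proof -
  obtain C where C: "C \<ge> 0" "\<And>h. norm (translate h \<triangleright> \<phi> - \<phi>) \<le> C * norm h"
    using G unfolding has_grad_def by blast
  define K where "K = onorm (M :: (int ^ 'n) ell2 \<Rightarrow> _) * cmod Z"
  have K0: "0 \<le> K" unfolding K_def by (intro mult_nonneg_nonneg onorm_pos_le[OF bounded_linear_M]) auto
  have MZ: "norm (M (cs Z \<triangleright> b)) \<le> K * norm b" for b
  proof -
    have "norm (M (cs Z \<triangleright> b)) \<le> onorm (M :: (int ^ 'n) ell2 \<Rightarrow> _) * norm (cs Z \<triangleright> b)" by (rule onorm[OF bounded_linear_M])
    also have "\<dots> \<le> onorm (M :: (int ^ 'n) ell2 \<Rightarrow> _) * (cmod Z * norm b)"
      by (intro mult_left_mono order_trans[OF norm_app] mult_right_mono norm_cs_le onorm_pos_le[OF bounded_linear_M]) auto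
    finally show ?thesis by (simp add: K_def mult.assoc)
  qed
  define \<Phi> where "\<Phi> n y = (1 / r n) *\<^sub>R (translate (r n *\<^sub>R y) \<triangleright> \<phi> - \<phi>)" for n y
  define f where "f n y = exp (M (cs Z \<triangleright> \<Phi> n y)) \<triangleright> translate (r n *\<^sub>R y) \<triangleright> a" for n y
  \<comment> \<open>The gradient at x as a real vector: the Laplace transform of the kernel is
    available for real vectors \<open>v\<close>, and this is where reality of the \<open>G i\<close>
    enters.\<close>
  define \<gamma> where "\<gamma> x = (\<chi> i. Re (ev (G i) x))" for x
  define g where "g y = exp (M (cs Z \<triangleright> (\<Sum>i\<in>UNIV. (y $ i) *\<^sub>R G i))) \<triangleright> a" for y :: "real ^ 'n"
  have \<Phi>: "norm (\<Phi> n y) \<le> C * norm y" for n y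
  proof -
    have "norm (\<Phi> n y) = norm (translate (r n *\<^sub>R y) \<triangleright> \<phi> - \<phi>) / r n" using r(1)[of n] by (simp add: \<Phi>_def)
    also have "\<dots> \<le> (C * norm (r n *\<^sub>R y)) / r n" using r(1)[of n] by (intro divide_right_mono C) auto
    also have "\<dots> = C * norm y" using r(1)[of n] by simp
    finally show ?thesis .
  qed
  have nf: "norm (f n y) \<le> norm a * exp ((K * C) * norm y)" for n y
  proof -
    have "norm (f n y) \<le> norm (exp (M (cs Z \<triangleright> \<Phi> n y))) * norm (translate (r n *\<^sub>R y) \<triangleright> a)"
      unfolding f_def by (rule norm_app)
    also have "\<dots> \<le> exp (norm (M (cs Z \<triangleright> \<Phi> n y))) * norm a"
      by (intro mult_mono norm_exp norm_translate_app_le) auto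
    also have "\<dots> \<le> exp (K * (C * norm y)) * norm a"
      by (intro mult_right_mono) (auto intro: order_trans[OF MZ mult_left_mono[OF \<Phi> K0]])
    finally show ?thesis by (simp add: mult_ac)
  qed
  have cf: "continuous_on UNIV (f n)" for n
    unfolding f_def[abs_def] \<Phi>_def
    by (intro continuous_on_app continuous_on_exp_M continuous_intros continuous_on_translate_scaled)
  have cg: "continuous_on UNIV g"
    unfolding g_def[abs_def] by (intro continuous_on_app continuous_on_exp_M continuous_intros)
  have f_g: "(\<lambda>n. f n y) \<longlonglongrightarrow> g y" for y
  proof -
    have ra: "filterlim r (at_right 0) sequentially"
    proof -
      have "r n \<noteq> 0" for n using r(1)[of n] by simp
      then show ?thesis unfolding filterlim_at using r by (auto intro!: always_eventually)
    qed
    have "((\<lambda>r. (1 / r) *\<^sub>R (translate (r *\<^sub>R y) \<triangleright> \<phi> - \<phi>)) \<longlongrightarrow> (\<Sum>i\<in>UNIV. (y $ i) *\<^sub>R G i)) (at_right 0)"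
      using G unfolding has_grad_def by blast
    from filterlim_compose[OF this ra] have "(\<lambda>n. \<Phi> n y) \<longlonglongrightarrow> (\<Sum>i\<in>UNIV. (y $ i) *\<^sub>R G i)"
      by (simp add: \<Phi>_def)
    then have 1: "(\<lambda>n. exp (M (cs Z \<triangleright> \<Phi> n y))) \<longlonglongrightarrow> exp (M (cs Z \<triangleright> (\<Sum>i\<in>UNIV. (y $ i) *\<^sub>R G i)))"
      by (intro exp_M_tendsto bounded_linear.tendsto[OF bounded_linear_app])
    have "(\<lambda>n. translate (r n *\<^sub>R y) \<triangleright> a) \<longlonglongrightarrow> translate (0 *\<^sub>R y) \<triangleright> a"
      by (rule continuous_on_tendsto_compose[OF continuous_on_translate_scaled[of UNIV "1", simplified, THEN continuous_on_compose2, of UNIV]])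
        (auto intro!: tendsto_intros r continuous_intros)
    then have 2: "(\<lambda>n. translate (r n *\<^sub>R y) \<triangleright> a) \<longlonglongrightarrow> a"
      by (metis ell2_eqI coord_translate echar_zero(2) mult_1 scale_zero_left)
    show ?thesis unfolding f_def g_def by (rule app.tendsto[OF 1 2])
  qed
  have ng: "norm (g y) \<le> norm a * exp ((K * C) * norm y)" for y
    using LIMSEQ_le_const2[OF tendsto_norm[OF f_g[of y]]] nf[of _ y] by blast
  have intf: "integrable lborel (\<lambda>y. cs (gker A y) \<triangleright> f n y)" for n
    by (rule integrable_kernel[OF cf _ nf]) (simp add: K0 C)
  have intg: "integrable lborel (\<lambda>y. cs (gker A y) \<triangleright> g y)"
    by (rule integrable_kernel[OF cg _ ng]) (simp add: K0 C)
  have lim: "(\<lambda>n. LINT y|lborel. cs (gker A y) \<triangleright> f n y) \<longlonglongrightarrow> (LINT y|lborel. cs (gker A y) \<triangleright> g y)"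
  proof (rule integral_dominated_convergence)
    show "integrable lborel (\<lambda>y::real ^ 'n. norm a * (cmod (gker A y) * exp ((K * C) * norm y)))"
      by (intro integrable_mult_right gker_exp_integrable A_pos mult_nonneg_nonneg K0 C)
    show "AE y in lborel. norm (cs (gker A y) \<triangleright> f n y) \<le> norm a * (cmod (gker A y) * exp ((K * C) * norm y))" for n
    proof (intro always_eventually allI)
      fix y
      have "norm (cs (gker A y) \<triangleright> f n y) \<le> norm (cs (gker A y) :: (int ^ 'n) ell2 blinop) * norm (f n y)" by (rule norm_app)
      also have "\<dots> \<le> cmod (gker A y) * (norm a * exp ((K * C) * norm y))"
        by (intro mult_mono norm_cs_le nf) auto
      finally show "norm (cs (gker A y) \<triangleright> f n y) \<le> norm a * (cmod (gker A y) * exp ((K * C) * norm y))"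
        by (simp add: mult_ac)
    qed
    show "AE y in lborel. (\<lambda>n. cs (gker A y) \<triangleright> f n y) \<longlonglongrightarrow> cs (gker A y) \<triangleright> g y"
      by (intro always_eventually allI bounded_linear.tendsto[OF bounded_linear_app] f_g)
  qed (use intf intg in \<open>auto dest: borel_measurable_integrable\<close>)
  \<comment> \<open>Checked at a point x, where the outer factor is the number \<open>e\<close> and
    can be moved under the integral.\<close>
  have lhs: "exp (M (cs Z \<triangleright> (- (1 / r n)) *\<^sub>R \<phi>)) \<triangleright> S ((r n)\<^sup>2) \<triangleright> exp (M (cs Z \<triangleright> (1 / r n) *\<^sub>R \<phi>)) \<triangleright> a
      = exp ((r n)\<^sup>2 * V) *\<^sub>R (LINT y|lborel. cs (gker A y) \<triangleright> f n y)" for n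
  proof (rule ev_eqI)
    fix x
    define b where "b = exp (M (cs Z \<triangleright> (1 / r n) *\<^sub>R \<phi>)) \<triangleright> a"
    define e where "e = exp (Z * ((- (1 / r n)) *\<^sub>R ev \<phi> x))"
    have ib: "integrable lborel (\<lambda>y. cs (gker A y) \<triangleright> translate (r n *\<^sub>R y) \<triangleright> b)"
      by (rule integrable_kernel[where C = 0 and B = "norm b"]) (auto intro: continuous_on_translate_scaled norm_translate_app_le)
    have "ev (exp (M (cs Z \<triangleright> (- (1 / r n)) *\<^sub>R \<phi>)) \<triangleright> S ((r n)\<^sup>2) \<triangleright> b) x
        = e * (exp ((r n)\<^sup>2 * V) *\<^sub>R (LINT y|lborel. ev (cs (gker A y) \<triangleright> translate (r n *\<^sub>R y) \<triangleright> b) x))"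
      using r(1)[of n] integral_bounded_linear[OF bounded_linear_ev ib, of x]
      by (simp add: S_kernel e_def del: app.scaleR_right)
    also have "\<dots> = exp ((r n)\<^sup>2 * V) *\<^sub>R (LINT y|lborel. e * ev (cs (gker A y) \<triangleright> translate (r n *\<^sub>R y) \<triangleright> b) x)"
      by (simp only: integral_mult_right_zero mult_scaleR_right)
    also have "(\<lambda>y. e * ev (cs (gker A y) \<triangleright> translate (r n *\<^sub>R y) \<triangleright> b) x) = (\<lambda>y. ev (cs (gker A y) \<triangleright> f n y) x)"
    proof
      fix y
      have "e * exp (Z * ((1 / r n) *\<^sub>R ev \<phi> (x + r n *\<^sub>R y))) = exp (Z * ((1 / r n) *\<^sub>R (ev \<phi> (x + r n *\<^sub>R y) - ev \<phi> x)))"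
        unfolding e_def exp_add[symmetric] by (simp add: scaleR_conv_of_real algebra_simps)
      then show "e * ev (cs (gker A y) \<triangleright> translate (r n *\<^sub>R y) \<triangleright> b) x = ev (cs (gker A y) \<triangleright> f n y) x"
        unfolding f_def b_def \<Phi>_def by (simp add: mult_ac del: app.scaleR_right)
    qed
    also have "(LINT y|lborel. ev (cs (gker A y) \<triangleright> f n y) x) = ev (LINT y|lborel. cs (gker A y) \<triangleright> f n y) x"
      by (rule integral_bounded_linear[OF bounded_linear_ev intf])
    finally show "ev (exp (M (cs Z \<triangleright> (- (1 / r n)) *\<^sub>R \<phi>)) \<triangleright> S ((r n)\<^sup>2) \<triangleright> exp (M (cs Z \<triangleright> (1 / r n) *\<^sub>R \<phi>)) \<triangleright> a) x
        = ev (exp ((r n)\<^sup>2 * V) *\<^sub>R (LINT y|lborel. cs (gker A y) \<triangleright> f n y)) x"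
      unfolding b_def by simp
  qed
  have rhs: "(LINT y|lborel. cs (gker A y) \<triangleright> g y) = exp (M (cs Z \<triangleright> (1 + \<nu>\<^sup>2) *\<^sub>R (\<Sum>i\<in>UNIV. prd (G i) (G i)))) \<triangleright> a"
  proof (rule ev_eqI)
    fix x
    have Gx: "ev (G i) x = of_real (\<gamma> x $ i)" for i using real[of i x] by (simp add: \<gamma>_def)
    have "ev (LINT y|lborel. cs (gker A y) \<triangleright> g y) x = (LINT y|lborel. ev (cs (gker A y) \<triangleright> g y) x)"
      by (rule integral_bounded_linear[OF bounded_linear_ev intg, symmetric])
    also have "\<dots> = (LINT y|lborel. ev a x * (gker A y * exp (Z * of_real (y \<bullet> \<gamma> x))))"
    proof (rule Bochner_Integration.integral_cong[OF refl])
      fix y :: "real ^ 'n"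
      have "ev (\<Sum>i\<in>UNIV. (y $ i) *\<^sub>R G i) x = of_real (y \<bullet> \<gamma> x)"
        by (simp add: ev_sum Gx inner_vec_def scaleR_conv_of_real)
      then show "ev (cs (gker A y) \<triangleright> g y) x = ev a x * (gker A y * exp (Z * of_real (y \<bullet> \<gamma> x)))"
        by (simp add: g_def del: app.scaleR_right app.sum_right)
    qed
    also have "\<dots> = ev a x * exp (A * Z\<^sup>2 * of_real ((norm (\<gamma> x))\<^sup>2))"
      by (simp only: integral_mult_right_zero gker_laplace(2)[OF A_pos])
    also have "\<dots> = exp (Z * ((1 + \<nu>\<^sup>2) *\<^sub>R (\<Sum>i\<in>UNIV. ev (G i) x * ev (G i) x))) * ev a x"
    proof -
      have "(\<Sum>i\<in>UNIV. ev (G i) x * ev (G i) x) = of_real ((norm (\<gamma> x))\<^sup>2)"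
        by (simp add: Gx power2_norm_eq_inner inner_vec_def)
      then show ?thesis unfolding AZ by (simp add: scaleR_conv_of_real mult_ac)
    qed
    finally show "ev (LINT y|lborel. cs (gker A y) \<triangleright> g y) x = ev (exp (M (cs Z \<triangleright> (1 + \<nu>\<^sup>2) *\<^sub>R (\<Sum>i\<in>UNIV. prd (G i) (G i)))) \<triangleright> a) x"
      by (simp add: ev_sum del: app.scaleR_right app.sum_right)
  qed
  have "(\<lambda>n. exp ((r n)\<^sup>2 * V)) \<longlonglongrightarrow> exp (0\<^sup>2 * V)" by (intro tendsto_intros r)
  from tendsto_scaleR[OF this lim] show ?thesis unfolding lhs rhs by simp
qed

end

section \<open>Approximate control of the abstract equation\<close>

lemma lipschitz_on_balls_bounded:
  fixes f :: "'a::real_normed_vector \<Rightarrow> 'b::real_normed_vector"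
  assumes "lipschitz_on_balls f"
  obtains B where "0 \<le> B" "\<And>x. norm x \<le> r \<Longrightarrow> norm (f x) \<le> B"
proof -
  obtain L where L: "0 < L" "\<And>x y. norm x \<le> max r 0 \<Longrightarrow> norm y \<le> max r 0 \<Longrightarrow> norm (f x - f y) \<le> L * norm (x - y)"
    using lipschitz_on_ballsE[OF assms] by metis
  show thesis
  proof (rule that[of "norm (f 0) + L * max r 0"])
    fix x :: 'a assume x: "norm x \<le> r"
    have "norm (f x) \<le> norm (f 0) + norm (f x - f 0)" using norm_triangle_ineq[of "f 0" "f x - f 0"] by simp
    also have "norm (f x - f 0) \<le> L * norm (x - 0)" using x by (intro L) auto
    also have "L * norm (x - 0) \<le> L * max r 0" using x L(1) by (intro mult_left_mono) auto
    finally show "norm (f x) \<le> norm (f 0) + L * max r 0" by simp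
  qed (use L in auto)
qed

lemma lipschitz_on_balls_linear:
  assumes "bounded_linear f"
  shows "lipschitz_on_balls f"
proof -
  interpret f: bounded_linear f by fact
  obtain K where "K > 0" "\<And>x. norm (f x) \<le> norm x * K" using f.pos_bounded by blast
  then show ?thesis unfolding lipschitz_on_balls_def
    by (intro allI exI[of _ K]) (auto simp: mult.commute simp flip: f.diff)
qed

lemma lipschitz_on_balls_const: "lipschitz_on_balls (\<lambda>x. c)"
  unfolding lipschitz_on_balls_def by (intro allI exI[of _ 1]) auto

lemma lipschitz_on_balls_bilinear:
  fixes f :: "'a::real_normed_vector \<Rightarrow> 'b::real_normed_vector" and g :: "'a \<Rightarrow> 'c::real_normed_vector"
    and bb :: "'b \<Rightarrow> 'c \<Rightarrow> 'd::real_normed_vector"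
  assumes bb: "bounded_bilinear bb" and f: "lipschitz_on_balls f" and g: "lipschitz_on_balls g"
  shows "lipschitz_on_balls (\<lambda>x. bb (f x) (g x))"
  unfolding lipschitz_on_balls_def
proof
  fix r
  interpret bb: bounded_bilinear bb by fact
  obtain K where K: "K > 0" "\<And>x y. norm (bb x y) \<le> norm x * norm y * K" using bb.pos_bounded by blast
  obtain L1 where L1: "0 < L1" "\<And>x y. norm x \<le> r \<Longrightarrow> norm y \<le> r \<Longrightarrow> norm (f x - f y) \<le> L1 * norm (x - y)"
    using lipschitz_on_ballsE[OF f] by metis
  obtain L2 where L2: "0 < L2" "\<And>x y. norm x \<le> r \<Longrightarrow> norm y \<le> r \<Longrightarrow> norm (g x - g y) \<le> L2 * norm (x - y)"
    using lipschitz_on_ballsE[OF g] by metis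
  obtain B1 where B1: "0 \<le> B1" "\<And>x. norm x \<le> r \<Longrightarrow> norm (f x) \<le> B1" using lipschitz_on_balls_bounded[OF f] by metis
  obtain B2 where B2: "0 \<le> B2" "\<And>x. norm x \<le> r \<Longrightarrow> norm (g x) \<le> B2" using lipschitz_on_balls_bounded[OF g] by metis
  show "\<exists>L>0. \<forall>x y. norm x \<le> r \<longrightarrow> norm y \<le> r \<longrightarrow> norm (bb (f x) (g x) - bb (f y) (g y)) \<le> L * norm (x - y)"
  proof (intro exI[of _ "(L1 * B2 + B1 * L2) * K + 1"] conjI allI impI)
    show "0 < (L1 * B2 + B1 * L2) * K + 1" using L1 L2 B1 B2 K by (intro add_nonneg_pos) auto
    fix x y :: 'a assume x: "norm x \<le> r" and y: "norm y \<le> r"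
    have "norm (bb (f x - f y) (g x)) \<le> norm (f x - f y) * norm (g x) * K" by (rule K)
    also have "\<dots> \<le> (L1 * norm (x - y)) * B2 * K"
      using L1 B1 B2 K x y by (intro mult_right_mono mult_mono) auto
    finally have 1: "norm (bb (f x - f y) (g x)) \<le> (L1 * norm (x - y)) * B2 * K" .
    have "norm (bb (f y) (g x - g y)) \<le> norm (f y) * norm (g x - g y) * K" by (rule K)
    also have "\<dots> \<le> B1 * (L2 * norm (x - y)) * K"
      using L2 B1 B2 K x y by (intro mult_right_mono mult_mono) auto
    finally have 2: "norm (bb (f y) (g x - g y)) \<le> B1 * (L2 * norm (x - y)) * K" .
    have "bb (f x) (g x) - bb (f y) (g y) = bb (f x - f y) (g x) + bb (f y) (g x - g y)"
      by (simp add: bb.diff_left bb.diff_right)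
    then have "norm (bb (f x) (g x) - bb (f y) (g y)) \<le> (L1 * norm (x - y)) * B2 * K + B1 * (L2 * norm (x - y)) * K"
      using 1 2 norm_triangle_le by (metis add_mono)
    also have "\<dots> \<le> ((L1 * B2 + B1 * L2) * K + 1) * norm (x - y)" by (simp add: algebra_simps)
    finally show "norm (bb (f x) (g x) - bb (f y) (g y)) \<le> ((L1 * B2 + B1 * L2) * K + 1) * norm (x - y)" .
  qed
qed

lemma lipschitz_on_balls_power:
  fixes f :: "'a::real_normed_vector \<Rightarrow> 'b::real_normed_algebra_1"
  shows "lipschitz_on_balls f \<Longrightarrow> lipschitz_on_balls (\<lambda>x. f x ^ n)"
  by (induction n) (auto intro: lipschitz_on_balls_const lipschitz_on_balls_bilinear[OF bounded_bilinear_mult])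

section \<open>Perturbation of solutions, free motion of small states, impulsive controls\<close>

context semilinear
begin

text \<open>The given solution is an approximate solution for the perturbed initial state, with
  defect M |a' - a|. The radius \<open>r0 + 1\<close> leaves room for the perturbed solution, which
  is why 1 enters the minimum with e.\<close>

lemma csol_perturb_initial:
  assumes T: "0 \<le> T" "T \<le> 1" and C: "continuous_on {0..T} C" and x: "csol C a T x" and e: "0 < e"
  shows "\<exists>\<rho>>0. \<forall>a'. norm (a' - a) < \<rho> \<longrightarrow> (\<exists>y. csol C a' T y \<and> norm (y T - x T) < e)"
proof -
  have cx: "continuous_on {0..T} x" using x by (simp add: mild_def)
  have "bounded (x ` {0..T})" "bounded (C ` {0..T})"
    by (auto intro!: compact_imp_bounded compact_continuous_image cx C)
  then obtain r0 c where b: "\<And>t. t \<in> {0..T} \<Longrightarrow> norm (x t) \<le> r0" "\<And>t. t \<in> {0..T} \<Longrightarrow> norm (C t) \<le> c"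
    by (fastforce simp: bounded_iff)
  have r0: "0 \<le> r0" using order_trans[OF norm_ge_zero b(1)[of 0]] T by simp
  obtain L where L: "0 < L" "\<And>x y. norm x \<le> r0 + 1 \<Longrightarrow> norm y \<le> r0 + 1 \<Longrightarrow> norm (N x - N y) \<le> L * norm (x - y)"
    using lipschitz_on_ballsE[OF N] by metis
  define E where "E = 2 * M * exp (2 * M * (c + 2 * L) * T)"
  have E: "E > 0" using M_pos by (simp add: E_def)
  show ?thesis
  proof (intro exI[of _ "min 1 e / E"] conjI allI impI)
    show "0 < min 1 e / E" using e E by simp
    fix a' assume a': "norm (a' - a) < min 1 e / E"
    then have small: "norm (a' - a) * E < min 1 e" using E by (simp add: less_divide_eq)
    have eq: "2 * (M * norm (a' - a)) * exp (2 * M * (c + 2 * L) * T) = norm (a' - a) * E" by (simp add: E_def)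
    have "\<exists>y. csol C a' T y \<and> (\<forall>t\<in>{0..T}. norm (y t - x t) \<le> 2 * (M * norm (a' - a)) * exp (2 * M * (c + 2 * L) * T))"
    proof (rule csol_near_approximate_solution[OF T C b(2) _ L cx b(1), where A = "\<lambda>t. S t \<triangleright> a"])
      show "((\<lambda>s. S (t - s) \<triangleright> (C s \<triangleright> x s + N (x s))) has_integral x t - S t \<triangleright> a) {0..t}" if "t \<in> {0..T}" for t
        using x that by (simp add: mild_def)
      show "norm (S t \<triangleright> a' - S t \<triangleright> a) \<le> M * norm (a' - a)" if "t \<in> {0..T}" for t
        using norm_S_app_le[of t "a' - a"] that T by simp
      show "r0 + 2 * (M * norm (a' - a)) * exp (2 * M * (c + 2 * L) * T) \<le> r0 + 1" unfolding eq using small by linarith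
    qed (use r0 in auto)
    then obtain y where y: "csol C a' T y" "\<forall>t\<in>{0..T}. norm (y t - x t) \<le> norm (a' - a) * E"
      unfolding eq by blast
    have "norm (y T - x T) \<le> norm (a' - a) * E" using y(2) T by simp
    then show "\<exists>y. csol C a' T y \<and> norm (y T - x T) < e" using y(1) small by (intro exI[of _ y]) linarith
  qed
qed

text \<open>The old solution solves the new equation with a defect, the Duhamel integral of (C' - C)
  x. The constant \<open>c + 1\<close> bounds all controls within distance 1 of
  \<open>C\<close>.\<close>

lemma csol_perturb_control:
  assumes T: "0 \<le> T" "T \<le> 1" and C: "continuous_on {0..T} C" and x: "csol C a T x" and e: "0 < e"
  shows "\<exists>\<rho>>0. \<forall>C'. continuous_on {0..T} C' \<longrightarrow> (\<forall>t\<in>{0..T}. norm (C' t - C t) \<le> \<rho>) \<longrightarrow>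
    (\<exists>y. csol C' a T y \<and> norm (y T - x T) < e)"
proof -
  have cx: "continuous_on {0..T} x" using x by (simp add: mild_def)
  have "bounded (x ` {0..T})" "bounded (C ` {0..T})"
    by (auto intro!: compact_imp_bounded compact_continuous_image cx C)
  then obtain r0 c where b: "\<And>t. t \<in> {0..T} \<Longrightarrow> norm (x t) \<le> r0" "\<And>t. t \<in> {0..T} \<Longrightarrow> norm (C t) \<le> c"
    by (fastforce simp: bounded_iff)
  have r0: "0 \<le> r0" using order_trans[OF norm_ge_zero b(1)[of 0]] T by simp
  obtain L where L: "0 < L" "\<And>x y. norm x \<le> r0 + 1 \<Longrightarrow> norm y \<le> r0 + 1 \<Longrightarrow> norm (N x - N y) \<le> L * norm (x - y)"
    using lipschitz_on_ballsE[OF N] by metis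
  define E where "E = 2 * (M * (r0 + 1)) * exp (2 * M * (c + 1 + 2 * L) * T)"
  have E: "E > 0" using M_pos r0 by (simp add: E_def)
  define \<rho> where "\<rho> = min 1 (min 1 e / (2 * E))"
  have \<rho>: "0 < \<rho>" "\<rho> \<le> 1" using e E by (auto simp: \<rho>_def)
  have "\<rho> * E \<le> min 1 e / (2 * E) * E" using E by (intro mult_right_mono) (auto simp: \<rho>_def)
  also have "\<dots> = min 1 e / 2" using E by simp
  also have "\<dots> < min 1 e" using e by (auto simp: min_def)
  finally have small: "\<rho> * E < min 1 e" .
  show ?thesis
  proof (intro exI[of _ \<rho>] conjI allI impI)
    fix C' assume C': "continuous_on {0..T} C'" and d: "\<forall>t\<in>{0..T}. norm (C' t - C t) \<le> \<rho>"
    have eq: "2 * (M * (\<rho> * (r0 + 1))) * exp (2 * M * (c + 1 + 2 * L) * T) = \<rho> * E" by (simp add: E_def)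
    define k where "k s = C' s \<triangleright> x s + N (x s)" for s
    have ck: "continuous_on {0..T} k" unfolding k_def by (intro continuous_intros C' cx continuous_on_N)
    \<comment> \<open>With this \<open>A\<close> the mild identity holds by definition; the whole
      estimate sits in the distance from \<open>A t\<close> to
      \<open>S t \<triangleright> a\<close>.\<close>
    define A where "A t = x t - integral {0..t} (\<lambda>s. S (t - s) \<triangleright> k s)" for t
    have hk: "((\<lambda>s. S (t - s) \<triangleright> k s) has_integral x t - A t) {0..t}" if "t \<in> {0..T}" for t
      using integrable_integral[OF duhamel_integrable[OF ck that T(2)]] by (simp add: A_def)
    have "\<exists>y. csol C' a T y \<and> (\<forall>t\<in>{0..T}. norm (y t - x t) \<le> 2 * (M * (\<rho> * (r0 + 1))) * exp (2 * M * (c + 1 + 2 * L) * T))"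
    proof (rule csol_near_approximate_solution[OF T C' _ _ L cx b(1), where A = A])
      show "norm (C' t) \<le> c + 1" if "t \<in> {0..T}" for t
        using d b(2)[OF that] \<rho>(2) that norm_triangle_ineq2[of "C' t" "C t"] by force
      show "((\<lambda>s. S (t - s) \<triangleright> (C' s \<triangleright> x s + N (x s))) has_integral x t - A t) {0..t}" if "t \<in> {0..T}" for t
        using hk[OF that] by (simp add: k_def)
      show "norm (S t \<triangleright> a - A t) \<le> M * (\<rho> * (r0 + 1))" if t: "t \<in> {0..T}" for t
      proof -
        have "((\<lambda>s. S (t - s) \<triangleright> (k s - (C s \<triangleright> x s + N (x s)))) has_integral (x t - A t) - (x t - S t \<triangleright> a)) {0..t}"
          using has_integral_diff[OF hk[OF t], of "\<lambda>s. S (t - s) \<triangleright> (C s \<triangleright> x s + N (x s))" "x t - S t \<triangleright> a"] x t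
          by (simp add: mild_def)
        moreover have "((\<lambda>s. \<rho> * (r0 + 1)) has_integral (\<rho> * (r0 + 1) * t)) {0..t}"
          using has_integral_const_real[of "\<rho> * (r0 + 1)" 0 t] t by (simp add: mult.commute)
        moreover have "norm (k s - (C s \<triangleright> x s + N (x s))) \<le> \<rho> * (r0 + 1)" if "s \<in> {0..t}" for s
        proof -
          have "k s - (C s \<triangleright> x s + N (x s)) = (C' s - C s) \<triangleright> x s" by (simp add: k_def)
          also have "norm \<dots> \<le> norm (C' s - C s) * norm (x s)" by (rule norm_app)
          also have "\<dots> \<le> \<rho> * (r0 + 1)" using d b(1)[of s] that t \<rho> by (intro mult_mono) auto
          finally show ?thesis .
        qed
        ultimately have "norm ((x t - A t) - (x t - S t \<triangleright> a)) \<le> M * (\<rho> * (r0 + 1) * t)"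
          using t T by (intro norm_duhamel_le[where h = "\<lambda>s. k s - (C s \<triangleright> x s + N (x s))"]) auto
        also have "\<dots> \<le> M * (\<rho> * (r0 + 1))"
          using M_pos \<rho> r0 t T by (intro mult_left_mono) (auto simp: mult_left_le)
        finally show ?thesis by simp
      qed
      show "r0 + 2 * (M * (\<rho> * (r0 + 1))) * exp (2 * M * (c + 1 + 2 * L) * T) \<le> r0 + 1" unfolding eq using small by linarith
    qed (use r0 in auto)
    then obtain y where y: "csol C' a T y" "\<forall>t\<in>{0..T}. norm (y t - x t) \<le> \<rho> * E"
      unfolding eq by blast
    have "norm (y T - x T) \<le> \<rho> * E" using y(2) T by simp
    then show "\<exists>y. csol C' a T y \<and> norm (y T - x T) < e" using y(1) small by (intro exI[of _ y]) linarith
  qed (rule \<rho>)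
qed

text \<open>The hypothesis \<open>norm a \<le> \<rho>\<close> keeps the solution in the ball of radius 2.\<close>

lemma csol_free_small:
  assumes NB: "0 \<le> NB" "\<And>x. norm (N x) \<le> NB * norm x ^ p" and p: "1 \<le> p"
  shows "\<exists>K \<rho>. 0 < \<rho> \<and> 0 \<le> K \<and> (\<forall>a T. 0 \<le> T \<longrightarrow> T \<le> 1 \<longrightarrow> norm a \<le> \<rho> \<longrightarrow>
    (\<exists>y. csol (\<lambda>_. 0) a T y \<and> norm (y T - S T \<triangleright> a) \<le> K * norm a ^ p))"
proof -
  obtain L where L: "0 < L" "\<And>x y. norm x \<le> 2 \<Longrightarrow> norm y \<le> 2 \<Longrightarrow> norm (N x - N y) \<le> L * norm (x - y)"
    using lipschitz_on_ballsE[OF N] by metis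
  define E where "E = exp (2 * M * (2 * L))"
  define K where "K = 2 * (M * (NB * M ^ p)) * E"
  have K0: "0 \<le> K" using M_pos NB by (simp add: K_def E_def)
  \<comment> \<open>The two bounds give M |a| \<le> 1, so that the free flow stays in the unit ball,
    and K |a|^p \<le> 1, so that the correction has norm at most 1.\<close>
  define \<rho> where "\<rho> = min (1 / M) (1 / (K + 1))"
  have \<rho>: "0 < \<rho>" "M * \<rho> \<le> 1" "K * \<rho> \<le> 1" "\<rho> \<le> 1"
  proof -
    show "0 < \<rho>" using M_pos K0 by (simp add: \<rho>_def)
    have "M * \<rho> \<le> M * (1 / M)" using M_pos by (intro mult_left_mono) (auto simp: \<rho>_def)
    then show "M * \<rho> \<le> 1" using M_pos by simp
    have "K * \<rho> \<le> K * (1 / (K + 1))" using K0 by (intro mult_left_mono) (auto simp: \<rho>_def)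
    also have "\<dots> \<le> 1" using K0 by (simp add: divide_le_eq)
    finally show "K * \<rho> \<le> 1" .
    have "\<rho> \<le> 1 / M" by (simp add: \<rho>_def)
    also have "\<dots> \<le> 1" using M_pos by simp
    finally show "\<rho> \<le> 1" .
  qed
  show ?thesis
  proof (rule exI[of _ K], rule exI[of _ \<rho>], intro conjI allI impI K0 \<rho>(1))
    fix a :: 'a and T :: real assume T: "0 \<le> T" "T \<le> 1" and a: "norm a \<le> \<rho>"
    define \<eta> where "\<eta> = M * (NB * (M * norm a) ^ p)"
    have \<eta>0: "0 \<le> \<eta>" using M_pos NB by (simp add: \<eta>_def)
    define z where "z t = S t \<triangleright> a" for t
    have zb: "norm (z t) \<le> M * norm a" if "t \<in> {0..T}" for t
      unfolding z_def using that T by (intro norm_S_app_le) auto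
    have Ma: "M * norm a \<le> 1"
    proof -
      have "M * norm a \<le> M * \<rho>" using a M_pos by (intro mult_left_mono) auto
      then show ?thesis using \<rho>(2) by linarith
    qed
    have cz: "continuous_on {0..T} z" unfolding z_def by (rule continuous_on_subset[OF S_strong]) auto
    have cN: "continuous_on {0..T} (\<lambda>t. N (z t))" by (rule continuous_on_N[OF cz])
    define A where "A t = z t - integral {0..t} (\<lambda>s. S (t - s) \<triangleright> N (z s))" for t
    have hk: "((\<lambda>s. S (t - s) \<triangleright> N (z s)) has_integral z t - A t) {0..t}" if "t \<in> {0..T}" for t
      using integrable_integral[OF duhamel_integrable[OF cN that T(2)]] by (simp add: A_def)
    have exp_le: "exp (2 * M * (0 + 2 * L) * T) \<le> E"
      unfolding E_def using M_pos L(1) T by (simp add: mult_left_le)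
    have le: "2 * \<eta> * exp (2 * M * (0 + 2 * L) * T) \<le> K * norm a ^ p"
    proof -
      have "2 * \<eta> * exp (2 * M * (0 + 2 * L) * T) \<le> 2 * \<eta> * E" using \<eta>0 by (intro mult_left_mono exp_le) auto
      also have "\<dots> = K * norm a ^ p" by (simp add: \<eta>_def K_def power_mult_distrib)
      finally show ?thesis .
    qed
    have le1: "K * norm a ^ p \<le> 1"
    proof -
      have "norm a ^ p \<le> norm a" using p power_decreasing[of 1 p "norm a"] a \<rho>(4) by simp
      then have "norm a ^ p \<le> \<rho>" using a by linarith
      then have "K * norm a ^ p \<le> K * \<rho>" using K0 by (rule mult_left_mono)
      then show ?thesis using \<rho>(3) by linarith
    qed
    have "\<exists>y. csol (\<lambda>_. 0) a T y \<and> (\<forall>t\<in>{0..T}. norm (y t - z t) \<le> 2 * \<eta> * exp (2 * M * (0 + 2 * L) * T))"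
    proof (rule csol_near_approximate_solution[where C = "\<lambda>_. 0" and c = 0 and r = 2 and L = L and z = z and A = A and r0 = 1 and \<eta> = \<eta>])
      show "((\<lambda>s. S (t - s) \<triangleright> (0 \<triangleright> z s + N (z s))) has_integral z t - A t) {0..t}" if "t \<in> {0..T}" for t
        using hk[OF that] by simp
      show "norm (z t) \<le> 1" if "t \<in> {0..T}" for t using zb[OF that] Ma by linarith
      show "norm (S t \<triangleright> a - A t) \<le> \<eta>" if t: "t \<in> {0..T}" for t
      proof -
        have "((\<lambda>s. NB * (M * norm a) ^ p) has_integral (NB * (M * norm a) ^ p * t)) {0..t}"
          using has_integral_const_real[of "NB * (M * norm a) ^ p" 0 t] t by (simp add: mult.commute)
        moreover have "norm (N (z s)) \<le> NB * (M * norm a) ^ p" if "s \<in> {0..t}" for s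
          using zb[of s] that t NB(1) by (intro order_trans[OF NB(2)] mult_left_mono power_mono) auto
        ultimately have "norm (z t - A t) \<le> M * (NB * (M * norm a) ^ p * t)"
          using hk[OF t] t T by (intro norm_duhamel_le) auto
        also have "\<dots> \<le> \<eta>" unfolding \<eta>_def using M_pos NB(1) t T
          by (intro mult_left_mono) (auto simp: mult_left_le)
        finally show ?thesis by (simp add: z_def)
      qed
      show "1 + 2 * \<eta> * exp (2 * M * (0 + 2 * L) * T) \<le> 2" using le le1 by linarith
    qed (use T L cz in auto)
    then obtain y where y: "csol (\<lambda>_. 0) a T y" "\<forall>t\<in>{0..T}. norm (y t - z t) \<le> 2 * \<eta> * exp (2 * M * (0 + 2 * L) * T)"
      by blast
    have "norm (y T - z T) \<le> 2 * \<eta> * exp (2 * M * (0 + 2 * L) * T)" using y(2) T by auto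
    then have "norm (y T - S T \<triangleright> a) \<le> K * norm a ^ p" using le by (simp add: z_def)
    then show "\<exists>y. csol (\<lambda>_. 0) a T y \<and> norm (y T - S T \<triangleright> a) \<le> K * norm a ^ p" using y(1) by blast
  qed
qed

text \<open>A large control \<open>\<omega>(t / d) / d\<close> acting for the short time \<open>d\<close>, with \<open>\<omega>(x) = 6 x (1 - x)\<close>
  of unit mass; the approximate solution is \<open>exp (\<Theta>(t) C) a\<close> with \<open>\<Theta>' = \<omega>\<close>.\<close>

lemma csol_impulse:
  fixes C :: "'a blinop"
  assumes e: "0 < e" and \<T>: "0 < \<T>"
  shows "\<exists>d. 0 < d \<and> d < \<T> \<and> d \<le> 1 \<and>
    (\<exists>y. csol (\<lambda>t. (6 * (t / d) * (1 - t / d) / d) *\<^sub>R C) a d y \<and> norm (y d - exp C \<triangleright> a) < e)"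
proof -
  define w where "w l = exp (l *\<^sub>R C) \<triangleright> a" for l :: real
  have w': "((\<lambda>l. w l) has_vector_derivative C \<triangleright> w l) (at l within X)" for l X
    using bounded_linear.has_vector_derivative[OF app.bounded_linear_left
        has_vector_derivative_at_within[OF exp_scaleR_has_vector_derivative_left[of C l]], of a X]
    by (simp add: w_def)
  have cw: "continuous_on X w" for X
    unfolding continuous_on_eq_continuous_within using has_vector_derivative_continuous[OF w'] by blast
  have "bounded (w ` {0..1})" "bounded ((\<lambda>l. N (w l)) ` {0..1})"
    by (auto intro!: compact_imp_bounded compact_continuous_image cw continuous_on_N)
  then obtain r0 n0 where b: "\<And>l. l \<in> {0..1} \<Longrightarrow> norm (w l) \<le> r0" "\<And>l. l \<in> {0..1} \<Longrightarrow> norm (N (w l)) \<le> n0"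
    by (fastforce simp: bounded_iff)
  have r0: "0 \<le> r0" using order_trans[OF norm_ge_zero b(1)[of 0]] by simp
  have n0: "0 \<le> n0" using order_trans[OF norm_ge_zero b(2)[of 0]] by simp
  obtain L where L: "0 < L" "\<And>x y. norm x \<le> r0 + 1 \<Longrightarrow> norm y \<le> r0 + 1 \<Longrightarrow> norm (N x - N y) \<le> L * norm (x - y)"
    using lipschitz_on_ballsE[OF N] by metis
  \<comment> \<open>During a pulse of length d the control has norm at most (3/2) |C| / d, so its
    product with d does not depend on d; 3/2 is the maximum of 6 x (1 - x).\<close>
  define E where "E = exp (2 * M * (3/2 * norm C + 2 * L))"
  have E: "E > 0" by (simp add: E_def)
  \<comment> \<open>The defect will be 3\<kappa>; the factor 8 makes twice the defect times
    \<open>E\<close> equal to 3/4 of \<open>min 1 e\<close>.\<close>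
  define \<kappa> where "\<kappa> = min 1 e / (8 * E)"
  have \<kappa>: "0 < \<kappa>" using e E by (simp add: \<kappa>_def)
  \<comment> \<open>strong continuity of the semigroup is uniform on the compact curve \<open>w\<close>\<close>
  have "continuous_on ({0..1} \<times> {0..1}) (\<lambda>p. S (fst p) \<triangleright> C \<triangleright> w (snd p))"
    by (rule continuous_on_S_app) (auto intro!: continuous_intros continuous_on_compose2[OF cw[of UNIV]])
  then have "uniformly_continuous_on ({0..1} \<times> {0..1}) (\<lambda>p. S (fst p) \<triangleright> C \<triangleright> w (snd p))"
    by (intro compact_uniformly_continuous compact_Times) auto
  then obtain d1 where d1: "0 < d1" "\<And>p q. p \<in> {0..1} \<times> {0..1} \<Longrightarrow> q \<in> {0..1} \<times> {0..1} \<Longrightarrow> dist p q < d1 \<Longrightarrow>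
      dist (S (fst p) \<triangleright> C \<triangleright> w (snd p)) (S (fst q) \<triangleright> C \<triangleright> w (snd q)) < \<kappa>"
    unfolding uniformly_continuous_on_def using \<kappa> by metis
  have "continuous_on {0..1} (\<lambda>t. S t \<triangleright> a)" by (rule continuous_on_subset[OF S_strong]) auto
  then have "uniformly_continuous_on {0..1} (\<lambda>t. S t \<triangleright> a)" by (intro compact_uniformly_continuous) auto
  then obtain d2 where d2: "0 < d2" "\<And>p q. p \<in> {0..1} \<Longrightarrow> q \<in> {0..1} \<Longrightarrow> dist p q < d2 \<Longrightarrow>
      dist (S p \<triangleright> a) (S q \<triangleright> a) < \<kappa>"
    unfolding uniformly_continuous_on_def using \<kappa> by metis
  \<comment> \<open>\<open>d1\<close> and \<open>d2\<close> make the semigroup close to the identity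
    on the curve \<open>C \<triangleright> w l\<close> and on \<open>a\<close>; the last entry keeps
    the contribution of the nonlinearity below \<kappa>.\<close>
  define d where "d = Min {1, \<T> / 2, d1 / 2, d2 / 2, \<kappa> / (M * (n0 + 1))}"
  have dd: "0 < d" "d \<le> 1" "d < \<T>" "d < d1" "d < d2" "d \<le> \<kappa> / (M * (n0 + 1))"
  proof -
    have pos: "0 < \<kappa> / (M * (n0 + 1))" using \<kappa> M_pos n0 by simp
    show "0 < d" unfolding d_def using pos \<T> d1(1) d2(1) by simp
    have "d \<le> \<T> / 2" "d \<le> d1 / 2" "d \<le> d2 / 2" unfolding d_def by (rule Min_le; simp)+
    then show "d < \<T>" "d < d1" "d < d2" using \<T> d1(1) d2(1) by linarith+
  qed (auto simp: d_def)
  define \<omega> where "\<omega> t = 6 * (t / d) * (1 - t / d) / d" for t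
  \<comment> \<open>The antiderivative 3 x^2 - 2 x^3 of 6 x (1 - x), rising from 0 to 1.\<close>
  define \<Theta> where "\<Theta> t = 3 * (t / d)\<^sup>2 - 2 * (t / d) ^ 3" for t
  have \<Theta>': "(\<Theta> has_vector_derivative \<omega> t) (at t within X)" for t X
    unfolding \<Theta>_def[abs_def] \<omega>_def has_real_derivative_iff_has_vector_derivative[symmetric]
    using dd(1) by (auto intro!: derivative_eq_intros simp: field_simps power2_eq_square power3_eq_cube)
  have \<omega>: "0 \<le> \<omega> t" "\<omega> t \<le> 3/2 / d" if "t \<in> {0..d}" for t
  proof -
    have x: "0 \<le> t / d" "t / d \<le> 1" using that dd(1) by (simp_all add: divide_le_eq)
    show "0 \<le> \<omega> t" unfolding \<omega>_def by (rule divide_nonneg_pos) (use x dd(1) in \<open>simp_all only: mult_nonneg_nonneg zero_le_numeral diff_ge_0_iff_ge\<close>)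
    have "6 * x * (1 - x) \<le> 3/2" for x :: real
      using zero_le_power2[of "x - 1/2"] by (simp add: power2_eq_square algebra_simps)
    from this[of "t / d"] show "\<omega> t \<le> 3/2 / d" unfolding \<omega>_def using dd(1) by (intro divide_right_mono) auto
  qed
  have \<Theta>: "\<Theta> t \<in> {0..1}" if "t \<in> {0..d}" for t
  proof -
    have x: "0 \<le> t / d" "t / d \<le> 1" using that dd(1) by (simp_all add: divide_le_eq)
    have p: "3 * x\<^sup>2 - 2 * x ^ 3 = x\<^sup>2 * (3 - 2 * x)" "1 - (3 * x\<^sup>2 - 2 * x ^ 3) = (1 - x)\<^sup>2 * (1 + 2 * x)" for x :: real
      by (simp_all add: power2_eq_square power3_eq_cube algebra_simps)
    have "\<Theta> t = (t / d)\<^sup>2 * (3 - 2 * (t / d))" unfolding \<Theta>_def by (rule p)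
    moreover have "1 - \<Theta> t = (1 - t / d)\<^sup>2 * (1 + 2 * (t / d))" unfolding \<Theta>_def by (rule p)
    moreover have "0 \<le> (t / d)\<^sup>2 * (3 - 2 * (t / d))" "0 \<le> (1 - t / d)\<^sup>2 * (1 + 2 * (t / d))"
      using x by (auto intro!: mult_nonneg_nonneg)
    ultimately show ?thesis by auto
  qed
  have \<Theta>0: "\<Theta> 0 = 0" and \<Theta>d: "\<Theta> d = 1" using dd(1) by (simp_all add: \<Theta>_def)
  have c\<Theta>: "continuous_on X \<Theta>" and c\<omega>: "continuous_on X \<omega>" for X
    unfolding \<Theta>_def[abs_def] \<omega>_def[abs_def] using dd(1) by (auto intro!: continuous_intros)
  define z where "z t = w (\<Theta> t)" for t
  have cz: "continuous_on X z" for X unfolding z_def by (rule continuous_on_compose2[OF cw[of UNIV] c\<Theta>]) auto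
  have z': "(z has_vector_derivative \<omega> t *\<^sub>R (C \<triangleright> z t)) (at t within X)" for t X
    unfolding z_def using vector_diff_chain_within[OF \<Theta>', of w "C \<triangleright> w (\<Theta> t)" t X, OF w'] by (simp add: o_def)
  define h where "h t = \<omega> t *\<^sub>R (C \<triangleright> z t)" for t
  have ch: "continuous_on X h" for X unfolding h_def by (intro continuous_intros c\<omega> cz)
  have zint: "(h has_integral z t - a) {0..t}" if "t \<in> {0..d}" for t
    using fundamental_theorem_of_calculus[of 0 t z h] z' that by (simp add: h_def z_def w_def \<Theta>0)
  define k where "k t = (\<omega> t *\<^sub>R C) \<triangleright> z t + N (z t)" for t
  have ck: "continuous_on {0..d} k" unfolding k_def by (intro continuous_intros c\<omega> cz continuous_on_N)
  define A where "A t = z t - integral {0..t} (\<lambda>s. S (t - s) \<triangleright> k s)" for t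
  have hk: "((\<lambda>s. S (t - s) \<triangleright> k s) has_integral z t - A t) {0..t}" if "t \<in> {0..d}" for t
    using integrable_integral[OF duhamel_integrable[OF ck that dd(2)]] by (simp add: A_def)
  define \<eta> where "\<eta> = 3 * \<kappa>"
  \<comment> \<open>Three errors of size \<kappa>: the semigroup acting on the initial state, the
    semigroup acting on the control term, and the nonlinearity.\<close>
  have defect: "norm (S t \<triangleright> a - A t) \<le> \<eta>" if t: "t \<in> {0..d}" for t
  proof -
    have cN: "continuous_on {0..d} (\<lambda>s. N (z s))" by (intro continuous_on_N cz)
    obtain I where I: "((\<lambda>s. S (t - s) \<triangleright> N (z s)) has_integral I) {0..t}"
      using duhamel_integrable[OF cN t dd(2)] by blast
    have "((\<lambda>s. n0) has_integral (n0 * t)) {0..t}"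
      using has_integral_const_real[of n0 0 t] t by (simp add: mult.commute)
    moreover have "norm (N (z s)) \<le> n0" if "s \<in> {0..t}" for s
      unfolding z_def using that t by (intro b \<Theta>) auto
    ultimately have "norm I \<le> M * (n0 * t)" using I t dd by (intro norm_duhamel_le) auto
    also have "\<dots> \<le> M * (n0 + 1) * d" using t n0 M_pos dd(1) by (auto intro!: mult_left_mono mult_mono simp: mult.assoc)
    also have "\<dots> \<le> \<kappa>" using dd(6) M_pos n0 by (simp add: le_divide_eq mult.commute)
    finally have nI: "norm I \<le> \<kappa>" .
    have J: "((\<lambda>s. S (t - s) \<triangleright> h s) has_integral (z t - A t) - I) {0..t}"
      using has_integral_diff[OF hk[OF t] I] by (simp add: k_def h_def)
    have D: "((\<lambda>s. S (t - s) \<triangleright> h s - h s) has_integral ((z t - A t) - I) - (z t - a)) {0..t}"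
      by (rule has_integral_diff[OF J zint[OF t]])
    have "norm (((z t - A t) - I) - (z t - a)) \<le> integral {0..t} (\<lambda>s. \<kappa> * \<omega> s)"
      unfolding integral_unique[OF D, symmetric]
    proof (rule integral_norm_bound_integral)
      show "(\<lambda>s. S (t - s) \<triangleright> h s - h s) integrable_on {0..t}" using D by blast
      show "(\<lambda>s. \<kappa> * \<omega> s) integrable_on {0..t}" by (intro integrable_continuous_real continuous_intros c\<omega>)
      fix s assume s: "s \<in> {0..t}"
      have "dist (S (t - s) \<triangleright> C \<triangleright> z s) (S 0 \<triangleright> C \<triangleright> z s) < \<kappa>"
        using d1(2)[of "(t - s, \<Theta> s)" "(0, \<Theta> s)"] s t dd \<Theta>[of s] by (auto simp: dist_Pair_Pair z_def dist_real_def)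
      then have "\<omega> s * norm (S (t - s) \<triangleright> C \<triangleright> z s - C \<triangleright> z s) \<le> \<omega> s * \<kappa>"
        using \<omega>(1)[of s] s t by (intro mult_left_mono) (auto simp: dist_norm)
      moreover have "norm (S (t - s) \<triangleright> h s - h s) = \<omega> s * norm (S (t - s) \<triangleright> C \<triangleright> z s - C \<triangleright> z s)"
        using \<omega>(1)[of s] s t by (simp add: h_def flip: scaleR_right_diff_distrib)
      ultimately show "norm (S (t - s) \<triangleright> h s - h s) \<le> \<kappa> * \<omega> s" by (simp add: mult.commute)
    qed
    also have "(\<omega> has_integral \<Theta> t - \<Theta> 0) {0..t}" using fundamental_theorem_of_calculus[of 0 t \<Theta> \<omega>] \<Theta>' t by auto
    then have "integral {0..t} (\<lambda>s. \<kappa> * \<omega> s) = \<kappa> * \<Theta> t"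
      using integral_unique[OF has_integral_mult_right[of \<omega> "\<Theta> t - \<Theta> 0" _ \<kappa>]] by (simp add: \<Theta>0)
    also have "\<kappa> * \<Theta> t \<le> \<kappa>" using \<Theta>[OF t] \<kappa> by (simp add: mult_left_le)
    finally have nD: "norm (((z t - A t) - I) - (z t - a)) \<le> \<kappa>" .
    have "dist (S t \<triangleright> a) (S 0 \<triangleright> a) < \<kappa>" using t dd by (intro d2) (auto simp: dist_real_def)
    then have nS: "norm (S t \<triangleright> a - a) \<le> \<kappa>" by (simp add: dist_norm)
    have "S t \<triangleright> a - A t = (S t \<triangleright> a - a) + ((((z t - A t) - I) - (z t - a)) + I)" by simp
    also have "norm \<dots> \<le> \<kappa> + (\<kappa> + \<kappa>)"
      by (intro norm_triangle_mono nS nD nI)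
    finally show ?thesis by (simp add: \<eta>_def)
  qed
  define c where "c = 3/2 / d * norm C"
  have exp_le: "exp (2 * M * (c + 2 * L) * d) \<le> E"
  proof -
    have "(c + 2 * L) * d = 3/2 * norm C + 2 * L * d" using dd(1) by (simp add: c_def field_simps)
    also have "\<dots> \<le> 3/2 * norm C + 2 * L" using L(1) dd by (simp add: mult_left_le)
    finally have "2 * M * ((c + 2 * L) * d) \<le> 2 * M * (3/2 * norm C + 2 * L)" using M_pos by (intro mult_left_mono) auto
    then show ?thesis by (simp add: E_def mult.assoc)
  qed
  have small: "2 * \<eta> * exp (2 * M * (c + 2 * L) * d) < min 1 e"
  proof -
    have "2 * \<eta> * exp (2 * M * (c + 2 * L) * d) \<le> 2 * \<eta> * E" using \<kappa> by (intro mult_left_mono exp_le) (auto simp: \<eta>_def)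
    also have "\<dots> = 6 / 8 * min 1 e" using E by (simp add: \<eta>_def \<kappa>_def)
    also have "\<dots> < min 1 e" using e by (auto simp: min_def)
    finally show ?thesis .
  qed
  have "\<exists>y. csol (\<lambda>t. \<omega> t *\<^sub>R C) a d y \<and> (\<forall>t\<in>{0..d}. norm (y t - z t) \<le> 2 * \<eta> * exp (2 * M * (c + 2 * L) * d))"
  proof (rule csol_near_approximate_solution[where c = c and r = "r0 + 1" and L = L and z = z and A = A and r0 = r0 and \<eta> = \<eta>])
    show "continuous_on {0..d} (\<lambda>t. \<omega> t *\<^sub>R C)" by (intro continuous_intros c\<omega>)
    show "norm (\<omega> t *\<^sub>R C) \<le> c" if "t \<in> {0..d}" for t
      using \<omega>(1)[OF that] mult_right_mono[OF \<omega>(2)[OF that], of "norm C"] by (simp add: c_def)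
    show "norm (z t) \<le> r0" if "t \<in> {0..d}" for t unfolding z_def by (intro b \<Theta> that)
    show "((\<lambda>s. S (t - s) \<triangleright> ((\<omega> s *\<^sub>R C) \<triangleright> z s + N (z s))) has_integral z t - A t) {0..t}" if "t \<in> {0..d}" for t
      using hk[OF that] by (simp add: k_def)
    show "r0 + 2 * \<eta> * exp (2 * M * (c + 2 * L) * d) \<le> r0 + 1" using small by linarith
  qed (use dd r0 defect L cz in auto)
  then obtain y where y: "csol (\<lambda>t. \<omega> t *\<^sub>R C) a d y" "\<forall>t\<in>{0..d}. norm (y t - z t) \<le> 2 * \<eta> * exp (2 * M * (c + 2 * L) * d)"
    by blast
  have "norm (y d - z d) \<le> 2 * \<eta> * exp (2 * M * (c + 2 * L) * d)" using y(2) dd by auto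
  then have "norm (y d - exp C \<triangleright> a) < e" using small by (simp add: z_def w_def \<Theta>d)
  then show ?thesis using y(1) dd unfolding \<omega>_def by blast
qed

end

section \<open>Phases that can be reached along the controlled equation\<close>

context sobolev
begin

lemma ev_M_power: "ev (M a ^ n \<triangleright> b) x = ev a x ^ n * ev b x"
  by (induction n) (simp_all add: mult.assoc)

lemma norm_M_le: "norm (M a) \<le> onorm M * norm a"
  by (rule onorm[OF bounded_linear_M])

lemma onorm_M_nonneg: "0 \<le> onorm M"
  by (rule onorm_pos_le[OF bounded_linear_M])

end

text \<open>\<open>pot\<close> abstracts the map from a control vector to the potential that it
  generates.\<close>

locale gl_control = gl s dim V \<nu>
  for s :: nat and dim :: "'n::finite itself" and V \<nu> :: real +
  fixes \<mu> :: real and \<sigma> :: nat and pot :: "'q::real_normed_vector \<Rightarrow> (int ^ 'n) ell2"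
  assumes \<sigma>: "1 \<le> \<sigma>" and pot: "bounded_linear pot"
begin

text \<open>For integer \<sigma> the factor |\<psi>|^(2\<sigma>) is a power of \<psi> times its
  conjugate. The nonlinearity is thus a polynomial in operators that depend real-linearly on the
  state, and local Lipschitz continuity follows.\<close>

definition N :: "(int ^ 'n) ell2 \<Rightarrow> (int ^ 'n) ell2" where
  "N a = cs (- (1 + \<i> * of_real \<mu>)) \<triangleright> (M (conj_ell2 a) ^ \<sigma> * M a ^ \<sigma>) \<triangleright> a"

lemma ev_N: "ev (N a) x = - (1 + \<i> * of_real \<mu>) * of_real (cmod (ev a x) ^ (2 * \<sigma>)) * ev a x"
proof -
  have "complex_of_real (cmod (ev a x) ^ (2 * \<sigma>)) = (cnj (ev a x) * ev a x) ^ \<sigma>"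
    by (simp only: power_mult of_real_power mult.commute[of "cnj (ev a x)"] complex_norm_square[symmetric])
  then show ?thesis by (simp add: N_def ev_M_power power_mult_distrib)
qed

text \<open>Each of the 2\<sigma> multiplication operators is bounded linearly by the state. The
  resulting order 2\<sigma> + 1 at 0 makes the nonlinearity negligible on very small states.\<close>

lemma norm_N_le: "norm (N a) \<le> cmod (1 + \<i> * of_real \<mu>) * onorm M ^ (2 * \<sigma>) * norm a ^ (2 * \<sigma> + 1)"
proof -
  have p: "norm (M b ^ \<sigma>) \<le> (onorm M * norm b) ^ \<sigma>" for b
    by (rule order_trans[OF norm_power_ineq]) (intro power_mono norm_M_le norm_ge_zero)
  have "norm (N a) \<le> norm (cs (- (1 + \<i> * of_real \<mu>)) :: (int ^ 'n) ell2 blinop) * norm ((M (conj_ell2 a) ^ \<sigma> * M a ^ \<sigma>) \<triangleright> a)"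
    unfolding N_def by (rule norm_app)
  also have "\<dots> \<le> cmod (- (1 + \<i> * of_real \<mu>)) * (((onorm M * norm (conj_ell2 a)) ^ \<sigma> * (onorm M * norm a) ^ \<sigma>) * norm a)"
    by (intro mult_mono norm_cs_le order_trans[OF norm_app] mult_right_mono order_trans[OF norm_mult_ineq] p
        mult_nonneg_nonneg zero_le_power onorm_M_nonneg norm_ge_zero)
  also have "\<dots> = cmod (- (1 + \<i> * of_real \<mu>)) * onorm M ^ (2 * \<sigma>) * norm a ^ (2 * \<sigma> + 1)"
  proof -
    have "x ^ (2 * \<sigma>) = x ^ \<sigma> * x ^ \<sigma>" for x :: real by (simp add: mult_2 power_add)
    then show ?thesis by (simp only: power_add power_one_right power_mult_distrib norm_conj_ell2 mult_ac)
  qed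
  finally show ?thesis by (simp only: norm_minus_cancel)
qed

sublocale semilinear S "exp V" N
proof
  have "lipschitz_on_balls (\<lambda>a. M (conj_ell2 a) ^ \<sigma>)" "lipschitz_on_balls (\<lambda>a. M a ^ \<sigma>)"
    by (intro lipschitz_on_balls_power lipschitz_on_balls_linear bounded_linear_M
      bounded_linear_compose[OF bounded_linear_M bounded_linear_conj_ell2])+
  then show "lipschitz_on_balls N"
    unfolding N_def[abs_def]
    by (intro lipschitz_on_balls_bilinear[OF bounded_bilinear_app] lipschitz_on_balls_const
        lipschitz_on_balls_bilinear[OF bounded_bilinear_mult] lipschitz_on_balls_linear[OF bounded_linear_ident])
qed

definition act :: "(int ^ 'n) ell2 \<Rightarrow> (int ^ 'n) ell2 blinop" where
  "act g = M (cs Z \<triangleright> g)"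

lemma bounded_linear_act: "bounded_linear act"
  unfolding act_def[abs_def] by (rule bounded_linear_compose[OF bounded_linear_M bounded_linear_app])

lemmas act_linear = bounded_linear.linear[OF bounded_linear_act]

lemma ev_exp_act [simp]: "ev (exp (act g) \<triangleright> a) x = exp (Z * ev g x) * ev a x"
  by (simp add: act_def)

lemma exp_act_add: "exp (act (g + h)) \<triangleright> a = exp (act h) \<triangleright> exp (act g) \<triangleright> a"
  by (rule ev_eqI) (simp add: distrib_left exp_add mult_ac)

lemma bounded_linear_act_pot: "bounded_linear (\<lambda>c. act (pot c))"
  by (rule bounded_linear_compose[OF bounded_linear_act pot])

text \<open>Controls that vanish at both ends can be concatenated continuously.\<close>

definition near_reach :: "(int ^ 'n) ell2 \<Rightarrow> (int ^ 'n) ell2 \<Rightarrow> real \<Rightarrow> bool" where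
  "near_reach a b \<T> \<longleftrightarrow> (\<forall>e>0. \<exists>T u x. 0 < T \<and> T < \<T> \<and> continuous_on {0..T} u \<and> u 0 = 0 \<and> u T = 0 \<and>
     csol (\<lambda>t. act (pot (u t))) a T x \<and> norm (x T - b) < e)"

lemma continuous_on_act_pot: "continuous_on X u \<Longrightarrow> continuous_on X (\<lambda>t. act (pot (u t)))"
  by (rule bounded_linear.continuous_on[OF bounded_linear_act_pot])

text \<open>The later leg is fixed first; its stability under perturbation of the initial state
  gives the accuracy \<rho> to which the earlier leg must hit \<open>b\<close>. A total time of at
  most 1 keeps within the range of the stability estimate.\<close>

lemma near_reach_trans:
  assumes ab: "near_reach a b T1" and bc: "near_reach b c T2" and le: "T1 + T2 \<le> 1"
  shows "near_reach a c (T1 + T2)"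
  unfolding near_reach_def
proof (intro allI impI)
  fix e :: real assume e: "0 < e"
  obtain t2 u2 x2 where 2: "0 < t2" "t2 < T2" "continuous_on {0..t2} u2" "u2 0 = 0" "u2 t2 = 0"
    "csol (\<lambda>t. act (pot (u2 t))) b t2 x2" "norm (x2 t2 - c) < e / 2"
    using bc e unfolding near_reach_def by (meson half_gt_zero)
  have T1: "0 < T1" using ab unfolding near_reach_def by (meson less_trans zero_less_one)
  obtain \<rho> where \<rho>: "0 < \<rho>" "\<And>a'. norm (a' - b) < \<rho> \<Longrightarrow> \<exists>y. csol (\<lambda>t. act (pot (u2 t))) a' t2 y \<and> norm (y t2 - x2 t2) < e / 2"
    using csol_perturb_initial[OF _ _ continuous_on_act_pot[OF 2(3)] 2(6), of "e / 2"] 2 T1 le e by auto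
  obtain t1 u1 x1 where 1: "0 < t1" "t1 < T1" "continuous_on {0..t1} u1" "u1 0 = 0" "u1 t1 = 0"
    "csol (\<lambda>t. act (pot (u1 t))) a t1 x1" "norm (x1 t1 - b) < \<rho>"
    using ab \<rho>(1) unfolding near_reach_def by meson
  obtain y where y: "csol (\<lambda>t. act (pot (u2 t))) (x1 t1) t2 y" "norm (y t2 - x2 t2) < e / 2"
    using \<rho>(2)[OF 1(7)] by blast
  define u where "u t = (if t \<le> t1 then u1 t else u2 (t - t1))" for t
  define x where "x t = (if t \<le> t1 then x1 t else y (t - t1))" for t
  have u2: "u t = u2 (t - t1)" if "t1 \<le> t" for t using that 1(5) 2(4) by (auto simp: u_def)
  have "continuous_on ({0..t1} \<union> {t1..t1 + t2}) u"
  proof (rule continuous_on_closed_Un)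
    show "continuous_on {0..t1} u" by (rule continuous_on_eq[OF 1(3)]) (simp add: u_def)
    have "continuous_on {t1..t1+t2} (\<lambda>t. u2 (t - t1))"
      by (rule continuous_on_compose2[OF 2(3)]) (auto intro!: continuous_intros)
    then show "continuous_on {t1..t1+t2} u" by (rule continuous_on_eq) (simp add: u2)
  qed auto
  then have cu: "continuous_on {0..t1 + t2} u" using 1(1) 2(1) by (simp add: ivl_disj_un_two_touch(4))
  have "mild (\<lambda>t. if t \<le> t1 then (\<lambda>x. act (pot (u1 t)) \<triangleright> x + N x) else (\<lambda>x. act (pot (u2 (t - t1))) \<triangleright> x + N x)) a (t1 + t2) x"
    unfolding x_def[abs_def] using 1 2 y by (intro mild_concat) auto
  also have "(\<lambda>t. if t \<le> t1 then (\<lambda>x. act (pot (u1 t)) \<triangleright> x + N x) else (\<lambda>x. act (pot (u2 (t - t1))) \<triangleright> x + N x))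
      = (\<lambda>t x. act (pot (u t)) \<triangleright> x + N x)" by (auto simp: u_def fun_eq_iff)
  finally have cx: "csol (\<lambda>t. act (pot (u t))) a (t1 + t2) x" .
  have "norm (x (t1 + t2) - c) < e"
  proof -
    have "x (t1 + t2) = y t2" using 2(1) by (simp add: x_def)
    moreover have "norm (y t2 - c) \<le> norm (y t2 - x2 t2) + norm (x2 t2 - c)"
      using norm_triangle_ineq[of "y t2 - x2 t2" "x2 t2 - c"] by simp
    ultimately show ?thesis using y(2) 2(7) by simp
  qed
  moreover have "u 0 = 0" "u (t1 + t2) = 0" using 1 2 by (simp_all add: u_def)
  ultimately show "\<exists>T u x. 0 < T \<and> T < T1 + T2 \<and> continuous_on {0..T} u \<and> u 0 = 0 \<and> u T = 0 \<and>
     csol (\<lambda>t. act (pot (u t))) a T x \<and> norm (x T - c) < e"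
    using cu cx 1 2 by (intro exI[of _ "t1 + t2"] exI[of _ u] exI[of _ x]) auto
qed

lemma near_reach_closed:
  assumes "\<And>e. 0 < e \<Longrightarrow> \<exists>c. near_reach a c \<T> \<and> norm (c - b) < e"
  shows "near_reach a b \<T>"
  unfolding near_reach_def
proof (intro allI impI)
  fix e :: real assume e: "0 < e"
  obtain c where c: "near_reach a c \<T>" "norm (c - b) < e / 2" using assms[of "e / 2"] e by auto
  obtain T u x where 1: "0 < T" "T < \<T>" "continuous_on {0..T} u" "u 0 = 0" "u T = 0"
    "csol (\<lambda>t. act (pot (u t))) a T x" "norm (x T - c) < e / 2"
    using c(1) e unfolding near_reach_def by (meson half_gt_zero)
  have "norm (x T - b) \<le> norm (x T - c) + norm (c - b)"
    using norm_triangle_ineq[of "x T - c" "c - b"] by simp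
  then have "norm (x T - b) < e" using 1(7) c(2) by linarith
  then show "\<exists>T u x. 0 < T \<and> T < \<T> \<and> continuous_on {0..T} u \<and> u 0 = 0 \<and> u T = 0 \<and>
     csol (\<lambda>t. act (pot (u t))) a T x \<and> norm (x T - b) < e"
    using 1 by blast
qed

lemma near_reach_free:
  assumes "0 < T" "T < \<T>" "csol (\<lambda>_. 0) a T x"
  shows "near_reach a (x T) \<T>"
  unfolding near_reach_def
proof (intro allI impI)
  fix e :: real assume "0 < e"
  then show "\<exists>T' u y. 0 < T' \<and> T' < \<T> \<and> continuous_on {0..T'} u \<and> u 0 = 0 \<and> u T' = 0 \<and>
     csol (\<lambda>t. act (pot (u t))) a T' y \<and> norm (y T' - x T) < e"
    using assms linear_0[OF bounded_linear.linear[OF bounded_linear_act_pot]]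
    by (intro exI[of _ T] exI[of _ "\<lambda>_. 0"] exI[of _ x]) auto
qed

text \<open>Quantified over all initial states and arbitrarily short times, so that phases can be
  composed: the second may start wherever the first ends, and each takes a share of the
  time.\<close>

definition reach :: "(int ^ 'n) ell2 \<Rightarrow> bool" where
  "reach g \<longleftrightarrow> (\<forall>a \<T>. 0 < \<T> \<longrightarrow> \<T> \<le> 1 \<longrightarrow> near_reach a (exp (act g) \<triangleright> a) \<T>)"

lemma reach_add:
  assumes "reach g" "reach h"
  shows "reach (g + h)"
  unfolding reach_def
proof (intro allI impI)
  fix a \<T> assume \<T>: "0 < \<T>" "\<T> \<le> (1::real)"
  have "near_reach a (exp (act g) \<triangleright> a) (\<T> / 2)" "near_reach (exp (act g) \<triangleright> a) (exp (act h) \<triangleright> exp (act g) \<triangleright> a) (\<T> / 2)"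
    using assms \<T> by (auto simp: reach_def)
  from near_reach_trans[OF this] show "near_reach a (exp (act (g + h)) \<triangleright> a) \<T>"
    using \<T> by (simp add: exp_act_add)
qed

text \<open>For a fixed state the multiplied state depends continuously on the phase.\<close>

lemma reach_closed:
  assumes "\<And>e. 0 < e \<Longrightarrow> \<exists>h. reach h \<and> norm (h - g) < e"
  shows "reach g"
  unfolding reach_def
proof (intro allI impI near_reach_closed)
  fix a \<T> and e :: real assume \<T>: "0 < \<T>" "\<T> \<le> (1::real)" and e: "0 < e"
  have "continuous_on UNIV (\<lambda>g. exp (act g) \<triangleright> a)"
    unfolding act_def by (intro continuous_intros continuous_on_exp_M)
  then obtain d where d: "0 < d" "\<And>h. dist h g < d \<Longrightarrow> dist (exp (act h) \<triangleright> a) (exp (act g) \<triangleright> a) < e"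
    unfolding continuous_on_iff using e by (metis UNIV_I)
  obtain h where h: "reach h" "norm (h - g) < d" using assms[OF d(1)] by blast
  then show "\<exists>c. near_reach a c \<T> \<and> norm (c - exp (act g) \<triangleright> a) < e"
    using d(2)[of h] \<T> by (intro exI[of _ "exp (act h) \<triangleright> a"]) (auto simp: reach_def dist_norm)
qed

text \<open>The pulse profile of \<open>csol_impulse\<close> vanishes at both ends of [0,d], as
  concatenation requires.\<close>

lemma reach_pot: "reach (pot c)"
  unfolding reach_def
proof (intro allI impI)
  fix a \<T> assume \<T>: "0 < \<T>" "\<T> \<le> (1::real)"
  show "near_reach a (exp (act (pot c)) \<triangleright> a) \<T>"
    unfolding near_reach_def
  proof (intro allI impI)
    fix e :: real assume e: "0 < e"
    obtain d y where d: "0 < d" "d < \<T>"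
      and y: "csol (\<lambda>t. (6 * (t / d) * (1 - t / d) / d) *\<^sub>R act (pot c)) a d y" "norm (y d - exp (act (pot c)) \<triangleright> a) < e"
      using csol_impulse[OF e \<T>(1), of "act (pot c)" a] by blast
    define u where "u t = (6 * (t / d) * (1 - t / d) / d) *\<^sub>R c" for t
    have "act (pot (u t)) = (6 * (t / d) * (1 - t / d) / d) *\<^sub>R act (pot c)" for t
      unfolding u_def by (rule linear_scale[OF bounded_linear.linear[OF bounded_linear_act_pot]])
    moreover have "continuous_on {0..d} u" unfolding u_def using d(1) by (auto intro!: continuous_intros)
    moreover have "u 0 = 0" "u d = 0" using d(1) by (simp_all add: u_def)
    ultimately show "\<exists>T u x. 0 < T \<and> T < \<T> \<and> continuous_on {0..T} u \<and> u 0 = 0 \<and> u T = 0 \<and>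
       csol (\<lambda>t. act (pot (u t))) a T x \<and> norm (x T - exp (act (pot c)) \<triangleright> a) < e"
      using d y by (intro exI[of _ d] exI[of _ u] exI[of _ y]) auto
  qed
qed

definition one :: "(int ^ 'n) ell2" where "one = single 0 1"

lemma ev_one [simp]: "ev one x = 1" by (simp add: one_def)

lemma translate_one: "translate h \<triangleright> one = one" by (rule ev_eqI) simp

lemma exp_act_one: "exp (act (c *\<^sub>R one)) = cs (exp (Z * of_real c))"
  by (rule blinop_eqI, rule ev_eqI) (simp add: scaleR_conv_of_real)

text \<open>The state is first multiplied by \<open>exp ((\<phi> - c) / r)\<close>, then evolves freely for the time \<open>r\<^sup>2\<close>, and
  is multiplied by \<open>exp ((c - \<phi>) / r)\<close>. The constant \<open>c\<close> makes the intermediate state so small that the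
  nonlinearity, being of higher order, is negligible even after the last multiplication.\<close>

lemma reach_square_gradient:
  assumes G: "has_grad \<phi> G" and real: "\<And>i x. ev (G i) x \<in> \<real>"
    and \<phi>: "\<And>c. reach (c *\<^sub>R \<phi>)" and one: "\<And>c. reach (c *\<^sub>R one)"
  shows "reach ((1 + \<nu>\<^sup>2) *\<^sub>R (\<Sum>i\<in>UNIV. prd (G i) (G i)))"
  unfolding reach_def
proof (intro allI impI near_reach_closed)
  fix a \<T> and e :: real assume \<T>: "0 < \<T>" "\<T> \<le> (1::real)" and e: "0 < e"
  define \<kappa> where "\<kappa> = norm (act \<phi>)"
  \<comment> \<open>Chosen so that \<kappa> + c + p (\<kappa> - c) \<le> -2 for p = 2\<sigma> + 1
    \<ge> 3: the last multiplication costs exp((\<kappa> + c)/r), and the p-th power of the state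
    gains exp(p (\<kappa> - c)/r).\<close>
  define c where "c = 3 * \<kappa> + 1"
  define p where "p = 2 * \<sigma> + 1"
  obtain K \<rho> where K: "0 < \<rho>" "0 \<le> K" "\<And>a T. 0 \<le> T \<Longrightarrow> T \<le> 1 \<Longrightarrow> norm a \<le> \<rho> \<Longrightarrow>
      \<exists>y. csol (\<lambda>_. 0) a T y \<and> norm (y T - S T \<triangleright> a) \<le> K * norm a ^ p"
    using csol_free_small[OF _ norm_N_le[folded p_def]] by (auto simp: p_def onorm_M_nonneg)
  define r where "r n = 1 / real (Suc n)" for n
  have r: "0 < r n" for n by (simp add: r_def)
  have r0: "r \<longlonglongrightarrow> 0" unfolding r_def[abs_def] using LIMSEQ_inverse_real_of_nat by (simp add: inverse_eq_divide)
  \<comment> \<open>Subtracting a constant changes the size of the factors but not the gradient,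
    hence not the limit.\<close>
  define \<phi>' where "\<phi>' = \<phi> + (- c) *\<^sub>R one"
  have G': "has_grad \<phi>' G"
  proof -
    have "has_grad one (\<lambda>_. 0)" unfolding has_grad_def by (auto simp: translate_one intro!: exI[of _ 0])
    from has_grad_add[OF G has_grad_scaleR[OF this, of "- c"]] show ?thesis by (simp add: \<phi>'_def)
  qed
  have reach': "reach (t *\<^sub>R \<phi>')" for t
    unfolding \<phi>'_def scaleR_add_right scaleR_scaleR by (intro reach_add \<phi> one)
  have norm_exp: "norm (exp (act (t *\<^sub>R \<phi>'))) \<le> exp (\<bar>t\<bar> * \<kappa> - t * c)" for t
  proof -
    have "exp (act (t *\<^sub>R \<phi>')) = exp (act (t *\<^sub>R \<phi>)) * cs (exp (Z * of_real (- (t * c))))"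
      unfolding \<phi>'_def exp_act_one[symmetric]
      by (rule blinop_eqI, rule ev_eqI) (simp add: scaleR_conv_of_real algebra_simps flip: exp_add)
    also have "norm \<dots> \<le> norm (exp (act (t *\<^sub>R \<phi>))) * norm (cs (exp (Z * of_real (- (t * c)))) :: (int ^ 'n) ell2 blinop)"
      by (rule norm_mult_ineq)
    also have "\<dots> \<le> exp (\<bar>t\<bar> * \<kappa>) * exp (- (t * c))"
    proof (intro mult_mono)
      have "norm (act (t *\<^sub>R \<phi>)) = \<bar>t\<bar> * \<kappa>" by (simp add: linear_scale[OF act_linear] \<kappa>_def)
      then show "norm (exp (act (t *\<^sub>R \<phi>))) \<le> exp (\<bar>t\<bar> * \<kappa>)" using norm_exp[of "act (t *\<^sub>R \<phi>)"] by simp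
      show "norm (cs (exp (Z * of_real (- (t * c)))) :: (int ^ 'n) ell2 blinop) \<le> exp (- (t * c))"
        by (rule order_trans[OF norm_cs_le]) (simp add: Z_def)
    qed auto
    finally show ?thesis by (simp flip: exp_add)
  qed
  define b where "b n = exp (act ((1 / r n) *\<^sub>R \<phi>')) \<triangleright> a" for n
  have nb: "norm (b n) \<le> exp ((\<kappa> - c) / r n) * norm a" for n
  proof -
    have "norm (b n) \<le> norm (exp (act ((1 / r n) *\<^sub>R \<phi>'))) * norm a" unfolding b_def by (rule norm_app)
    also have "\<dots> \<le> exp (\<bar>1 / r n\<bar> * \<kappa> - (1 / r n) * c) * norm a" by (intro mult_right_mono norm_exp) auto
    also have "\<bar>1 / r n\<bar> * \<kappa> - (1 / r n) * c = (\<kappa> - c) / r n" using r[of n] by (simp add: diff_divide_distrib)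
    finally show ?thesis .
  qed
  have \<kappa>0: "0 \<le> \<kappa>" by (simp add: \<kappa>_def)
  have lim_exp: "(\<lambda>n. C * exp (- d / r n)) \<longlonglongrightarrow> 0" if "0 < d" for C d :: real
    unfolding r_def using that by real_asymp
  have "(\<lambda>n. norm a * exp (- (c - \<kappa>) / r n)) \<longlonglongrightarrow> 0" by (rule lim_exp) (use \<kappa>0 in \<open>simp add: c_def\<close>)
  then have ev1: "\<forall>\<^sub>F n in sequentially. norm a * exp (- (c - \<kappa>) / r n) < \<rho>" using K(1) by (rule order_tendstoD)
  have "(\<lambda>n. (K * norm a ^ p) * exp (- 2 / r n)) \<longlonglongrightarrow> 0" by (rule lim_exp) simp
  then have ev2: "\<forall>\<^sub>F n in sequentially. (K * norm a ^ p) * exp (- 2 / r n) < e / 2" using e by (intro order_tendstoD) auto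
  have "(\<lambda>n. (r n)\<^sup>2) \<longlonglongrightarrow> 0\<^sup>2" by (intro tendsto_intros r0)
  then have ev3: "\<forall>\<^sub>F n in sequentially. (r n)\<^sup>2 < \<T> / 4"
    by (rule order_tendstoD) (use \<T> in simp)
  let ?b = "exp (act ((1 + \<nu>\<^sup>2) *\<^sub>R (\<Sum>i\<in>UNIV. prd (G i) (G i)))) \<triangleright> a"
  have "(\<lambda>n. exp (act ((- (1 / r n)) *\<^sub>R \<phi>')) \<triangleright> S ((r n)\<^sup>2) \<triangleright> b n) \<longlonglongrightarrow> ?b"
    unfolding b_def act_def by (rule conjugated_semigroup_tendsto[OF G' real r r0])
  then have ev4: "\<forall>\<^sub>F n in sequentially. dist (exp (act ((- (1 / r n)) *\<^sub>R \<phi>')) \<triangleright> S ((r n)\<^sup>2) \<triangleright> b n) ?b < e / 2"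
    by (rule tendstoD) (use e in simp)
  obtain n where n: "norm a * exp (- (c - \<kappa>) / r n) < \<rho>" "(K * norm a ^ p) * exp (- 2 / r n) < e / 2"
    "(r n)\<^sup>2 < \<T> / 4" "dist (exp (act ((- (1 / r n)) *\<^sub>R \<phi>')) \<triangleright> S ((r n)\<^sup>2) \<triangleright> b n) ?b < e / 2"
    using eventually_conj[OF ev1 eventually_conj[OF ev2 eventually_conj[OF ev3 ev4]]]
    unfolding eventually_sequentially by blast
  have "norm (b n) \<le> \<rho>" using nb[of n] n(1) by (simp add: mult.commute)
  then obtain y where y: "csol (\<lambda>_. 0) (b n) ((r n)\<^sup>2) y" "norm (y ((r n)\<^sup>2) - S ((r n)\<^sup>2) \<triangleright> b n) \<le> K * norm (b n) ^ p"
    using K(3)[of "(r n)\<^sup>2" "b n"] n(3) \<T> by auto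
  let ?U = "exp (act ((- (1 / r n)) *\<^sub>R \<phi>'))"
  \<comment> \<open>Three legs share the time: a quarter for each of the first two and a half for
    the last.\<close>
  have R1: "near_reach a (b n) (\<T> / 4)"
    using reach'[of "1 / r n"] \<T> by (simp add: reach_def b_def)
  have R2: "near_reach (b n) (y ((r n)\<^sup>2)) (\<T> / 4)"
    by (rule near_reach_free[OF _ n(3) y(1)]) (use r[of n] in simp)
  have R3: "near_reach (y ((r n)\<^sup>2)) (?U \<triangleright> y ((r n)\<^sup>2)) (\<T> / 2)"
    using reach'[of "- (1 / r n)"] \<T> by (simp add: reach_def)
  have "near_reach a (?U \<triangleright> y ((r n)\<^sup>2)) (\<T> / 4 + \<T> / 4 + \<T> / 2)"
    by (rule near_reach_trans[OF near_reach_trans[OF R1 R2] R3]) (use \<T> in auto)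
  then have R: "near_reach a (?U \<triangleright> y ((r n)\<^sup>2)) \<T>" by simp
  have "norm (?U \<triangleright> (y ((r n)\<^sup>2) - S ((r n)\<^sup>2) \<triangleright> b n)) \<le> norm ?U * (K * norm (b n) ^ p)"
    by (rule order_trans[OF norm_app mult_left_mono[OF y(2)]]) simp
  also have "\<dots> \<le> exp ((\<kappa> + c) / r n) * (K * (exp ((\<kappa> - c) / r n) * norm a) ^ p)"
  proof (intro mult_mono mult_left_mono power_mono nb K)
    have "\<bar>- (1 / r n)\<bar> * \<kappa> - (- (1 / r n)) * c = (\<kappa> + c) / r n" using r[of n] by (simp add: add_divide_distrib)
    then show "norm ?U \<le> exp ((\<kappa> + c) / r n)" using norm_exp[of "- (1 / r n)"] by simp
  qed (use K in auto)
  also have "\<dots> = (K * norm a ^ p) * exp (((\<kappa> + c) + real p * (\<kappa> - c)) / r n)"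
    by (simp add: power_mult_distrib add_divide_distrib exp_add mult_ac flip: exp_of_nat_mult)
  also have "\<dots> \<le> (K * norm a ^ p) * exp (- 2 / r n)"
  proof (intro mult_left_mono)
    have "(\<kappa> + c) + real p * (\<kappa> - c) = (2 - 4 * real \<sigma>) * \<kappa> - 2 * real \<sigma>" by (simp add: p_def c_def algebra_simps)
    also have "\<dots> \<le> 0 * \<kappa> - 2" using \<sigma> \<kappa>0 by (intro diff_mono mult_right_mono) auto
    finally have "((\<kappa> + c) + real p * (\<kappa> - c)) / r n \<le> (0 * \<kappa> - 2) / r n"
      using r[of n] by (intro divide_right_mono) auto
    then show "exp (((\<kappa> + c) + real p * (\<kappa> - c)) / r n) \<le> exp (- 2 / r n)" by simp
  qed (use K in auto)
  also have "\<dots> < e / 2" by (rule n)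
  finally have "norm (?U \<triangleright> y ((r n)\<^sup>2) - ?U \<triangleright> S ((r n)\<^sup>2) \<triangleright> b n) < e / 2" by simp
  then have "norm ((?U \<triangleright> y ((r n)\<^sup>2) - ?U \<triangleright> S ((r n)\<^sup>2) \<triangleright> b n) + (?U \<triangleright> S ((r n)\<^sup>2) \<triangleright> b n - ?b)) < e"
    using n(4) unfolding dist_norm by (intro norm_triangle_lt) linarith
  then show "\<exists>c. near_reach a c \<T> \<and> norm (c - ?b) < e"
    using R by (intro exI[of _ "?U \<triangleright> y ((r n)\<^sup>2)"]) simp
qed

end

section \<open>Saturation\<close>

text \<open>Frequencies with nonzero scalar product may be added. A frequency \<open>l\<close> orthogonal to \<open>k\<close> is
  added by a detour through \<open>k + m\<close>, with a generator \<open>m\<close> that is orthogonal to neither.\<close>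

lemma lattice_saturation:
  fixes P :: "(int, 'n::{finite,linorder}) vec \<Rightarrow> bool"
  defines "ip \<equiv> \<lambda>k l :: (int, 'n) vec. \<Sum>i\<in>UNIV. k $ i * l $ i"
  assumes P0: "P 0" and Pm: "\<And>k. P k \<Longrightarrow> P (- k)"
    and P_add: "\<And>k l. P k \<Longrightarrow> P l \<Longrightarrow> ip k l \<noteq> 0 \<Longrightarrow> P (k + l)"
    and gen: "\<And>k. k \<in> control_freqs \<Longrightarrow> P k"
  shows "P k"
proof -
  define o1 :: "(int, 'n) vec" where "o1 = (\<chi> i. 1)"
  define e :: "'n \<Rightarrow> (int, 'n) vec" where "e i = axis i 1" for i
  let ?m = "Max (UNIV :: 'n set)"
  have Po: "P o1" by (intro gen) (simp add: control_freqs_def o1_def)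
  have Pe: "P (e i)" if "i \<noteq> ?m" for i using that by (intro gen) (auto simp: control_freqs_def e_def)
  have ip_add: "ip (k + l) m = ip k m + ip l m" for k l m
    by (simp add: ip_def distrib_right sum.distrib)
  have ip_minus: "ip (- k) m = - ip k m" "ip k (- m) = - ip k m" for k m
    by (simp_all add: ip_def sum_negf)
  have ip_comm: "ip k m = ip m k" for k m by (simp add: ip_def mult.commute)
  have ip_e: "ip k (e i) = k $ i" for k i
    by (simp add: ip_def e_def axis_def if_distrib[of "(*) _"] cong: if_cong)
  have e_nth: "e i $ j = (if i = j then 1 else 0)" for i j by (auto simp: e_def axis_def)
  have o1_nth: "o1 $ i = 1" for i by (simp add: o1_def)
  define N where "N = int CARD('n)"
  have ip_oo: "ip o1 o1 = N" by (simp add: ip_def o1_def N_def)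
  have ip_eo: "ip (e i) o1 = 1" for i using ip_e[of o1 i] by (simp add: ip_comm o1_def)
  have Pd: "P (k - l)" if "P k" "P l" "ip k l \<noteq> 0" for k l
    using P_add[OF that(1) Pm[OF that(2)]] that(3) by (simp add: ip_minus)
  \<comment> \<open>The three conditions are those of the moves +m, +l and -m, in this
    order.\<close>
  have detour: "P (k + l)" if k: "P k" and l: "P l" and m: "P m" and n: "ip k m \<noteq> 0" "ip k l + ip m l \<noteq> 0" "ip k m + ip l m + ip m m \<noteq> 0"
    for k l m
  proof -
    have "P (k + m)" using k m n(1) by (rule P_add)
    then have "P (k + m + l)" by (rule P_add[OF _ l]) (use n(2) in \<open>simp add: ip_add\<close>)
    then have "P (k + m + l - m)" by (rule Pd[OF _ m]) (use n(3) in \<open>simp add: ip_add\<close>)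
    then show ?thesis by (simp add: algebra_simps)
  qed
  have card: "N \<ge> 1" unfolding N_def using zero_less_card_finite[where 'a='n] by linarith
  \<comment> \<open>If k is orthogonal to \<open>e i\<close>, the detour uses \<open>o1\<close> or
    \<open>- o1\<close> according to the sign of \<open>ip k o1\<close>, so that the last condition
    of \<open>detour\<close> holds by positivity.\<close>
  have add_e1: "P (k + e i)" if k: "P k" and i: "i \<noteq> ?m" and o: "ip k o1 \<noteq> 0 \<or> k $ i \<noteq> 0" for k i
  proof (cases "k $ i = 0")
    case True
    show ?thesis
    proof (cases "ip k o1 > 0")
      case pos: True
      show ?thesis
        by (rule detour[OF k Pe[OF i] Po]) (use True pos card in \<open>simp_all add: ip_e ip_eo ip_oo o1_nth\<close>)
    next
      case False
      then have neg: "ip k o1 < 0" using o True by linarith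
      show ?thesis
        by (rule detour[OF k Pe[OF i] Pm[OF Po]]) (use True neg card in \<open>simp_all add: ip_minus ip_e ip_eo ip_oo o1_nth\<close>)
    qed
  next
    case False
    then show ?thesis using k Pe[OF i] by (intro P_add) (simp_all add: ip_e)
  qed
  have other: "\<exists>j. j \<noteq> ?m \<and> k $ j \<noteq> 0" if "ip k o1 = 0" "k \<noteq> 0" for k
  proof (rule ccontr)
    assume "\<nexists>j. j \<noteq> ?m \<and> k $ j \<noteq> 0"
    then have z: "\<And>j. j \<noteq> ?m \<Longrightarrow> k $ j = 0" by blast
    have "ip k o1 = (\<Sum>j\<in>{?m}. k $ j)"
      unfolding ip_def o1_def by (rule sum.mono_neutral_cong_right) (auto simp: z)
    then have "k $ ?m = 0" using that by simp
    then have "k = 0" using z by (simp add: vec_eq_iff) metis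
    then show False using that by simp
  qed
  \<comment> \<open>The vector is \<open>e j\<close> or \<open>- e j\<close> with j not the last
    index; its scalar product with \<open>o1\<close> is 1 or -1, which lifts k off the hyperplane
    orthogonal to \<open>o1\<close>.\<close>
  have helper: "\<exists>m. P m \<and> ip k m > 0 \<and> ip m m = 1 \<and> \<bar>ip m o1\<bar> = 1 \<and> (\<forall>i. k $ i = 0 \<longrightarrow> m $ i = 0)"
    if kz: "ip k o1 = 0" "k \<noteq> 0" for k
  proof -
    obtain j where j: "j \<noteq> ?m" "k $ j \<noteq> 0" using other[OF kz] by blast
    show ?thesis
    proof (cases "k $ j > 0")
      case True
      then show ?thesis using Pe[OF j(1)] by (intro exI[of _ "e j"]) (auto simp: ip_e ip_eo e_nth)
    next
      case False
      then show ?thesis using Pm[OF Pe[OF j(1)]] j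
        by (intro exI[of _ "- e j"]) (auto simp: ip_minus ip_e ip_eo e_nth)
    qed
  qed
  have add_e: "P (k + e i)" if k: "P k" and i: "i \<noteq> ?m" for k i
  proof (cases "k = 0 \<or> ip k o1 \<noteq> 0 \<or> k $ i \<noteq> 0")
    case True
    then show ?thesis using add_e1[OF k i] Pe[OF i] by auto
  next
    case False
    obtain m where m: "P m" "ip k m > 0" "ip m m = 1" "\<bar>ip m o1\<bar> = 1" "m $ i = 0" using helper[of k] False by auto
    have "P (k + m)" using k m by (intro P_add) auto
    then have "P (k + m + e i)" using False m i by (intro add_e1) (auto simp: ip_add)
    then have "P (k + m + e i - m)"
      by (rule Pd[OF _ m(1)]) (use m in \<open>simp add: ip_add ip_comm[of "e i" m] ip_e\<close>)
    then show ?thesis by (simp add: algebra_simps)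
  qed
  have add_o: "P (k + o1)" if k: "P k" for k
  proof (cases "k = 0 \<or> ip k o1 \<noteq> 0")
    case True
    then show ?thesis using P_add[OF k Po] Po by auto
  next
    case False
    obtain m where m: "P m" "ip k m > 0" "ip m m = 1" "\<bar>ip m o1\<bar> = 1" using helper[of k] False by auto
    \<comment> \<open>Here \<open>ip k m\<close> \<ge> 1, \<open>ip m m\<close> = 1 and
      \<open>ip o1 m\<close> \<ge> -1, so the last condition of \<open>detour\<close> concerns a
      positive number.\<close>
    show ?thesis by (rule detour[OF k Po m(1)]) (use False m in \<open>auto simp: ip_comm[of o1 m]\<close>)
  qed
  have sub_e: "P (k - e i)" if "P k" "i \<noteq> ?m" for k i
    using Pm[OF add_e[OF Pm[OF that(1)] that(2)]] by simp
  have sub_o: "P (k - o1)" if "P k" for k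
    using Pm[OF add_o[OF Pm[OF that]]] by simp
  have succ: "k + (n + 1) *s v = (k + n *s v) + v" "k + (n - 1) *s v = (k + n *s v) - v" for k v :: "(int, 'n) vec" and n
    by (simp_all add: vec_eq_iff algebra_simps)
  have add_eN: "P (k + n *s e i)" if "P k" "i \<noteq> ?m" for k i and n :: int
  proof (induction n rule: int_induct[where k = 0])
    case base
    then show ?case using that by simp
  next
    case (step1 n)
    then show ?case using add_e[OF _ that(2), of "k + n *s e i"] unfolding succ by simp
  next
    case (step2 n)
    then show ?case using sub_e[OF _ that(2), of "k + n *s e i"] unfolding succ by simp
  qed
  have add_oN: "P (k + n *s o1)" if "P k" for k and n :: int
  proof (induction n rule: int_induct[where k = 0])
    case base
    then show ?case using that by simp
  next
    case (step1 n)
    then show ?case using add_o[of "k + n *s o1"] unfolding succ by simp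
  next
    case (step2 n)
    then show ?case using sub_o[of "k + n *s o1"] unfolding succ by simp
  qed
  have sums: "P (b + (\<Sum>i\<in>A. (k $ i - k $ ?m) *s e i))" if "finite A" "?m \<notin> A" "P b" for A b
    using that
  proof (induction A arbitrary: b rule: finite_induct)
    case (insert i A)
    have "P (b + (k $ i - k $ ?m) *s e i)" using insert by (intro add_eN) auto
    then show ?case using insert.IH[of "b + (k $ i - k $ ?m) *s e i"] insert by (simp add: add.assoc)
  qed simp
  \<comment> \<open>The control frequencies form a basis of the lattice: k is its last entry times
    (1,...,1) plus corrections along the other basis vectors.\<close>
  have "P ((0 + k $ ?m *s o1) + (\<Sum>i\<in>UNIV - {?m}. (k $ i - k $ ?m) *s e i))"
    by (intro sums add_oN P0) auto
  also have "(0 + k $ ?m *s o1) + (\<Sum>i\<in>UNIV - {?m}. (k $ i - k $ ?m) *s e i) = k"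
  proof (rule vec_eq_iff[THEN iffD2], rule allI)
    fix j
    have "(\<Sum>i\<in>UNIV - {?m}. (k $ i - k $ ?m) *s e i) $ j = (\<Sum>i\<in>UNIV - {?m}. if i = j then k $ i - k $ ?m else 0)"
      by (simp add: e_nth if_distrib cong: if_cong)
    also have "\<dots> = (if j = ?m then 0 else k $ j - k $ ?m)" by (subst sum.delta) auto
    finally show "((0 + k $ ?m *s o1) + (\<Sum>i\<in>UNIV - {?m}. (k $ i - k $ ?m) *s e i)) $ j = k $ j"
      by (simp add: o1_def)
  qed
  finally show ?thesis .
qed

section \<open>Sines and cosines as elements of the algebra, with their gradients\<close>

context sobolev
begin

definition cosX :: "int ^ 'n \<Rightarrow> (int ^ 'n) ell2" where
  "cosX k = single k (of_real (wt k) / 2) + single (- k) (of_real (wt k) / 2)"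

definition sinX :: "int ^ 'n \<Rightarrow> (int ^ 'n) ell2" where
  "sinX k = single k (- \<i> * of_real (wt k) / 2) + single (- k) (\<i> * of_real (wt k) / 2)"

lemma echar_cis: "echar k x = cis (freq k \<bullet> x)"
  by (simp add: echar_def cis_conv_exp)

lemma ev_cosX [simp]: "ev (cosX k) x = of_real (cos (freq k \<bullet> x))"
  by (simp add: cosX_def echar_uminus) (simp add: echar_cis complex_eq_iff)

lemma ev_sinX [simp]: "ev (sinX k) x = of_real (sin (freq k \<bullet> x))"
  by (simp add: sinX_def echar_uminus) (simp add: echar_cis complex_eq_iff)

text \<open>|e^(i t) - 1| \<le> |t| gives the uniform bound, and the derivative of the exponential
  at 0 gives the limit.\<close>

lemma has_grad_single: "has_grad (single k c) (\<lambda>i. single k (\<i> * of_int (k $ i) * c))"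
proof -
  have eq: "translate h \<triangleright> single k c - single k c = single k ((echar k h - 1) * c)" for h
    by (rule ell2_eqI) (simp add: algebra_simps)
  show ?thesis
    unfolding has_grad_def eq
  proof (intro conjI allI)
    have "norm (single k ((echar k h - 1) * c)) \<le> norm (freq k) * cmod c * norm h" for h
    proof -
      have "cmod (echar k h - 1) \<le> \<bar>freq k \<bullet> h\<bar>"
        unfolding echar_def using iexp_approx1[of "freq k \<bullet> h" 0] by simp
      also have "\<dots> \<le> norm (freq k) * norm h" by (rule Cauchy_Schwarz_ineq2)
      finally have "cmod (echar k h - 1) * cmod c \<le> (norm (freq k) * norm h) * cmod c" by (intro mult_right_mono) auto
      then show ?thesis by (simp add: norm_mult mult_ac)
    qed
    then show "\<exists>C\<ge>0. \<forall>h. norm (single k ((echar k h - 1) * c)) \<le> C * norm h"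
      by (intro exI[of _ "norm (freq k) * cmod c"]) auto
    fix y :: "real ^ 'n"
    define d where "d = freq k \<bullet> y"
    have "((\<lambda>z. (exp (\<i> * of_real d * z) - 1) / z) \<longlongrightarrow> \<i> * of_real d) (at 0)"
    proof -
      have "((\<lambda>z. exp (\<i> * of_real d * z)) has_field_derivative (\<i> * of_real d)) (at 0)"
        by (auto intro!: derivative_eq_intros)
      then show ?thesis by (simp add: has_field_derivative_iff)
    qed
    moreover have "filterlim complex_of_real (at 0) (at_right 0)"
      unfolding filterlim_at by (auto simp: eventually_at_filter intro!: tendsto_eq_intros always_eventually)
    ultimately have "((\<lambda>r. (exp (\<i> * of_real d * of_real r) - 1) / of_real r) \<longlongrightarrow> \<i> * of_real d) (at_right 0)"
      by (rule filterlim_compose)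
    moreover have "(exp (\<i> * of_real d * of_real r) - 1) / of_real r = (1 / r) *\<^sub>R (echar k (r *\<^sub>R y) - 1)" for r
      by (simp add: echar_def d_def scaleR_conv_of_real[where 'a=complex] mult_ac)
    ultimately have "((\<lambda>r. (1 / r) *\<^sub>R (echar k (r *\<^sub>R y) - 1)) \<longlongrightarrow> \<i> * of_real d) (at_right 0)" by simp
    then have "((\<lambda>r. single k ((1 / r) *\<^sub>R (echar k (r *\<^sub>R y) - 1) * c)) \<longlongrightarrow> single k (\<i> * of_real d * c)) (at_right 0)"
      by (intro bounded_linear.tendsto[OF bounded_linear_single] tendsto_intros)
    moreover have "(\<Sum>i\<in>UNIV. (y $ i) *\<^sub>R single k (\<i> * of_int (k $ i) * c)) = single k (\<i> * of_real d * c)"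
    proof -
      have lin: "linear (single k)" by (rule bounded_linear.linear[OF bounded_linear_single])
      have "(\<Sum>i\<in>UNIV. (y $ i) *\<^sub>R single k (\<i> * of_int (k $ i) * c)) = single k (\<Sum>i\<in>UNIV. (y $ i) *\<^sub>R (\<i> * of_int (k $ i) * c))"
        by (simp only: linear_sum[OF lin] linear_scale[OF lin])
      also have "(\<Sum>i\<in>UNIV. (y $ i) *\<^sub>R (\<i> * of_int (k $ i) * c)) = \<i> * of_real d * c"
        by (simp add: d_def inner_vec_def scaleR_conv_of_real sum_distrib_left sum_distrib_right mult_ac)
      finally show ?thesis .
    qed
    moreover have "(1 / r) *\<^sub>R single k ((echar k (r *\<^sub>R y) - 1) * c) = single k ((1 / r) *\<^sub>R (echar k (r *\<^sub>R y) - 1) * c)" for r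
      using linear_scale[OF bounded_linear.linear[OF bounded_linear_single]] by (metis mult_scaleR_left)
    ultimately show "((\<lambda>r. (1 / r) *\<^sub>R single k ((echar k (r *\<^sub>R y) - 1) * c)) \<longlongrightarrow> (\<Sum>i\<in>UNIV. (y $ i) *\<^sub>R single k (\<i> * of_int (k $ i) * c))) (at_right 0)"
      by simp
  qed
qed

definition grad_cos :: "int ^ 'n \<Rightarrow> 'n \<Rightarrow> (int ^ 'n) ell2" where
  "grad_cos k i = (- real_of_int (k $ i)) *\<^sub>R sinX k"

definition grad_sin :: "int ^ 'n \<Rightarrow> 'n \<Rightarrow> (int ^ 'n) ell2" where
  "grad_sin k i = real_of_int (k $ i) *\<^sub>R cosX k"

lemma has_grad_cosX: "has_grad (cosX k) (grad_cos k)"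
proof -
  have "grad_cos k = (\<lambda>i. single k (\<i> * of_int (k $ i) * (of_real (wt k) / 2)) + single (- k) (\<i> * of_int ((- k) $ i) * (of_real (wt k) / 2)))"
    by (rule ext, rule ell2_eqI) (simp add: grad_cos_def sinX_def scaleR_conv_of_real)
  then show ?thesis unfolding cosX_def by (simp only:) (intro has_grad_add has_grad_single)
qed

lemma has_grad_sinX: "has_grad (sinX k) (grad_sin k)"
proof -
  have "grad_sin k = (\<lambda>i. single k (\<i> * of_int (k $ i) * (- \<i> * of_real (wt k) / 2)) + single (- k) (\<i> * of_int ((- k) $ i) * (\<i> * of_real (wt k) / 2)))"
    by (rule ext, rule ell2_eqI) (auto simp: grad_sin_def cosX_def scaleR_conv_of_real complex_eq_iff)
  then show ?thesis unfolding sinX_def by (simp only:) (intro has_grad_add has_grad_single)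
qed

definition gdot :: "('n \<Rightarrow> (int ^ 'n) ell2) \<Rightarrow> ('n \<Rightarrow> (int ^ 'n) ell2) \<Rightarrow> (int ^ 'n) ell2" where
  "gdot F G = (\<Sum>i\<in>UNIV. prd (F i) (G i))"

lemma ev_gdot: "ev (gdot F G) x = (\<Sum>i\<in>UNIV. ev (F i) x * ev (G i) x)"
  by (simp add: gdot_def ev_sum)

end

section \<open>From the control directions to all real phases\<close>

locale saturated = gl_control s dim V \<nu> \<mu> \<sigma> pot
  for s :: nat and dim :: "'n::{finite,linorder} itself" and V \<nu> \<mu> :: real and \<sigma> :: nat
    and pot :: "'q::real_normed_vector \<Rightarrow> (int, 'n) vec ell2" +
  assumes pot_one: "one \<in> range pot"
    and pot_cos: "k \<in> control_freqs \<Longrightarrow> cosX k \<in> range pot"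
    and pot_sin: "k \<in> control_freqs \<Longrightarrow> sinX k \<in> range pot"
begin

text \<open>\<open>reach\<close> is closed under sums but a priori not under negation. The phases
  all of whose real multiples can be reached form a vector space, on which bilinear arguments
  work.\<close>

definition W :: "(int, 'n) vec ell2 \<Rightarrow> bool" where
  "W g \<longleftrightarrow> (\<forall>c. reach (c *\<^sub>R g))"

lemma W_add: "W g \<Longrightarrow> W h \<Longrightarrow> W (g + h)"
  unfolding W_def scaleR_add_right by (blast intro: reach_add)

lemma W_scaleR: "W g \<Longrightarrow> W (c *\<^sub>R g)"
  unfolding W_def by simp

lemma W_pot: "g \<in> range pot \<Longrightarrow> W g"
  unfolding W_def using reach_pot linear_scale[OF bounded_linear.linear[OF pot]] by (metis imageE)

lemma W_one: "W one"
  by (rule W_pot[OF pot_one])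

lemma W_diff: "W g \<Longrightarrow> W h \<Longrightarrow> W (g - h)"
  using W_add[of g "(-1) *\<^sub>R h"] W_scaleR[of h "-1"] by simp

lemma W_sum: "finite X \<Longrightarrow> (\<And>i. i \<in> X \<Longrightarrow> W (f i)) \<Longrightarrow> W (\<Sum>i\<in>X. f i)"
  by (induction rule: finite_induct) (auto intro: W_add W_scaleR[OF W_one, of 0, simplified])

definition real_grad :: "(int, 'n) vec ell2 \<Rightarrow> ('n \<Rightarrow> (int, 'n) vec ell2) \<Rightarrow> bool" where
  "real_grad \<phi> G \<longleftrightarrow> has_grad \<phi> G \<and> (\<forall>i x. ev (G i) x \<in> \<real>)"

text \<open>The squared gradient is quadratic in \<phi>, so a nonnegative factor is absorbed by
  rescaling \<phi> with sqrt (c / (1 + \<nu>^2)); a negative factor cannot be obtained in this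
  way.\<close>

lemma reach_gdot:
  assumes "W \<phi>" "real_grad \<phi> G" "0 \<le> c"
  shows "reach (c *\<^sub>R gdot G G)"
proof -
  define l where "l = sqrt (c / (1 + \<nu>\<^sup>2))"
  have pos: "0 < 1 + \<nu>\<^sup>2" by (simp add: add_pos_nonneg)
  have l: "(1 + \<nu>\<^sup>2) * (l * l) = c"
    using assms(3) pos by (simp add: l_def)
  have "reach ((1 + \<nu>\<^sup>2) *\<^sub>R (\<Sum>i\<in>UNIV. prd (l *\<^sub>R G i) (l *\<^sub>R G i)))"
  proof (rule reach_square_gradient)
    show "has_grad (l *\<^sub>R \<phi>) (\<lambda>i. l *\<^sub>R G i)" using assms(2) by (intro has_grad_scaleR) (simp add: real_grad_def)
    show "ev (l *\<^sub>R G i) x \<in> \<real>" for i x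
      using assms(2) by (simp add: real_grad_def scaleR_conv_of_real)
    show "reach (c *\<^sub>R l *\<^sub>R \<phi>)" for c using assms(1) by (simp add: W_def)
    show "reach (c *\<^sub>R one)" for c using W_one by (simp add: W_def)
  qed
  also have "(1 + \<nu>\<^sup>2) *\<^sub>R (\<Sum>i\<in>UNIV. prd (l *\<^sub>R G i) (l *\<^sub>R G i)) = c *\<^sub>R gdot G G"
    by (rule ev_eqI) (simp add: ev_gdot ev_sum scaleR_conv_of_real sum_distrib_left l[symmetric] mult_ac)
  finally show ?thesis .
qed

text \<open>Polarisation: |grad (f + b g)|^2 - |grad f|^2 - b^2 |grad g|^2 is 2 b times the product
  of the gradients. Subtracting the squares needs their negative multiples, hence the hypotheses on
  \<open>gdot F F\<close> and \<open>gdot G G\<close>; the sign of b gives both signs of the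
  result.\<close>

lemma W_gdot:
  assumes f: "W f" "real_grad f F" "W (gdot F F)" and g: "W g" "real_grad g G" "W (gdot G G)"
  shows "W (gdot F G)"
  unfolding W_def
proof
  fix c
  have one: "reach ((2 * (c * b)) *\<^sub>R gdot F G)" if c: "0 \<le> c" for c b :: real
  proof -
    have "W (f + b *\<^sub>R g)" by (intro W_add W_scaleR f g)
    moreover have "real_grad (f + b *\<^sub>R g) (\<lambda>i. F i + b *\<^sub>R G i)"
      using f(2) g(2) unfolding real_grad_def
      by (auto intro!: has_grad_add has_grad_scaleR Reals_add simp: scaleR_conv_of_real)
    ultimately have "reach (c *\<^sub>R gdot (\<lambda>i. F i + b *\<^sub>R G i) (\<lambda>i. F i + b *\<^sub>R G i))" using c by (rule reach_gdot)
    moreover have "reach ((- c) *\<^sub>R gdot F F)" "reach ((- (c * b * b)) *\<^sub>R gdot G G)" using f(3) g(3) unfolding W_def by blast+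
    ultimately have "reach (c *\<^sub>R gdot (\<lambda>i. F i + b *\<^sub>R G i) (\<lambda>i. F i + b *\<^sub>R G i) + (- c) *\<^sub>R gdot F F + (- (c * b * b)) *\<^sub>R gdot G G)"
      by (intro reach_add)
    also have "c *\<^sub>R gdot (\<lambda>i. F i + b *\<^sub>R G i) (\<lambda>i. F i + b *\<^sub>R G i) + (- c) *\<^sub>R gdot F F + (- (c * b * b)) *\<^sub>R gdot G G
        = (2 * (c * b)) *\<^sub>R gdot F G"
      by (rule ev_eqI) (simp add: ev_gdot scaleR_conv_of_real algebra_simps sum.distrib flip: sum_distrib_left)
    finally show ?thesis .
  qed
  show "reach (c *\<^sub>R gdot F G)"
    using one[of "\<bar>c\<bar> / 2" "sgn c"] by (simp add: abs_mult_sgn)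
qed

definition P :: "(int, 'n) vec \<Rightarrow> bool" where
  "P k \<longleftrightarrow> W (cosX k) \<and> W (sinX k)"

lemma real_grad_cosX: "real_grad (cosX k) (grad_cos k)"
  and real_grad_sinX: "real_grad (sinX k) (grad_sin k)"
  by (simp_all add: real_grad_def has_grad_cosX has_grad_sinX, simp_all add: grad_cos_def grad_sin_def scaleR_conv_of_real)

lemma ip_freq: "(\<Sum>i\<in>UNIV. real_of_int (k $ i) * real_of_int (l $ i)) = freq k \<bullet> freq l"
  by (simp add: inner_vec_def)

lemma gdot_trig:
  "ev (gdot (grad_cos k) (grad_cos l)) x
     = of_real ((freq k \<bullet> freq l) * (sin (freq k \<bullet> x) * sin (freq l \<bullet> x)))"
  "ev (gdot (grad_sin k) (grad_sin l)) x
     = of_real ((freq k \<bullet> freq l) * (cos (freq k \<bullet> x) * cos (freq l \<bullet> x)))"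
  "ev (gdot (grad_cos k) (grad_sin l)) x
     = of_real (- (freq k \<bullet> freq l) * (sin (freq k \<bullet> x) * cos (freq l \<bullet> x)))"
  unfolding ip_freq[symmetric]
  by (simp_all add: ev_gdot grad_cos_def grad_sin_def scaleR_conv_of_real sum_distrib_left sum_distrib_right sum_negf mult_ac)

text \<open>The two squares add up to the constant |k|^2, which can be reached with either sign. A
  negative multiple of one square is thus a positive multiple of the other plus a constant.\<close>

lemma W_square:
  assumes k: "P k"
  shows "W (gdot (grad_cos k) (grad_cos k))" (is "W ?S")
    and "W (gdot (grad_sin k) (grad_sin k))" (is "W ?C")
proof -
  have Wk: "W (cosX k)" "W (sinX k)" using k by (auto simp: P_def)
  define q where "q = freq k \<bullet> freq k"
  have sum: "?S + ?C = q *\<^sub>R one"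
  proof (rule ev_eqI)
    fix x
    have "ev (?S + ?C) x = of_real (q * (sin (freq k \<bullet> x) * sin (freq k \<bullet> x)) + q * (cos (freq k \<bullet> x) * cos (freq k \<bullet> x)))"
      by (simp only: ev_add gdot_trig q_def of_real_add)
    also have "q * (sin (freq k \<bullet> x) * sin (freq k \<bullet> x)) + q * (cos (freq k \<bullet> x) * cos (freq k \<bullet> x)) = q"
      by (simp flip: distrib_left power2_eq_square)
    finally show "ev (?S + ?C) x = ev (q *\<^sub>R one) x" by (simp add: scaleR_conv_of_real)
  qed
  have S: "reach (c *\<^sub>R ?S)" and C: "reach (c *\<^sub>R ?C)" if "0 \<le> c" for c
    using reach_gdot[OF Wk(1) real_grad_cosX that] reach_gdot[OF Wk(2) real_grad_sinX that] by auto
  have neg: "reach (c *\<^sub>R (q *\<^sub>R one) + (- c) *\<^sub>R g)" if "reach ((- c) *\<^sub>R g)" for c g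
    using reach_add[OF _ that, of "c *\<^sub>R (q *\<^sub>R one)"] W_one by (simp add: W_def)
  show "W ?S" unfolding W_def
  proof
    fix c
    show "reach (c *\<^sub>R ?S)"
    proof (cases "0 \<le> c")
      case False
      have "reach (c *\<^sub>R (q *\<^sub>R one) + (- c) *\<^sub>R ?C)" by (rule neg[OF C]) (use False in simp)
      then show ?thesis by (simp only: sum[symmetric]) (simp add: scaleR_add_right)
    qed (rule S)
  qed
  show "W ?C" unfolding W_def
  proof
    fix c
    show "reach (c *\<^sub>R ?C)"
    proof (cases "0 \<le> c")
      case False
      have "reach (c *\<^sub>R (q *\<^sub>R one) + (- c) *\<^sub>R ?S)" by (rule neg[OF S]) (use False in simp)
      then show ?thesis by (simp only: sum[symmetric]) (simp add: scaleR_add_right)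
    qed (rule C)
  qed
qed

lemma P_minus: "P k \<Longrightarrow> P (- k)"
proof -
  have "cosX (- k) = cosX k" "sinX (- k) = (-1) *\<^sub>R sinX k"
    by (auto intro!: ev_eqI simp: freq_minus)
  then show "P k \<Longrightarrow> P (- k)" unfolding P_def by (metis W_scaleR)
qed

text \<open>The addition theorems express cosine and sine of k + l by products of sines and cosines.
  These products are gradient products divided by the scalar product of k and l, which must not
  vanish.\<close>

lemma P_add:
  assumes k: "P k" and l: "P l" and kl: "freq k \<bullet> freq l \<noteq> 0"
  shows "P (k + l)"
proof -
  have W: "W (cosX k)" "W (sinX k)" "W (cosX l)" "W (sinX l)" using k l by (auto simp: P_def)
  define q where "q = freq k \<bullet> freq l"
  have q: "q \<noteq> 0" using kl by (simp add: q_def)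
  have q': "freq l \<bullet> freq k = q" by (simp add: q_def inner_commute)
  have r1: "(1 / q) *\<^sub>R (of_real (q * a) - of_real (q * b)) = (of_real (a - b) :: complex)" for a b
  proof -
    have "(1 / q) *\<^sub>R (of_real (q * a) - of_real (q * b)) = complex_of_real ((1 / q) * (q * a - q * b))"
      by (simp add: scaleR_conv_of_real)
    also have "(1 / q) * (q * a - q * b) = a - b" using q by (simp add: right_diff_distrib)
    finally show ?thesis .
  qed
  have r2: "(- 1 / q) *\<^sub>R (of_real (- q * a) + of_real (- q * b)) = (of_real (a + b) :: complex)" for a b
  proof -
    have "(- 1 / q) *\<^sub>R (of_real (- q * a) + of_real (- q * b)) = complex_of_real ((- 1 / q) * (- q * a + - q * b))"
      by (simp only: scaleR_conv_of_real of_real_mult of_real_add)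
    also have "(- 1 / q) * (- q * a + - q * b) = a + b" using q by (simp add: field_simps)
    finally show ?thesis .
  qed
  have "W (gdot (grad_cos k) (grad_cos l))" "W (gdot (grad_sin k) (grad_sin l))" "W (gdot (grad_cos k) (grad_sin l))" "W (gdot (grad_cos l) (grad_sin k))"
    by (rule W_gdot[OF W(1) real_grad_cosX W_square(1)[OF k] W(3) real_grad_cosX W_square(1)[OF l]]
        W_gdot[OF W(2) real_grad_sinX W_square(2)[OF k] W(4) real_grad_sinX W_square(2)[OF l]]
        W_gdot[OF W(1) real_grad_cosX W_square(1)[OF k] W(4) real_grad_sinX W_square(2)[OF l]]
        W_gdot[OF W(3) real_grad_cosX W_square(1)[OF l] W(2) real_grad_sinX W_square(2)[OF k]])+
  note g = this
  have "W ((1 / q) *\<^sub>R (gdot (grad_sin k) (grad_sin l) - gdot (grad_cos k) (grad_cos l)))"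
    by (intro W_scaleR W_diff g)
  moreover have "W ((- 1 / q) *\<^sub>R (gdot (grad_cos k) (grad_sin l) + gdot (grad_cos l) (grad_sin k)))"
    by (intro W_scaleR W_add g)
  moreover have "(1 / q) *\<^sub>R (gdot (grad_sin k) (grad_sin l) - gdot (grad_cos k) (grad_cos l)) = cosX (k + l)"
    by (rule ev_eqI) (simp only: ev_scaleR ev_diff gdot_trig q_def[symmetric] r1 ev_cosX freq_add inner_add_left cos_add)
  moreover have "(- 1 / q) *\<^sub>R (gdot (grad_cos k) (grad_sin l) + gdot (grad_cos l) (grad_sin k)) = sinX (k + l)"
    by (rule ev_eqI) (simp only: ev_scaleR ev_add gdot_trig q_def[symmetric] q' r2 ev_sinX freq_add inner_add_left sin_add mult.commute)
  ultimately show ?thesis by (simp add: P_def)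
qed

lemma P_all: "P k"
proof (rule lattice_saturation[of P])
  have "cosX 0 = one" "sinX 0 = 0 *\<^sub>R one" by (auto intro!: ev_eqI)
  then show "P 0" unfolding P_def by (metis W_one W_scaleR)
  show "P (k + l)" if "P k" "P l" "(\<Sum>i\<in>UNIV. k $ i * l $ i) \<noteq> 0" for k l
  proof (rule P_add[OF that(1,2)])
    have "freq k \<bullet> freq l = real_of_int (\<Sum>i\<in>UNIV. k $ i * l $ i)" by (simp add: inner_vec_def)
    then show "freq k \<bullet> freq l \<noteq> 0" using that(3) by (simp only: of_int_eq_0_iff not_False_eq_True)
  qed
  show "P k" if "k \<in> control_freqs" for k
    using that by (simp add: P_def W_pot pot_cos pot_sin)
qed (rule P_minus)

text \<open>Truncate the Fourier series of \<theta> and average with its conjugate. As \<theta> is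
  its own conjugate this does not increase the error, and the result is a real combination of sines
  and cosines.\<close>

theorem reach_real:
  assumes real: "\<And>x. ev \<theta> x \<in> \<real>"
  shows "reach \<theta>"
proof (rule reach_closed)
  fix e :: real assume e: "0 < e"
  obtain F where F: "finite F" "norm (\<theta> - (\<Sum>k\<in>F. single k (coord \<theta> k))) < e"
    using ell2_finite_approx[OF e] by blast
  define p where "p = (\<Sum>k\<in>F. single k (coord \<theta> k))"
  define h where "h = (1/2) *\<^sub>R (p + conj_ell2 p)"
  have lin: "linear conj_ell2" by (rule bounded_linear.linear[OF bounded_linear_conj_ell2])
  have \<theta>: "conj_ell2 \<theta> = \<theta>"
    using real by (intro ev_eqI) (simp add: Reals_cnj_iff)
  have "h = (\<Sum>k\<in>F. (Re (coord \<theta> k) / wt k) *\<^sub>R cosX k - (Im (coord \<theta> k) / wt k) *\<^sub>R sinX k)"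
  proof (rule ev_eqI)
    fix x
    have "ev h x = (\<Sum>k\<in>F. (1/2) * (ev (single k (coord \<theta> k)) x + cnj (ev (single k (coord \<theta> k)) x)))"
      by (simp add: h_def p_def ev_sum sum.distrib sum_distrib_left scaleR_conv_of_real distrib_left)
    also have "\<dots> = ev (\<Sum>k\<in>F. (Re (coord \<theta> k) / wt k) *\<^sub>R cosX k - (Im (coord \<theta> k) / wt k) *\<^sub>R sinX k) x"
      unfolding ev_sum
    proof (rule sum.cong[OF refl])
      fix k
      have "(1/2) * (z + cnj z) = of_real (Re z)" for z by (simp add: complex_add_cnj)
      moreover have "Re (ev (single k (coord \<theta> k)) x) = (Re (coord \<theta> k) / wt k) * cos (freq k \<bullet> x) - (Im (coord \<theta> k) / wt k) * sin (freq k \<bullet> x)"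
        by (simp add: echar_cis diff_divide_distrib)
      ultimately show "(1/2) * (ev (single k (coord \<theta> k)) x + cnj (ev (single k (coord \<theta> k)) x))
          = ev ((Re (coord \<theta> k) / wt k) *\<^sub>R cosX k - (Im (coord \<theta> k) / wt k) *\<^sub>R sinX k) x"
        by (simp only:) (simp add: scaleR_conv_of_real)
    qed
    finally show "ev h x = ev (\<Sum>k\<in>F. (Re (coord \<theta> k) / wt k) *\<^sub>R cosX k - (Im (coord \<theta> k) / wt k) *\<^sub>R sinX k) x" .
  qed
  moreover have "W (\<Sum>k\<in>F. (Re (coord \<theta> k) / wt k) *\<^sub>R cosX k - (Im (coord \<theta> k) / wt k) *\<^sub>R sinX k)"
    using P_all by (intro W_sum F W_diff W_scaleR) (auto simp: P_def)
  ultimately have "W h" by simp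
  then have "reach h" unfolding W_def by (metis scaleR_one)
  moreover have "norm (h - \<theta>) < e"
  proof -
    have "h - \<theta> = (1/2) *\<^sub>R ((p - \<theta>) + conj_ell2 (p - \<theta>))"
      by (simp add: h_def linear_diff[OF lin] \<theta> algebra_simps flip: scaleR_2)
    also have "norm \<dots> \<le> (1/2) * (norm (p - \<theta>) + norm (conj_ell2 (p - \<theta>)))"
      by (simp add: norm_triangle_ineq del: norm_conj_ell2)
    also have "\<dots> < e" using F(2) by (simp add: p_def norm_minus_commute)
    finally show ?thesis .
  qed
  ultimately show "\<exists>h. reach h \<and> norm (h - \<theta>) < e" by blast
qed

end

section \<open>Smooth functions belong to the Sobolev space\<close>

lemma C_k_continuous: "C_k m f \<Longrightarrow> continuous_on UNIV f"
  by (cases m) (auto intro!: continuous_at_imp_continuous_on differentiable_imp_continuous_within)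

lemma C_k_component:
  fixes f :: "'a::real_normed_vector \<Rightarrow> real ^ 'q"
  shows "C_k m f \<Longrightarrow> C_k m (\<lambda>x. f x $ j)"
proof (induction m arbitrary: f)
  case 0
  then show ?case by (auto intro: continuous_intros)
next
  case (Suc m)
  have d: "((\<lambda>x. f x $ j) has_derivative (\<lambda>v. frechet_derivative f (at x) v $ j)) (at x)" for x
    using Suc.prems by (auto intro!: bounded_linear.has_derivative[OF bounded_linear_vec_nth] simp: frechet_derivative_works)
  have e: "frechet_derivative (\<lambda>x. f x $ j) (at x) = (\<lambda>v. frechet_derivative f (at x) v $ j)" for x
    using frechet_derivative_at[OF d[of x]] by simp
  show ?case using Suc d by (auto simp: e differentiable_def)
qed

lemma torus_smooth_component:
  fixes f :: "real ^ 'n \<Rightarrow> real ^ 'q"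
  shows "torus_smooth f \<Longrightarrow> torus_smooth (\<lambda>x. f x $ j)"
  by (auto simp: torus_smooth_def torus_periodic_def intro: C_k_component)

text \<open>The integral \<open>J h\<close> of the shifted function against the conjugate
  exponential is differentiated at h = 0 in two ways: under the integral sign, and from
  \<open>J h\<close> = e^(i k_i h) \<open>J 0\<close>, which is shift invariance. The derivative is
  one-sided because shifts are taken in [0, 2 pi].\<close>

lemma fourier_coeff_partial_derivative:
  fixes g :: "real ^ 'n \<Rightarrow> real"
  assumes g: "\<And>x. g differentiable (at x)" "continuous_on UNIV (\<lambda>x. frechet_derivative g (at x) (axis i 1))"
    and per: "torus_periodic g"
  shows "fourier_coeff (\<lambda>x. of_real (frechet_derivative g (at x) (axis i 1))) k
    = \<i> * of_int (k $ i) * fourier_coeff (\<lambda>x. of_real (g x)) k"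
proof -
  let ?D = "\<lambda>x. frechet_derivative g (at x) (axis i 1)"
  have cg: "continuous_on UNIV g"
    using g(1) by (auto intro!: continuous_at_imp_continuous_on differentiable_imp_continuous_within)
  define J where "J h = integral torus_cube (\<lambda>x. of_real (g (x + axis i h)) * echar (- k) x)" for h
  have d: "((\<lambda>h. g (x + axis i h)) has_vector_derivative ?D (x + axis i h)) (at h within U)" for x h U
  proof -
    have ax: "axis i h = h *\<^sub>R axis i 1" for h :: real by (simp add: vec_eq_iff axis_def)
    have 1: "((\<lambda>h. x + h *\<^sub>R axis i 1) has_derivative (\<lambda>h. h *\<^sub>R axis i 1)) (at h within U)"
      by (auto intro!: derivative_eq_intros)
    have 2: "(g has_derivative frechet_derivative g (at (x + h *\<^sub>R axis i 1))) (at (x + h *\<^sub>R axis i 1))"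
      using g(1) frechet_derivative_works by blast
    have "(\<lambda>h. g (x + axis i h)) = (\<lambda>h. g (x + h *\<^sub>R axis i 1))"
      by (rule ext, subst ax, rule refl)
    then show ?thesis unfolding has_vector_derivative_def ax[of h]
      using has_derivative_compose[OF 1 2] by (simp only: linear_scale[OF has_derivative_linear[OF 2]])
  qed
  have J': "(J has_vector_derivative integral torus_cube (\<lambda>x. of_real (?D (x + axis i 0)) * echar (- k) x)) (at 0 within {0..2 * pi})"
    unfolding J_def torus_cube_def
  proof (rule leibniz_rule_vector_derivative)
    show "((\<lambda>h. of_real (g (x + axis i h)) * echar (- k) x) has_vector_derivative
        of_real (?D (x + axis i h)) * echar (- k) x) (at h within {0..2 * pi})" for h x
      by (intro has_vector_derivative_mult_left has_vector_derivative_of_real d[folded has_real_derivative_iff_has_vector_derivative])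
    show "(\<lambda>x. of_real (g (x + axis i h)) * echar (- k) x) integrable_on cbox 0 (\<chi> i. 2 * pi)" for h
      by (intro integrable_continuous continuous_intros continuous_on_compose2[OF cg]) auto
    have "continuous_on ({0..2 * pi} \<times> cbox 0 (\<chi> i. 2 * pi)) (\<lambda>p. of_real (?D (snd p + axis i (fst p))) * echar (- k) (snd p))"
    proof (intro continuous_intros continuous_on_compose2[OF g(2)] continuous_on_compose2[OF continuous_on_echar[of UNIV]])
      have "axis i h = h *\<^sub>R axis i 1" for h :: real by (simp add: vec_eq_iff axis_def)
      then have "(\<lambda>p :: real \<times> (real ^ 'n). axis i (fst p) :: real ^ 'n) = (\<lambda>p. fst p *\<^sub>R axis i 1)" by (intro ext)
      then show "continuous_on ({0..2 * pi} \<times> cbox 0 (\<chi> i. 2 * pi)) (\<lambda>p :: real \<times> (real ^ 'n). axis i (fst p) :: real ^ 'n)"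
        by (simp only:) (intro continuous_intros)
    qed auto
    then show "continuous_on ({0..2 * pi} \<times> cbox 0 (\<chi> i. 2 * pi)) (\<lambda>(h, x). of_real (?D (x + axis i h)) * echar (- k) x)"
      by (simp add: case_prod_unfold)
  qed auto
  have J: "J h = exp (of_real h * (\<i> * of_int (k $ i))) * J 0" if h: "h \<in> {0..2 * pi}" for h
  proof -
    let ?f = "\<lambda>x. of_real (g x) * echar (- k) x"
    have "torus_periodic ?f"
      using per torus_periodic_echar[of "- k"] by (simp add: torus_periodic_def)
    moreover have "continuous_on UNIV ?f" by (intro continuous_intros cg)
    ultimately have "integral torus_cube (\<lambda>x. ?f (x + axis i h)) = integral torus_cube ?f"
      using h by (intro torus_integral_shift) auto
    moreover have "?f (x + axis i h) = exp (- (of_real h * (\<i> * of_int (k $ i)))) * (of_real (g (x + axis i h)) * echar (- k) x)" for x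
      by (simp add: echar_plus echar_axis cis_conv_exp mult_ac)
    ultimately have "exp (- (of_real h * (\<i> * of_int (k $ i)))) * J h = J 0"
      by (simp add: J_def axis_eq_0_iff[THEN iffD2])
    then show ?thesis by (simp add: exp_minus divide_simps mult.commute[of "inverse _"] flip: divide_inverse)
  qed
  have "((\<lambda>h. exp (of_real h * (\<i> * of_int (k $ i))) * J 0) has_vector_derivative (\<i> * of_int (k $ i)) * J 0) (at 0 within {0..2 * pi})"
  proof (rule has_vector_derivative_mult_left)
    have "((\<lambda>z. exp (z * (\<i> * of_int (k $ i)))) has_field_derivative \<i> * of_int (k $ i)) (at (of_real 0))"
      by (auto intro!: derivative_eq_intros)
    then show "((\<lambda>h. exp (of_real h * (\<i> * of_int (k $ i)))) has_vector_derivative \<i> * of_int (k $ i)) (at 0 within {0..2 * pi})"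
      by (rule has_vector_derivative_real_field[THEN has_vector_derivative_at_within])
  qed
  then have "(J has_vector_derivative (\<i> * of_int (k $ i)) * J 0) (at 0 within {0..2 * pi})"
    by (rule has_vector_derivative_transform[rotated 2]) (simp, rule J)
  then have "integral torus_cube (\<lambda>x. of_real (?D (x + axis i 0)) * echar (- k) x) = \<i> * of_int (k $ i) * J 0"
    using vector_derivative_unique_within_closed_interval[of 0 "2 * pi" 0 J] J' by simp
  then have "integral torus_cube (\<lambda>x. of_real (?D x) * echar (- k) x) = \<i> * of_int (k $ i) * integral torus_cube (\<lambda>x. of_real (g x) * echar (- k) x)"
    by (simp add: J_def axis_eq_0_iff[THEN iffD2])
  then show ?thesis
    by (subst (1 2) fourier_coeff_continuous) (auto intro!: continuous_intros g(2) cg)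
qed

text \<open>Differentiates m times in the fixed direction i. Each derivative is again periodic, by
  uniqueness of the derivative.\<close>

lemma fourier_coeff_decay:
  fixes g :: "real ^ 'n \<Rightarrow> real"
  assumes "C_k m g" "torus_periodic g"
  shows "\<exists>B\<ge>0. \<forall>k. \<bar>real_of_int (k $ i)\<bar> ^ m * cmod (fourier_coeff (\<lambda>x. of_real (g x)) k) \<le> B"
  using assms
proof (induction m arbitrary: g)
  case 0
  have c: "continuous_on UNIV (\<lambda>x. complex_of_real (g x))" using 0 by (auto intro: continuous_intros)
  have "bounded ((\<lambda>x. complex_of_real (g x)) ` torus_cube)"
    unfolding torus_cube_def by (intro compact_imp_bounded compact_continuous_image continuous_on_subset[OF c]) auto
  then obtain B where B: "\<And>x. x \<in> torus_cube \<Longrightarrow> cmod (of_real (g x)) \<le> B" by (auto simp: bounded_iff)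
  have "cmod (fourier_coeff (\<lambda>x. of_real (g x)) k) \<le> B" for k by (rule norm_fourier_coeff_le[OF c B])
  then show ?case using order_trans[OF norm_ge_zero] by (intro exI[of _ B]) fastforce
next
  case (Suc m)
  let ?D = "\<lambda>x. frechet_derivative g (at x) (axis i 1)"
  have D: "C_k m ?D" and diff: "\<And>x. g differentiable (at x)" using Suc.prems by auto
  have "frechet_derivative g (at (x + axis j (2 * pi))) = frechet_derivative g (at x)" for x j
  proof -
    let ?p = "axis j (2 * pi) :: real ^ 'n"
    have "(g has_derivative frechet_derivative g (at (x + ?p))) (at (x + ?p))" using diff frechet_derivative_works by blast
    moreover have "((\<lambda>y. y + ?p) has_derivative (\<lambda>v. v)) (at x)" by (auto intro!: derivative_eq_intros)
    ultimately have "((\<lambda>y. g (y + ?p)) has_derivative frechet_derivative g (at (x + ?p))) (at x)"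
      using has_derivative_compose by blast
    moreover have "(\<lambda>y. g (y + ?p)) = g" using Suc.prems(2) by (auto simp: torus_periodic_def)
    ultimately show ?thesis using frechet_derivative_at by fastforce
  qed
  then have per: "torus_periodic ?D" by (simp add: torus_periodic_def)
  obtain B where B: "B \<ge> 0" "\<And>k. \<bar>real_of_int (k $ i)\<bar> ^ m * cmod (fourier_coeff (\<lambda>x. of_real (?D x)) k) \<le> B"
    using Suc.IH[OF D per] by blast
  show ?case
  proof (intro exI[of _ B] conjI allI B(1))
    fix k
    have "fourier_coeff (\<lambda>x. of_real (?D x)) k = \<i> * of_int (k $ i) * fourier_coeff (\<lambda>x. of_real (g x)) k"
      by (rule fourier_coeff_partial_derivative[OF diff C_k_continuous[OF D] Suc.prems(2)])
    then show "\<bar>real_of_int (k $ i)\<bar> ^ Suc m * cmod (fourier_coeff (\<lambda>x. of_real (g x)) k) \<le> B"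
      using B(2)[of k] by (simp add: norm_mult mult_ac)
  qed
qed

text \<open>Reduces the weight to pure powers of the coordinates, so that only repeated derivatives
  in a single direction enter the decay of Fourier coefficients. Both sides are compared with the
  maximum \<open>y\<close> of 1 and the squared coordinates.\<close>

lemma one_plus_norm_power_le:
  fixes v :: "real ^ 'n"
  shows "(1 + (norm v)\<^sup>2) ^ s \<le> (real CARD('n) + 1) ^ s * (1 + (\<Sum>i\<in>UNIV. \<bar>v $ i\<bar> ^ (2 * s)))"
proof -
  define y where "y = Max (insert 1 (range (\<lambda>i. (v $ i)\<^sup>2)))"
  have y: "1 \<le> y" "\<And>i. (v $ i)\<^sup>2 \<le> y" unfolding y_def by (rule Max_ge; simp)+
  have "(norm v)\<^sup>2 = (\<Sum>i\<in>UNIV. (v $ i)\<^sup>2)"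
    unfolding power2_norm_eq_inner inner_vec_def by (simp add: power2_eq_square)
  also have "\<dots> \<le> real CARD('n) * y" using sum_bounded_above[of UNIV "\<lambda>i. (v $ i)\<^sup>2" y] y by simp
  finally have "1 + (norm v)\<^sup>2 \<le> (real CARD('n) + 1) * y" using y(1) by (simp add: algebra_simps)
  then have "(1 + (norm v)\<^sup>2) ^ s \<le> ((real CARD('n) + 1) * y) ^ s" by (intro power_mono) auto
  also have "\<dots> = (real CARD('n) + 1) ^ s * y ^ s" by (rule power_mult_distrib)
  also have "y ^ s \<le> 1 + (\<Sum>i\<in>UNIV. \<bar>v $ i\<bar> ^ (2 * s))"
  proof -
    have "y \<in> insert 1 (range (\<lambda>i. (v $ i)\<^sup>2))" unfolding y_def by (rule Max_in) auto
    then consider "y = 1" | i where "y = (v $ i)\<^sup>2" by auto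
    then show ?thesis
    proof cases
      case 1
      then show ?thesis by (simp add: sum_nonneg)
    next
      case 2
      then have "y ^ s = \<bar>v $ i\<bar> ^ (2 * s)" by (simp add: power_mult)
      also have "\<dots> \<le> (\<Sum>i\<in>UNIV. \<bar>v $ i\<bar> ^ (2 * s))" by (rule member_le_sum) auto
      finally show ?thesis by simp
    qed
  qed
  finally show ?thesis by (simp add: mult_left_mono)
qed

context sobolev
begin

lemma torus_smooth_Hs:
  fixes \<theta> :: "real ^ 'n \<Rightarrow> real"
  assumes \<theta>: "torus_smooth \<theta>"
  obtains a where "\<And>x. ev a x = of_real (\<theta> x)"
proof -
  let ?f = "\<lambda>x. complex_of_real (\<theta> x)"
  have per: "torus_periodic \<theta>" and Ck: "\<And>m. C_k m \<theta>" using \<theta> by (auto simp: torus_smooth_def)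
  have c: "continuous_on UNIV ?f" using Ck[of 0] by (auto intro: continuous_intros)
  obtain B0 where B0: "B0 \<ge> 0" "\<And>k :: int ^ 'n. cmod (fourier_coeff ?f k) \<le> B0"
    using fourier_coeff_decay[OF Ck[of 0] per] by auto
  have "\<forall>i. \<exists>B. B \<ge> 0 \<and> (\<forall>k :: int ^ 'n. \<bar>real_of_int (k $ i)\<bar> ^ (2 * s) * cmod (fourier_coeff ?f k) \<le> B)"
    using fourier_coeff_decay[OF Ck per] by blast
  then obtain B where B: "\<And>i. B i \<ge> 0" "\<And>i (k :: int ^ 'n). \<bar>real_of_int (k $ i)\<bar> ^ (2 * s) * cmod (fourier_coeff ?f k) \<le> B i" by metis
  define C where "C = (real CARD('n) + 1) ^ s * (B0 + (\<Sum>i\<in>UNIV. B i))"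
  have le: "(1 + (norm (freq k))\<^sup>2) ^ s * cmod (fourier_coeff ?f k) \<le> C" for k :: "int ^ 'n"
  proof -
    have "(1 + (norm (freq k))\<^sup>2) ^ s * cmod (fourier_coeff ?f k)
        \<le> ((real CARD('n) + 1) ^ s * (1 + (\<Sum>i\<in>UNIV. \<bar>freq k $ i\<bar> ^ (2 * s)))) * cmod (fourier_coeff ?f k)"
      by (intro mult_right_mono one_plus_norm_power_le) auto
    also have "\<dots> = (real CARD('n) + 1) ^ s * (cmod (fourier_coeff ?f k) + (\<Sum>i\<in>UNIV. \<bar>real_of_int (k $ i)\<bar> ^ (2 * s) * cmod (fourier_coeff ?f k)))"
      by (simp add: distrib_right sum_distrib_right mult.assoc)
    also have "\<dots> \<le> C" unfolding C_def by (intro mult_left_mono add_mono sum_mono B0 B) auto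
    finally show ?thesis .
  qed
  have "Hs_term s ?f summable_on UNIV"
  proof (rule summable_on_comparison_test)
    show "(\<lambda>k. C\<^sup>2 * (1 / wt k)\<^sup>2) summable_on UNIV" by (intro summable_on_cmult_right summable_wt)
    fix k :: "int ^ 'n"
    let ?w = "(1 + (norm (freq k))\<^sup>2) ^ s"
    have w: "?w > 0" by (intro zero_less_power add_pos_nonneg) auto
    \<comment> \<open>Derivatives of order 2s give coefficients of size C / (1 + |k|^2)^s; squared
      and weighted, they are bounded by C^2 times the summable
      \<open>(1 / wt k)\<^sup>2\<close>.\<close>
    have "?w * (cmod (fourier_coeff ?f k))\<^sup>2 = (?w * cmod (fourier_coeff ?f k))\<^sup>2 / ?w"
      using w by (simp add: power2_eq_square)
    also have "\<dots> \<le> C\<^sup>2 / ?w" using w le[of k] by (intro divide_right_mono power_mono) auto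
    also have "\<dots> = C\<^sup>2 * (1 / wt k)\<^sup>2" by (simp add: power_divide wt_sq)
    finally show "Hs_term s ?f k \<le> C\<^sup>2 * (1 / wt k)\<^sup>2" by (simp add: Hs_term_def)
  qed (simp add: Hs_term_def)
  moreover have "?f \<in> torus_L2"
    unfolding torus_L2_def
  proof (intro CollectI conjI)
    show "torus_periodic ?f" using per by (simp add: torus_periodic_def)
    show "?f \<in> borel_measurable lebesgue" by (rule continuous_imp_measurable_lebesgue[OF c])
    show "set_integrable lebesgue torus_cube (\<lambda>x. (cmod (?f x))\<^sup>2)"
      unfolding torus_cube_def by (intro absolutely_integrable_continuous continuous_intros continuous_on_subset[OF c]) auto
  qed
  ultimately have "?f \<in> Hs s" by (simp add: Hs_def)
  then have "AE x in lebesgue. ?f x = ev (emb ?f) x" by (rule Hs_AE_ev)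
  then have neg: "negligible {x. ?f x \<noteq> ev (emb ?f) x}"
    unfolding negligible_iff_null_sets completion.AE_iff_null_sets by simp
  \<comment> \<open>Two continuous functions that agree almost everywhere agree everywhere: an open
    null set is empty.\<close>
  have "open {x. ?f x \<noteq> ev (emb ?f) x}"
    by (intro open_Collect_neq c continuous_on_ev)
  then have "{x. ?f x \<noteq> ev (emb ?f) x} = {}" using neg open_not_negligible by blast
  then have "ev (emb ?f) x = ?f x" for x by (metis (mono_tags, lifting) emptyE mem_Collect_eq)
  then show thesis by (rule that)
qed

end

section \<open>Mild solutions on the torus\<close>

text \<open>Polynomials have polynomial derivatives on the whole line; iterating a chosen derivative
  \<open>d\<close> provides all the orders.\<close>

lemma polynomial_function_smooth_on_interval:
  fixes p :: "real \<Rightarrow> 'b::euclidean_space"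
  assumes "polynomial_function p"
  shows "smooth_on_interval T p"
proof -
  have "\<exists>q. polynomial_function q \<and> (\<forall>t. (p has_vector_derivative q t) (at t))" if "polynomial_function p" for p :: "real \<Rightarrow> 'b"
    using has_vector_derivative_polynomial_function[OF that] by metis
  then obtain d where d: "\<And>p :: real \<Rightarrow> 'b. polynomial_function p \<Longrightarrow> polynomial_function (d p)"
    "\<And>p t. polynomial_function p \<Longrightarrow> (p has_vector_derivative d p t) (at t)" by metis
  have poly: "polynomial_function ((d ^^ m) p)" for m
    using assms d(1) by (induction m) auto
  show ?thesis
    unfolding smooth_on_interval_def
    using d(2)[OF poly] by (intro exI[of _ "\<lambda>m. (d ^^ m) p"]) (auto intro: has_vector_derivative_at_within)
qed

context sobolev
begin

lemma AE_ev_Hs_norm: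
  assumes "torus_periodic f" "f \<in> borel_measurable lebesgue" "AE x in lebesgue. f x = ev a x"
  shows "Hs_norm s f = norm a"
proof -
  have "Hs_term s f summable_on UNIV" using AE_ev_Hs[OF assms] by (simp add: Hs_def)
  from Hs_norm_emb[OF this] show ?thesis by (simp add: AE_ev_emb[OF assms])
qed

lemma emb_diff:
  assumes f: "f \<in> Hs s" and g: "g \<in> Hs s"
  shows "(\<lambda>x. f x - g x) \<in> Hs s" "emb (\<lambda>x. f x - g x) = emb f - emb g"
proof -
  have per: "torus_periodic (\<lambda>x. f x - g x)"
    using Hs_periodic[OF f] Hs_periodic[OF g] by (simp add: torus_periodic_def)
  have m: "(\<lambda>x. f x - g x) \<in> borel_measurable lebesgue"
    by (intro borel_measurable_diff Hs_measurable f g)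
  have ae: "AE x in lebesgue. f x - g x = ev (emb f - emb g) x"
    using Hs_AE_ev[OF f] Hs_AE_ev[OF g] by eventually_elim simp
  show "(\<lambda>x. f x - g x) \<in> Hs s" "emb (\<lambda>x. f x - g x) = emb f - emb g"
    by (rule AE_ev_Hs[OF per m ae] AE_ev_emb[OF per m ae])+
qed

lemma Hs_norm_diff: "f \<in> Hs s \<Longrightarrow> g \<in> Hs s \<Longrightarrow> Hs_norm s (\<lambda>x. f x - g x) = norm (emb f - emb g)"
  using emb_diff[of f g] Hs_norm_emb[of "\<lambda>x. f x - g x"] by (simp add: Hs_def)

lemma Hs_continuous_iff:
  assumes "\<And>t. t \<in> {0..T} \<Longrightarrow> \<psi> t \<in> Hs s"
  shows "Hs_continuous s T \<psi> \<longleftrightarrow> continuous_on {0..T} (\<lambda>t. emb (\<psi> t))"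
proof -
  have "((\<lambda>r. Hs_norm s (\<lambda>x. \<psi> r x - \<psi> t x)) \<longlongrightarrow> 0) (at t within {0..T})
      \<longleftrightarrow> ((\<lambda>t. emb (\<psi> t)) \<longlongrightarrow> emb (\<psi> t)) (at t within {0..T})" if t: "t \<in> {0..T}" for t
  proof -
    have "\<forall>\<^sub>F r in at t within {0..T}. Hs_norm s (\<lambda>x. \<psi> r x - \<psi> t x) = norm (emb (\<psi> r) - emb (\<psi> t))"
      unfolding eventually_at_filter using assms t by (intro always_eventually) (auto simp: Hs_norm_diff)
    from tendsto_cong[OF this] show ?thesis
      by (simp add: tendsto_norm_zero_iff LIM_zero_iff)
  qed
  then show ?thesis using assms by (auto simp: Hs_continuous_def continuous_on_def)
qed

text \<open>A Riemann sum of \<open>F\<close> is \<open>ev\<close> of the Riemann sum of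
  \<open>g\<close>, so both gauge conditions bound the same norm.\<close>

lemma Hs_has_integral_iff:
  assumes F: "\<And>r. r \<in> {a..b} \<Longrightarrow> F r = ev (g r)" and f: "f \<in> Hs s"
  shows "Hs_has_integral s F f a b \<longleftrightarrow> (g has_integral emb f) {a..b}"
proof -
  have norm: "Hs_norm s (\<lambda>x. (\<Sum>(r, J)\<in>\<D>. measure lborel J *\<^sub>R F r x) - f x)
      = norm ((\<Sum>(r, J)\<in>\<D>. measure lborel J *\<^sub>R g r) - emb f)" if D: "\<D> tagged_division_of {a..b}" for \<D>
  proof -
    have eq: "(\<lambda>x. \<Sum>(r, J)\<in>\<D>. measure lborel J *\<^sub>R F r x) = ev (\<Sum>(r, J)\<in>\<D>. measure lborel J *\<^sub>R g r)"
    proof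
      fix x
      have "(\<Sum>(r, J)\<in>\<D>. measure lborel J *\<^sub>R F r x) = (\<Sum>(r, J)\<in>\<D>. measure lborel J *\<^sub>R ev (g r) x)"
      proof (rule sum.cong[OF refl])
        fix p assume p: "p \<in> \<D>"
        obtain r J where rJ: "p = (r, J)" by (cases p)
        have "r \<in> {a..b}" using tag_in_interval[OF D] p rJ by blast
        then show "(case p of (r, J) \<Rightarrow> measure lborel J *\<^sub>R F r x) = (case p of (r, J) \<Rightarrow> measure lborel J *\<^sub>R ev (g r) x)"
          by (simp add: rJ F)
      qed
      also have "\<dots> = ev (\<Sum>(r, J)\<in>\<D>. measure lborel J *\<^sub>R g r) x"
        unfolding ev_sum by (rule sum.cong) (auto simp: case_prod_unfold)
      finally show "(\<Sum>(r, J)\<in>\<D>. measure lborel J *\<^sub>R F r x) = ev (\<Sum>(r, J)\<in>\<D>. measure lborel J *\<^sub>R g r) x" .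
    qed
    have "Hs_norm s (\<lambda>x. ev (\<Sum>(r, J)\<in>\<D>. measure lborel J *\<^sub>R g r) x - f x)
        = norm ((\<Sum>(r, J)\<in>\<D>. measure lborel J *\<^sub>R g r) - emb f)"
      using Hs_norm_diff[OF ev_Hs f] by simp
    then show ?thesis using fun_cong[OF eq] by simp
  qed
  have "\<forall>r\<in>{a..b}. F r \<in> Hs s" using F ev_Hs by auto
  then have "Hs_has_integral s F f a b \<longleftrightarrow> (\<forall>e>0. \<exists>\<gamma>. gauge \<gamma> \<and>
        (\<forall>\<D>. \<D> tagged_division_of {a..b} \<and> \<gamma> fine \<D> \<longrightarrow>
           norm ((\<Sum>(r, J)\<in>\<D>. measure lborel J *\<^sub>R g r) - emb f) < e))"
    unfolding Hs_has_integral_def using f by (simp add: norm cong: conj_cong)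
  also have "\<dots> \<longleftrightarrow> (g has_integral emb f) {a..b}"
    unfolding cbox_interval[symmetric] has_integral ..
  finally show ?thesis .
qed

end

context gl_control
begin

text \<open>For an arbitrary representative \<open>\<phi> t\<close> only an identity almost
  everywhere is available; it is enough for \<open>AE_ev_Hs\<close> and
  \<open>AE_ev_emb\<close>.\<close>

lemma forcing_gl_Hs:
  fixes Q :: "(real, 'n) vec \<Rightarrow> (real, 'p::finite) vec"
  assumes pot_ev: "\<And>x. ev (pot c) x = of_real (u t \<bullet> Q x)" and per: "torus_periodic Q"
    and \<phi>: "\<phi> t \<in> Hs s"
  shows "forcing_gl \<sigma> \<mu> Q u (- \<nu>) \<phi> t \<in> Hs s"
    and "emb (forcing_gl \<sigma> \<mu> Q u (- \<nu>) \<phi> t) = act (pot c) \<triangleright> emb (\<phi> t) + N (emb (\<phi> t))"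
proof -
  let ?f = "forcing_gl \<sigma> \<mu> Q u (- \<nu>) \<phi> t"
  have p: "torus_periodic ?f"
    using per Hs_periodic[OF \<phi>] by (simp add: torus_periodic_def forcing_gl_def)
  have mQ: "(\<lambda>x. complex_of_real (u t \<bullet> Q x)) \<in> borel_measurable lebesgue"
    unfolding pot_ev[symmetric] by (intro continuous_imp_measurable_lebesgue continuous_on_ev)
  have m\<phi>: "\<phi> t \<in> borel_measurable lebesgue" by (rule Hs_measurable[OF \<phi>])
  have m: "?f \<in> borel_measurable lebesgue"
    unfolding forcing_gl_def using mQ m\<phi> by measurable
  have ae: "AE x in lebesgue. ?f x = ev (act (pot c) \<triangleright> emb (\<phi> t) + N (emb (\<phi> t))) x"
    using Hs_AE_ev[OF \<phi>] by eventually_elim (simp add: forcing_gl_def ev_N act_def pot_ev Z_def algebra_simps)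
  show "?f \<in> Hs s" "emb ?f = act (pot c) \<triangleright> emb (\<phi> t) + N (emb (\<phi> t))"
    by (rule AE_ev_Hs[OF p m ae] AE_ev_emb[OF p m ae])+
qed

text \<open>Covers arbitrary representatives and not only continuous ones, since uniqueness in the
  theorem compares all solutions of the original equation.\<close>

lemma mild_solution_iff:
  fixes Q :: "(real, 'n) vec \<Rightarrow> (real, 'p::finite) vec"
  assumes pot_ev: "\<And>t x. ev (pot (w t)) x = of_real (u t \<bullet> Q x)" and per: "torus_periodic Q"
    and \<psi>0: "\<psi>\<^sub>0 \<in> Hs s" and \<phi>: "\<And>t. t \<in> {0..T} \<Longrightarrow> \<phi> t \<in> Hs s"
  shows "mild_solution s V \<nu> \<sigma> \<mu> Q u (- \<nu>) \<psi>\<^sub>0 T \<phi> \<longleftrightarrow>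
    csol (\<lambda>t. act (pot (w t))) (emb \<psi>\<^sub>0) T (\<lambda>t. emb (\<phi> t))"
proof -
  have "Hs_has_integral s (\<lambda>r. semigroup_gl V \<nu> (t - r) (forcing_gl \<sigma> \<mu> Q u (- \<nu>) \<phi> r))
          (\<lambda>x. \<phi> t x - semigroup_gl V \<nu> t \<psi>\<^sub>0 x) 0 t \<longleftrightarrow>
      ((\<lambda>r. S (t - r) \<triangleright> (act (pot (w r)) \<triangleright> emb (\<phi> r) + N (emb (\<phi> r)))) has_integral
        (emb (\<phi> t) - S t \<triangleright> emb \<psi>\<^sub>0)) {0..t}" if t: "t \<in> {0..T}" for t
  proof -
    have sg0: "semigroup_gl V \<nu> t \<psi>\<^sub>0 = ev (S t \<triangleright> emb \<psi>\<^sub>0)" using t by (intro semigroup_gl_ev \<psi>0) auto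
    have "(\<lambda>x. \<phi> t x - semigroup_gl V \<nu> t \<psi>\<^sub>0 x) \<in> Hs s"
      "emb (\<lambda>x. \<phi> t x - semigroup_gl V \<nu> t \<psi>\<^sub>0 x) = emb (\<phi> t) - S t \<triangleright> emb \<psi>\<^sub>0"
      unfolding sg0 using emb_diff[OF \<phi>[OF t] ev_Hs] by simp_all
    moreover have "semigroup_gl V \<nu> (t - r) (forcing_gl \<sigma> \<mu> Q u (- \<nu>) \<phi> r)
        = ev (S (t - r) \<triangleright> (act (pot (w r)) \<triangleright> emb (\<phi> r) + N (emb (\<phi> r))))" if r: "r \<in> {0..t}" for r
    proof -
      have \<phi>r: "\<phi> r \<in> Hs s" using r t by (intro \<phi>) auto
      show ?thesis
        using r by (simp only: semigroup_gl_ev[OF _ forcing_gl_Hs(1)[where c = "w r" and t = r and u = u and Q = Q and \<phi> = \<phi>, OF pot_ev per \<phi>r]]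
          forcing_gl_Hs(2)[where c = "w r" and t = r and u = u and Q = Q and \<phi> = \<phi>, OF pot_ev per \<phi>r] diff_ge_0_iff_ge atLeastAtMost_iff)
    qed
    ultimately show ?thesis by (simp only: Hs_has_integral_iff)
  qed
  moreover have "Hs_continuous s T \<phi> \<longleftrightarrow> continuous_on {0..T} (\<lambda>t. emb (\<phi> t))"
    by (rule Hs_continuous_iff[OF \<phi>])
  ultimately show ?thesis by (simp add: mild_solution_def mild_def del: app.add_right)
qed

end

theorem theorem1p2:
  fixes Q :: "real ^ 'n::{finite,linorder} \<Rightarrow> real ^ 'q"
    and V \<nu> \<mu> \<epsilon> \<T> :: real
    and \<sigma> s :: nat
    and \<psi>\<^sub>0 :: "real ^ 'n::{finite,linorder} \<Rightarrow> complex"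
    and \<theta> :: "real ^ 'n::{finite,linorder} \<Rightarrow> real"
  assumes "\<sigma> \<ge> 1"
    and "V \<ge> 0"
    and "torus_smooth Q"
    and "{\<lambda>x. 1} \<union> (\<Union>k\<in>control_freqs. {\<lambda>x. sin (x \<bullet> freq k), \<lambda>x. cos (x \<bullet> freq k)})
           \<subseteq> component_span Q"
    and "s \<ge> s_crit CARD('n)"
    and "\<epsilon> > 0"
    and "\<T> > 0"
    and "\<psi>\<^sub>0 \<in> Hs s"
    and "torus_smooth \<theta>"
  shows "\<exists>T\<in>{0<..<\<T>}. \<exists>(u :: real \<Rightarrow> real ^ 'q) (R :: real). smooth_on_interval T u \<and>
           (\<exists>\<psi>. mild_solution s V \<nu> \<sigma> \<mu> Q u R \<psi>\<^sub>0 T \<psi> \<and>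
              (\<forall>\<phi>. mild_solution s V \<nu> \<sigma> \<mu> Q u R \<psi>\<^sub>0 T \<phi> \<longrightarrow>
                 (\<forall>t\<in>{0..T}. AE x in lebesgue. \<phi> t x = \<psi> t x)) \<and>
              (\<lambda>x. \<psi> T x - exp ((1 - \<i> * complex_of_real \<nu>) * complex_of_real (\<theta> x)) * \<psi>\<^sub>0 x) \<in> Hs s \<and>
              Hs_norm s (\<lambda>x. \<psi> T x - exp ((1 - \<i> * complex_of_real \<nu>) * complex_of_real (\<theta> x)) * \<psi>\<^sub>0 x) < \<epsilon>)"
proof -
  interpret sobolev s "TYPE('n)" by standard (rule assms(5))
  have "\<forall>j. \<exists>a. \<forall>x. ev a x = of_real (Q x $ j)"
    using torus_smooth_Hs[OF torus_smooth_component[OF assms(3)]] by metis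
  then obtain q where q: "\<And>j x. ev (q j) x = of_real (Q x $ j)" by metis
  obtain \<theta>' where \<theta>': "\<And>x. ev \<theta>' x = of_real (\<theta> x)" using torus_smooth_Hs[OF assms(9)] by blast
  define pot where "pot c = (\<Sum>j\<in>UNIV. (c $ j) *\<^sub>R q j)" for c :: "real ^ 'q"
  have pot_ev: "ev (pot c) x = of_real (c \<bullet> Q x)" for c x
    by (simp add: pot_def ev_sum q inner_vec_def scaleR_conv_of_real)
  have lp: "linear pot" by (rule linearI) (simp_all add: pot_def sum.distrib scaleR_add_left scaleR_sum_right)
  then have bl: "bounded_linear pot" by (rule linear_conv_bounded_linear[THEN iffD1])
  \<comment> \<open>Membership in the span of the components of \<open>Q\<close> becomes membership
    in the range of \<open>pot\<close>, because continuous representatives determine the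
    element.\<close>
  have range: "g \<in> range pot" if f: "f \<in> component_span Q" and g: "\<And>x. ev g x = of_real (f x)" for f g
  proof -
    obtain c where c: "\<And>x. f x = (\<Sum>j\<in>UNIV. c j * Q x $ j)" using f by (auto simp: component_span_def)
    have "g = pot (\<chi> j. c j)"
      by (rule ev_eqI) (simp add: pot_ev g c inner_vec_def)
    then show ?thesis by blast
  qed
  interpret gl_control s "TYPE('n)" V \<nu> \<mu> \<sigma> pot
    by standard (use assms(1,2) linear_add[OF lp] linear_scale[OF lp] bounded_linear.bounded[OF bl] in auto)
  interpret saturated s "TYPE('n)" V \<nu> \<mu> \<sigma> pot
  proof
    show "one \<in> range pot" by (rule range[of "\<lambda>_. 1"]) (use assms(4) in auto)
    fix k :: "(int, 'n) vec" assume k: "k \<in> control_freqs"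
    show "cosX k \<in> range pot" by (rule range[of "\<lambda>x. cos (x \<bullet> freq k)"]) (use assms(4) k in \<open>auto simp: inner_commute\<close>)
    show "sinX k \<in> range pot" by (rule range[of "\<lambda>x. sin (x \<bullet> freq k)"]) (use assms(4) k in \<open>auto simp: inner_commute\<close>)
  qed
  let ?b = "exp (act \<theta>') \<triangleright> emb \<psi>\<^sub>0"
  have "reach \<theta>'" by (rule reach_real) (simp add: \<theta>')
  \<comment> \<open>The time is capped by 1, the range of the semigroup bound. Half of \<epsilon> is
    spent here, the other half on making the control smooth.\<close>
  then have "near_reach (emb \<psi>\<^sub>0) ?b (min \<T> 1)" using assms(7) by (simp add: reach_def)
  moreover have "0 < \<epsilon> / 2" using assms(6) by simp
  ultimately obtain T w x where T: "0 < T" "T < min \<T> 1" and w: "continuous_on {0..T} w"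
    and x: "csol (\<lambda>t. act (pot (w t))) (emb \<psi>\<^sub>0) T x" "norm (x T - ?b) < \<epsilon> / 2"
    unfolding near_reach_def by blast
  obtain \<rho> where \<rho>: "\<rho> > 0" "\<And>C. continuous_on {0..T} C \<Longrightarrow> (\<And>t. t \<in> {0..T} \<Longrightarrow> norm (C t - act (pot (w t))) \<le> \<rho>) \<Longrightarrow>
      \<exists>y. csol C (emb \<psi>\<^sub>0) T y \<and> norm (y T - x T) < \<epsilon> / 2"
    using csol_perturb_control[OF _ _ continuous_on_act_pot[OF w] x(1) \<open>0 < \<epsilon> / 2\<close>] T by auto
  obtain K where K: "K > 0" "\<And>c. norm (act (pot c)) \<le> norm c * K"
    using bounded_linear.pos_bounded[OF bounded_linear_act_pot] by blast
  \<comment> \<open>Stone-Weierstrass: a polynomial within \<rho> / K of \<open>w\<close> changes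
    the operator \<open>act (pot (w t))\<close> by at most \<rho>.\<close>
  obtain u where u: "polynomial_function u" "\<And>t. t \<in> {0..T} \<Longrightarrow> norm (w t - u t) < \<rho> / K"
    using Stone_Weierstrass_polynomial_function[OF _ w, of "\<rho> / K"] \<rho>(1) K(1) by auto
  have cu: "continuous_on {0..T} u" by (rule continuous_on_polymonial_function[OF u(1)])
  have lin: "linear (\<lambda>c. act (pot c))" by (rule bounded_linear.linear[OF bounded_linear_act_pot])
  have near: "norm (act (pot (u t)) - act (pot (w t))) \<le> \<rho>" if "t \<in> {0..T}" for t
  proof -
    have "norm (act (pot (u t)) - act (pot (w t))) = norm (act (pot (u t - w t)))" by (simp add: linear_diff[OF lin])
    also have "\<dots> \<le> norm (u t - w t) * K" by (rule K)
    also have "\<dots> \<le> \<rho> / K * K" using u(2)[OF that] K(1) by (intro mult_right_mono) (auto simp: norm_minus_commute)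
    finally show ?thesis using K(1) by simp
  qed
  obtain y where y: "csol (\<lambda>t. act (pot (u t))) (emb \<psi>\<^sub>0) T y" "norm (y T - x T) < \<epsilon> / 2"
    using \<rho>(2)[OF continuous_on_act_pot[OF cu] near] by blast
  have per: "torus_periodic Q" using assms(3) by (simp add: torus_smooth_def)
  define \<psi> where "\<psi> t = ev (y t)" for t
  have iff: "mild_solution s V \<nu> \<sigma> \<mu> Q u (- \<nu>) \<psi>\<^sub>0 T \<phi> \<longleftrightarrow>
      csol (\<lambda>t. act (pot (u t))) (emb \<psi>\<^sub>0) T (\<lambda>t. emb (\<phi> t))" if "\<And>t. t \<in> {0..T} \<Longrightarrow> \<phi> t \<in> Hs s" for \<phi>
    by (rule mild_solution_iff[OF pot_ev per assms(8) that])
  have sol: "mild_solution s V \<nu> \<sigma> \<mu> Q u (- \<nu>) \<psi>\<^sub>0 T \<psi>"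
    using y(1) by (subst iff) (simp_all add: \<psi>_def ev_Hs)
  \<comment> \<open>The coordinates of any other solution solve the abstract equation and so
    coincide with \<open>y\<close>; for functions this means equality almost everywhere.\<close>
  have unique: "AE x in lebesgue. \<phi> t x = \<psi> t x"
    if \<phi>: "mild_solution s V \<nu> \<sigma> \<mu> Q u (- \<nu>) \<psi>\<^sub>0 T \<phi>" and t: "t \<in> {0..T}" for \<phi> t
  proof -
    have Hs: "\<And>t. t \<in> {0..T} \<Longrightarrow> \<phi> t \<in> Hs s" using \<phi> by (simp add: mild_solution_def Hs_continuous_def)
    then have "csol (\<lambda>t. act (pot (u t))) (emb \<psi>\<^sub>0) T (\<lambda>t. emb (\<phi> t))" using iff \<phi> by blast
    then have "emb (\<phi> t) = y t"
      using csol_unique[OF _ _ continuous_on_act_pot[OF cu] _ y(1) t] T by simp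
    then show ?thesis using Hs_AE_ev[OF Hs[OF t]] by (simp add: \<psi>_def)
  qed
  let ?d = "\<lambda>x. \<psi> T x - exp ((1 - \<i> * complex_of_real \<nu>) * complex_of_real (\<theta> x)) * \<psi>\<^sub>0 x"
  have c\<theta>: "continuous_on UNIV (\<lambda>x. exp ((1 - \<i> * complex_of_real \<nu>) * complex_of_real (\<theta> x)))"
    unfolding \<theta>'[symmetric] by (intro continuous_intros continuous_on_ev)
  have per_d: "torus_periodic ?d"
    using assms(9) Hs_periodic[OF assms(8)] torus_periodic_ev[of "y T"]
    by (simp add: torus_periodic_def torus_smooth_def \<psi>_def)
  have meas_d: "?d \<in> borel_measurable lebesgue"
    unfolding \<psi>_def
    by (intro borel_measurable_diff borel_measurable_times Hs_measurable[OF assms(8)]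
        continuous_imp_measurable_lebesgue continuous_on_ev c\<theta>)
  \<comment> \<open>\<open>exp (act \<theta>')\<close> multiplies by e^((1 - i\<nu>)\<theta>), so
    the error function agrees almost everywhere with the continuous representative of
    \<open>y T - ?b\<close>.\<close>
  have ae_d: "AE x in lebesgue. ?d x = ev (y T - ?b) x"
    using Hs_AE_ev[OF assms(8)] by eventually_elim (simp add: \<psi>_def \<theta>' Z_def)
  have "norm (y T - ?b) \<le> norm (y T - x T) + norm (x T - ?b)"
    using norm_triangle_ineq[of "y T - x T" "x T - ?b"] by simp
  then have "norm (y T - ?b) < \<epsilon>" using x(2) y(2) by linarith
  then have "Hs_norm s ?d < \<epsilon>" by (simp only: AE_ev_Hs_norm[OF per_d meas_d ae_d])
  moreover have "?d \<in> Hs s" by (rule AE_ev_Hs[OF per_d meas_d ae_d])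
  moreover have "smooth_on_interval T u" by (rule polynomial_function_smooth_on_interval[OF u(1)])
  moreover have "T \<in> {0<..<\<T>}" using T by simp
  ultimately show ?thesis using sol unique by blast
qed

end
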